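(* Let $K$ be a kernel satisfying Hypothesis (A) with parameter $\gamma>0$ (see context). Let $r\ge 2$ and let $u$ be an adapted process belonging to $L^{r}(\Omega\times[0,1],\mathrm{P}\otimes dt)$. Then the family of random variables $\bigl(M_t(u)=\int_0^t K(t,s)\,u_s\,dB_s,\ t\in[0,1]\bigr)$ has a version whose trajectories belong almost surely to $\mathcal{I}_{\gamma-\epsilon,r}$ for any $\epsilon\in(0,\gamma)$. Consequently, if $\gamma>1/r$, the sample paths are almost surely $(\gamma-1/r-\epsilon)$-Hölder continuous for any $\epsilon\in(0,\gamma)$. Moreover, for any $\epsilon\in(0,\gamma)$ there is a constant $c$, not depending on $u$, such that for every $t\in(0,1]$ $$\lVert M(u)\rVert_{L^r(\Omega;\mathcal{I}_{\gamma-\epsilon,r}([0,t]))}\le c\,\lVert u\rVert_{L^r(\Omega\times[0,t])}.$$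
   Context: $(B_s,\ s\in[0,1])$ is a one-dimensional standard Brownian motion on the Wiener space $(\Omega,\mathrm{P})$; adaptedness refers to its filtration and $dB$-integrals are Itô integrals. $\mathcal{L}^p([0,T])$ denotes the Lebesgue space $L^p([0,T],dt)$, $0<T\le 1$. For $\alpha>0$ and $f\in\mathcal{L}^1([0,T])$, $(I_{0^+}^{\alpha}f)(x)=\frac{1}{\Gamma(\alpha)}\int_0^x f(t)(x-t)^{\alpha-1}\,dt$. The space $\mathcal{I}_{\alpha,p}([0,T])$ is $I_{0^+}^{\alpha}(\mathcal{L}^p([0,T]))$ with norm $\lVert f\rVert_{\mathcal{I}_{\alpha,p}}=\lVert I_{0^+}^{-\alpha}f\rVert_{\mathcal{L}^p([0,T])}$, where $I_{0^+}^{-\alpha}$ is the inverse of $I_{0^+}^{\alpha}$; when the interval is omitted, $T=1$. $(K(t,s),\ s,t\in[0,1])$ is a measurable deterministic kernel (no boundedness is assumed), and $K$ also denotes the linear map $Kf(t)=\int_0^t K(t,s)f(s)\,ds$. Hypothesis (A): there exists $\gamma>0$ such that, for any $t\in[0,1]$, the map $K$ is continuous both from $\mathcal{L}^1([0,t])$ into $\mathcal{I}_{\gamma,2}([0,t])$ and from $\mathcal{L}^2([0,t])$ into $\mathcal{I}_{\gamma+1/2,2}([0,t])$.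
   Formalization: For γ ≤ 1/r the integral M_t(u) may not exist for t in a null set; existence is claimed for a.e. t (every t if γ > 1/r) and the version agrees with M_t wherever it exists. Hölder continuity of order above 1 is meant in the higher-order sense (on derivatives). *)

theory Defs
  imports "HOL-Probability.Probability"
begin

text \<open>
  Elements of \<open>Lp p M\<close> are functions, not classes modulo null sets; so \<open>Lp_norm\<close> is a
  seminorm.  It is meaningful only on \<open>Lp p M\<close>, since the Bochner integral of a
  non-integrable function is 0.
\<close>

definition Lp :: "real \<Rightarrow> 'a measure \<Rightarrow> ('a \<Rightarrow> real) set" where
  "Lp p M = {f \<in> borel_measurable M. integrable M (\<lambda>x. \<bar>f x\<bar> powr p)}"

definition Lp_norm :: "real \<Rightarrow> 'a measure \<Rightarrow> ('a \<Rightarrow> real) \<Rightarrow> real" where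
  "Lp_norm p M f = (LINT x|M. \<bar>f x\<bar> powr p) powr (1 / p)"

abbreviation dt :: "real \<Rightarrow> real measure" where
  "dt T \<equiv> restrict_space lborel {0..T}"

definition frac_int :: "real \<Rightarrow> (real \<Rightarrow> real) \<Rightarrow> real \<Rightarrow> real" where
  "frac_int \<alpha> f x = (LBINT t:{0..x}. f t * (x - t) powr (\<alpha> - 1)) / Gamma \<alpha>"

text \<open>
  For \<open>\<alpha> * p > 1\<close> the integral \<open>frac_int \<alpha> g x\<close> of \<open>g \<in> Lp p\<close> converges at every point
  and is continuous in \<open>x\<close>, so the image of \<open>Lp p\<close> is a space of continuous functions and
  belonging to it is a statement about every point. For \<open>\<alpha> * p \<le> 1\<close> the integral
  converges in general only almost everywhere, and elements of the image are determined
  only up to null sets. The predicate \<open>pointwise\<close> expresses "at the relevant points".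
\<close>

definition pointwise :: "real \<Rightarrow> real \<Rightarrow> real \<Rightarrow> (real \<Rightarrow> bool) \<Rightarrow> bool" where
  "pointwise \<alpha> p T P \<longleftrightarrow> (AE x in dt T. P x) \<and> (\<alpha> * p > 1 \<longrightarrow> (\<forall>x\<in>{0..T}. P x))"

definition frac_space :: "real \<Rightarrow> real \<Rightarrow> real \<Rightarrow> (real \<Rightarrow> real) set" where
  "frac_space \<alpha> p T = {h. \<exists>g \<in> Lp p (dt T). pointwise \<alpha> p T (\<lambda>x. h x = frac_int \<alpha> g x)}"

text \<open>The preimage chosen here is unique up to a null set, as \<open>frac_int \<alpha>\<close> is injective.\<close>

definition frac_inv :: "real \<Rightarrow> real \<Rightarrow> real \<Rightarrow> (real \<Rightarrow> real) \<Rightarrow> real \<Rightarrow> real" where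
  "frac_inv \<alpha> p T h =
     (SOME g. g \<in> Lp p (dt T) \<and> pointwise \<alpha> p T (\<lambda>x. h x = frac_int \<alpha> g x))"

definition frac_norm :: "real \<Rightarrow> real \<Rightarrow> real \<Rightarrow> (real \<Rightarrow> real) \<Rightarrow> real" where
  "frac_norm \<alpha> p T h = Lp_norm p (dt T) (frac_inv \<alpha> p T h)"

definition measurable_kernel :: "(real \<Rightarrow> real \<Rightarrow> real) \<Rightarrow> bool" where
  "measurable_kernel K \<longleftrightarrow>
     (\<lambda>(t, s). K t s) \<in> borel_measurable (restrict_space borel ({0..1} \<times> {0..1}))"

definition volterra_op :: "(real \<Rightarrow> real \<Rightarrow> real) \<Rightarrow> (real \<Rightarrow> real) \<Rightarrow> real \<Rightarrow> real" where
  "volterra_op K f t = (LBINT s:{0..t}. K t s * f s)"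

text \<open>
  \<open>volterra_continuous K q \<alpha> p T\<close>: the operator is a well-defined continuous map from
  \<open>Lp q\<close> to \<open>frac_space \<alpha> p\<close> on \<open>[0,T]\<close>. Convergence of the defining integrals is
  required explicitly, because a divergent integral has value 0 in HOL.
\<close>

definition volterra_continuous ::
  "(real \<Rightarrow> real \<Rightarrow> real) \<Rightarrow> real \<Rightarrow> real \<Rightarrow> real \<Rightarrow> real \<Rightarrow> bool" where
  "volterra_continuous K q \<alpha> p T \<longleftrightarrow>
     (\<forall>f \<in> Lp q (dt T).
        pointwise \<alpha> p T (\<lambda>t. set_integrable lborel {0..t} (\<lambda>s. K t s * f s)) \<and>
        volterra_op K f \<in> frac_space \<alpha> p T) \<and>
     (\<forall>f \<in> Lp q (dt T). \<forall>e>0. \<exists>d>0. \<forall>g \<in> Lp q (dt T).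
        Lp_norm q (dt T) (\<lambda>s. g s - f s) < d \<longrightarrow>
        frac_norm \<alpha> p T (\<lambda>t. volterra_op K g t - volterra_op K f t) < e)"

definition hypothesis_A :: "(real \<Rightarrow> real \<Rightarrow> real) \<Rightarrow> real \<Rightarrow> bool" where
  "hypothesis_A K \<gamma> \<longleftrightarrow> \<gamma> > 0 \<and>
     (\<forall>t\<in>{0..1}. volterra_continuous K 1 \<gamma> 2 t \<and> volterra_continuous K 2 (\<gamma> + 1/2) 2 t)"

definition standard_brownian_motion :: "'w measure \<Rightarrow> (real \<Rightarrow> 'w \<Rightarrow> real) \<Rightarrow> bool" where
  "standard_brownian_motion M B \<longleftrightarrow> prob_space M \<and>
     (\<forall>t\<in>{0..1}. B t \<in> borel_measurable M) \<and>
     (AE \<omega> in M. B 0 \<omega> = 0) \<and>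
     (AE \<omega> in M. continuous_on {0..1} (\<lambda>t. B t \<omega>)) \<and>
     (\<forall>s t. 0 \<le> s \<and> s < t \<and> t \<le> 1 \<longrightarrow>
        distributed M lborel (\<lambda>\<omega>. B t \<omega> - B s \<omega>) (normal_density 0 (sqrt (t - s)))) \<and>
     (\<forall>n \<tau>. mono_on {..n} \<tau> \<and> \<tau> ` {..n} \<subseteq> {0..1} \<longrightarrow>
        prob_space.indep_vars M (\<lambda>_. borel) (\<lambda>i \<omega>. B (\<tau> (Suc i)) \<omega> - B (\<tau> i) \<omega>) {..<n::nat})"

definition brownian_filtration ::
  "'w measure \<Rightarrow> (real \<Rightarrow> 'w \<Rightarrow> real) \<Rightarrow> real \<Rightarrow> 'w measure" where
  "brownian_filtration M B s = sigma (space M)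
     ({B r -` A \<inter> space M | r A. r \<in> {0..s} \<and> A \<in> sets borel} \<union> null_sets M)"

definition adapted_process ::
  "'w measure \<Rightarrow> (real \<Rightarrow> 'w \<Rightarrow> real) \<Rightarrow> (real \<Rightarrow> 'w \<Rightarrow> real) \<Rightarrow> bool" where
  "adapted_process M B u \<longleftrightarrow>
     (\<forall>s\<in>{0..1}. u s \<in> borel_measurable (brownian_filtration M B s))"

text \<open>
  A simple process on \<open>[0,t]\<close> takes on \<open>(\<tau> i, \<tau> (i+1)]\<close> the value \<open>\<xi> i\<close>, a bounded
  variable known at time \<open>\<tau> i\<close>.
\<close>

definition simple_process ::
  "'w measure \<Rightarrow> (real \<Rightarrow> 'w \<Rightarrow> real) \<Rightarrow> real \<Rightarrow> nat \<Rightarrow> (nat \<Rightarrow> real) \<Rightarrow> (nat \<Rightarrow> 'w \<Rightarrow> real) \<Rightarrow> bool"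
where
  "simple_process M B t n \<tau> \<xi> \<longleftrightarrow> \<tau> 0 = 0 \<and> \<tau> n = t \<and> mono_on {..n} \<tau> \<and>
     (\<forall>i<n. \<xi> i \<in> borel_measurable (brownian_filtration M B (\<tau> i)) \<and>
            (\<exists>C. \<forall>\<omega>\<in>space M. \<bar>\<xi> i \<omega>\<bar> \<le> C))"

definition simple_value ::
  "nat \<Rightarrow> (nat \<Rightarrow> real) \<Rightarrow> (nat \<Rightarrow> 'w \<Rightarrow> real) \<Rightarrow> real \<Rightarrow> 'w \<Rightarrow> real" where
  "simple_value n \<tau> \<xi> s \<omega> = (\<Sum>i<n. \<xi> i \<omega> * indicator {\<tau> i<..\<tau> (Suc i)} s)"

definition simple_integral ::
  "(real \<Rightarrow> 'w \<Rightarrow> real) \<Rightarrow> nat \<Rightarrow> (nat \<Rightarrow> real) \<Rightarrow> (nat \<Rightarrow> 'w \<Rightarrow> real) \<Rightarrow> 'w \<Rightarrow> real" where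
  "simple_integral B n \<tau> \<xi> \<omega> = (\<Sum>i<n. \<xi> i \<omega> * (B (\<tau> (Suc i)) \<omega> - B (\<tau> i) \<omega>))"

text \<open>
  \<open>X\<close> is (a representative of) the integral of \<open>v\<close> over \<open>[0,t]\<close> with respect to \<open>B\<close>: the
  mean-square limit of the integrals of simple processes converging to \<open>v\<close> in mean square.
\<close>

definition has_ito_integral ::
  "'w measure \<Rightarrow> (real \<Rightarrow> 'w \<Rightarrow> real) \<Rightarrow> real \<Rightarrow> (real \<Rightarrow> 'w \<Rightarrow> real) \<Rightarrow> ('w \<Rightarrow> real) \<Rightarrow> bool" where
  "has_ito_integral M B t v X \<longleftrightarrow>
     (\<lambda>(\<omega>, s). v s \<omega>) \<in> Lp 2 (M \<Otimes>\<^sub>M dt t) \<and> X \<in> Lp 2 M \<and>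
     (\<exists>n \<tau> \<xi>. (\<forall>k::nat. simple_process M B t (n k) (\<tau> k) (\<xi> k)) \<and>
        (\<lambda>k. Lp_norm 2 (M \<Otimes>\<^sub>M dt t)
               (\<lambda>(\<omega>, s). simple_value (n k) (\<tau> k) (\<xi> k) s \<omega> - v s \<omega>)) \<longlonglongrightarrow> 0 \<and>
        (\<lambda>k. Lp_norm 2 M (\<lambda>\<omega>. simple_integral B (n k) (\<tau> k) (\<xi> k) \<omega> - X \<omega>)) \<longlonglongrightarrow> 0)"

definition ito_integral ::
  "'w measure \<Rightarrow> (real \<Rightarrow> 'w \<Rightarrow> real) \<Rightarrow> real \<Rightarrow> (real \<Rightarrow> 'w \<Rightarrow> real) \<Rightarrow> 'w \<Rightarrow> real" where
  "ito_integral M B t v = (SOME X. has_ito_integral M B t v X)"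

definition ito_integrable ::
  "'w measure \<Rightarrow> (real \<Rightarrow> 'w \<Rightarrow> real) \<Rightarrow> real \<Rightarrow> (real \<Rightarrow> 'w \<Rightarrow> real) \<Rightarrow> bool" where
  "ito_integrable M B t v \<longleftrightarrow> (\<exists>X. has_ito_integral M B t v X)"

definition volterra_process ::
  "'w measure \<Rightarrow> (real \<Rightarrow> 'w \<Rightarrow> real) \<Rightarrow> (real \<Rightarrow> real \<Rightarrow> real) \<Rightarrow> (real \<Rightarrow> 'w \<Rightarrow> real) \<Rightarrow> real \<Rightarrow> 'w \<Rightarrow> real"
where
  "volterra_process M B K u t = ito_integral M B t (\<lambda>s \<omega>. K t s * u s \<omega>)"

definition volterra_defined_at ::
  "'w measure \<Rightarrow> (real \<Rightarrow> 'w \<Rightarrow> real) \<Rightarrow> (real \<Rightarrow> real \<Rightarrow> real) \<Rightarrow> (real \<Rightarrow> 'w \<Rightarrow> real) \<Rightarrow> real \<Rightarrow> bool"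
where
  "volterra_defined_at M B K u t \<longleftrightarrow> ito_integrable M B t (\<lambda>s \<omega>. K t s * u s \<omega>)"

text \<open>
  A version is a measurable process that equals the given one almost surely at each time.
  Times at which the Ito integral does not exist are exempt: a kernel that is singular
  at \<open>s = t\<close> can make the integrand fail to be square integrable for some \<open>t\<close>.
\<close>

definition volterra_version ::
  "'w measure \<Rightarrow> (real \<Rightarrow> 'w \<Rightarrow> real) \<Rightarrow> (real \<Rightarrow> real \<Rightarrow> real) \<Rightarrow> (real \<Rightarrow> 'w \<Rightarrow> real) \<Rightarrow>
   (real \<Rightarrow> 'w \<Rightarrow> real) \<Rightarrow> bool"
where
  "volterra_version M B K u N \<longleftrightarrow>
     (\<lambda>(\<omega>, t). N t \<omega>) \<in> borel_measurable (M \<Otimes>\<^sub>M dt 1) \<and>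
     (\<forall>t\<in>{0..1}. volterra_defined_at M B K u t \<longrightarrow>
        (AE \<omega> in M. N t \<omega> = volterra_process M B K u t \<omega>))"

text \<open>
  For an exponent above 1 the first-order Hoelder condition would force the function to be
  constant; as usual the condition then bears on the derivative of order \<open>m\<close>, where the
  exponent is \<open>m + \<sigma>\<close> with \<open>0 < \<sigma> \<le> 1\<close>. At exponents \<open>\<le> 1\<close> (including
  exponents \<open>\<le> 0\<close>) one has \<open>m = 0\<close> and the condition is the usual inequality.
\<close>

definition holder_continuous :: "real \<Rightarrow> (real \<Rightarrow> real) \<Rightarrow> bool" where
  "holder_continuous a f \<longleftrightarrow>
     (let m = nat (\<lceil>a\<rceil> - 1) in
      \<exists>D :: nat \<Rightarrow> real \<Rightarrow> real.
        (\<forall>x\<in>{0..1}. D 0 x = f x) \<and>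
        (\<forall>k<m. \<forall>x\<in>{0..1}. (D k has_real_derivative D (Suc k) x) (at x within {0..1})) \<and>
        continuous_on {0..1} (D m) \<and>
        (\<exists>C. \<forall>x\<in>{0..1}. \<forall>y\<in>{0..1}. \<bar>D m x - D m y\<bar> \<le> C * \<bar>x - y\<bar> powr (a - real m)))"

end

(*
  Fix eps in (0,gamma). By (A) the operator I^{-(gamma-eps)} K maps L^2 boundedly into bounded
  functions and L^1 boundedly into L^2. Its value at x is a bounded functional on L^2, so it has a
  kernel H(x,.), whose squares have bounded integral in s for each x, and in x for each s. With
  Y(x) = int H(x,s) u_s dB_s, the moment inequality
    E|int h u dB|^r <= C (int h^2)^(r/2-1) int h^2 E|u|^r
  gives int_0^t E|Y|^r dx <= c int_0^t E|u|^r ds, using that H is causal. Since M(u) is the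
  fractional integral of order gamma-eps of Y, the norm estimate follows. H is only approximated,
  by dyadic step functions in s, for which all stochastic integrals are finite sums and no
  stochastic Fubini theorem is needed. The preimages for a sequence of values of eps serve all
  other values by the semigroup property.
*)
theory Submission
  imports Defs
begin

section \<open>Integral inequalities and completeness\<close>

text \<open>The loss \<epsilon> comes from a borderline case. The preimage of \<open>K f\<close> of
  order \<gamma> + 1/2 lies in L2, and integration of order exactly 1/2 does not map L2 into bounded
  functions, while order 1/2 + \<epsilon> does. The L1 half of (A) controls the integral of order
  1/2 of this same preimage, and a further integration of order \<epsilon> keeps that bound. The two
  bounds are dual. Evaluation at x being bounded on L2 bounds the row H(x,.), which gives the factor
  with exponent r/2 - 1 in the moment inequality. The bound from L1 into L2, tested on indicators of
  L1 norm 1, bounds the columns, which appear after exchanging integrals. Two obstacles shape the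
  rest. As K may be unbounded, K(t,.) u can fail to be square integrable at some t; so the integral
  is treated as a closed relation between integrands and random variables, and square integrability
  is deduced from convergence of the integrals. And u is only jointly measurable and adapted, so its
  simple approximations are averages over preceding intervals, whose measurability with respect to
  the filtration has to be proved.\<close>

abbreviation pow_int :: "real \<Rightarrow> 'a measure \<Rightarrow> ('a \<Rightarrow> real) \<Rightarrow> ennreal" where
 "pow_int p N f \<equiv> \<integral>\<^sup>+x. ennreal (\<bar>f x\<bar> powr p) \<partial>N"

abbreviation pow_upto :: "real \<Rightarrow> real \<Rightarrow> (real \<Rightarrow> real) \<Rightarrow> ennreal" where
 "pow_upto p T f \<equiv> \<integral>\<^sup>+t. ennreal (indicator {0..T} t * \<bar>f t\<bar> powr p) \<partial>lborel"

abbreviation abs_upto :: "real \<Rightarrow> (real \<Rightarrow> real) \<Rightarrow> ennreal" where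
 "abs_upto T f \<equiv> \<integral>\<^sup>+t. ennreal (indicator {0..T} t * \<bar>f t\<bar>) \<partial>lborel"

abbreviation sq_upto :: "real \<Rightarrow> (real \<Rightarrow> real) \<Rightarrow> ennreal" where
 "sq_upto T f \<equiv> \<integral>\<^sup>+t. ennreal (indicator {0..T} t * (f t)\<^sup>2) \<partial>lborel"

abbreviation nsq :: "'a measure \<Rightarrow> ('a \<Rightarrow> real) \<Rightarrow> ennreal" where
 "nsq N f \<equiv> (\<integral>\<^sup>+x. ennreal ((f x)\<^sup>2) \<partial>N)"

abbreviation moment :: "real \<Rightarrow> 'a measure \<Rightarrow> ('a \<Rightarrow> real) \<Rightarrow> real" where
 "moment p N f \<equiv> LINT x|N. \<bar>f x\<bar> powr p"

text \<open>Convexity of the p-th power, as Young's inequality for y / c. The free c lets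
  \<open>weighted_holder\<close> trade a sum of two terms for a product of powers.\<close>

lemma young_scaled:
 fixes y c p :: real
 assumes "y \<ge> 0" "c > 0" "p \<ge> 1"
 shows "y \<le> c powr (1 - p) / p * y powr p + c * (1 - 1 / p)"
proof (cases "y = 0")
 case False
 have "(y / c) powr 1 * 1 powr (1 - 1/p) \<le> (1/p) * (y / c) powr p + (1 - 1/p) * 1"
  using Youngs_inequality_0[of "1/p" "1 - 1/p" "(y/c) powr p" 1] assms False
  by (simp add: powr_powr)
 then have "c * (y / c) \<le> c * ((1/p) * (y / c) powr p + (1 - 1/p))"
  using assms False by (intro mult_left_mono) auto
 also have "\<dots> = c powr (1 - p) / p * y powr p + c * (1 - 1 / p)"
  using assms False by (simp add: powr_divide powr_diff field_simps)
 finally show ?thesis using assms by simp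
qed (use assms in simp)

lemma AE_zero_of_nn_integral:
 fixes f :: "'a \<Rightarrow> real"
 assumes [measurable]: "f \<in> borel_measurable M" and "\<And>x. f x \<ge> 0"
  and "(\<integral>\<^sup>+x. ennreal (f x) \<partial>M) \<le> 0"
 shows "AE x in M. f x = 0"
proof -
 have "(\<integral>\<^sup>+x. ennreal (f x) \<partial>M) = 0" using assms by simp
 then have "AE x in M. ennreal (f x) = 0" by (simp add: nn_integral_0_iff_AE)
 then show ?thesis by eventually_elim (use assms(2) in \<open>simp add: ennreal_eq_0_iff antisym\<close>)
qed

text \<open>Hoelder's inequality for the measure with density \<open>wt\<close>, by integrating
  \<open>young_scaled\<close> pointwise. \<open>A\<close> and \<open>B\<close> are upper bounds
  instead of the integrals themselves, so that estimates can be inserted directly.\<close>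

lemma weighted_holder:
 fixes f wt :: "'a \<Rightarrow> real"
 assumes [measurable]: "f \<in> borel_measurable M" "wt \<in> borel_measurable M"
  and f: "\<And>x. f x \<ge> 0" and wt: "\<And>x. wt x \<ge> 0"
  and p: "p \<ge> 1" and A0: "A \<ge> 0" and B0: "B \<ge> 0"
  and A: "(\<integral>\<^sup>+x. ennreal (wt x) \<partial>M) \<le> ennreal A"
  and B: "(\<integral>\<^sup>+x. ennreal (f x powr p * wt x) \<partial>M) \<le> ennreal B"
 shows "(\<integral>\<^sup>+x. ennreal (f x * wt x) \<partial>M) \<le> ennreal (A powr (1 - 1/p) * B powr (1/p))"
proof (cases "A = 0 \<or> B = 0")
 case True
 then have "AE x in M. wt x = 0 \<or> f x powr p * wt x = 0"
 proof
  assume "A = 0"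
  then have "AE x in M. wt x = 0" using A wt by (intro AE_zero_of_nn_integral) auto
  then show ?thesis by eventually_elim auto
 next
  assume "B = 0"
  then have "AE x in M. f x powr p * wt x = 0" using B wt by (intro AE_zero_of_nn_integral) auto
  then show ?thesis by eventually_elim auto
 qed
 then have "AE x in M. ennreal (f x * wt x) = 0" by eventually_elim auto
 then have "(\<integral>\<^sup>+x. ennreal (f x * wt x) \<partial>M) = 0" by (subst nn_integral_0_iff_AE) auto
 then show ?thesis by simp
next
 case False
 with A0 B0 have pos: "A > 0" "B > 0" by auto
 \<comment> \<open>This c minimises the integrated right side of Young's inequality; it makes
   \<open>c powr (1 - p) * B\<close> equal to \<open>c * A\<close>.\<close>
 define c where "c = (B / A) powr (1/p)"
 have c: "c > 0" using pos by (simp add: c_def)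
 have "(\<integral>\<^sup>+x. ennreal (f x * wt x) \<partial>M) \<le>
   (\<integral>\<^sup>+x. ennreal (c powr (1 - p) / p) * ennreal (f x powr p * wt x) + ennreal (c * (1 - 1 / p)) * ennreal (wt x) \<partial>M)"
 proof (rule nn_integral_mono)
  fix x
  have "f x * wt x \<le> (c powr (1 - p) / p * f x powr p + c * (1 - 1 / p)) * wt x"
   using young_scaled[OF f c p] wt by (rule mult_right_mono)
  then have "f x * wt x \<le> c powr (1 - p) / p * (f x powr p * wt x) + c * (1 - 1 / p) * wt x"
   by (simp add: algebra_simps)
  then show "ennreal (f x * wt x) \<le> ennreal (c powr (1 - p) / p) * ennreal (f x powr p * wt x) + ennreal (c * (1 - 1 / p)) * ennreal (wt x)"
   using wt p c by (simp flip: ennreal_mult ennreal_plus add: ennreal_leI)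
 qed
 also have "\<dots> = ennreal (c powr (1 - p) / p) * (\<integral>\<^sup>+x. ennreal (f x powr p * wt x) \<partial>M) + ennreal (c * (1 - 1 / p)) * (\<integral>\<^sup>+x. ennreal (wt x) \<partial>M)"
  by (simp add: nn_integral_add nn_integral_cmult)
 also have "\<dots> \<le> ennreal (c powr (1 - p) / p) * ennreal B + ennreal (c * (1 - 1 / p)) * ennreal A"
  by (intro add_mono mult_left_mono A B) auto
 also have "\<dots> = ennreal (c powr (1 - p) / p * B + c * (1 - 1 / p) * A)"
  using p c pos by (simp flip: ennreal_mult ennreal_plus)
 also have "c powr (1 - p) * B = A powr (1 - 1/p) * B powr (1/p)"
  using pos p unfolding c_def
  by (simp add: powr_powr powr_divide powr_diff powr_minus field_simps flip: powr_add)
 then have "c powr (1 - p) / p * B + c * (1 - 1 / p) * A = A powr (1 - 1/p) * B powr (1/p) / p + c * (1 - 1 / p) * A"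
  by (simp add: field_simps)
 also have "c * A = A powr (1 - 1/p) * B powr (1/p)"
 proof -
  have "A powr (1 - 1/p) = A / A powr (1/p)" using pos by (simp add: powr_diff)
  then show ?thesis using pos unfolding c_def by (simp add: powr_divide)
 qed
 then have "A powr (1 - 1/p) * B powr (1/p) / p + c * (1 - 1 / p) * A = A powr (1 - 1/p) * B powr (1/p)"
  using p by (simp add: field_simps)
 finally show ?thesis .
qed

lemma weighted_holder_finite:
 fixes f wt :: "'a \<Rightarrow> real"
 assumes [measurable]: "f \<in> borel_measurable M" "wt \<in> borel_measurable M"
  and wt: "\<And>x. wt x \<ge> 0" and p: "p \<ge> 1"
  and A: "(\<integral>\<^sup>+x. ennreal (wt x) \<partial>M) < \<infinity>"
  and B: "(\<integral>\<^sup>+x. ennreal (\<bar>f x\<bar> powr p * wt x) \<partial>M) < \<infinity>"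
 shows "(\<integral>\<^sup>+x. ennreal (\<bar>f x\<bar> * wt x) \<partial>M) < \<infinity>"
proof -
 obtain a where a: "a \<ge> 0" "(\<integral>\<^sup>+x. ennreal (wt x) \<partial>M) = ennreal a" 
  using A by (cases "\<integral>\<^sup>+x. ennreal (wt x) \<partial>M") auto
 obtain b where b: "b \<ge> 0" "(\<integral>\<^sup>+x. ennreal (\<bar>f x\<bar> powr p * wt x) \<partial>M) = ennreal b" 
  using B by (cases "\<integral>\<^sup>+x. ennreal (\<bar>f x\<bar> powr p * wt x) \<partial>M") auto
 show ?thesis
  using weighted_holder[of "\<lambda>x. \<bar>f x\<bar>" M wt p a b] a b wt p by (simp add: order_le_less_trans)
qed

text \<open>Integrability is not asked for: the Bochner integral of a non-integrable function is
  0.\<close>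

lemma ennreal_abs_integral_le:
 fixes f :: "'a \<Rightarrow> real"
 shows "ennreal \<bar>\<integral>x. f x \<partial>M\<bar> \<le> (\<integral>\<^sup>+x. ennreal \<bar>f x\<bar> \<partial>M)"
proof (cases "integrable M f")
 case True
 then show ?thesis
  using integral_norm_bound_ennreal[OF True] by simp
qed (simp add: not_integrable_integral_eq)

text \<open>Jensen's inequality for a measure of mass at most \<open>A\<close>; the factor
  \<open>A powr (p - 1)\<close> accounts for the missing normalisation. For \<open>A\<close>
  positive an infinite right side makes the claim trivial.\<close>

lemma integral_powr_le:
 fixes f wt :: "'a \<Rightarrow> real"
 assumes [measurable]: "f \<in> borel_measurable M" "wt \<in> borel_measurable M"
  and wt: "\<And>x. wt x \<ge> 0"
  and p: "p \<ge> 1" and A0: "A \<ge> 0"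
  and A: "(\<integral>\<^sup>+x. ennreal (wt x) \<partial>M) \<le> ennreal A"
 shows "ennreal (\<bar>\<integral>x. f x * wt x \<partial>M\<bar> powr p) \<le>
  ennreal (A powr (p - 1)) * (\<integral>\<^sup>+x. ennreal (\<bar>f x\<bar> powr p * wt x) \<partial>M)"
proof (cases "A = 0")
 case True
 then have "AE x in M. wt x = 0" using A wt by (intro AE_zero_of_nn_integral) auto
 then have "AE x in M. f x * wt x = 0" by eventually_elim simp
 then have "(\<integral>x. f x * wt x \<partial>M) = 0" by (simp add: integral_eq_zero_AE)
 then show ?thesis using p by simp
next
 case False
 with A0 have A': "A > 0" by auto
 show ?thesis
 proof (cases "\<integral>\<^sup>+x. ennreal (\<bar>f x\<bar> powr p * wt x) \<partial>M")
  case (real b)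
  have "ennreal \<bar>\<integral>x. f x * wt x \<partial>M\<bar> \<le> (\<integral>\<^sup>+x. ennreal (\<bar>f x\<bar> * wt x) \<partial>M)"
   using ennreal_abs_integral_le[of M "\<lambda>x. f x * wt x"] wt by (simp add: abs_mult)
  also have "\<dots> \<le> ennreal (A powr (1 - 1/p) * b powr (1/p))"
   using real p A A0 by (intro weighted_holder) (auto simp: wt)
  finally have "\<bar>\<integral>x. f x * wt x \<partial>M\<bar> \<le> A powr (1 - 1/p) * b powr (1/p)"
   by (subst (asm) ennreal_le_iff) auto
  then have "\<bar>\<integral>x. f x * wt x \<partial>M\<bar> powr p \<le> (A powr (1 - 1/p) * b powr (1/p)) powr p"
   using p by (intro powr_mono2) auto
  also have "\<dots> = A powr ((1 - 1/p) * p) * b"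
   using p A' real by (simp add: powr_mult powr_powr)
  also have "(1 - 1/p) * p = p - 1" using p by (simp add: field_simps)
  finally show ?thesis using real by (simp flip: ennreal_mult)
 next
  case top
  then show ?thesis using A' by (simp add: ennreal_mult_top)
 qed
qed

section \<open>Subsequences, Fatou's lemma and completeness\<close>

lemma subseq_below:
 fixes a c :: "nat \<Rightarrow> ennreal"
 assumes "a \<longlonglongrightarrow> 0" and c: "\<And>k. c k > 0"
 shows "\<exists>s. strict_mono s \<and> (\<forall>k. a (s k) < c k)"
proof -
 have ev: "\<exists>n>m. a n < c k" for m k
  using order_tendstoD(2)[OF assms(1) c[of k]] eventually_gt_at_top[of m]
  by (metis (mono_tags, lifting) eventually_conj eventually_sequentially linear)
 have "\<exists>s. \<forall>k. a (s k) < c k \<and> s k < s (Suc k)"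
  using ev by (intro dependent_nat_choice) auto
 then show ?thesis by (auto simp: strict_mono_Suc_iff)
qed

text \<open>Along a subsequence with summable integrals the sum of the functions has finite
  integral, hence is finite almost everywhere, and its terms tend to 0.\<close>

lemma nn_tendsto_zero_subseq_AE:
 assumes [measurable]: "\<And>n. g n \<in> borel_measurable M"
  and lim: "(\<lambda>n. \<integral>\<^sup>+x. g n x \<partial>M) \<longlonglongrightarrow> 0"
 shows "\<exists>s. strict_mono s \<and> (AE x in M. (\<lambda>n. g (s n) x) \<longlonglongrightarrow> (0::ennreal))"
proof -
 obtain s where s: "strict_mono s" "\<And>k. (\<integral>\<^sup>+x. g (s k) x \<partial>M) < ennreal ((1/2)^k)"
  using subseq_below[OF lim, of "\<lambda>k. ennreal ((1/2)^k)"] by auto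
 have "(\<integral>\<^sup>+x. (\<Sum>k. g (s k) x) \<partial>M) = (\<Sum>k. \<integral>\<^sup>+x. g (s k) x \<partial>M)"
  by (intro nn_integral_suminf) auto
 also have "\<dots> \<le> (\<Sum>k. ennreal ((1/2)^k))"
  using s(2) by (intro suminf_le) (auto intro: less_imp_le)
 also have "\<dots> < \<infinity>" by (subst suminf_ennreal2) (auto simp: summable_geometric)
 finally have "AE x in M. (\<Sum>k. g (s k) x) \<noteq> \<infinity>"
  by (intro nn_integral_PInf_AE) auto
 then have "AE x in M. (\<lambda>n. g (s n) x) \<longlonglongrightarrow> 0"
 proof eventually_elim
  case (elim x)
  have fin: "g (s k) x < \<infinity>" for k
   using elim sum_le_suminf[of "\<lambda>k. g (s k) x" "{k}"] by (auto simp: less_top)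
  have eq: "ennreal (enn2real (g (s k) x)) = g (s k) x" for k using fin[of k] by (simp add: less_top)
  have "summable (\<lambda>k. enn2real (g (s k) x))"
   using elim by (intro summable_suminf_not_top) (auto simp: eq)
  then have "(\<lambda>k. enn2real (g (s k) x)) \<longlonglongrightarrow> 0" by (rule summable_LIMSEQ_zero)
  then have "(\<lambda>k. ennreal (enn2real (g (s k) x))) \<longlonglongrightarrow> ennreal 0" by (intro tendsto_ennrealI)
  then show ?case using fin by (simp add: less_top)
 qed
 with s show ?thesis by blast
qed

lemma ennreal_powr_tendsto_0_iff:
 fixes h :: "nat \<Rightarrow> real"
 assumes "p > 0"
 shows "(\<lambda>n. ennreal (\<bar>h n\<bar> powr p)) \<longlonglongrightarrow> 0 \<longleftrightarrow> h \<longlonglongrightarrow> 0"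
proof -
 have "(\<lambda>n. ennreal (\<bar>h n\<bar> powr p)) \<longlonglongrightarrow> ennreal 0 \<longleftrightarrow> (\<lambda>n. \<bar>h n\<bar> powr p) \<longlonglongrightarrow> 0"
  by (intro tendsto_ennreal_iff) auto
 also have "\<dots> \<longleftrightarrow> h \<longlonglongrightarrow> 0"
 proof
  assume "(\<lambda>n. \<bar>h n\<bar> powr p) \<longlonglongrightarrow> 0"
  then have "(\<lambda>n. (\<bar>h n\<bar> powr p) powr (1/p)) \<longlonglongrightarrow> 0 powr (1/p)"
   using assms by (intro tendsto_powr2) auto
  then show "h \<longlonglongrightarrow> 0" using assms by (simp add: powr_powr tendsto_rabs_zero_iff)
 next
  assume "h \<longlonglongrightarrow> 0"
  then have "(\<lambda>n. \<bar>h n\<bar>) \<longlonglongrightarrow> 0" by (simp add: tendsto_rabs_zero_iff)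
  then have "(\<lambda>n. \<bar>h n\<bar> powr p) \<longlonglongrightarrow> 0 powr p"
   using assms by (intro tendsto_powr2) auto
  then show "(\<lambda>n. \<bar>h n\<bar> powr p) \<longlonglongrightarrow> 0" using assms by simp
 qed
 finally show ?thesis by simp
qed

lemma Lp_tendsto_subseq_AE:
 fixes f :: "nat \<Rightarrow> 'a \<Rightarrow> real"
 assumes [measurable]: "\<And>n. f n \<in> borel_measurable M" "g \<in> borel_measurable M" and p: "p > 0"
  and lim: "(\<lambda>n. pow_int p M (\<lambda>x. f n x - g x)) \<longlonglongrightarrow> 0"
 shows "\<exists>s. strict_mono s \<and> (AE x in M. (\<lambda>n. f (s n) x) \<longlonglongrightarrow> g x)"
proof -
 obtain s where s: "strict_mono s" "AE x in M. (\<lambda>n. ennreal (\<bar>f (s n) x - g x\<bar> powr p)) \<longlonglongrightarrow> 0"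
  using nn_tendsto_zero_subseq_AE[OF _ lim] by auto
 from s(2) have "AE x in M. (\<lambda>n. f (s n) x) \<longlonglongrightarrow> g x"
  by eventually_elim (subst (asm) ennreal_powr_tendsto_0_iff[OF p], rule Lim_null[THEN iffD2])
 with s(1) show ?thesis by blast
qed

text \<open>Carries moment bounds from approximations to their limits. The bound is asked only
  eventually, since it often holds from some level of approximation on.\<close>

lemma nn_powr_fatou:
 fixes f :: "nat \<Rightarrow> 'a \<Rightarrow> real"
 assumes [measurable]: "\<And>n. f n \<in> borel_measurable M" and p: "p > 0"
  and lim: "AE x in M. (\<lambda>n. f n x) \<longlonglongrightarrow> g x"
  and bound: "\<forall>\<^sub>F n in sequentially. pow_int p M (f n) \<le> c"
 shows "pow_int p M g \<le> c"
proof -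
 have "pow_int p M g = (\<integral>\<^sup>+x. liminf (\<lambda>n. ennreal (\<bar>f n x\<bar> powr p)) \<partial>M)"
 proof (rule nn_integral_cong_AE, use lim in eventually_elim)
  case (elim x)
  have "(\<lambda>n. ennreal (\<bar>f n x\<bar> powr p)) \<longlonglongrightarrow> ennreal (\<bar>g x\<bar> powr p)"
   using elim p by (intro tendsto_ennrealI tendsto_powr2 tendsto_rabs) auto
  then show ?case using lim_imp_Liminf[of sequentially] by fastforce
 qed
 also have "\<dots> \<le> liminf (\<lambda>n. pow_int p M (f n))"
  by (intro nn_integral_liminf) auto
 also have "\<dots> \<le> limsup (\<lambda>n. pow_int p M (f n))"
  by (intro Liminf_le_Limsup) simp
 also have "\<dots> \<le> c" using bound by (rule Limsup_bounded)
 finally show ?thesis .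
qed

text \<open>Riesz-Fischer. Only differences enter, so the \<open>f n\<close> need not be in Lp
  themselves. Minkowski's inequality is avoided by showing that the increments of a subsequence
  decay geometrically at almost every point.\<close>

lemma Lp_complete:
 fixes f :: "nat \<Rightarrow> 'a \<Rightarrow> real"
 assumes [measurable]: "\<And>n. f n \<in> borel_measurable M" and p: "p > 0"
  and cauchy: "\<And>e. e > 0 \<Longrightarrow> \<exists>N. \<forall>m\<ge>N. \<forall>n\<ge>N. pow_int p M (\<lambda>x. f m x - f n x) \<le> e"
 shows "\<exists>g\<in>borel_measurable M. (\<lambda>n. pow_int p M (\<lambda>x. f n x - g x)) \<longlonglongrightarrow> 0"
proof -
 define d where "d m n = pow_int p M (\<lambda>x. f m x - f n x)" for m n
 \<comment> \<open>The second factor cancels the weight in \<open>2^k * h k x\<close>, whose p-th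
   power then has integral at most \<open>(1/2)^k\<close>. So almost everywhere \<open>h k x\<close>
   is of order \<open>(1/2)^k\<close>, hence summable.\<close>
 define c :: "nat \<Rightarrow> real" where "c k = (1/2)^k * ((1/2)^k) powr p" for k
 have c: "c k > 0" for k by (simp add: c_def)
 have "\<exists>N>j. \<forall>m\<ge>N. \<forall>n\<ge>N. d m n \<le> ennreal (c k)" for j k
 proof -
  obtain N where N: "\<forall>m\<ge>N. \<forall>n\<ge>N. d m n \<le> ennreal (c k)"
   using cauchy[of "ennreal (c k)"] c by (auto simp: d_def)
  then show ?thesis by (intro exI[of _ "max N (Suc j)"]) auto
 qed
 then have "\<exists>s. \<forall>k. (\<forall>m\<ge>s k. \<forall>n\<ge>s k. d m n \<le> ennreal (c k)) \<and> s k < s (Suc k)"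
  by (intro dependent_nat_choice) meson+
 then obtain s where s: "\<And>k m n. m \<ge> s k \<Longrightarrow> n \<ge> s k \<Longrightarrow> d m n \<le> ennreal (c k)" "strict_mono s"
  by (auto simp: strict_mono_Suc_iff)
 define h where "h k x = f (s (Suc k)) x - f (s k) x" for k x
 have [measurable]: "h k \<in> borel_measurable M" for k unfolding h_def by simp
 have dh: "pow_int p M (h k) \<le> ennreal (c k)" for k
  using s(1)[of k "s (Suc k)" "s k"] strict_mono_less_eq[OF s(2), of k "Suc k"] by (simp add: d_def h_def)
 have "(\<integral>\<^sup>+x. (\<Sum>k. ennreal (\<bar>2^k * h k x\<bar> powr p)) \<partial>M) = (\<Sum>k. pow_int p M (\<lambda>x. 2^k * h k x))"
  by (intro nn_integral_suminf) auto
 also have "\<dots> \<le> (\<Sum>k. ennreal ((1/2)^k))"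
 proof (intro suminf_le)
  fix k
  have "pow_int p M (\<lambda>x. 2^k * h k x) = ennreal ((2^k) powr p) * pow_int p M (h k)"
   by (subst nn_integral_cmult[symmetric]) (auto simp: abs_mult powr_mult ennreal_mult intro!: nn_integral_cong)
  also have "\<dots> \<le> ennreal ((2^k) powr p) * ennreal (c k)" using dh by (intro mult_left_mono) auto
  also have "\<dots> = ennreal ((1/2)^k)"
   by (simp add: c_def power_divide powr_divide flip: ennreal_mult)
  finally show "pow_int p M (\<lambda>x. 2^k * h k x) \<le> ennreal ((1/2)^k)" .
 qed auto
 also have "\<dots> < \<infinity>" by (subst suminf_ennreal2) (auto simp: summable_geometric)
 finally have "AE x in M. (\<Sum>k. ennreal (\<bar>2^k * h k x\<bar> powr p)) \<noteq> \<infinity>"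
  by (intro nn_integral_PInf_AE) auto
 then have conv: "AE x in M. convergent (\<lambda>k. f (s k) x)"
 proof eventually_elim
  case (elim x)
  have "summable (\<lambda>k. \<bar>2^k * h k x\<bar> powr p)"
   using elim by (intro summable_suminf_not_top) auto
  then have "(\<lambda>k. \<bar>2^k * h k x\<bar> powr p) \<longlonglongrightarrow> 0" by (rule summable_LIMSEQ_zero)
  then have "(\<lambda>k. ennreal (\<bar>2^k * h k x\<bar> powr p)) \<longlonglongrightarrow> ennreal 0" by (intro tendsto_ennrealI)
  then have "(\<lambda>k. 2^k * h k x) \<longlonglongrightarrow> 0" using ennreal_powr_tendsto_0_iff[OF p] by simp
  then have "Bseq (\<lambda>k. 2^k * h k x)" by (intro convergent_imp_Bseq convergentI)
  then obtain C where C: "\<And>k. \<bar>2^k * h k x\<bar> \<le> C" by (auto simp: Bseq_def)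
  have hC: "norm (h k x) \<le> C * (1/2)^k" for k
   using C[of k] by (simp add: abs_mult field_simps power_divide)
  have "summable (\<lambda>k. h k x)"
   by (rule summable_comparison_test'[where g="\<lambda>k. C * (1/2)^k"])
    (use hC in \<open>auto intro!: summable_mult summable_geometric\<close>)
  then have "convergent (\<lambda>n. \<Sum>k<n. h k x)" by (simp add: summable_iff_convergent)
  moreover have "(\<Sum>k<n. h k x) = f (s n) x - f (s 0) x" for n
   unfolding h_def by (rule sum_lessThan_telescope[of "\<lambda>k. f (s k) x"])
  ultimately have "convergent (\<lambda>n. f (s n) x - f (s 0) x)" by simp
  then have "convergent (\<lambda>n. (f (s n) x - f (s 0) x) + f (s 0) x)"
   by (intro convergent_add convergent_const)
  then show ?case by simp
 qed
 define g where "g x = lim (\<lambda>k. f (s k) x)" for x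
 have [measurable]: "g \<in> borel_measurable M" unfolding g_def by measurable
 have lim: "AE x in M. (\<lambda>k. f (s k) x) \<longlonglongrightarrow> g x"
  using conv by eventually_elim (simp add: g_def convergent_LIMSEQ_iff)
 have "(\<lambda>n. pow_int p M (\<lambda>x. f n x - g x)) \<longlonglongrightarrow> 0"
 proof (rule order_tendstoI)
  fix e :: ennreal assume "0 < e"
  then obtain e' where e': "0 < e'" "e' < e" using dense by blast
  obtain N where N: "\<And>m n. m \<ge> N \<Longrightarrow> n \<ge> N \<Longrightarrow> pow_int p M (\<lambda>x. f m x - f n x) \<le> e'"
   using cauchy[OF e'(1)] by blast
  have "pow_int p M (\<lambda>x. f n x - g x) \<le> e'" if "n \<ge> N" for n
  proof (rule nn_powr_fatou[where f="\<lambda>k x. f n x - f (s k) x"])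
   show "AE x in M. (\<lambda>k. f n x - f (s k) x) \<longlonglongrightarrow> f n x - g x"
    using lim by eventually_elim (intro tendsto_intros)
   show "\<forall>\<^sub>F k in sequentially. pow_int p M (\<lambda>x. f n x - f (s k) x) \<le> e'"
    using eventually_ge_at_top[of N]
    by eventually_elim (use that N seq_suble[OF s(2)] le_trans in blast)
  qed (use p in auto)
  then show "\<forall>\<^sub>F n in sequentially. pow_int p M (\<lambda>x. f n x - g x) < e"
   using e' by (auto simp: eventually_sequentially intro!: exI[of _ N] intro: le_less_trans)
 qed simp
 then show ?thesis by (intro bexI[of _ g]) auto
qed

section \<open>Fractional integrals\<close>

text \<open>With the range of integration built into the kernel, fractional integrals are integrals
  over the line and Fubini applies without moving limits. The point t = x may be left out, as 0
  \<open>powr\<close> anything is 0.\<close>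

definition frac_kernel :: "real \<Rightarrow> real \<Rightarrow> real \<Rightarrow> real" where
 "frac_kernel \<alpha> x t = (if 0 \<le> t \<and> t < x then (x - t) powr (\<alpha> - 1) / Gamma \<alpha> else 0)"

text \<open>Its finiteness at x says that the integral behind \<open>frac_int \<alpha> f x\<close>
  converges, which the value of \<open>frac_int\<close> alone cannot tell.\<close>

definition nn_frac :: "real \<Rightarrow> (real \<Rightarrow> real) \<Rightarrow> real \<Rightarrow> ennreal" where
 "nn_frac \<alpha> f x = (\<integral>\<^sup>+t. ennreal (\<bar>f t\<bar> * frac_kernel \<alpha> x t) \<partial>lborel)"

lemma frac_kernel_nonneg: "\<alpha> > 0 \<Longrightarrow> frac_kernel \<alpha> x t \<ge> 0"
 unfolding frac_kernel_def by (simp add: Gamma_real_pos less_imp_le)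

lemma measurable_frac_kernel[measurable (raw)]:
 assumes [measurable]: "f \<in> borel_measurable N" "g \<in> borel_measurable N"
 shows "(\<lambda>wt. frac_kernel \<alpha> (f wt) (g wt)) \<in> borel_measurable N"
 unfolding frac_kernel_def by measurable

lemma frac_int_eq: "frac_int \<alpha> f x = (LINT t|lborel. f t * frac_kernel \<alpha> x t)"
proof -
 have "frac_int \<alpha> f x = (LINT t|lborel. (indicator {0..x} t *\<^sub>R (f t * (x - t) powr (\<alpha> - 1))) / Gamma \<alpha>)"
  unfolding frac_int_def set_lebesgue_integral_def by simp
 also have "\<dots> = (LINT t|lborel. f t * frac_kernel \<alpha> x t)"
  by (intro Bochner_Integration.integral_cong) (auto simp: frac_kernel_def indicator_def)
 finally show ?thesis .
qed

lemma measurable_frac_int[measurable]: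
 assumes [measurable]: "f \<in> borel_measurable borel"
 shows "frac_int \<alpha> f \<in> borel_measurable borel"
 unfolding frac_int_eq[abs_def] by measurable

lemma measurable_nn_frac[measurable]:
 assumes [measurable]: "f \<in> borel_measurable borel"
 shows "nn_frac \<alpha> f \<in> borel_measurable borel"
 unfolding nn_frac_def by measurable

lemma Gamma_plus1_pos: "(\<alpha>::real) > 0 \<Longrightarrow> Gamma (\<alpha> + 1) = \<alpha> * Gamma \<alpha>"
 by (rule Gamma_plus1) (auto dest: nonpos_Ints_nonpos)

section \<open>Mass of the kernel in either variable, and the semigroup identity\<close>

lemma nn_integral_powr_from_0:
 assumes "a > -1" "c \<ge> (0::real)"
 shows "(\<integral>\<^sup>+x. ennreal (indicator {0..c} x * x powr a) \<partial>lborel) = ennreal (c powr (a+1) / (a+1))"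
 using nn_integral_has_integral_lebesgue[OF _ has_integral_powr_from_0[OF assms]] by simp

lemma nn_integral_frac_kernel_powr:
 assumes "\<alpha> > 0" "(\<alpha> - 1) * q > -1" "x \<ge> 0"
 shows "(\<integral>\<^sup>+t. ennreal (frac_kernel \<alpha> x t powr q) \<partial>lborel) =
  ennreal (x powr ((\<alpha> - 1) * q + 1) / ((\<alpha> - 1) * q + 1) / Gamma \<alpha> powr q)"
proof -
 have G: "Gamma \<alpha> > 0" using assms by (simp add: Gamma_real_pos)
 have "(\<integral>\<^sup>+t. ennreal (frac_kernel \<alpha> x t powr q) \<partial>lborel) =
   (\<integral>\<^sup>+z. ennreal (frac_kernel \<alpha> x (x + (-1) * z) powr q) \<partial>lborel)"
  by (subst nn_integral_real_affine[where c="-1" and t=x]) auto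
 also have "\<dots> = (\<integral>\<^sup>+z. ennreal (indicator {0..x} z * z powr ((\<alpha> - 1) * q)) * ennreal (1 / Gamma \<alpha> powr q) \<partial>lborel)"
 proof (intro nn_integral_cong)
  fix z
  show "ennreal (frac_kernel \<alpha> x (x + - 1 * z) powr q) =
   ennreal (indicator {0..x} z * z powr ((\<alpha> - 1) * q)) * ennreal (1 / Gamma \<alpha> powr q)"
   using G by (auto simp: frac_kernel_def indicator_def powr_divide powr_powr simp flip: ennreal_mult)
 qed
 also have "\<dots> = ennreal (x powr ((\<alpha> - 1) * q + 1) / ((\<alpha> - 1) * q + 1)) * ennreal (1 / Gamma \<alpha> powr q)"
  using assms by (subst nn_integral_multc) (auto simp: nn_integral_powr_from_0)
 also have "\<dots> = ennreal (x powr ((\<alpha> - 1) * q + 1) / ((\<alpha> - 1) * q + 1) / Gamma \<alpha> powr q)"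
  using assms by (simp flip: ennreal_mult)
 finally show ?thesis .
qed

lemma nn_integral_frac_kernel:
 assumes "\<alpha> > 0" "x \<ge> 0"
 shows "(\<integral>\<^sup>+t. ennreal (frac_kernel \<alpha> x t) \<partial>lborel) = ennreal (x powr \<alpha> / Gamma (\<alpha> + 1))"
proof -
 have "(\<integral>\<^sup>+t. ennreal (frac_kernel \<alpha> x t) \<partial>lborel) = (\<integral>\<^sup>+t. ennreal (frac_kernel \<alpha> x t powr 1) \<partial>lborel)"
  using frac_kernel_nonneg[OF assms(1)] by simp
 then show ?thesis
  using assms nn_integral_frac_kernel_powr[of \<alpha> 1 x] Gamma_real_pos[of \<alpha>]
  by (simp add: Gamma_plus1_pos)
qed

lemma nn_integral_frac_kernel_shift:
 assumes "\<alpha> > 0" "0 \<le> a" "a \<le> x"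
 shows "(\<integral>\<^sup>+t. ennreal (indicator {a..} t * frac_kernel \<alpha> x t) \<partial>lborel) = ennreal ((x - a) powr \<alpha> / Gamma (\<alpha> + 1))"
proof -
 have "(\<integral>\<^sup>+t. ennreal (indicator {a..} t * frac_kernel \<alpha> x t) \<partial>lborel) =
   (\<integral>\<^sup>+z. ennreal (indicator {a..} (a + 1 * z) * frac_kernel \<alpha> x (a + 1 * z)) \<partial>lborel)"
  by (subst nn_integral_real_affine[where c=1 and t=a]) auto
 also have "\<dots> = (\<integral>\<^sup>+z. ennreal (frac_kernel \<alpha> (x - a) z) \<partial>lborel)"
  using assms by (intro nn_integral_cong) (auto simp: frac_kernel_def indicator_def algebra_simps)
 finally show ?thesis using assms by (simp add: nn_integral_frac_kernel)
qed

text \<open>Together with \<open>nn_integral_frac_kernel\<close> this gives both halves of Schur's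
  test, from which boundedness on Lp follows.\<close>

lemma nn_integral_frac_kernel_left:
 assumes "\<alpha> > 0" "0 \<le> T" "T \<le> 1"
 shows "(\<integral>\<^sup>+x. ennreal (indicator {0..T} x * frac_kernel \<alpha> x t) \<partial>lborel) \<le> ennreal (indicator {0..T} t / Gamma (\<alpha> + 1))"
proof (cases "t \<in> {0..T}")
 case True
 have G: "Gamma \<alpha> > 0" using assms by (simp add: Gamma_real_pos)
 have "(\<integral>\<^sup>+x. ennreal (indicator {0..T} x * frac_kernel \<alpha> x t) \<partial>lborel) =
  (\<integral>\<^sup>+z. ennreal (indicator {0..T} (t + 1 * z) * frac_kernel \<alpha> (t + 1 * z) t) \<partial>lborel)"
  by (subst nn_integral_real_affine[where c=1 and t=t]) auto
 also have "\<dots> = (\<integral>\<^sup>+z. ennreal (indicator {0..T - t} z * z powr (\<alpha> - 1)) * ennreal (1 / Gamma \<alpha>) \<partial>lborel)"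
  using True G by (intro nn_integral_cong) (auto simp: frac_kernel_def indicator_def simp flip: ennreal_mult)
 also have "\<dots> = ennreal ((T - t) powr \<alpha> / \<alpha>) * ennreal (1 / Gamma \<alpha>)"
  using assms True by (subst nn_integral_multc) (auto simp: nn_integral_powr_from_0)
 also have "\<dots> = ennreal ((T - t) powr \<alpha> / Gamma (\<alpha> + 1))"
  using assms G by (simp add: Gamma_plus1_pos flip: ennreal_mult)
 also have "\<dots> \<le> ennreal (1 / Gamma (\<alpha> + 1))"
  using assms True Gamma_real_pos[of "\<alpha> + 1"]
  by (intro ennreal_leI divide_right_mono) (auto intro: powr_le1)
 finally show ?thesis using True by simp
next
 case False
 then have "(\<integral>\<^sup>+x. ennreal (indicator {0..T} x * frac_kernel \<alpha> x t) \<partial>lborel) = (\<integral>\<^sup>+x. 0 \<partial>(lborel :: real measure))"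
  by (intro nn_integral_cong) (auto simp: frac_kernel_def indicator_def)
 then show ?thesis by simp
qed

text \<open>The substitution y = t + (x - t) z turns the composition of kernels into Euler's Beta
  integral.\<close>

lemma frac_kernel_semigroup:
 assumes "\<alpha> > 0" "\<beta> > 0"
 shows "(\<integral>\<^sup>+y. ennreal (frac_kernel \<alpha> x y * frac_kernel \<beta> y t) \<partial>lborel) = ennreal (frac_kernel (\<alpha> + \<beta>) x t)"
proof (cases "0 \<le> t \<and> t < x")
 case True
 define d where "d = x - t"
 have d: "d > 0" using True by (simp add: d_def)
 have G: "Gamma \<alpha> > 0" "Gamma \<beta> > 0" "Gamma (\<alpha> + \<beta>) > 0" using assms by (auto simp: Gamma_real_pos)
 have B: "Beta \<beta> \<alpha> = Gamma \<alpha> * Gamma \<beta> / Gamma (\<alpha> + \<beta>)" by (simp add: Beta_def add.commute)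
 have "(\<integral>\<^sup>+y. ennreal (frac_kernel \<alpha> x y * frac_kernel \<beta> y t) \<partial>lborel) =
   ennreal d * (\<integral>\<^sup>+z. ennreal (frac_kernel \<alpha> x (t + d * z) * frac_kernel \<beta> (t + d * z) t) \<partial>lborel)"
  using d by (subst nn_integral_real_affine[where c=d and t=t]) auto
 also have "(\<integral>\<^sup>+z. ennreal (frac_kernel \<alpha> x (t + d * z) * frac_kernel \<beta> (t + d * z) t) \<partial>lborel) =
  (\<integral>\<^sup>+z. ennreal (indicator {0..1} z * (z powr (\<beta> - 1) * (1 - z) powr (\<alpha> - 1))) *
    ennreal (d powr (\<alpha> + \<beta> - 2) / (Gamma \<alpha> * Gamma \<beta>)) \<partial>lborel)"
 proof (intro nn_integral_cong)
  fix z
  show "ennreal (frac_kernel \<alpha> x (t + d * z) * frac_kernel \<beta> (t + d * z) t) =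
   ennreal (indicator {0..1} z * (z powr (\<beta> - 1) * (1 - z) powr (\<alpha> - 1))) *
    ennreal (d powr (\<alpha> + \<beta> - 2) / (Gamma \<alpha> * Gamma \<beta>))"
  proof (cases "0 < z \<and> z < 1")
   case z: True
   have "d * z < d * 1" using d z by (intro mult_strict_left_mono) auto
   moreover have "x = t + d" by (simp add: d_def)
   ultimately have "t + d * z < x" by linarith
   moreover have "0 \<le> t + d * z" "t < t + d * z" using z d True by auto
   moreover have "(x - (t + d * z)) powr (\<alpha> - 1) = d powr (\<alpha> - 1) * (1 - z) powr (\<alpha> - 1)"
    using z d by (subst powr_mult[symmetric]) (simp add: d_def algebra_simps)
   moreover have "d powr (\<alpha> - 1) * d powr (\<beta> - 1) = d powr (\<alpha> + \<beta> - 2)" by (simp flip: powr_add)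
   ultimately show ?thesis
    using z d True G by (simp add: frac_kernel_def powr_mult field_simps flip: ennreal_mult)
  next
   case z: False
   have "frac_kernel \<alpha> x (t + d * z) = 0 \<or> frac_kernel \<beta> (t + d * z) t = 0"
   proof (cases "z \<le> 0")
    case True
    then have "d * z \<le> 0" using d by (simp add: mult_le_0_iff)
    then show ?thesis by (auto simp: frac_kernel_def)
   next
    case False
    with z have "d * z \<ge> d" using d by simp
    then show ?thesis by (auto simp: frac_kernel_def d_def)
   qed
   moreover have "indicator {0..1} z * (z powr (\<beta> - 1) * (1 - z) powr (\<alpha> - 1)) = 0"
    using z by (auto simp: indicator_def)
   ultimately show ?thesis by auto
  qed
 qed
 also have "\<dots> = ennreal (Beta \<beta> \<alpha>) * ennreal (d powr (\<alpha> + \<beta> - 2) / (Gamma \<alpha> * Gamma \<beta>))"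
  using nn_integral_has_integral_lebesgue[OF _ has_integral_Beta_real[OF assms(2,1)]]
  by (subst nn_integral_multc) auto
 also have "\<dots> = ennreal (d powr (\<alpha> + \<beta> - 2) / Gamma (\<alpha> + \<beta>))"
  using G by (simp add: B flip: ennreal_mult)
 also have "ennreal d * \<dots> = ennreal (d * d powr (\<alpha> + \<beta> - 2) / Gamma (\<alpha> + \<beta>))"
  using d G by (simp flip: ennreal_mult)
 also have "d * d powr (\<alpha> + \<beta> - 2) = d powr (\<alpha> + \<beta> - 1)"
  using d powr_mult_base[of d "\<alpha> + \<beta> - 2"] by simp
 finally show ?thesis using True by (simp add: frac_kernel_def d_def)
next
 case False
 then have "(\<integral>\<^sup>+y. ennreal (frac_kernel \<alpha> x y * frac_kernel \<beta> y t) \<partial>lborel) = (\<integral>\<^sup>+y. 0 \<partial>(lborel :: real measure))"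
  by (intro nn_integral_cong) (auto simp: frac_kernel_def)
 then show ?thesis using False by (auto simp: frac_kernel_def)
qed

section \<open>Convergence, composition and linearity\<close>

lemma integrable_frac:
 assumes [measurable]: "f \<in> borel_measurable borel" and "\<alpha> > 0" "nn_frac \<alpha> f x < \<infinity>"
 shows "integrable lborel (\<lambda>t. f t * frac_kernel \<alpha> x t)"
 using assms(3) frac_kernel_nonneg[OF assms(2)]
 by (intro integrableI_bounded) (auto simp: nn_frac_def abs_mult)

text \<open>Fubini: by the kernel identity the absolute double integral is exactly
  \<open>nn_frac (\<alpha> + \<beta>) f x\<close>. Finiteness at this one x therefore suffices, even
  if the inner fractional integral diverges at some points.\<close>

lemma frac_int_semigroup:
 assumes [measurable]: "f \<in> borel_measurable borel" and ab: "\<alpha> > 0" "\<beta> > 0"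
  and fin: "nn_frac (\<alpha> + \<beta>) f x < \<infinity>"
 shows "frac_int \<alpha> (frac_int \<beta> f) x = frac_int (\<alpha> + \<beta>) f x"
proof -
 note nn = frac_kernel_nonneg[OF ab(1)] frac_kernel_nonneg[OF ab(2)] 
 let ?F = "\<lambda>y t. f t * frac_kernel \<beta> y t * frac_kernel \<alpha> x y"
 have int: "integrable (lborel \<Otimes>\<^sub>M lborel) (case_prod (\<lambda>t y. ?F y t))"
 proof (rule integrableI_bounded)
  have "(\<integral>\<^sup>+p. ennreal (norm (case_prod (\<lambda>t y. ?F y t) p)) \<partial>(lborel \<Otimes>\<^sub>M lborel)) =
    (\<integral>\<^sup>+t. \<integral>\<^sup>+y. ennreal (norm (?F y t)) \<partial>lborel \<partial>lborel)"
   by (subst lborel.nn_integral_fst[symmetric]) auto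
  also have "\<dots> = (\<integral>\<^sup>+t. (\<integral>\<^sup>+y. ennreal \<bar>f t\<bar> * ennreal (frac_kernel \<alpha> x y * frac_kernel \<beta> y t) \<partial>lborel) \<partial>lborel)"
   by (auto simp: abs_mult nn mult_ac simp flip: ennreal_mult intro!: nn_integral_cong)
  also have "\<dots> = nn_frac (\<alpha> + \<beta>) f x"
   unfolding nn_frac_def using ab
   by (intro nn_integral_cong)
   (subst nn_integral_cmult, measurable, simp only: frac_kernel_semigroup, simp add: frac_kernel_nonneg flip: ennreal_mult)
  finally show "(\<integral>\<^sup>+p. ennreal (norm (case_prod (\<lambda>t y. ?F y t) p)) \<partial>(lborel \<Otimes>\<^sub>M lborel)) < \<infinity>"
   using fin by simp
 qed measurable
 have K: "(LINT y|lborel. frac_kernel \<alpha> x y * frac_kernel \<beta> y t) = frac_kernel (\<alpha> + \<beta>) x t" for t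
  using ab nn frac_kernel_semigroup[OF ab, of x t]
  by (subst integral_eq_nn_integral) (auto simp: frac_kernel_nonneg)
 have "frac_int \<alpha> (frac_int \<beta> f) x = (LINT y|lborel. LINT t|lborel. ?F y t)"
  unfolding frac_int_eq by simp
 also have "\<dots> = (LINT t|lborel. LINT y|lborel. ?F y t)"
  by (rule lborel_pair.Fubini_integral[OF int])
 also have "\<dots> = (LINT t|lborel. f t * (LINT y|lborel. frac_kernel \<alpha> x y * frac_kernel \<beta> y t))"
  by (simp add: mult_ac flip: Bochner_Integration.integral_mult_right_zero)
 finally show ?thesis unfolding K frac_int_eq .
qed

lemma frac_int_linear:
 assumes [measurable]: "f \<in> borel_measurable borel" "g \<in> borel_measurable borel" and "\<alpha> > 0"
  and "nn_frac \<alpha> f x < \<infinity>" "nn_frac \<alpha> g x < \<infinity>"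
 shows "frac_int \<alpha> (\<lambda>t. a * f t + b * g t) x = a * frac_int \<alpha> f x + b * frac_int \<alpha> g x"
proof -
 have "frac_int \<alpha> (\<lambda>t. a * f t + b * g t) x =
  (LINT t|lborel. a * (f t * frac_kernel \<alpha> x t) + b * (g t * frac_kernel \<alpha> x t))"
  unfolding frac_int_eq by (simp add: algebra_simps)
 also have "\<dots> = a * frac_int \<alpha> f x + b * frac_int \<alpha> g x"
  unfolding frac_int_eq using assms by (subst Bochner_Integration.integral_add) (auto intro: integrable_frac)
 finally show ?thesis .
qed

lemma frac_int_cong_AE:
 assumes [measurable]: "f \<in> borel_measurable borel" "g \<in> borel_measurable borel"
  and "AE t in lborel. t \<in> {0..x} \<longrightarrow> f t = g t"
 shows "frac_int \<alpha> f x = frac_int \<alpha> g x"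
 unfolding frac_int_eq by (intro integral_cong_AE) (use assms(3) in \<open>auto simp: frac_kernel_def\<close>)

lemma frac_int_cong:
 assumes "\<And>t. t \<in> {0..x} \<Longrightarrow> f t = g t"
 shows "frac_int \<alpha> f x = frac_int \<alpha> g x"
 unfolding frac_int_eq by (intro Bochner_Integration.integral_cong) (use assms in \<open>auto simp: frac_kernel_def\<close>)

lemma frac_kernel_le_one:
 assumes "\<alpha> \<ge> 1" "x \<le> 1"
 shows "frac_kernel \<alpha> x t \<le> 1 / Gamma \<alpha>"
 unfolding frac_kernel_def using assms Gamma_real_pos[of \<alpha>]
 by (auto intro!: divide_right_mono powr_le1)

lemma nn_frac_finite_ge_one:
 assumes [measurable]: "f \<in> borel_measurable borel" and "\<alpha> \<ge> 1" "x \<le> 1"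
  and fin: "abs_upto x f < \<infinity>"
 shows "nn_frac \<alpha> f x < \<infinity>"
proof -
 have "nn_frac \<alpha> f x \<le> (\<integral>\<^sup>+t. ennreal (1 / Gamma \<alpha>) * ennreal (indicator {0..x} t * \<bar>f t\<bar>) \<partial>lborel)"
  unfolding nn_frac_def
 proof (intro nn_integral_mono)
  fix t
  have "\<bar>f t\<bar> * frac_kernel \<alpha> x t \<le> 1 / Gamma \<alpha> * (indicator {0..x} t * \<bar>f t\<bar>)"
  proof (cases "t \<in> {0..x}")
   case True
   then show ?thesis
    using mult_left_mono[OF frac_kernel_le_one[OF assms(2,3), of t], of "\<bar>f t\<bar>"] by (simp add: mult.commute)
  qed (auto simp: frac_kernel_def)
  then show "ennreal (\<bar>f t\<bar> * frac_kernel \<alpha> x t) \<le> ennreal (1 / Gamma \<alpha>) * ennreal (indicator {0..x} t * \<bar>f t\<bar>)"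
   using assms(2) Gamma_real_pos[of \<alpha>] by (subst ennreal_mult[symmetric]) (auto intro: ennreal_leI)
 qed
 also have "\<dots> < \<infinity>" using fin by (simp add: nn_integral_cmult ennreal_mult_less_top)
 finally show ?thesis .
qed

section \<open>Bounds on Lp and pointwise bounds\<close>

lemma nn_integral_frac_le:
 assumes [measurable]: "f \<in> borel_measurable borel" and "\<alpha> > 0" "0 \<le> T" "T \<le> 1"
 shows "(\<integral>\<^sup>+x. indicator {0..T} x * nn_frac \<alpha> f x \<partial>lborel) \<le>
  ennreal (1 / Gamma (\<alpha> + 1)) * abs_upto T f"
proof -
 have nn: "frac_kernel \<alpha> x t \<ge> 0" for x t using assms by (simp add: frac_kernel_nonneg)
 have G: "Gamma (\<alpha> + 1) > 0" using assms by (simp add: Gamma_real_pos)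
 have "(\<integral>\<^sup>+x. indicator {0..T} x * nn_frac \<alpha> f x \<partial>lborel) =
  (\<integral>\<^sup>+x. \<integral>\<^sup>+t. ennreal \<bar>f t\<bar> * ennreal (indicator {0..T} x * frac_kernel \<alpha> x t) \<partial>lborel \<partial>lborel)"
  unfolding nn_frac_def
  by (subst nn_integral_cmult[symmetric]) (auto simp: nn mult_ac indicator_def simp flip: ennreal_mult intro!: nn_integral_cong)
 also have "\<dots> = (\<integral>\<^sup>+t. \<integral>\<^sup>+x. ennreal \<bar>f t\<bar> * ennreal (indicator {0..T} x * frac_kernel \<alpha> x t) \<partial>lborel \<partial>lborel)"
  by (rule lborel_pair.Fubini') measurable
 also have "\<dots> = (\<integral>\<^sup>+t. ennreal \<bar>f t\<bar> * (\<integral>\<^sup>+x. ennreal (indicator {0..T} x * frac_kernel \<alpha> x t) \<partial>lborel) \<partial>lborel)"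
  by (intro nn_integral_cong nn_integral_cmult) measurable
 also have "\<dots> \<le> (\<integral>\<^sup>+t. ennreal \<bar>f t\<bar> * ennreal (indicator {0..T} t / Gamma (\<alpha> + 1)) \<partial>lborel)"
  using assms by (intro nn_integral_mono mult_left_mono nn_integral_frac_kernel_left) auto
 also have "\<dots> = (\<integral>\<^sup>+t. ennreal (1 / Gamma (\<alpha> + 1)) * ennreal (indicator {0..T} t * \<bar>f t\<bar>) \<partial>lborel)"
  using G by (intro nn_integral_cong) (auto simp: indicator_def mult.commute)
 also have "\<dots> = ennreal (1 / Gamma (\<alpha> + 1)) * abs_upto T f"
  by (rule nn_integral_cmult) measurable
 finally show ?thesis .
qed

lemma AE_nn_frac_finite:
 assumes [measurable]: "f \<in> borel_measurable borel" and "\<alpha> > 0" "0 \<le> T" "T \<le> 1"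
  and fin: "abs_upto T f < \<infinity>"
 shows "AE x in lborel. x \<in> {0..T} \<longrightarrow> nn_frac \<alpha> f x < \<infinity>"
proof -
 have "(\<integral>\<^sup>+x. indicator {0..T} x * nn_frac \<alpha> f x \<partial>lborel) < \<infinity>"
  using fin by (intro le_less_trans[OF nn_integral_frac_le[OF assms(1-4)]]) (simp add: ennreal_mult_less_top)
 then have "AE x in lborel. indicator {0..T} x * nn_frac \<alpha> f x \<noteq> \<infinity>"
  by (intro nn_integral_PInf_AE) auto
 then show ?thesis by eventually_elim (auto simp: less_top)
qed

text \<open>Schur's test: Jensen in t yields p - 1 powers of the kernel mass, Tonelli in x yields
  the last one. The interval [0,T] is the same on both sides, which is what the norm estimate on
  [0,t] will need.\<close>

lemma frac_int_Lp_bound: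
 assumes [measurable]: "f \<in> borel_measurable borel" and "\<alpha> > 0" "0 \<le> T" "T \<le> 1" "p \<ge> 1"
 shows "pow_upto p T (frac_int \<alpha> f) \<le>
  ennreal ((1 / Gamma (\<alpha> + 1)) powr p) * pow_upto p T f"
proof -
 define A where "A = 1 / Gamma (\<alpha> + 1)"
 have A: "A > 0" using assms by (simp add: A_def Gamma_real_pos)
 have nn: "frac_kernel \<alpha> x t \<ge> 0" for x t using assms by (simp add: frac_kernel_nonneg)
 have "pow_upto p T (frac_int \<alpha> f) \<le>
  (\<integral>\<^sup>+x. ennreal (A powr (p - 1)) * (indicator {0..T} x * nn_frac \<alpha> (\<lambda>t. \<bar>f t\<bar> powr p) x) \<partial>lborel)"
 proof (intro nn_integral_mono)
  fix x
  show "ennreal (indicator {0..T} x * \<bar>frac_int \<alpha> f x\<bar> powr p) \<le>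
   ennreal (A powr (p - 1)) * (indicator {0..T} x * nn_frac \<alpha> (\<lambda>t. \<bar>f t\<bar> powr p) x)"
  proof (cases "x \<in> {0..T}")
   case True
   have "(\<integral>\<^sup>+t. ennreal (frac_kernel \<alpha> x t) \<partial>lborel) \<le> ennreal A"
    using True assms Gamma_real_pos[of "\<alpha> + 1"]
    by (subst nn_integral_frac_kernel) (auto simp: A_def intro!: ennreal_leI divide_right_mono powr_le1)
   then show ?thesis
    using integral_powr_le[of f lborel "frac_kernel \<alpha> x" p A] True assms A nn
    by (simp add: frac_int_eq nn_frac_def)
  qed simp
 qed
 also have "\<dots> = ennreal (A powr (p - 1)) * (\<integral>\<^sup>+x. indicator {0..T} x * nn_frac \<alpha> (\<lambda>t. \<bar>f t\<bar> powr p) x \<partial>lborel)"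
  by (rule nn_integral_cmult) measurable
 also have "\<dots> \<le> ennreal (A powr (p - 1)) * (ennreal A * pow_upto p T f)"
  using nn_integral_frac_le[of "\<lambda>t. \<bar>f t\<bar> powr p" \<alpha> T] assms by (intro mult_left_mono) (auto simp: A_def)
 also have "\<dots> = ennreal (A powr (p - 1) * A) * pow_upto p T f"
  using A by (simp add: ennreal_mult mult.assoc)
 also have "A powr (p - 1) * A = A powr p" using A powr_mult_base[of A "p - 1"] by (simp add: mult.commute)
 finally show ?thesis by (simp add: A_def)
qed

text \<open>The condition \<open>\<alpha> * p > 1\<close> is exactly what puts the kernel into the
  Lebesgue space of the conjugate exponent q.\<close>

lemma frac_kernel_conj_integral:
 assumes "\<alpha> > 0" "p > 1" "\<alpha> * p > 1" "0 \<le> x" "x \<le> 1"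
 defines "q \<equiv> p / (p - 1)"
 shows "(\<integral>\<^sup>+t. ennreal (frac_kernel \<alpha> x t powr q) \<partial>lborel) \<le> ennreal (1 / ((\<alpha> - 1) * q + 1) / Gamma \<alpha> powr q)"
  and "(\<alpha> - 1) * q + 1 > 0"
proof -
 have "((\<alpha> - 1) * q + 1) * (p - 1) = \<alpha> * p - 1" using assms by (simp add: q_def field_simps)
 then show q: "(\<alpha> - 1) * q + 1 > 0" using assms by (metis diff_gt_0_iff_gt zero_less_mult_pos2)
 show "(\<integral>\<^sup>+t. ennreal (frac_kernel \<alpha> x t powr q) \<partial>lborel) \<le> ennreal (1 / ((\<alpha> - 1) * q + 1) / Gamma \<alpha> powr q)"
  using q assms by (subst nn_integral_frac_kernel_powr)
   (auto intro!: ennreal_leI divide_right_mono powr_le1)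
qed

text \<open>Splitting off the weight k^q, with q conjugate to p, makes Hoelder's inequality an
  instance of the weighted inequalities above: raised to the power p, the remaining factor k^(1-q)
  cancels the weight, because (1 - q) p + q = 0.\<close>

lemma frac_kernel_conj_weight:
 assumes "\<alpha> > 0" "p > 1"
 defines "q \<equiv> p / (p - 1)"
 shows "f * frac_kernel \<alpha> x t = f * frac_kernel \<alpha> x t powr (1 - q) * frac_kernel \<alpha> x t powr q"
  and "\<bar>f * frac_kernel \<alpha> x t powr (1 - q)\<bar> powr p * frac_kernel \<alpha> x t powr q \<le> indicator {0..x} t * \<bar>f\<bar> powr p"
proof -
 have nn: "frac_kernel \<alpha> x t \<ge> 0" using assms by (simp add: frac_kernel_nonneg)
 show "f * frac_kernel \<alpha> x t = f * frac_kernel \<alpha> x t powr (1 - q) * frac_kernel \<alpha> x t powr q"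
  using nn by (simp add: mult.assoc flip: powr_add)
 have e: "(1 - q) * p + q = 0" using assms by (simp add: q_def field_simps)
 have "\<bar>f * frac_kernel \<alpha> x t powr (1 - q)\<bar> powr p * frac_kernel \<alpha> x t powr q =
  \<bar>f\<bar> powr p * frac_kernel \<alpha> x t powr ((1 - q) * p + q)"
  by (simp add: abs_mult powr_mult powr_powr powr_add)
 also have "\<dots> \<le> indicator {0..x} t * \<bar>f\<bar> powr p"
  unfolding e using nn by (auto simp: frac_kernel_def indicator_def)
 finally show "\<bar>f * frac_kernel \<alpha> x t powr (1 - q)\<bar> powr p * frac_kernel \<alpha> x t powr q \<le> indicator {0..x} t * \<bar>f\<bar> powr p" .
qed

lemma nn_frac_finite_Lp:
 assumes [measurable]: "f \<in> borel_measurable borel" and ap: "\<alpha> > 0" "p > 1" "\<alpha> * p > 1" and x: "0 \<le> x" "x \<le> 1"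
  and fin: "pow_upto p x f < \<infinity>"
 shows "nn_frac \<alpha> f x < \<infinity>"
proof -
 define q where "q = p / (p - 1)"
 note b = frac_kernel_conj_integral[OF ap x, folded q_def] and wt = frac_kernel_conj_weight[OF ap(1,2), folded q_def]
 have "nn_frac \<alpha> f x = (\<integral>\<^sup>+t. ennreal (\<bar>f t * frac_kernel \<alpha> x t powr (1 - q)\<bar> * frac_kernel \<alpha> x t powr q) \<partial>lborel)"
  unfolding nn_frac_def by (intro nn_integral_cong, subst wt(1)) (simp add: abs_mult)
 also have "\<dots> < \<infinity>"
 proof (rule weighted_holder_finite[where p=p])
  show "(\<integral>\<^sup>+t. ennreal (frac_kernel \<alpha> x t powr q) \<partial>lborel) < \<infinity>" using b(1) by (rule le_less_trans) simp
  show "(\<integral>\<^sup>+t. ennreal (\<bar>f t * frac_kernel \<alpha> x t powr (1 - q)\<bar> powr p * frac_kernel \<alpha> x t powr q) \<partial>lborel) < \<infinity>"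
   using wt(2) by (intro le_less_trans[OF nn_integral_mono fin] ennreal_leI)
 qed (use ap in auto)
 finally show ?thesis .
qed

lemma frac_int_sup_bound:
 assumes ap: "\<alpha> > 0" "p > 1" "\<alpha> * p > 1"
 obtains D where "D \<ge> 0"
  "\<And>f x. f \<in> borel_measurable borel \<Longrightarrow> 0 \<le> x \<Longrightarrow> x \<le> 1 \<Longrightarrow>
   ennreal (\<bar>frac_int \<alpha> f x\<bar> powr p) \<le> ennreal D * pow_upto p x f"
proof
 define q where "q = p / (p - 1)"
 define A where "A = 1 / ((\<alpha> - 1) * q + 1) / Gamma \<alpha> powr q"
 show "A powr (p - 1) \<ge> 0" by simp
 fix f :: "real \<Rightarrow> real" and x :: real
 assume [measurable]: "f \<in> borel_measurable borel" and x: "0 \<le> x" "x \<le> 1"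
 note b = frac_kernel_conj_integral[OF ap x, folded q_def] and wt = frac_kernel_conj_weight[OF ap(1,2), folded q_def]
 have "A \<ge> 0" using b(2) by (simp add: A_def)
 then have "ennreal (\<bar>LINT t|lborel. (f t * frac_kernel \<alpha> x t powr (1 - q)) * frac_kernel \<alpha> x t powr q\<bar> powr p) \<le>
  ennreal (A powr (p - 1)) * (\<integral>\<^sup>+t. ennreal (\<bar>f t * frac_kernel \<alpha> x t powr (1 - q)\<bar> powr p * frac_kernel \<alpha> x t powr q) \<partial>lborel)"
  using b ap by (intro integral_powr_le) (auto simp: A_def)
 also have "\<dots> \<le> ennreal (A powr (p - 1)) * pow_upto p x f"
  using wt(2) by (intro mult_left_mono nn_integral_mono ennreal_leI) auto
 finally show "ennreal (\<bar>frac_int \<alpha> f x\<bar> powr p) \<le> ennreal (A powr (p - 1)) * pow_upto p x f"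
  unfolding frac_int_eq wt(1)[symmetric] .
qed

text \<open>The positive and the negative part of \<open>f\<close> are densities of finite measures
  that agree on all half-lines, hence coincide. Here \<open>ennreal (g t)\<close> and
  \<open>ennreal (- g t)\<close> are the two parts, as \<open>ennreal\<close> sends negative numbers
  to 0.\<close>

lemma indefinite_zero_imp_zero:
 fixes f :: "real \<Rightarrow> real"
 assumes [measurable]: "f \<in> borel_measurable borel"
  and fin: "abs_upto T f < \<infinity>"
  and z: "\<And>x. x \<in> {0..T} \<Longrightarrow> (LINT t|lborel. indicator {0..x} t * f t) = 0"
 shows "AE t in lborel. t \<in> {0..T} \<longrightarrow> f t = (0::real)"
proof -
 define g where "g t = indicator {0..T} t * f t" for t
 have [measurable]: "g \<in> borel_measurable borel" unfolding g_def by measurable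
 have g: "integrable lborel g"
  using fin by (intro integrableI_bounded) (auto simp: g_def abs_mult)
 define h where "h x t = indicator {x<..} t * g t" for x t :: real
 have h: "integrable lborel (h x)" for x
  unfolding h_def using integrable_mult_indicator[OF _ g, of "{x<..}"] by simp
 have h0: "(LINT t|lborel. h x t) = 0" for x
 proof (cases "x < 0 \<or> T < x \<or> T < 0")
  case True
  then have "h x = (\<lambda>t. indicator {0..T} t * f t) \<or> h x = (\<lambda>t. 0)"
   by (auto simp: h_def g_def fun_eq_iff indicator_def)
  moreover have "(LINT t|lborel. indicator {0..T} t * f t) = 0"
   using z[of T] by (cases "T < 0") auto
  ultimately show ?thesis by auto
 next
  case False
  then have x: "0 \<le> x" "x \<le> T" by auto
  have i: "integrable lborel (\<lambda>t. indicator {0..x} t * f t)"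
  proof -
   have "(\<lambda>t. indicator {0..x} t * f t) = (\<lambda>t. indicator {0..x} t *\<^sub>R g t)"
    using x by (auto simp: g_def fun_eq_iff indicator_def)
   then show ?thesis using integrable_mult_indicator[OF _ g, of "{0..x}"] by simp
  qed
  have "h x = (\<lambda>t. g t - indicator {0..x} t * f t)"
   using x by (auto simp: h_def g_def fun_eq_iff indicator_def)
  then have "(LINT t|lborel. h x t) = (LINT t|lborel. g t) - (LINT t|lborel. indicator {0..x} t * f t)"
   using g i by simp
  then show ?thesis using z[of x] z[of T] x by (simp add: g_def)
 qed
 have hfin: "(\<integral>\<^sup>+t. ennreal (h x t) \<partial>lborel) < \<infinity>" "(\<integral>\<^sup>+t. ennreal (- h x t) \<partial>lborel) < \<infinity>" for x
  using h[of x] by (auto simp: real_integrable_def less_top)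
 have heq: "(\<integral>\<^sup>+t. ennreal (h x t) \<partial>lborel) = (\<integral>\<^sup>+t. ennreal (- h x t) \<partial>lborel)" for x
 proof -
  have "(\<integral>\<^sup>+t. ennreal (h x t) \<partial>lborel) = ennreal (enn2real (\<integral>\<^sup>+t. ennreal (h x t) \<partial>lborel))"
   using hfin(1)[of x] by (simp add: less_top)
  also have "enn2real (\<integral>\<^sup>+t. ennreal (h x t) \<partial>lborel) = enn2real (\<integral>\<^sup>+t. ennreal (- h x t) \<partial>lborel)"
   using h0[of x] real_lebesgue_integral_def[OF h, of x] by linarith
  also have "ennreal \<dots> = (\<integral>\<^sup>+t. ennreal (- h x t) \<partial>lborel)"
   using hfin(2)[of x] by (simp add: less_top)
  finally show ?thesis .
 qed
 have e: "emeasure (density lborel (\<lambda>t. ennreal (g t))) {x<..} = (\<integral>\<^sup>+t. ennreal (h x t) \<partial>lborel)"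
  "emeasure (density lborel (\<lambda>t. ennreal (- g t))) {x<..} = (\<integral>\<^sup>+t. ennreal (- h x t) \<partial>lborel)" for x
  by (auto simp: emeasure_density h_def indicator_def intro!: nn_integral_cong)
 have "density lborel (\<lambda>t. ennreal (g t)) = density lborel (\<lambda>t. ennreal (- g t))"
 proof (rule measure_eqI_lessThan)
  show "emeasure (density lborel (\<lambda>t. ennreal (g t))) {x<..} < \<infinity>" for x
   unfolding e by (rule hfin)
  show "emeasure (density lborel (\<lambda>t. ennreal (g t))) {x<..} = emeasure (density lborel (\<lambda>t. ennreal (- g t))) {x<..}" for x
   unfolding e by (rule heq)
 qed (rule sets_density[THEN trans], rule sets_lborel)+
 then have "AE t in lborel. ennreal (g t) = ennreal (- g t)"
  by (intro sigma_finite_measure.density_unique[OF sigma_finite_lborel]) auto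
 then show ?thesis
 proof eventually_elim
  case (elim t)
  then have "g t = 0"
   by (cases "g t \<ge> 0") (auto simp: ennreal_neg ennreal_eq_0_iff)
  then show ?case by (auto simp: g_def)
 qed
qed

lemma frac_int_one:
 assumes [measurable]: "f \<in> borel_measurable borel"
 shows "frac_int 1 f x = (LINT t|lborel. indicator {0..x} t * f t)"
proof -
 have "AE t in lborel. f t * frac_kernel 1 x t = indicator {0..x} t * f t"
  using AE_lborel_singleton[of x] by eventually_elim (auto simp: frac_kernel_def indicator_def)
 then show ?thesis unfolding frac_int_eq by (intro integral_cong_AE) auto
qed

lemma continuous_frac_int_one:
 assumes [measurable]: "f \<in> borel_measurable borel"
  and fin: "abs_upto T f < \<infinity>"
 shows "continuous_on {0..T} (frac_int 1 f)"
proof -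
 have si: "set_integrable lborel {0..x} f" if "x \<le> T" for x
 proof -
  have "(\<integral>\<^sup>+t. ennreal (norm (indicator {0..x} t *\<^sub>R f t)) \<partial>lborel) \<le> abs_upto T f"
   using that by (intro nn_integral_mono) (auto simp: indicator_def)
  then show ?thesis unfolding set_integrable_def using fin by (intro integrableI_bounded) (auto intro: le_less_trans)
 qed
 have "continuous_on {0..T} (\<lambda>x. integral {0..x} f)"
  by (rule indefinite_integral_continuous_1) (use set_borel_integral_eq_integral(1)[OF si] in auto)
 moreover have "frac_int 1 f x = integral {0..x} f" if "x \<in> {0..T}" for x
  using set_borel_integral_eq_integral(2)[OF si, of x] that by (simp add: frac_int_one set_lebesgue_integral_def)
 ultimately show ?thesis by (subst continuous_on_cong) auto
qed

text \<open>A nonzero value at an interior point would persist on an interval of positive length;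
  the endpoints follow by closure.\<close>

lemma continuous_AE_zero:
 fixes F :: "real \<Rightarrow> real"
 assumes cont: "continuous_on {0..T} F" and ae: "AE x in lborel. x \<in> {0..T} \<longrightarrow> F x = 0" and x: "x \<in> {0..T}" and T: "0 < T"
 shows "F x = 0"
proof -
 define U where "U = {0<..<T} \<inter> F -` (- {0})"
 have "open U" unfolding U_def
  by (rule continuous_open_preimage) (auto intro: continuous_on_subset[OF cont])
 have "U = {}"
 proof (rule ccontr)
  assume "U \<noteq> {}"
  then obtain y e where e: "e > 0" "cball y e \<subseteq> U" using \<open>open U\<close> open_contains_cball by blast
  have "AE x in lborel. x \<notin> {y - e..y + e}"
   using ae by eventually_elim (use e in \<open>auto simp: U_def cball_eq_atLeastAtMost\<close>)
  then have "emeasure lborel {y - e..y + e} = 0"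
   by (subst (asm) AE_iff_measurable[of "{y - e..y + e}"]) auto
  then show False using e by simp
 qed
 then have z: "F y = 0" if "y \<in> {0<..<T}" for y using that by (auto simp: U_def)
 have "closure {0<..<T} = {0..T}" using T by simp
 then show ?thesis
  using continuous_constant_on_closure[of "{0<..<T}" F 0 x] cont z x by auto
qed

lemma frac_int_one_zero:
 assumes [measurable]: "f \<in> borel_measurable borel"
  and fin: "abs_upto T f < \<infinity>"
  and z: "AE x in lborel. x \<in> {0..T} \<longrightarrow> frac_int 1 f x = 0"
 shows "AE t in lborel. t \<in> {0..T} \<longrightarrow> f t = 0"
proof (rule indefinite_zero_imp_zero[OF assms(1,2)])
 fix x assume x: "x \<in> {0..T}"
 show "(LINT t|lborel. indicator {0..x} t * f t) = 0"
 proof (cases "T > 0")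
  case True
  then show ?thesis
   using continuous_AE_zero[OF continuous_frac_int_one[OF assms(1,2)] z x] by (simp add: frac_int_one)
 next
  case False
  then have "x = 0" using x by auto
  moreover have "frac_kernel 1 0 t = 0" for t by (auto simp: frac_kernel_def)
  then have "frac_int 1 f 0 = 0" by (simp add: frac_int_eq)
  ultimately show ?thesis by (simp only: frac_int_one[OF assms(1)])
 qed
qed

lemma nn_indicator_mono:
 fixes f :: "real \<Rightarrow> real"
 assumes "abs_upto T f < \<infinity>" "x \<le> T"
 shows "abs_upto x f < \<infinity>"
 using assms by (intro le_less_trans[OF nn_integral_mono assms(1)]) (auto simp: indicator_def)

lemma frac_int_nat_zero:
 assumes "f \<in> borel_measurable borel" and T: "0 \<le> T" "T \<le> 1"
  and "abs_upto T f < \<infinity>"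
  and "\<And>x. x \<in> {0..T} \<Longrightarrow> frac_int (real (Suc N)) f x = 0"
 shows "AE t in lborel. t \<in> {0..T} \<longrightarrow> f t = 0"
 using assms(1,4,5)
proof (induction N arbitrary: f)
 case 0
 have "AE x in lborel. x \<in> {0..T} \<longrightarrow> frac_int 1 f x = 0"
  by (rule AE_I2) (use 0(3) in simp)
 then show ?case by (rule frac_int_one_zero[OF 0(1,2)])
next
 case (Suc N)
 note [measurable] = Suc.prems(1)
 have "AE t in lborel. t \<in> {0..T} \<longrightarrow> frac_int 1 f t = 0"
 proof (rule Suc.IH)
  show "abs_upto T (frac_int 1 f) < \<infinity>"
  proof (rule le_less_trans)
   show "abs_upto T (frac_int 1 f) \<le>
    ennreal ((1 / Gamma (1 + 1)) powr 1) * abs_upto T f"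
    using frac_int_Lp_bound[OF Suc.prems(1), of 1 T 1] T by simp
  qed (use Suc.prems(2) in \<open>simp add: ennreal_mult_less_top\<close>)
  fix x assume x: "x \<in> {0..T}"
  have "nn_frac (real (Suc N) + 1) f x < \<infinity>"
   using x T by (intro nn_frac_finite_ge_one[OF Suc.prems(1)] nn_indicator_mono[OF Suc.prems(2)]) auto
  then have "frac_int (real (Suc N)) (frac_int 1 f) x = frac_int (real (Suc N) + 1) f x"
   by (intro frac_int_semigroup[OF Suc.prems(1)]) simp_all
  moreover have "real (Suc N) + 1 = real (Suc (Suc N))" by simp
  ultimately show "frac_int (real (Suc N)) (frac_int 1 f) x = 0"
   using Suc.prems(3)[OF x] by (simp only:)
 qed measurable
 then show ?case by (intro frac_int_one_zero[OF Suc.prems(1,2)])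
qed

text \<open>Abel's device: a further integration raises the order to an integer, and iterated
  ordinary integration can be undone one order at a time.\<close>

lemma frac_int_injective:
 assumes [measurable]: "f \<in> borel_measurable borel" and T: "0 \<le> T" "T \<le> 1" and "\<alpha> > 0"
  and fin: "abs_upto T f < \<infinity>"
  and z: "AE x in lborel. x \<in> {0..T} \<longrightarrow> frac_int \<alpha> f x = 0"
 shows "AE t in lborel. t \<in> {0..T} \<longrightarrow> f t = 0"
proof -
 obtain n where n: "\<alpha> \<le> real n" using real_arch_simple by blast
 \<comment> \<open>\<open>Suc n\<close> keeps \<beta> positive even when \<alpha> equals n.\<close>
 define \<beta> where "\<beta> = real (Suc n) - \<alpha>"
 have \<beta>: "\<beta> > 0" "\<beta> + \<alpha> = real (Suc n)" using n by (auto simp: \<beta>_def)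
 show ?thesis
 proof (rule frac_int_nat_zero[OF assms(1) T fin])
  fix x assume x: "x \<in> {0..T}"
  have "frac_int (\<beta> + \<alpha>) f x = frac_int \<beta> (frac_int \<alpha> f) x"
   using x T \<beta> assms(4) by (intro frac_int_semigroup[symmetric] nn_frac_finite_ge_one nn_indicator_mono[OF fin]) auto
  also have "\<dots> = frac_int \<beta> (\<lambda>t. 0) x"
   using z x by (intro frac_int_cong_AE) (auto elim!: eventually_mono)
  also have "\<dots> = 0" by (simp add: frac_int_eq)
  finally show "frac_int (real (Suc n)) f x = 0" by (simp add: \<beta>)
 qed
qed

section \<open>Inverses and norms on the spaces of fractional integrals\<close>

lemma indicator_powr:
 assumes "p > 0"
 shows "indicator A t * \<bar>g t\<bar> powr p = \<bar>indicator A t * g t\<bar> powr (p::real)"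
 using assms by (auto simp: indicator_def)

lemma Lp_dt_iff:
 assumes "p > 0"
 shows "g \<in> Lp p (dt T) \<longleftrightarrow> (\<lambda>t. indicator {0..T} t * g t) \<in> borel_measurable borel \<and>
  pow_upto p T g < \<infinity>"
proof -
 have m: "g \<in> borel_measurable (dt T) \<longleftrightarrow> (\<lambda>t. indicator {0..T} t * g t) \<in> borel_measurable borel"
  by (subst borel_measurable_restrict_space_iff) auto
 have "integrable (dt T) (\<lambda>x. \<bar>g x\<bar> powr p) \<longleftrightarrow> (pow_upto p T g) < \<infinity>"
  if [measurable]: "(\<lambda>t. indicator {0..T} t * g t) \<in> borel_measurable borel"
 proof -
  have "integrable (dt T) (\<lambda>x. \<bar>g x\<bar> powr p) \<longleftrightarrow> integrable lborel (\<lambda>t. indicator {0..T} t * \<bar>g t\<bar> powr p)"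
   by (subst integrable_restrict_space) (auto simp: set_integrable_def)
  also have "\<dots> \<longleftrightarrow> (pow_upto p T g) < \<infinity>"
   unfolding indicator_powr[OF assms] by (subst integrable_iff_bounded) auto
  finally show ?thesis .
 qed
 with m show ?thesis unfolding Lp_def by blast
qed

lemma Lp_norm_powr:
 assumes "g \<in> Lp p M" "p > 0"
 shows "ennreal (Lp_norm p M g powr p) = pow_int p M g"
proof -
 have "Lp_norm p M g powr p = moment p M g"
  using assms by (simp add: Lp_norm_def powr_powr integral_nonneg_AE)
 then show ?thesis using assms by (simp add: Lp_def nn_integral_eq_integral)
qed

lemma Lp_norm_dt_powr:
 assumes "g \<in> Lp p (dt T)" "p > 0"
 shows "ennreal (Lp_norm p (dt T) g powr p) = pow_upto p T g"
 unfolding Lp_norm_powr[OF assms]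
 by (subst nn_integral_restrict_space) (auto intro!: nn_integral_cong simp: indicator_def)

lemma Lp_norm_nonneg: "Lp_norm p M g \<ge> 0"
 by (simp add: Lp_norm_def)

lemma AE_dt_iff: "(AE x in dt T. P x) \<longleftrightarrow> (AE x in lborel. x \<in> {0..T} \<longrightarrow> P x)"
 by (subst AE_restrict_space_iff) auto

lemma nn_indicator_L1:
 fixes g :: "real \<Rightarrow> real"
 assumes [measurable]: "(\<lambda>t. indicator {0..T} t * g t) \<in> borel_measurable borel" and p: "p \<ge> 1"
  and fin: "pow_upto p T g < \<infinity>"
 shows "abs_upto T g < \<infinity>"
proof -
 have p0: "p > 0" using p by simp
 have eq: "\<bar>indicator {0..T} t * g t\<bar> powr p * indicator {0..T} t = indicator {0..T} t * \<bar>g t\<bar> powr p"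
  "\<bar>indicator {0..T} t * g t\<bar> * indicator {0..T} t = indicator {0..T} t * \<bar>g t\<bar>" for t
  using p0 by (auto simp: indicator_def)
 have "(\<integral>\<^sup>+t. ennreal (indicator {0..T} t) \<partial>lborel) < \<infinity>"
  by (simp add: ennreal_indicator emeasure_lborel_Icc_eq)
 then have "(\<integral>\<^sup>+t. ennreal (\<bar>indicator {0..T} t * g t\<bar> * indicator {0..T} t) \<partial>lborel) < \<infinity>"
  using fin p by (intro weighted_holder_finite[where p=p]) (auto simp: eq)
 then show ?thesis by (simp add: eq)
qed

lemma frac_int_indicator: "x \<le> T \<Longrightarrow> frac_int \<alpha> (\<lambda>t. indicator {0..T} t * g t) x = frac_int \<alpha> g x"
 by (rule frac_int_cong) auto

lemma frac_preimage_unique: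
 assumes g: "g \<in> Lp p (dt T)" "pointwise \<alpha> p T (\<lambda>x. h x = frac_int \<alpha> g x)"
  and g': "g' \<in> Lp p (dt T)" "pointwise \<alpha> p T (\<lambda>x. h x = frac_int \<alpha> g' x)"
  and p: "p \<ge> 1" and \<alpha>: "\<alpha> > 0" and T: "0 \<le> T" "T \<le> 1"
 shows "AE t in lborel. t \<in> {0..T} \<longrightarrow> g' t = g t"
proof -
 let ?g = "\<lambda>t. indicator {0..T} t * g t" and ?g' = "\<lambda>t. indicator {0..T} t * g' t"
 have p0: "p > 0" using p by simp
 have [measurable]: "?g \<in> borel_measurable borel" "?g' \<in> borel_measurable borel"
  using g(1) g'(1) by (simp_all add: Lp_dt_iff[OF p0])
 have L1: "abs_upto T g < \<infinity>" "abs_upto T g' < \<infinity>"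
  using g(1) g'(1) unfolding Lp_dt_iff[OF p0] by (blast intro: nn_indicator_L1[OF _ p])+
 then have L1': "(\<integral>\<^sup>+t. ennreal \<bar>?g t\<bar> \<partial>lborel) < \<infinity>" "(\<integral>\<^sup>+t. ennreal \<bar>?g' t\<bar> \<partial>lborel) < \<infinity>"
  by (simp_all add: abs_mult)
 have abs: "indicator {0..T} t * \<bar>indicator {0..T} t * f t\<bar> = indicator {0..T} t * \<bar>f t\<bar>" for t and f :: "real \<Rightarrow> real"
  by (auto simp: indicator_def)
 let ?d = "\<lambda>t. 1 * ?g' t + (-1) * ?g t"
 have "AE t in lborel. t \<in> {0..T} \<longrightarrow> ?d t = 0"
 proof (rule frac_int_injective[OF _ T \<alpha>])
  have "abs_upto T ?d \<le>
   (\<integral>\<^sup>+t. ennreal (\<bar>?g t\<bar>) + ennreal (\<bar>?g' t\<bar>) \<partial>lborel)"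
   by (intro nn_integral_mono) (auto simp: indicator_def simp flip: ennreal_plus intro!: ennreal_leI)
  also have "\<dots> < \<infinity>"
   using L1' by (subst nn_integral_add) simp_all
  finally show "abs_upto T ?d < \<infinity>" .
  have "AE x in lborel. x \<in> {0..T} \<longrightarrow> nn_frac \<alpha> ?g x < \<infinity>" "AE x in lborel. x \<in> {0..T} \<longrightarrow> nn_frac \<alpha> ?g' x < \<infinity>"
   by (rule AE_nn_frac_finite[OF _ \<alpha> T], measurable, use L1 in \<open>simp add: abs\<close>)+
  moreover have "AE x in lborel. x \<in> {0..T} \<longrightarrow> frac_int \<alpha> g x = frac_int \<alpha> g' x"
   using g(2) g'(2) unfolding pointwise_def AE_dt_iff by (auto elim: eventually_elim2)
  ultimately show "AE x in lborel. x \<in> {0..T} \<longrightarrow> frac_int \<alpha> ?d x = 0"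
  proof eventually_elim
   case (elim x)
   show ?case
   proof
    assume x: "x \<in> {0..T}"
    then have "frac_int \<alpha> ?d x = 1 * frac_int \<alpha> ?g' x + (-1) * frac_int \<alpha> ?g x"
     using elim \<alpha> by (intro frac_int_linear) auto
    then show "frac_int \<alpha> ?d x = 0" using x elim frac_int_indicator[of x T \<alpha>] by auto
   qed
  qed
 qed measurable
 then show ?thesis by eventually_elim auto
qed

lemma Lp_norm_cong_AE:
 assumes "f \<in> borel_measurable M" "g \<in> borel_measurable M" "AE x in M. f x = g x"
 shows "Lp_norm p M f = Lp_norm p M g"
proof -
 note [measurable] = assms(1,2)
 have "moment p M f = moment p M g"
  by (intro integral_cong_AE) (use assms(3) in \<open>auto elim: eventually_mono\<close>)
 then show ?thesis by (simp add: Lp_norm_def)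
qed

text \<open>Makes the choice by \<open>SOME\<close> harmless: norms can be computed from any
  preimage \<open>g\<close> at hand.\<close>

lemma frac_inv_props:
 assumes g: "g \<in> Lp p (dt T)" "pointwise \<alpha> p T (\<lambda>x. h x = frac_int \<alpha> g x)"
  and p: "p \<ge> 1" and \<alpha>: "\<alpha> > 0" and T: "0 \<le> T" "T \<le> 1"
 shows "frac_inv \<alpha> p T h \<in> Lp p (dt T)" "pointwise \<alpha> p T (\<lambda>x. h x = frac_int \<alpha> (frac_inv \<alpha> p T h) x)"
  "AE t in lborel. t \<in> {0..T} \<longrightarrow> frac_inv \<alpha> p T h t = g t"
  "frac_norm \<alpha> p T h = Lp_norm p (dt T) g"
proof -
 have "frac_inv \<alpha> p T h \<in> Lp p (dt T) \<and> pointwise \<alpha> p T (\<lambda>x. h x = frac_int \<alpha> (frac_inv \<alpha> p T h) x)"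
  unfolding frac_inv_def by (rule someI[of _ g]) (use g in auto)
 then show 1: "frac_inv \<alpha> p T h \<in> Lp p (dt T)" and 2: "pointwise \<alpha> p T (\<lambda>x. h x = frac_int \<alpha> (frac_inv \<alpha> p T h) x)" by auto
 show 3: "AE t in lborel. t \<in> {0..T} \<longrightarrow> frac_inv \<alpha> p T h t = g t"
  by (rule frac_preimage_unique[OF g 1 2 p \<alpha> T])
 show "frac_norm \<alpha> p T h = Lp_norm p (dt T) g"
  unfolding frac_norm_def using 1 3 g(1) by (intro Lp_norm_cong_AE) (auto simp: Lp_def AE_dt_iff)
qed

section \<open>Hoelder continuity of fractional integrals\<close>

text \<open>For \<sigma> \<le> 1 the kernel decreases in its upper variable, so the absolute
  difference of the kernels at x and y can be integrated exactly. The result is x^\<sigma> -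
  y^\<sigma> + 2 (y - x)^\<sigma> up to the Gamma factor, and the first two terms together are not
  positive.\<close>

lemma frac_int_bounded_holder:
 assumes [measurable]: "W \<in> borel_measurable borel" and W: "\<And>t. t \<in> {0..1} \<Longrightarrow> \<bar>W t\<bar> \<le> C"
  and \<sigma>: "0 < \<sigma>" "\<sigma> \<le> 1" and xy: "0 \<le> x" "x \<le> y" "y \<le> 1"
 shows "\<bar>frac_int \<sigma> W y - frac_int \<sigma> W x\<bar> \<le> 2 * C / Gamma (\<sigma> + 1) * (y - x) powr \<sigma>"
proof -
 have C: "C \<ge> 0" using W[of 0] by simp
 have G: "Gamma (\<sigma> + 1) > 0" "Gamma \<sigma> > 0" using \<sigma> by (auto simp: Gamma_real_pos)
 have nn: "frac_kernel \<sigma> z t \<ge> 0" for z t using \<sigma> by (simp add: frac_kernel_nonneg)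
 have ik: "integrable lborel (frac_kernel \<sigma> z)" "(LINT t|lborel. frac_kernel \<sigma> z t) = z powr \<sigma> / Gamma (\<sigma> + 1)"
  if "z \<ge> 0" for z
 proof -
  show "integrable lborel (frac_kernel \<sigma> z)"
   by (rule integrableI_nonneg) (simp_all add: nn nn_integral_frac_kernel[OF \<sigma>(1) that])
  show "(LINT t|lborel. frac_kernel \<sigma> z t) = z powr \<sigma> / Gamma (\<sigma> + 1)"
   by (subst integral_eq_nn_integral) (use G in \<open>simp_all add: nn nn_integral_frac_kernel[OF \<sigma>(1) that]\<close>)
 qed
 let ?k = "\<lambda>t. indicator {x..} t * frac_kernel \<sigma> y t"
 have ish: "integrable lborel ?k" "(LINT t|lborel. ?k t) = (y - x) powr \<sigma> / Gamma (\<sigma> + 1)"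
 proof -
  show "integrable lborel ?k"
   by (rule integrableI_nonneg) (use xy in \<open>simp_all add: nn nn_integral_frac_kernel_shift[OF \<sigma>(1)]\<close>)
  show "(LINT t|lborel. ?k t) = (y - x) powr \<sigma> / Gamma (\<sigma> + 1)"
   by (subst integral_eq_nn_integral) (use G xy in \<open>simp_all add: nn nn_integral_frac_kernel_shift[OF \<sigma>(1)]\<close>)
 qed
 have iW: "integrable lborel (\<lambda>t. W t * frac_kernel \<sigma> z t)" if "z \<ge> 0" "z \<le> 1" for z
 proof (rule Bochner_Integration.integrable_bound)
  show "integrable lborel (\<lambda>t. C * frac_kernel \<sigma> z t)" using ik(1)[OF that(1)] by simp
  show "AE t in lborel. norm (W t * frac_kernel \<sigma> z t) \<le> norm (C * frac_kernel \<sigma> z t)"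
  proof (rule AE_I2)
   fix t
   show "norm (W t * frac_kernel \<sigma> z t) \<le> norm (C * frac_kernel \<sigma> z t)"
    using W[of t] C nn[of z t] that by (cases "0 \<le> t \<and> t < z") (auto simp: abs_mult frac_kernel_def intro!: divide_right_mono mult_right_mono)
  qed
 qed measurable
 have "frac_int \<sigma> W y - frac_int \<sigma> W x = (LINT t|lborel. W t * frac_kernel \<sigma> y t - W t * frac_kernel \<sigma> x t)"
  unfolding frac_int_eq using iW[of x] iW[of y] xy by simp
 also have "\<bar>\<dots>\<bar> \<le> (LINT t|lborel. \<bar>W t * frac_kernel \<sigma> y t - W t * frac_kernel \<sigma> x t\<bar>)"
  by (rule integral_abs_bound)
 also have "\<dots> \<le> (LINT t|lborel. C * (frac_kernel \<sigma> x t - frac_kernel \<sigma> y t + 2 * ?k t))"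
 proof (rule integral_mono)
  show "integrable lborel (\<lambda>t. \<bar>W t * frac_kernel \<sigma> y t - W t * frac_kernel \<sigma> x t\<bar>)"
   using iW[of x] iW[of y] xy by simp
  show "integrable lborel (\<lambda>t. C * (frac_kernel \<sigma> x t - frac_kernel \<sigma> y t + 2 * ?k t))"
   using ik(1)[of x] ik(1)[of y] ish(1) xy by simp
  fix t
  have "\<bar>W t\<bar> * \<bar>frac_kernel \<sigma> y t - frac_kernel \<sigma> x t\<bar> \<le> C * (frac_kernel \<sigma> x t - frac_kernel \<sigma> y t + 2 * ?k t)"
  proof (cases "0 \<le> t \<and> t < y")
   case True
   \<comment> \<open>Before x the difference has a fixed sign. From x on only the kernel at y is
     left, which enters with the wrong sign and is corrected by the doubled term.\<close>
   have "\<bar>frac_kernel \<sigma> y t - frac_kernel \<sigma> x t\<bar> = frac_kernel \<sigma> x t - frac_kernel \<sigma> y t + 2 * ?k t"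
   proof (cases "t < x")
    case True
    have "frac_kernel \<sigma> y t \<le> frac_kernel \<sigma> x t"
     using True xy \<sigma> G by (auto simp: frac_kernel_def intro!: divide_right_mono powr_mono2')
    then show ?thesis using True by (auto simp: indicator_def)
   next
    case False
    then have "frac_kernel \<sigma> x t = 0" by (simp add: frac_kernel_def)
    then show ?thesis using False nn[of y t] by simp
   qed
   then show ?thesis using W[of t] True xy C by (simp add: mult_right_mono)
  next
   case False
   then show ?thesis using xy by (auto simp: frac_kernel_def)
  qed
  then show "\<bar>W t * frac_kernel \<sigma> y t - W t * frac_kernel \<sigma> x t\<bar> \<le> C * (frac_kernel \<sigma> x t - frac_kernel \<sigma> y t + 2 * ?k t)"
   by (simp add: abs_mult flip: right_diff_distrib)
 qed
 also have "\<dots> = C * (x powr \<sigma> / Gamma (\<sigma> + 1) - y powr \<sigma> / Gamma (\<sigma> + 1) + 2 * ((y - x) powr \<sigma> / Gamma (\<sigma> + 1)))"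
  using ik[of x] ik[of y] ish xy by simp
 also have "\<dots> \<le> C * (2 * ((y - x) powr \<sigma> / Gamma (\<sigma> + 1)))"
  using xy \<sigma> C G by (intro mult_left_mono) (auto simp: divide_right_mono powr_mono2)
 finally show ?thesis by (simp add: mult_ac)
qed

lemma frac_int_has_derivative:
 assumes [measurable]: "f \<in> borel_measurable borel" and c: "continuous_on {0..1} f" and x: "x \<in> {0..1}"
 shows "(frac_int 1 f has_real_derivative f x) (at x within {0..1})"
proof -
 have eq: "frac_int 1 f y = integral {0..y} f" if "y \<in> {0..1}" for y
 proof -
  have "continuous_on {0..y} f" using that by (intro continuous_on_subset[OF c]) auto
  then have "set_integrable lborel {0..y} f" by (rule borel_integrable_atLeastAtMost')
  then show ?thesis using set_borel_integral_eq_integral(2)[of "{0..y}" f] by (simp add: frac_int_one set_lebesgue_integral_def)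
 qed
 have "((\<lambda>u. integral {0..u} f) has_real_derivative f x) (at x within {0..1})"
  using integral_has_real_derivative[OF c x] .
 then show ?thesis
  by (rule has_field_derivative_transform_within[where d=1]) (use eq x in auto)
qed

lemma holder_imp_continuous_on:
 fixes F :: "real \<Rightarrow> real"
 assumes "\<And>x y. x \<in> S \<Longrightarrow> y \<in> S \<Longrightarrow> \<bar>F x - F y\<bar> \<le> C * \<bar>x - y\<bar> powr \<sigma>" and "\<sigma> > 0"
 shows "continuous_on S F"
 unfolding continuous_on_def
proof
 fix x assume x: "x \<in> S"
 have "((\<lambda>y. \<bar>y - x\<bar>) \<longlongrightarrow> \<bar>x - x\<bar>) (at x within S)" by (intro tendsto_intros)
 then have "((\<lambda>y. C * \<bar>y - x\<bar> powr \<sigma>) \<longlongrightarrow> C * 0 powr \<sigma>) (at x within S)"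
  using assms(2) by (intro tendsto_mult tendsto_const tendsto_powr2) auto
 then have "((\<lambda>y. C * \<bar>y - x\<bar> powr \<sigma>) \<longlongrightarrow> 0) (at x within S)" using assms(2) by simp
 moreover have "\<forall>\<^sub>F y in at x within S. norm (F y - F x) \<le> C * \<bar>y - x\<bar> powr \<sigma>"
  using assms(1) x by (auto simp: eventually_at_filter)
 ultimately have "((\<lambda>y. F y - F x) \<longlongrightarrow> 0) (at x within S)" by (rule Lim_null_comparison[rotated])
 then show "(F \<longlongrightarrow> F x) (at x within S)" by (simp add: Lim_null[of F])
qed

text \<open>Split the order as \<sigma> + (\<kappa> - \<sigma>). The second part exceeds 1/r and
  sends Lr to bounded functions, the first then gives \<sigma>-Hoelder continuity.\<close>

lemma frac_int_holder:
 assumes [measurable]: "Y \<in> borel_measurable borel" and r: "r > 1"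
  and fin: "pow_upto r 1 Y < \<infinity>"
  and \<sigma>: "0 < \<sigma>" "\<sigma> \<le> 1" and \<kappa>: "\<kappa> - \<sigma> > 1 / r"
 obtains C where "\<And>x y. x \<in> {0..1} \<Longrightarrow> y \<in> {0..1} \<Longrightarrow> \<bar>frac_int \<kappa> Y x - frac_int \<kappa> Y y\<bar> \<le> C * \<bar>x - y\<bar> powr \<sigma>"
proof -
 define W where "W = frac_int (\<kappa> - \<sigma>) Y"
 have [measurable]: "W \<in> borel_measurable borel" unfolding W_def by measurable
 have pos: "\<kappa> - \<sigma> > 0" using \<kappa> r by (meson less_trans zero_less_divide_1_iff zero_less_one)
 have p1: "(\<kappa> - \<sigma>) * r > 1" using \<kappa> r by (simp add: divide_less_eq mult.commute)
 then have p2: "(\<sigma> + (\<kappa> - \<sigma>)) * r > 1" using \<sigma> r by (smt (verit) mult_strict_right_mono)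
 have fin': "pow_upto r x Y < \<infinity>" if "x \<le> 1" for x
  using that by (intro le_less_trans[OF nn_integral_mono fin]) (auto simp: indicator_def)
 have sg: "frac_int \<sigma> W x = frac_int \<kappa> Y x" if "x \<in> {0..1}" for x
 proof -
  have "nn_frac (\<sigma> + (\<kappa> - \<sigma>)) Y x < \<infinity>"
   using that \<sigma> pos p2 r fin' by (intro nn_frac_finite_Lp[where p=r]) auto
  then have "frac_int \<sigma> W x = frac_int (\<sigma> + (\<kappa> - \<sigma>)) Y x"
   unfolding W_def using \<sigma> pos by (intro frac_int_semigroup) auto
  then show ?thesis by simp
 qed
 obtain D where D: "D \<ge> 0" "\<And>f x. f \<in> borel_measurable borel \<Longrightarrow> 0 \<le> x \<Longrightarrow> x \<le> 1 \<Longrightarrow>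
   ennreal (\<bar>frac_int (\<kappa> - \<sigma>) f x\<bar> powr r) \<le> ennreal D * pow_upto r x f"
  using frac_int_sup_bound[OF pos r p1] by blast
 define S where "S = enn2real (ennreal D * pow_upto r 1 Y)"
 have W: "\<bar>W x\<bar> \<le> S powr (1 / r)" if "x \<in> {0..1}" for x
 proof -
  have "ennreal (\<bar>W x\<bar> powr r) \<le> ennreal D * pow_upto r x Y"
   unfolding W_def using that by (intro D) auto
  also have "\<dots> \<le> ennreal D * pow_upto r 1 Y"
   using that by (intro mult_left_mono nn_integral_mono) (auto simp: indicator_def)
  also have "\<dots> = ennreal S"
   unfolding S_def using fin by (subst ennreal_enn2real) (auto simp: ennreal_mult_less_top)
  finally have "\<bar>W x\<bar> powr r \<le> S" by (subst (asm) ennreal_le_iff) (auto simp: S_def)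
  then have "(\<bar>W x\<bar> powr r) powr (1/r) \<le> S powr (1 / r)" using r by (intro powr_mono2) auto
  then show ?thesis using r by (simp add: powr_powr)
 qed
 define C where "C = 2 * S powr (1 / r) / Gamma (\<sigma> + 1)"
 have le: "\<bar>frac_int \<kappa> Y y - frac_int \<kappa> Y x\<bar> \<le> C * (y - x) powr \<sigma>" if "0 \<le> x" "x \<le> y" "y \<le> 1" for x y
  using frac_int_bounded_holder[of W "S powr (1/r)" \<sigma> x y] W \<sigma> that by (simp add: C_def sg)
 show ?thesis
 proof
  fix x y :: real assume "x \<in> {0..1}" "y \<in> {0..1}"
  then show "\<bar>frac_int \<kappa> Y x - frac_int \<kappa> Y y\<bar> \<le> C * \<bar>x - y\<bar> powr \<sigma>"
   using le[of x y] le[of y x] by (cases "x \<le> y") (auto simp: abs_minus_commute)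
 qed
qed

lemma frac_int_continuous:
 assumes [measurable]: "Y \<in> borel_measurable borel" and r: "r > 1"
  and fin: "pow_upto r 1 Y < \<infinity>"
  and \<kappa>: "\<kappa> > 1 / r"
 shows "continuous_on {0..1} (frac_int \<kappa> Y)"
proof -
 define \<sigma> where "\<sigma> = min 1 ((\<kappa> - 1 / r) / 2)"
 have half: "q < \<kappa> - (\<kappa> - q) / 2" if "q < \<kappa>" for q using that by (simp add: field_simps)
 have s: "0 < \<sigma>" "\<sigma> \<le> 1" "\<kappa> - \<sigma> > 1 / r"
  using \<kappa> half[OF \<kappa>] by (auto simp: \<sigma>_def min_def)
 obtain C where "\<And>x y. x \<in> {0..1} \<Longrightarrow> y \<in> {0..1} \<Longrightarrow> \<bar>frac_int \<kappa> Y x - frac_int \<kappa> Y y\<bar> \<le> C * \<bar>x - y\<bar> powr \<sigma>"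
  using frac_int_holder[OF assms(1) r fin s] by blast
 then show ?thesis using s(1) by (rule holder_imp_continuous_on)
qed

text \<open>Each derivative lowers the order of the fractional integral by 1, so the functions
  \<open>D k\<close> required by \<open>holder_continuous\<close> are fractional integrals of the
  same \<open>Y\<close>; only the last one needs a Hoelder estimate.\<close>

lemma frac_int_holder_continuous:
 assumes [measurable]: "Y \<in> borel_measurable borel" and r: "r > 1"
  and fin: "pow_upto r 1 Y < \<infinity>"
  and \<beta>: "\<beta> > 1 / r" and a: "a < \<beta> - 1 / r"
  and N: "\<And>x. x \<in> {0..1} \<Longrightarrow> N x = frac_int \<beta> Y x"
 shows "holder_continuous a N"
proof -
 define m where "m = nat (\<lceil>a\<rceil> - 1)"
 \<comment> \<open>For a \<le> 0 one has m = 0, and any positive \<sigma> will do: distances in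
   [0,1] are at most 1, so the bound with exponent \<sigma> implies the one with exponent a.\<close>
 define \<sigma> where "\<sigma> = (if a > 0 then a - real m else min 1 ((\<beta> - 1 / r) / 2))"
 have r0: "1 / r > 0" using r by simp
 have m: "m = 0" if "a \<le> 0" unfolding m_def using that by (simp add: ceiling_le_iff)
 have m': "real m < a" "a \<le> real m + 1" if "a > 0"
 proof -
  have "real m = real_of_int \<lceil>a\<rceil> - 1" unfolding m_def using that by (simp add: of_nat_nat)
  then show "real m < a" "a \<le> real m + 1" by linarith+
 qed
 have half: "q < \<beta> - (\<beta> - q) / 2" if "q < \<beta>" for q using that by (simp add: field_simps)
 have \<sigma>: "0 < \<sigma>" "\<sigma> \<le> 1" "\<beta> - real m - \<sigma> > 1 / r"
  using m m' a \<beta> half[OF \<beta>] by (auto simp: \<sigma>_def min_def split: if_splits)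
 define D where "D k = frac_int (\<beta> - real k) Y" for k
 have fin': "pow_upto r x Y < \<infinity>" if "x \<le> 1" for x
  using that by (intro le_less_trans[OF nn_integral_mono fin]) (auto simp: indicator_def)
 have cont: "continuous_on {0..1} (D k)" if "k \<le> m" for k
  unfolding D_def using \<sigma> that by (intro frac_int_continuous[OF assms(1) r fin]) linarith
 obtain C where C: "\<And>x y. x \<in> {0..1} \<Longrightarrow> y \<in> {0..1} \<Longrightarrow> \<bar>D m x - D m y\<bar> \<le> C * \<bar>x - y\<bar> powr \<sigma>"
  using frac_int_holder[OF assms(1) r fin \<sigma>] unfolding D_def by blast
 have der: "(D k has_real_derivative D (Suc k) x) (at x within {0..1})" if "k < m" "x \<in> {0..1}" for k x
 proof -
  have k: "\<beta> - real (Suc k) > 1 / r" using that(1) \<sigma> by linarith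
  have 1: "(frac_int 1 (D (Suc k)) has_real_derivative D (Suc k) x) (at x within {0..1})"
   using cont[of "Suc k"] that unfolding D_def by (intro frac_int_has_derivative) auto
  have 2: "frac_int 1 (D (Suc k)) y = D k y" if y: "y \<in> {0..1}" for y
  proof -
   have "(1 + (\<beta> - real (Suc k))) * r > 1"
   proof -
    have "\<beta> - real k > 1 / r" using k by simp
    then show ?thesis using r by (simp add: divide_less_eq)
   qed
   then have "nn_frac (1 + (\<beta> - real (Suc k))) Y y < \<infinity>"
    using y order_less_trans[OF r0 k] r fin' by (intro nn_frac_finite_Lp[where p=r]) auto
   then have "frac_int 1 (D (Suc k)) y = frac_int (1 + (\<beta> - real (Suc k))) Y y"
    unfolding D_def using order_less_trans[OF r0 k] by (intro frac_int_semigroup) simp_all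
   then show ?thesis by (simp add: D_def)
  qed
  show ?thesis
   by (rule has_field_derivative_transform_within[OF 1 zero_less_one that(2)]) (use 2 in auto)
 qed
 have "\<bar>D m x - D m y\<bar> \<le> \<bar>C\<bar> * \<bar>x - y\<bar> powr (a - real m)" if xy: "x \<in> {0..1}" "y \<in> {0..1}" for x y
 proof -
  have le1: "\<bar>x - y\<bar> \<le> 1" using xy by auto
  have "\<bar>D m x - D m y\<bar> \<le> \<bar>C\<bar> * \<bar>x - y\<bar> powr \<sigma>"
   using C[OF xy] by (smt (verit) mult_right_mono powr_ge_zero)
  also have "\<dots> \<le> \<bar>C\<bar> * \<bar>x - y\<bar> powr (a - real m)"
  proof (cases "a > 0 \<or> x = y")
   case False
   then have "\<bar>x - y\<bar> powr \<sigma> \<le> \<bar>x - y\<bar> powr (a - real m)"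
    using le1 \<sigma> m by (intro powr_mono') auto
   then show ?thesis by (rule mult_left_mono) simp
  qed (auto simp: \<sigma>_def)
  finally show ?thesis .
 qed
 then show ?thesis
  unfolding holder_continuous_def Let_def m_def[symmetric]
  using N der cont by (intro exI[of _ D] conjI exI[of _ "\<bar>C\<bar>"] ballI allI impI) (auto simp: D_def)
qed

section \<open>The operator of the kernel\<close>

text \<open>Members are Borel on the whole line although only [0,1] is measured, so that they can be
  integrated and combined without restricted spaces.\<close>

definition L2_01 :: "(real \<Rightarrow> real) set" where
 "L2_01 = {f \<in> borel_measurable borel. sq_upto 1 f < \<infinity>}"

lemma L2_01_Lp: "f \<in> L2_01 \<Longrightarrow> f \<in> Lp 2 (dt 1)"
 unfolding L2_01_def by (subst Lp_dt_iff) auto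

lemma L2_01_lin:
 assumes "f \<in> L2_01" "g \<in> L2_01"
 shows "(\<lambda>t. a * f t + b * g t) \<in> L2_01"
proof -
 have [measurable]: "f \<in> borel_measurable borel" "g \<in> borel_measurable borel" using assms by (auto simp: L2_01_def)
 have "sq_upto 1 (\<lambda>t. a * f t + b * g t) \<le>
  (\<integral>\<^sup>+t. ennreal (2 * a\<^sup>2) * ennreal (indicator {0..1} t * (f t)\<^sup>2) + ennreal (2 * b\<^sup>2) * ennreal (indicator {0..1} t * (g t)\<^sup>2) \<partial>lborel)"
 proof (intro nn_integral_mono)
  fix t
  have "(a * f t + b * g t)\<^sup>2 \<le> 2 * a\<^sup>2 * (f t)\<^sup>2 + 2 * b\<^sup>2 * (g t)\<^sup>2"
   using sum_squares_bound[of "a * f t" "b * g t"] by (simp add: power2_sum power_mult_distrib)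
  then have "indicator {0..1} t * (a * f t + b * g t)\<^sup>2 \<le> 2 * a\<^sup>2 * (indicator {0..1} t * (f t)\<^sup>2) + 2 * b\<^sup>2 * (indicator {0..1} t * (g t)\<^sup>2)"
   by (auto simp: indicator_def)
  then show "ennreal (indicator {0..1} t * (a * f t + b * g t)\<^sup>2) \<le>
   ennreal (2 * a\<^sup>2) * ennreal (indicator {0..1} t * (f t)\<^sup>2) + ennreal (2 * b\<^sup>2) * ennreal (indicator {0..1} t * (g t)\<^sup>2)"
   by (simp flip: ennreal_mult ennreal_plus add: ennreal_leI)
 qed
 also have "\<dots> < \<infinity>"
  using assms by (subst nn_integral_add) (auto simp: nn_integral_cmult L2_01_def ennreal_mult_less_top)
 finally show ?thesis by (simp add: L2_01_def)
qed

text \<open>\<open>P\<close> comes from a seminorm and may vanish, so one cannot normalise by it.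
  Scaling by 1 / N instead contradicts the implication if N exceeds P / d.\<close>

lemma scaled_bound:
 fixes N P d :: real
 assumes "P \<ge> 0" "d > 0" and imp: "\<And>c. c > 0 \<Longrightarrow> c * P < d \<Longrightarrow> c * N < 1"
 shows "N \<le> P / d"
proof (rule ccontr)
 assume "\<not> N \<le> P / d"
 then have n: "P / d < N" by simp
 then have N: "N > 0" using assms(1,2) by (smt (verit) divide_nonneg_pos)
 have "1 / N * P < d" using n N assms(2) by (simp add: field_simps)
 then have "1 / N * N < 1" using imp[of "1 / N"] N by simp
 then show False using N by simp
qed

lemma Lp_norm_scale:
 assumes "c \<ge> 0" "p > 0"
 shows "Lp_norm p M (\<lambda>x. c * g x) = c * Lp_norm p M g"
 using assms by (simp add: Lp_norm_def abs_mult powr_mult powr_powr)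

lemma Lp_scale: "g \<in> Lp p M \<Longrightarrow> (\<lambda>x. c * g x) \<in> Lp p M"
 unfolding Lp_def by (auto simp: abs_mult powr_mult)

lemma volterra_op_scale: "volterra_op K (\<lambda>s. c * f s) t = c * volterra_op K f t"
 unfolding volterra_op_def set_lebesgue_integral_def
 by (simp add: mult_ac flip: Bochner_Integration.integral_mult_right_zero)

lemma pointwise_mono:
 assumes "pointwise \<alpha> p T P" "\<And>x. x \<in> {0..T} \<Longrightarrow> P x \<Longrightarrow> Q x"
 shows "pointwise \<alpha> p T Q"
 using assms unfolding pointwise_def AE_dt_iff by (auto elim!: eventually_mono)

lemma pointwise_all:
 assumes "\<And>x. x \<in> {0..T} \<Longrightarrow> P x"
 shows "pointwise \<alpha> p T P"
 using assms unfolding pointwise_def AE_dt_iff by auto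

lemma frac_int_scale: "frac_int \<alpha> (\<lambda>t. c * f t) x = c * frac_int \<alpha> f x"
 unfolding frac_int_eq by (simp add: mult.assoc)

text \<open>Continuity at 0 gives boundedness by homogeneity. Only multiples of a single f are
  compared, so additivity of \<open>frac_norm\<close> is not involved.\<close>

lemma volterra_bounded:
 assumes vc: "volterra_continuous K q \<alpha> 2 1" and q: "q > 0" and \<alpha>: "\<alpha> > 0"
 obtains C where "C \<ge> 0" "\<And>f. f \<in> Lp q (dt 1) \<Longrightarrow> frac_norm \<alpha> 2 1 (volterra_op K f) \<le> C * Lp_norm q (dt 1) f"
proof -
 have 0: "(\<lambda>s. 0) \<in> Lp q (dt 1)" by (simp add: Lp_def)
 then obtain d where d: "d > 0" "\<And>g. g \<in> Lp q (dt 1) \<Longrightarrow> Lp_norm q (dt 1) g < d \<Longrightarrow>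
   frac_norm \<alpha> 2 1 (\<lambda>t. volterra_op K g t - volterra_op K (\<lambda>s. 0) t) < 1"
 proof -
  have "\<exists>d>0. \<forall>g \<in> Lp q (dt 1). Lp_norm q (dt 1) (\<lambda>s. g s - 0) < d \<longrightarrow>
    frac_norm \<alpha> 2 1 (\<lambda>t. volterra_op K g t - volterra_op K (\<lambda>s. 0) t) < 1"
   using vc[unfolded volterra_continuous_def, THEN conjunct2, rule_format, OF 0, of 1] by simp
  then show ?thesis using that by auto
 qed
 have "volterra_op K (\<lambda>s. 0) t = 0" for t by (simp add: volterra_op_def)
 with d(2) have d2: "\<And>g. g \<in> Lp q (dt 1) \<Longrightarrow> Lp_norm q (dt 1) g < d \<Longrightarrow> frac_norm \<alpha> 2 1 (volterra_op K g) < 1" by simp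
 have "frac_norm \<alpha> 2 1 (volterra_op K f) \<le> Lp_norm q (dt 1) f / d" if f: "f \<in> Lp q (dt 1)" for f
 proof (rule scaled_bound[OF Lp_norm_nonneg d(1)])
  fix c :: real assume c: "c > 0" "c * Lp_norm q (dt 1) f < d"
  obtain g where g: "g \<in> Lp 2 (dt 1)" "pointwise \<alpha> 2 1 (\<lambda>x. volterra_op K f x = frac_int \<alpha> g x)"
   using vc f unfolding volterra_continuous_def frac_space_def by blast
  have n1: "frac_norm \<alpha> 2 1 (volterra_op K f) = Lp_norm 2 (dt 1) g"
   by (rule frac_inv_props(4)[OF g _ \<alpha>]) auto
  have "frac_norm \<alpha> 2 1 (volterra_op K (\<lambda>s. c * f s)) = Lp_norm 2 (dt 1) (\<lambda>x. c * g x)"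
   by (rule frac_inv_props(4)[OF Lp_scale[OF g(1)] _ _ \<alpha>])
    (auto simp: volterra_op_scale frac_int_scale intro!: pointwise_mono[OF g(2)])
  moreover have "frac_norm \<alpha> 2 1 (volterra_op K (\<lambda>s. c * f s)) < 1"
   using c q by (intro d2 Lp_scale f) (simp add: Lp_norm_scale)
  ultimately show "c * frac_norm \<alpha> 2 1 (volterra_op K f) < 1" using c n1 by (simp add: Lp_norm_scale)
 qed
 then show ?thesis using d(1) by (intro that[of "1 / d"]) auto
qed

lemma Lp_norm_sq:
 assumes "g \<in> Lp 2 (dt 1)"
 shows "sq_upto 1 g = ennreal ((Lp_norm 2 (dt 1) g)\<^sup>2)"
 using Lp_norm_dt_powr[OF assms] Lp_norm_nonneg[of 2 "dt 1" g] by simp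

lemma Lp_norm_one:
 assumes "g \<in> Lp 1 (dt 1)"
 shows "abs_upto 1 g = ennreal (Lp_norm 1 (dt 1) g)"
 using Lp_norm_dt_powr[OF assms] Lp_norm_nonneg[of 1 "dt 1" g] by simp

lemma L2_01_Lp1:
 assumes "f \<in> L2_01" shows "f \<in> Lp 1 (dt 1)"
proof -
 have [measurable]: "f \<in> borel_measurable borel" using assms by (simp add: L2_01_def)
 have "abs_upto 1 f < \<infinity>"
  by (rule nn_indicator_L1[where p=2]) (use assms in \<open>auto simp: L2_01_def\<close>)
 then show ?thesis by (subst Lp_dt_iff) auto
qed

lemma nn_indicator_sq_mono:
 fixes f :: "real \<Rightarrow> real"
 assumes "sq_upto 1 f < \<infinity>" "x \<le> 1"
 shows "pow_upto 2 x f < \<infinity>"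
 using assms by (intro le_less_trans[OF nn_integral_mono assms(1)]) (auto simp: indicator_def)

lemma nn_frac_finite_L2:
 assumes "f \<in> borel_measurable borel" "sq_upto 1 f < \<infinity>"
  and "\<alpha> > 1/2" "x \<in> {0..1}"
 shows "nn_frac \<alpha> f x < \<infinity>"
 using assms nn_indicator_sq_mono[OF assms(2), of x] by (intro nn_frac_finite_Lp[where p=2]) auto

text \<open>\<open>G f\<close> is the preimage of \<open>K f\<close> of order \<gamma> + 1/2. By the
  semigroup property its integral of order 1/2 is the preimage of order \<gamma>, so the L1 half of
  (A) bounds that integral by the L1 norm of f.\<close>

lemma kernel_preimage:
 assumes hA: "hypothesis_A K \<gamma>"
 obtains G :: "(real \<Rightarrow> real) \<Rightarrow> real \<Rightarrow> real" and C :: real where "C \<ge> 0"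
  "\<And>f. G f \<in> borel_measurable borel"
  "\<And>f. f \<in> L2_01 \<Longrightarrow> sq_upto 1 (G f) \<le> ennreal C * sq_upto 1 f"
  "\<And>f t. f \<in> L2_01 \<Longrightarrow> t \<in> {0..1} \<Longrightarrow> frac_int (\<gamma> + 1/2) (G f) t = volterra_op K f t"
  "\<And>f. f \<in> L2_01 \<Longrightarrow> sq_upto 1 (frac_int (1/2) (G f)) \<le> ennreal C * (abs_upto 1 f)\<^sup>2"
proof -
 have \<gamma>: "\<gamma> > 0" and vc1: "volterra_continuous K 1 \<gamma> 2 1" and vc2: "volterra_continuous K 2 (\<gamma> + 1/2) 2 1"
  using hA unfolding hypothesis_A_def by auto
 obtain C2 where C2: "C2 \<ge> 0" "\<And>f. f \<in> Lp 2 (dt 1) \<Longrightarrow> frac_norm (\<gamma> + 1/2) 2 1 (volterra_op K f) \<le> C2 * Lp_norm 2 (dt 1) f"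
  using volterra_bounded[OF vc2] \<gamma> by auto
 obtain C1 where C1: "C1 \<ge> 0" "\<And>f. f \<in> Lp 1 (dt 1) \<Longrightarrow> frac_norm \<gamma> 2 1 (volterra_op K f) \<le> C1 * Lp_norm 1 (dt 1) f"
  using volterra_bounded[OF vc1] \<gamma> by auto
 \<comment> \<open>The value 0 outside \<open>L2_01\<close> and outside [0,1] makes every
   \<open>G f\<close> Borel without conditions.\<close>
 define G where "G f t = (if f \<in> L2_01 then indicator {0..1} t * frac_inv (\<gamma> + 1/2) 2 1 (volterra_op K f) t else 0)" for f t
 have inv: "frac_inv (\<gamma> + 1/2) 2 1 (volterra_op K f) \<in> Lp 2 (dt 1)"
  "pointwise (\<gamma> + 1/2) 2 1 (\<lambda>x. volterra_op K f x = frac_int (\<gamma> + 1/2) (frac_inv (\<gamma> + 1/2) 2 1 (volterra_op K f)) x)"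
  if f: "f \<in> L2_01" for f
 proof -
  obtain g where g: "g \<in> Lp 2 (dt 1)" "pointwise (\<gamma> + 1/2) 2 1 (\<lambda>x. volterra_op K f x = frac_int (\<gamma> + 1/2) g x)"
   using vc2 L2_01_Lp[OF f] unfolding volterra_continuous_def frac_space_def by blast
  show "frac_inv (\<gamma> + 1/2) 2 1 (volterra_op K f) \<in> Lp 2 (dt 1)"
   "pointwise (\<gamma> + 1/2) 2 1 (\<lambda>x. volterra_op K f x = frac_int (\<gamma> + 1/2) (frac_inv (\<gamma> + 1/2) 2 1 (volterra_op K f)) x)"
   using frac_inv_props(1,2)[OF g] \<gamma> by auto
 qed
 have Gm: "G f \<in> borel_measurable borel" for f
  using inv(1)[of f] by (cases "f \<in> L2_01") (simp_all add: G_def[abs_def] Lp_dt_iff)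
 have Gsq: "sq_upto 1 (G f) = ennreal ((frac_norm (\<gamma> + 1/2) 2 1 (volterra_op K f))\<^sup>2)"
  if f: "f \<in> L2_01" for f
 proof -
  have "sq_upto 1 (G f) =
   sq_upto 1 (frac_inv (\<gamma> + 1/2) 2 1 (volterra_op K f))"
   using f by (intro nn_integral_cong) (auto simp: G_def indicator_def)
  then show ?thesis using Lp_norm_sq[OF inv(1)[OF f]] by (simp add: frac_norm_def)
 qed
 have Gb: "sq_upto 1 (G f) \<le> ennreal (C2\<^sup>2) * sq_upto 1 f"
  if f: "f \<in> L2_01" for f
 proof -
  have "frac_norm (\<gamma> + 1/2) 2 1 (volterra_op K f) \<le> C2 * Lp_norm 2 (dt 1) f" by (rule C2(2)[OF L2_01_Lp[OF f]])
  moreover have "0 \<le> frac_norm (\<gamma> + 1/2) 2 1 (volterra_op K f)" by (simp add: frac_norm_def Lp_norm_nonneg)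
  ultimately have "(frac_norm (\<gamma> + 1/2) 2 1 (volterra_op K f))\<^sup>2 \<le> (C2 * Lp_norm 2 (dt 1) f)\<^sup>2" by (rule power_mono)
  then show ?thesis unfolding Gsq[OF f] Lp_norm_sq[OF L2_01_Lp[OF f]]
   by (simp add: power_mult_distrib ennreal_leI flip: ennreal_mult)
 qed
 have Gfin: "sq_upto 1 (G f) < \<infinity>" if f: "f \<in> L2_01" for f
  unfolding Gsq[OF f] by simp
 have GK: "frac_int (\<gamma> + 1/2) (G f) t = volterra_op K f t" if "f \<in> L2_01" "t \<in> {0..1}" for f t
 proof -
  have "frac_int (\<gamma> + 1/2) (G f) t = frac_int (\<gamma> + 1/2) (frac_inv (\<gamma> + 1/2) 2 1 (volterra_op K f)) t"
   using that by (intro frac_int_cong) (auto simp: G_def)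
  moreover have "(\<gamma> + 1/2) * 2 > 1" using \<gamma> by simp
  ultimately show ?thesis using inv(2)[OF that(1)] that(2) unfolding pointwise_def by auto
 qed
 have b1: "sq_upto 1 (frac_int (1/2) (G f)) \<le> ennreal (C1\<^sup>2) * (abs_upto 1 f)\<^sup>2"
  if f: "f \<in> L2_01" for f
 proof -
  note [measurable] = Gm
  have "pow_upto 2 1 (frac_int (1/2) (G f)) \<le>
   ennreal ((1 / Gamma (1/2 + 1)) powr 2) * pow_upto 2 1 (G f)"
   by (rule frac_int_Lp_bound) auto
  also have "\<dots> < \<infinity>" using Gfin[OF f] by (simp add: ennreal_mult_less_top)
  finally have L: "frac_int (1/2) (G f) \<in> Lp 2 (dt 1)" by (subst Lp_dt_iff) auto
  have "frac_norm \<gamma> 2 1 (volterra_op K f) = Lp_norm 2 (dt 1) (frac_int (1/2) (G f))"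
  proof (rule frac_inv_props(4)[OF L])
   have "frac_int \<gamma> (frac_int (1/2) (G f)) x = frac_int (\<gamma> + 1/2) (G f) x" if "x \<in> {0..1}" for x
    using \<gamma> that Gfin[OF f] by (intro frac_int_semigroup nn_frac_finite_L2 Gm) auto
   then show "pointwise \<gamma> 2 1 (\<lambda>x. volterra_op K f x = frac_int \<gamma> (frac_int (1/2) (G f)) x)"
    using GK[OF f] by (intro pointwise_all) auto
  qed (use \<gamma> in auto)
  then have "Lp_norm 2 (dt 1) (frac_int (1/2) (G f)) \<le> C1 * Lp_norm 1 (dt 1) f"
   using C1(2)[OF L2_01_Lp1[OF f]] by simp
  then have "(Lp_norm 2 (dt 1) (frac_int (1/2) (G f)))\<^sup>2 \<le> (C1 * Lp_norm 1 (dt 1) f)\<^sup>2"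
   by (intro power_mono Lp_norm_nonneg)
  then show ?thesis unfolding Lp_norm_sq[OF L] Lp_norm_one[OF L2_01_Lp1[OF f]]
   using C1(1) Lp_norm_nonneg[of 1 "dt 1" f]
   by (simp add: power_mult_distrib ennreal_leI ennreal_power flip: ennreal_mult)
 qed
 show ?thesis
 proof (rule that[of "max (C1\<^sup>2) (C2\<^sup>2)" G])
  show "max (C1\<^sup>2) (C2\<^sup>2) \<ge> 0" by (simp add: max_def)
  fix f assume f: "f \<in> L2_01"
  show "sq_upto 1 (G f) \<le> ennreal (max (C1\<^sup>2) (C2\<^sup>2)) * sq_upto 1 f"
   by (rule order_trans[OF Gb[OF f]], rule mult_right_mono, rule ennreal_leI, simp_all)
  show "sq_upto 1 (frac_int (1/2) (G f)) \<le> ennreal (max (C1\<^sup>2) (C2\<^sup>2)) * (abs_upto 1 f)\<^sup>2"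
   by (rule order_trans[OF b1[OF f]], rule mult_right_mono, rule ennreal_leI, simp_all)
 qed (use Gm GK in auto)
qed

lemma volterra_op_integrable:
 assumes hA: "hypothesis_A K \<gamma>" and "f \<in> L2_01" "t \<in> {0..1}"
 shows "set_integrable lborel {0..t} (\<lambda>s. K t s * f s)"
proof -
 have \<gamma>: "\<gamma> > 0" and vc2: "volterra_continuous K 2 (\<gamma> + 1/2) 2 1"
  using hA unfolding hypothesis_A_def by auto
 then have "pointwise (\<gamma> + 1/2) 2 1 (\<lambda>t. set_integrable lborel {0..t} (\<lambda>s. K t s * f s))"
  using L2_01_Lp[OF assms(2)] unfolding volterra_continuous_def by blast
 then show ?thesis using \<gamma> assms(3) unfolding pointwise_def by auto
qed

lemma volterra_op_linear:
 assumes hA: "hypothesis_A K \<gamma>" and "f \<in> L2_01" "g \<in> L2_01" "t \<in> {0..1}"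
 shows "volterra_op K (\<lambda>s. a * f s + b * g s) t = a * volterra_op K f t + b * volterra_op K g t"
proof -
 have "volterra_op K (\<lambda>s. a * f s + b * g s) t = (LBINT s:{0..t}. a * (K t s * f s) + b * (K t s * g s))"
  unfolding volterra_op_def by (simp add: algebra_simps)
 also have "\<dots> = a * volterra_op K f t + b * volterra_op K g t"
  unfolding volterra_op_def using volterra_op_integrable[OF hA] assms
  by (subst set_integral_add) (auto simp: set_integral_mult_right)
 finally show ?thesis .
qed

text \<open>\<Phi> is I^(1/2+\<epsilon>) after \<open>G\<close>, hence the preimage of order
  \<gamma> - \<epsilon>. It is bounded at each point because (1/2 + \<epsilon>) 2 > 1, and the L1
  bound on I^(1/2) \<open>G\<close> survives the remaining order \<epsilon>.\<close>

lemma kernel_functional: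
 assumes hA: "hypothesis_A K \<gamma>" and \<epsilon>: "0 < \<epsilon>" "\<epsilon> < \<gamma>"
 obtains \<Phi> :: "(real \<Rightarrow> real) \<Rightarrow> real \<Rightarrow> real" and C :: real where "C \<ge> 0"
  "\<And>f. \<Phi> f \<in> borel_measurable borel"
  "\<And>f g x a b. f \<in> L2_01 \<Longrightarrow> g \<in> L2_01 \<Longrightarrow> x \<in> {0..1} \<Longrightarrow> \<Phi> (\<lambda>s. a * f s + b * g s) x = a * \<Phi> f x + b * \<Phi> g x"
  "\<And>f x. f \<in> L2_01 \<Longrightarrow> x \<in> {0..1} \<Longrightarrow> ennreal ((\<Phi> f x)\<^sup>2) \<le> ennreal C * sq_upto 1 f"
  "\<And>f. f \<in> L2_01 \<Longrightarrow> sq_upto 1 (\<Phi> f) \<le> ennreal C * (abs_upto 1 f)\<^sup>2"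
  "\<And>f t. f \<in> L2_01 \<Longrightarrow> t \<in> {0..1} \<Longrightarrow> frac_int (\<gamma> - \<epsilon>) (\<Phi> f) t = volterra_op K f t"
  "\<And>f a x. f \<in> L2_01 \<Longrightarrow> a \<in> {0..1} \<Longrightarrow> (\<And>s. s \<in> {0..a} \<Longrightarrow> f s = 0) \<Longrightarrow> x \<in> {0..a} \<Longrightarrow> \<Phi> f x = 0"
proof -
 obtain G C where C: "C \<ge> 0" and [measurable]: "\<And>f. G f \<in> borel_measurable borel"
  and Gb: "\<And>f. f \<in> L2_01 \<Longrightarrow> sq_upto 1 (G f) \<le> ennreal C * sq_upto 1 f"
  and GK: "\<And>f t. f \<in> L2_01 \<Longrightarrow> t \<in> {0..1} \<Longrightarrow> frac_int (\<gamma> + 1/2) (G f) t = volterra_op K f t"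
  and G1: "\<And>f. f \<in> L2_01 \<Longrightarrow> sq_upto 1 (frac_int (1/2) (G f)) \<le> ennreal C * (abs_upto 1 f)\<^sup>2"
  by (rule kernel_preimage[OF hA], rule that) blast+
 have \<gamma>: "\<gamma> > 0" using \<epsilon> by simp
 define \<Phi> where "\<Phi> f = frac_int (1/2 + \<epsilon>) (G f)" for f
 have Gfin: "sq_upto 1 (G f) < \<infinity>" if "f \<in> L2_01" for f
  using Gb[OF that] that by (auto simp: L2_01_def ennreal_mult_less_top intro: le_less_trans)
 have Gnn: "nn_frac \<alpha> (G f) x < \<infinity>" if "f \<in> L2_01" "x \<in> {0..1}" "\<alpha> > 1/2" for f x \<alpha>
  using Gfin[OF that(1)] that by (intro nn_frac_finite_L2) auto
 obtain D where D: "D \<ge> 0" "\<And>f x. f \<in> borel_measurable borel \<Longrightarrow> 0 \<le> x \<Longrightarrow> x \<le> 1 \<Longrightarrow>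
   ennreal (\<bar>frac_int (1/2 + \<epsilon>) f x\<bar> powr 2) \<le> ennreal D * pow_upto 2 x f"
  using frac_int_sup_bound[of "1/2 + \<epsilon>" 2] \<epsilon> by auto
 define E where "E = (1 / Gamma (\<epsilon> + 1)) powr 2"
 have GL: "G f \<in> Lp 2 (dt 1)" if "f \<in> L2_01" for f
  using Gfin[OF that] by (subst Lp_dt_iff) auto
 \<comment> \<open>\<open>G\<close> selects representatives, so it is linear only almost everywhere;
   the integration in \<Phi> then gives linearity at every x.\<close>
 have Glin: "AE t in lborel. t \<in> {0..1} \<longrightarrow> G (\<lambda>s. a * f s + b * g s) t = a * G f t + b * G g t"
  if f: "f \<in> L2_01" and g: "g \<in> L2_01" for f g a b
 proof (rule frac_preimage_unique[where \<alpha>="\<gamma> + 1/2" and p=2 and h="volterra_op K (\<lambda>s. a * f s + b * g s)"])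
  have "(\<lambda>t. a * G f t + b * G g t) \<in> L2_01"
   using Gfin f g by (intro L2_01_lin) (auto simp: L2_01_def)
  then show "(\<lambda>t. a * G f t + b * G g t) \<in> Lp 2 (dt 1)" by (rule L2_01_Lp)
  show "G (\<lambda>s. a * f s + b * g s) \<in> Lp 2 (dt 1)" by (intro GL L2_01_lin f g)
  show "pointwise (\<gamma> + 1/2) 2 1 (\<lambda>x. volterra_op K (\<lambda>s. a * f s + b * g s) x = frac_int (\<gamma> + 1/2) (G (\<lambda>s. a * f s + b * g s)) x)"
   by (intro pointwise_all) (simp add: GK[OF L2_01_lin[OF f g]])
  have "frac_int (\<gamma> + 1/2) (\<lambda>t. a * G f t + b * G g t) x = volterra_op K (\<lambda>s. a * f s + b * g s) x" if x: "x \<in> {0..1}" for x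
  proof -
   have "frac_int (\<gamma> + 1/2) (\<lambda>t. a * G f t + b * G g t) x = a * frac_int (\<gamma> + 1/2) (G f) x + b * frac_int (\<gamma> + 1/2) (G g) x"
    using \<gamma> x f g by (intro frac_int_linear Gnn) auto
   then show ?thesis using GK[OF f x] GK[OF g x] volterra_op_linear[OF hA f g x] by simp
  qed
  then show "pointwise (\<gamma> + 1/2) 2 1 (\<lambda>x. volterra_op K (\<lambda>s. a * f s + b * g s) x = frac_int (\<gamma> + 1/2) (\<lambda>t. a * G f t + b * G g t) x)"
   by (intro pointwise_all) simp
 qed (use \<gamma> in auto)
 show ?thesis
 proof (rule that[of "D * C + E * C" \<Phi>])
  show "D * C + E * C \<ge> 0" using D C by (simp add: E_def)
  show "\<Phi> f \<in> borel_measurable borel" for f unfolding \<Phi>_def by measurable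
 next
  fix f g x and a b :: real
  assume f: "f \<in> L2_01" and g: "g \<in> L2_01" and x: "x \<in> {0..1::real}"
  have "\<Phi> (\<lambda>s. a * f s + b * g s) x = frac_int (1/2 + \<epsilon>) (\<lambda>t. a * G f t + b * G g t) x"
   unfolding \<Phi>_def by (intro frac_int_cong_AE) (use Glin[OF f g, of a b] x in \<open>auto elim!: eventually_mono\<close>)
  also have "\<dots> = a * \<Phi> f x + b * \<Phi> g x"
   unfolding \<Phi>_def using \<epsilon> x f g by (intro frac_int_linear Gnn) auto
  finally show "\<Phi> (\<lambda>s. a * f s + b * g s) x = a * \<Phi> f x + b * \<Phi> g x" .
 next
  fix f x assume f: "f \<in> L2_01" and x: "x \<in> {0..1::real}"
  have "ennreal ((\<Phi> f x)\<^sup>2) \<le> ennreal D * pow_upto 2 x (G f)"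
   using D(2)[of "G f" x] x by (simp add: \<Phi>_def)
  also have "\<dots> \<le> ennreal D * sq_upto 1 (G f)"
   using x by (intro mult_left_mono nn_integral_mono) (auto simp: indicator_def)
  also have "\<dots> \<le> ennreal D * (ennreal C * sq_upto 1 f)"
   by (intro mult_left_mono Gb f) auto
  also have "\<dots> = ennreal (D * C) * sq_upto 1 f"
   using D(1) C by (simp add: ennreal_mult mult.assoc)
  also have "\<dots> \<le> ennreal (D * C + E * C) * sq_upto 1 f"
   using C by (intro mult_right_mono ennreal_leI) (auto simp: E_def)
  finally show "ennreal ((\<Phi> f x)\<^sup>2) \<le> ennreal (D * C + E * C) * sq_upto 1 f" .
 next
  fix f assume f: "f \<in> L2_01"
  have eq: "\<Phi> f x = frac_int \<epsilon> (frac_int (1/2) (G f)) x" if "x \<in> {0..1}" for x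
   unfolding \<Phi>_def using \<epsilon> Gnn[OF f that, of "\<epsilon> + 1/2"]
   by (subst frac_int_semigroup) (auto simp: add.commute)
  have "sq_upto 1 (\<Phi> f) =
    pow_upto 2 1 (frac_int \<epsilon> (frac_int (1/2) (G f)))"
   by (intro nn_integral_cong) (auto simp: indicator_def eq)
  also have "\<dots> \<le> ennreal E * pow_upto 2 1 (frac_int (1/2) (G f))"
   unfolding E_def using \<epsilon> by (intro frac_int_Lp_bound) auto
  also have "\<dots> \<le> ennreal E * (ennreal C * (abs_upto 1 f)\<^sup>2)"
   using G1[OF f] by (intro mult_left_mono) auto
  also have "\<dots> = ennreal (E * C) * (abs_upto 1 f)\<^sup>2"
   using C by (simp add: ennreal_mult mult.assoc E_def)
  also have "\<dots> \<le> ennreal (D * C + E * C) * (abs_upto 1 f)\<^sup>2"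
   using C D(1) by (intro mult_right_mono ennreal_leI) auto
  finally show "sq_upto 1 (\<Phi> f) \<le> ennreal (D * C + E * C) * (abs_upto 1 f)\<^sup>2" .
 next
  fix f t assume f: "f \<in> L2_01" and t: "t \<in> {0..1::real}"
  have "nn_frac ((\<gamma> - \<epsilon>) + (1/2 + \<epsilon>)) (G f) t < \<infinity>" using \<gamma> by (intro Gnn f t) simp
  then have "frac_int (\<gamma> - \<epsilon>) (\<Phi> f) t = frac_int ((\<gamma> - \<epsilon>) + (1/2 + \<epsilon>)) (G f) t"
   unfolding \<Phi>_def using \<epsilon> by (intro frac_int_semigroup) auto
  also have "(\<gamma> - \<epsilon>) + (1/2 + \<epsilon>) = \<gamma> + 1/2" by simp
  finally show "frac_int (\<gamma> - \<epsilon>) (\<Phi> f) t = volterra_op K f t" using GK[OF f t] by simp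
 next
  fix f and a x :: real
  assume f: "f \<in> L2_01" and a: "a \<in> {0..1}" and z: "\<And>s. s \<in> {0..a} \<Longrightarrow> f s = 0" and x: "x \<in> {0..a}"
  \<comment> \<open>Causality: \<open>K f\<close> vanishes on [0,a] along with f, and fractional
    integration is injective on that interval.\<close>
  have "AE t in lborel. t \<in> {0..a} \<longrightarrow> G f t = 0"
  proof (rule frac_int_injective[where \<alpha>="\<gamma> + 1/2"])
   have "abs_upto 1 (G f) < \<infinity>"
    by (rule nn_indicator_L1[where p=2]) (use Gfin[OF f] in auto)
   then show "abs_upto a (G f) < \<infinity>"
    by (rule nn_indicator_mono) (use a in simp)
   have "volterra_op K f t = 0" if "t \<in> {0..a}" for t
   proof -
    have "volterra_op K f t = (LBINT s:{0..t}. 0)"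
     unfolding volterra_op_def using z that by (intro set_lebesgue_integral_cong) auto
    then show ?thesis by simp
   qed
   then show "AE t in lborel. t \<in> {0..a} \<longrightarrow> frac_int (\<gamma> + 1/2) (G f) t = 0"
    using GK[OF f] a by (intro AE_I2) auto
  qed (use \<gamma> a in auto)
  then have "\<Phi> f x = frac_int (1/2 + \<epsilon>) (\<lambda>t. 0) x"
   unfolding \<Phi>_def by (intro frac_int_cong_AE) (use x in \<open>auto elim!: eventually_mono\<close>)
  then show "\<Phi> f x = 0" by (simp add: frac_int_eq)
 qed
qed

section \<open>Increments of Brownian motion\<close>

locale brownian =
 fixes M :: "'w measure" and B :: "real \<Rightarrow> 'w \<Rightarrow> real"
 assumes bm: "standard_brownian_motion M B"

sublocale brownian \<subseteq> prob_space M
 using bm by (simp add: standard_brownian_motion_def)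

context brownian
begin

abbreviation F :: "real \<Rightarrow> 'w measure" where "F \<equiv> brownian_filtration M B"

lemma B_measurable: "t \<in> {0..1} \<Longrightarrow> B t \<in> borel_measurable M"
 using bm by (simp add: standard_brownian_motion_def)

lemma B_zero: "AE w in M. B 0 w = 0"
 using bm by (simp add: standard_brownian_motion_def)

lemma B_increment_normal:
 "0 \<le> s \<Longrightarrow> s < t \<Longrightarrow> t \<le> 1 \<Longrightarrow>
  distributed M lborel (\<lambda>w. B t w - B s w) (normal_density 0 (sqrt (t - s)))"
 using bm by (simp add: standard_brownian_motion_def)

lemma B_increments_indep:
 "mono_on {..n} \<tau> \<Longrightarrow> \<tau> ` {..n} \<subseteq> {0..1} \<Longrightarrow>
  indep_vars (\<lambda>_. borel) (\<lambda>i w. B (\<tau> (Suc i)) w - B (\<tau> i) w) {..<n::nat}"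
 using bm unfolding standard_brownian_motion_def by blast

section \<open>The filtration and its independence of later increments\<close>

lemma F_gen: "{B r -` A \<inter> space M | r A. r \<in> {0..s} \<and> A \<in> sets borel} \<union> null_sets M \<subseteq> Pow (space M)"
 using sets.sets_into_space by auto

lemma space_F[simp]: "space (F s) = space M"
 unfolding brownian_filtration_def by (rule space_measure_of[OF F_gen])

lemma sets_F: "sets (F s) = sigma_sets (space M)
  ({B r -` A \<inter> space M | r A. r \<in> {0..s} \<and> A \<in> sets borel} \<union> null_sets M)"
 unfolding brownian_filtration_def by (rule sets_measure_of[OF F_gen])

lemma sets_F_mono:
 assumes "s \<le> t"
 shows "sets (F s) \<subseteq> sets (F t)"
proof -
 have "{0..s} \<subseteq> {0..t}" using assms by auto
 then show ?thesis unfolding sets_F by (intro sigma_sets_mono') blast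
qed

lemma sets_F_le: "s \<le> 1 \<Longrightarrow> sets (F s) \<subseteq> sets M"
 unfolding sets_F by (rule sets.sigma_sets_subset) (auto intro!: measurable_sets[OF B_measurable])

lemma F_subalgebra: "s \<le> 1 \<Longrightarrow> subalgebra M (F s)"
 unfolding subalgebra_def using sets_F_le by auto

lemma measurable_F_mono: "f \<in> borel_measurable (F s) \<Longrightarrow> s \<le> t \<Longrightarrow> f \<in> borel_measurable (F t)"
 using sets_F_mono[of s t] by (auto simp: measurable_def)

lemma measurable_F_M: "f \<in> borel_measurable (F s) \<Longrightarrow> s \<le> 1 \<Longrightarrow> f \<in> borel_measurable M"
 using sets_F_le[of s] by (auto simp: measurable_def)

lemma B_measurable_F: "0 \<le> r \<Longrightarrow> r \<le> s \<Longrightarrow> B r \<in> borel_measurable (F s)"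
 by (rule measurableI) (auto simp: sets_F intro!: sigma_sets.Basic)

lemma null_sets_F: "N \<in> null_sets M \<Longrightarrow> N \<in> sets (F s)"
 by (auto simp: sets_F intro!: sigma_sets.Basic)

text \<open>Finite-dimensional events up to time s: a family stable under intersection that
  generates the filtration up to null sets.\<close>

definition cylinders :: "real \<Rightarrow> 'w set set" where
 "cylinders s = {space M \<inter> (\<Inter>r\<in>R. B r -` A r) | R A. finite R \<and> R \<subseteq> {0..s} \<and> (\<forall>r. A r \<in> sets borel)}"

lemma cylinders_Int:
 assumes "C \<in> cylinders s" "D \<in> cylinders s"
 shows "C \<inter> D \<in> cylinders s"
proof -
 obtain R A where C: "C = space M \<inter> (\<Inter>r\<in>R. B r -` A r)" "finite R" "R \<subseteq> {0..s}" "\<forall>r. A r \<in> sets borel"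
  using assms(1) unfolding cylinders_def by blast
 obtain S E where D: "D = space M \<inter> (\<Inter>r\<in>S. B r -` E r)" "finite S" "S \<subseteq> {0..s}" "\<forall>r. E r \<in> sets borel"
  using assms(2) unfolding cylinders_def by blast
 have "C \<inter> D = space M \<inter> (\<Inter>r\<in>R \<union> S. B r -` ((if r \<in> R then A r else UNIV) \<inter> (if r \<in> S then E r else UNIV)))"
  unfolding C D by (auto split: if_splits)
 moreover have "\<forall>r. (if r \<in> R then A r else UNIV) \<inter> (if r \<in> S then E r else UNIV) \<in> sets borel"
  using C(4) D(4) by auto
 ultimately show ?thesis unfolding cylinders_def
  by (intro CollectI exI[of _ "R \<union> S"] exI[of _ "\<lambda>r. (if r \<in> R then A r else UNIV) \<inter> (if r \<in> S then E r else UNIV)"] conjI)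
   (use C(2,3) D(2,3) in simp_all)
qed

lemma cylinders_sets: "s \<le> 1 \<Longrightarrow> C \<in> cylinders s \<Longrightarrow> C \<in> sets M"
proof -
 assume s: "s \<le> 1" and "C \<in> cylinders s"
 then obtain R A where C: "C = space M \<inter> (\<Inter>r\<in>R. B r -` A r)" "finite R" "R \<subseteq> {0..s}" "\<forall>r. A r \<in> sets borel"
  unfolding cylinders_def by blast
 have "B r -` A r \<inter> space M \<in> sets M" if "r \<in> R" for r
  using that C s by (intro measurable_sets[OF B_measurable]) auto
 then have "(\<Inter>r\<in>R. B r -` A r \<inter> space M) \<in> sets M" if "R \<noteq> {}"
  using that C(2) by (intro sets.finite_INT) auto
 moreover have "C = (if R = {} then space M else (\<Inter>r\<in>R. B r -` A r \<inter> space M))"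
  unfolding C by auto
 ultimately show ?thesis by simp
qed

text \<open>The times of the cylinder, sorted and followed by t, form a partition. Since B starts at
  0, each value of B is almost surely a sum of earlier increments, so the cylinder is almost surely
  an event of increments before s.\<close>

lemma cylinder_indep_increment:
 assumes st: "0 \<le> s" "s < t" "t \<le> 1" and C: "C \<in> cylinders s" and E: "E \<in> sets borel"
 shows "prob (C \<inter> ((\<lambda>w. B t w - B s w) -` E \<inter> space M)) = prob C * prob ((\<lambda>w. B t w - B s w) -` E \<inter> space M)"
proof -
 obtain R A where R: "C = space M \<inter> (\<Inter>r\<in>R. B r -` A r)" "finite R" "R \<subseteq> {0..s}" "\<forall>r. A r \<in> sets borel"
  using C unfolding cylinders_def by blast
 \<comment> \<open>With 0 in the list, sums of increments give the values of B themselves; with s in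
   it, the last increment starts exactly at s.\<close>
 define L where "L = sorted_list_of_set (insert 0 (insert s R))"
 have setL: "set L = insert 0 (insert s R)" unfolding L_def by (rule set_sorted_list_of_set) (use R(2) in simp)
 have sL: "sorted L" unfolding L_def by (rule sorted_sorted_list_of_set)
 have ne: "L \<noteq> []" using setL by auto
 define n where "n = length L - 1"
 have len: "length L = Suc n" using ne by (cases L) (auto simp: n_def)
 define \<tau> where "\<tau> i = (if i \<le> n then L ! i else t)" for i
 have Ls: "L ! i \<in> {0..s}" if "i \<le> n" for i
  using nth_mem[of i L] that len setL R(3) st(1) by auto
 have \<tau>0: "\<tau> 0 = 0"
 proof -
  obtain i where i: "i < length L" "L ! i = 0" using setL by (metis in_set_conv_nth insertI1)
  then have "L ! 0 \<le> 0" using sorted_nth_mono[OF sL, of 0 i] by simp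
  then show ?thesis using Ls[of 0] by (simp add: \<tau>_def)
 qed
 have \<tau>n: "\<tau> n = s"
 proof -
  obtain i where i: "i < length L" "L ! i = s" using setL by (metis in_set_conv_nth insert_iff)
  then have "s \<le> L ! n" using sorted_nth_mono[OF sL, of i n] len by simp
  then show ?thesis using Ls[of n] by (simp add: \<tau>_def)
 qed
 have mono: "mono_on {..Suc n} \<tau>"
 proof (rule mono_onI)
  fix i j assume ij: "i \<in> {..Suc n}" "j \<in> {..Suc n}" "i \<le> j"
  show "\<tau> i \<le> \<tau> j"
   using sorted_nth_mono[OF sL, of i j] Ls[of i] ij len st by (auto simp: \<tau>_def)
 qed
 define X where "X i w = B (\<tau> (Suc i)) w - B (\<tau> i) w" for i w
 have ind: "indep_vars (\<lambda>_. borel) X {..<Suc n}"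
  unfolding X_def
 proof (rule B_increments_indep[OF mono], rule image_subsetI)
  fix i show "\<tau> i \<in> {0..1}"
   using Ls[of i] st by (cases "i \<le> n") (auto simp: \<tau>_def)
 qed
 have ind2: "indep_var (PiM {..<n} (\<lambda>_. borel)) (\<lambda>w. restrict (\<lambda>i. X i w) {..<n}) (PiM {n} (\<lambda>_. borel)) (\<lambda>w. restrict (\<lambda>i. X i w) {n})"
  by (rule indep_var_restrict[OF ind]) auto
 have "\<exists>j. \<forall>r\<in>R. j r \<le> n \<and> \<tau> (j r) = r"
 proof (rule bchoice, rule ballI)
  fix r assume "r \<in> R"
  then have "r \<in> set L" by (simp add: setL)
  then obtain i where "i < length L" "L ! i = r" by (metis in_set_conv_nth)
  then show "\<exists>i. i \<le> n \<and> \<tau> i = r" using len by (intro exI[of _ i]) (simp add: \<tau>_def)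
 qed
 then obtain j where j: "\<And>r. r \<in> R \<Longrightarrow> j r \<le> n" "\<And>r. r \<in> R \<Longrightarrow> \<tau> (j r) = r" by blast
 define S where "S = {x \<in> space (PiM {..<n} (\<lambda>_. borel)). \<forall>r\<in>R. (\<Sum>i<j r. x i) \<in> A r}"
 have S: "S \<in> sets (PiM {..<n} (\<lambda>_. borel :: real measure))"
 proof -
  have "(\<lambda>x. \<Sum>i<j r. x i) \<in> borel_measurable (PiM {..<n} (\<lambda>_. borel :: real measure))" if "r \<in> R" for r
   using j(1)[OF that] by (intro borel_measurable_sum measurable_component_singleton) auto
  then show ?thesis unfolding S_def using R(2,4)
   by (intro sets.sets_Collect_finite_All) (auto intro: measurable_sets_Collect)
 qed
 define D where "D = (\<lambda>w. restrict (\<lambda>i. X i w) {..<n}) -` S \<inter> space M"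
 define H where "H = (\<lambda>w. B t w - B s w) -` E \<inter> space M"
 have Xm: "X i \<in> borel_measurable M" if "i \<le> n" for i
  using ind that unfolding indep_vars_def by auto
 have Dm: "D \<in> sets M"
  unfolding D_def using S by (intro measurable_sets[OF measurable_restrict]) (auto intro: Xm)
 have Hm: "H \<in> sets M"
  unfolding H_def using E st by (intro measurable_sets[OF borel_measurable_diff]) (auto intro: B_measurable)
 have Cm: "C \<in> sets M" using cylinders_sets[OF _ C] st by auto
 \<comment> \<open>Only almost everywhere, since B 0 = 0 holds only almost surely.\<close>
 have CD: "AE w in M. w \<in> C \<longleftrightarrow> w \<in> D"
  using B_zero AE_space
 proof eventually_elim
  case (elim w)
  have "(\<Sum>i<j r. X i w) = B r w" if "r \<in> R" for r
   using sum_lessThan_telescope[of "\<lambda>i. B (\<tau> i) w" "j r"] j(2)[OF that] elim \<tau>0 by (simp add: X_def)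
  moreover have "(\<Sum>i<j r. restrict (\<lambda>i. X i w) {..<n} i) = (\<Sum>i<j r. X i w)" if "r \<in> R" for r
   using j(1)[OF that] by (intro sum.cong) auto
  ultimately show ?case
   using elim by (auto simp: D_def S_def R space_PiM)
 qed
 define G where "G = {x \<in> space (PiM {n} (\<lambda>_. borel :: real measure)). x n \<in> E}"
 have Gm: "G \<in> sets (PiM {n} (\<lambda>_. borel))"
  unfolding G_def using E by (intro measurable_sets_Collect[OF measurable_component_singleton]) auto
 have HG: "(\<lambda>w. restrict (\<lambda>i. X i w) {n}) -` G \<inter> space M = H"
 proof -
  have "X n w = B t w - B s w" for w unfolding X_def \<tau>n by (simp add: \<tau>_def)
  then show ?thesis by (auto simp: G_def H_def space_PiM)
 qed
 have "prob (D \<inter> H) = prob D * prob H"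
 proof -
  have "D \<inter> H = (\<lambda>w. (restrict (\<lambda>i. X i w) {..<n}, restrict (\<lambda>i. X i w) {n})) -` (S \<times> G) \<inter> space M"
   unfolding D_def HG[symmetric] by auto
  then show ?thesis using indep_varD[OF ind2 S Gm] HG by (simp add: D_def)
 qed
 moreover have "prob (C \<inter> H) = prob (D \<inter> H)"
  using CD Cm Dm Hm by (intro finite_measure_eq_AE) auto
 moreover have "prob C = prob D"
  using CD Cm Dm by (intro finite_measure_eq_AE) auto
 ultimately show ?thesis by (simp add: H_def)
qed

text \<open>Independence passes from a generating family stable under intersection to the
  sigma-algebra. The null sets in the filtration force a family slightly larger than the
  cylinders.\<close>

lemma F_indep_increment:
 assumes st: "0 \<le> s" "s < t" "t \<le> 1" and \<xi>: "\<xi> \<in> borel_measurable (F s)"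
 shows "indep_var borel \<xi> borel (\<lambda>w. B t w - B s w)"
proof -
 let ?\<Delta> = "\<lambda>w. B t w - B s w"
 have \<Delta>m: "?\<Delta> \<in> borel_measurable M" using st by (intro borel_measurable_diff B_measurable) auto
 define \<D> where "\<D> = {?\<Delta> -` E \<inter> space M | E. E \<in> sets borel}"
 \<comment> \<open>Events equal to a cylinder up to a null set. Null sets belong here through the
   empty cylinder.\<close>
 define \<G> where "\<G> = {A \<in> events. \<exists>C\<in>cylinders s. AE w in M. w \<in> A \<longleftrightarrow> w \<in> C}"
 have "indep_set \<G> \<D>"
 proof (rule indep_setI)
  show "\<G> \<subseteq> events" by (auto simp: \<G>_def)
  show "\<D> \<subseteq> events" using \<Delta>m by (auto simp: \<D>_def)
  fix a b assume a: "a \<in> \<G>" and b: "b \<in> \<D>"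
  obtain C where C: "C \<in> cylinders s" "AE w in M. w \<in> a \<longleftrightarrow> w \<in> C" using a by (auto simp: \<G>_def)
  obtain E where E: "E \<in> sets borel" "b = ?\<Delta> -` E \<inter> space M" using b by (auto simp: \<D>_def)
  have m: "a \<in> events" "b \<in> events" "C \<in> events"
   using a b \<Delta>m cylinders_sets[OF _ C(1)] st by (auto simp: \<G>_def \<D>_def)
  have "prob (a \<inter> b) = prob (C \<inter> b)" "prob a = prob C"
   using C(2) m by (auto intro!: finite_measure_eq_AE)
  then show "prob (a \<inter> b) = prob a * prob b"
   using cylinder_indep_increment[OF st C(1) E(1)] E(2) by simp
 qed
 moreover have "Int_stable \<G>"
 proof (rule Int_stableI)
  fix a b assume "a \<in> \<G>" "b \<in> \<G>"
  then obtain C D where C: "a \<in> events" "C \<in> cylinders s" "AE w in M. w \<in> a \<longleftrightarrow> w \<in> C"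
   and D: "b \<in> events" "D \<in> cylinders s" "AE w in M. w \<in> b \<longleftrightarrow> w \<in> D" by (auto simp: \<G>_def)
  have "AE w in M. w \<in> a \<inter> b \<longleftrightarrow> w \<in> C \<inter> D" using C(3) D(3) by eventually_elim auto
  then show "a \<inter> b \<in> \<G>"
   unfolding \<G>_def using C(1) D(1) cylinders_Int[OF C(2) D(2)] by (intro CollectI conjI bexI[of _ "C \<inter> D"]) auto
 qed
 moreover have "Int_stable \<D>"
 proof (rule Int_stableI)
  fix a b assume "a \<in> \<D>" "b \<in> \<D>"
  then obtain E E' where "a = ?\<Delta> -` E \<inter> space M" "b = ?\<Delta> -` E' \<inter> space M" "E \<in> sets borel" "E' \<in> sets borel"
   by (auto simp: \<D>_def)
  then show "a \<inter> b \<in> \<D>" unfolding \<D>_def by (intro CollectI exI[of _ "E \<inter> E'"]) auto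
 qed
 ultimately have ind: "indep_set (sigma_sets (space M) \<G>) (sigma_sets (space M) \<D>)"
  by (rule indep_set_sigma_sets)
 have "{B r -` A \<inter> space M | r A. r \<in> {0..s} \<and> A \<in> sets borel} \<union> null_sets M \<subseteq> \<G>"
 proof
  fix A assume "A \<in> {B r -` A \<inter> space M | r A. r \<in> {0..s} \<and> A \<in> sets borel} \<union> null_sets M"
  then consider r E where "A = B r -` E \<inter> space M" "r \<in> {0..s}" "E \<in> sets borel" | "A \<in> null_sets M" by auto
  then show "A \<in> \<G>"
  proof cases
   case 1
   have "A = space M \<inter> (\<Inter>q\<in>{r}. B q -` (\<lambda>_. E) q)" using 1 by auto
   then have "A \<in> cylinders s" unfolding cylinders_def using 1 by (intro CollectI exI[of _ "{r}"] exI[of _ "\<lambda>_. E"]) auto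
   moreover have "A \<in> events" using 1 st by (auto intro!: measurable_sets[OF B_measurable])
   ultimately show ?thesis by (auto simp: \<G>_def)
  next
   case 2
   have "{} = space M \<inter> (\<Inter>q\<in>{0::real}. B q -` (\<lambda>_. {}) q)" by auto
   then have "{} \<in> cylinders s" unfolding cylinders_def using st by (intro CollectI exI[of _ "{0}"] exI[of _ "\<lambda>_. {}"]) auto
   moreover have "AE w in M. w \<in> A \<longleftrightarrow> w \<in> {}" using AE_not_in[OF 2] by simp
   ultimately show ?thesis using 2 by (auto simp: \<G>_def)
  qed
 qed
 then have FG: "sets (F s) \<subseteq> sigma_sets (space M) \<G>" unfolding sets_F by (rule sigma_sets_mono')
 have "sigma_sets (space M) {\<xi> -` A \<inter> space M | A. A \<in> sets borel} \<subseteq> sets (F s)"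
  using measurable_sets[OF \<xi>] sets.sigma_sets_subset[of "{\<xi> -` A \<inter> space M | A. A \<in> sets borel}" "F s"] by auto
 with FG have sub: "sigma_sets (space M) {\<xi> -` A \<inter> space M | A. A \<in> sets borel} \<subseteq> sigma_sets (space M) \<G>" by blast
 have "indep_set (sigma_sets (space M) {\<xi> -` A \<inter> space M | A. A \<in> sets borel}) (sigma_sets (space M) \<D>)"
  using ind sub unfolding indep_set_def by (elim indep_sets_mono_sets) (auto split: bool.split)
 then show ?thesis
  unfolding indep_var_eq \<D>_def using \<Delta>m measurable_F_M[OF \<xi>] st by auto
qed

section \<open>Moments and covariances of increments\<close>

lemma increment_moment:
 assumes st: "0 \<le> s" "s \<le> t" "t \<le> 1" and p: "p \<ge> 0"
 shows "integrable M (\<lambda>w. \<bar>B t w - B s w\<bar> powr p)"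
  and "p > 0 \<Longrightarrow> moment p M (\<lambda>w. B t w - B s w) = (t - s) powr (p / 2) * (LINT x|lborel. std_normal_density x * \<bar>x\<bar> powr p)"
proof -
 have "integrable M (\<lambda>w. \<bar>B t w - B s w\<bar> powr p) \<and>
  (p > 0 \<longrightarrow> (moment p M (\<lambda>w. B t w - B s w)) = (t - s) powr (p / 2) * (LINT x|lborel. std_normal_density x * \<bar>x\<bar> powr p))"
 proof (cases "s = t")
  case False
  define \<sigma> where "\<sigma> = sqrt (t - s)"
  have \<sigma>: "\<sigma> > 0" using False st by (simp add: \<sigma>_def)
  define Z where "Z w = (B t w - B s w) / \<sigma>" for w
  have Z: "distributed M lborel Z std_normal_density"
   using B_increment_normal[of s t] normal_standard_normal_convert[OF \<sigma>, of "\<lambda>w. B t w - B s w" 0] False st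
   by (simp add: \<sigma>_def Z_def[abs_def])
  obtain k :: nat where k: "p \<le> real k" using real_arch_simple by blast
  have "integrable lborel (\<lambda>x. std_normal_density x * \<bar>x\<bar> powr p)"
  proof (rule Bochner_Integration.integrable_bound)
   show "integrable lborel (\<lambda>x. std_normal_density x * 1 + std_normal_density x * \<bar>x - 0\<bar> ^ k)"
    using integrable_normal_moment_abs[of 1 0 0] integrable_normal_moment_abs[of 1 0 k]
    by (intro Bochner_Integration.integrable_add) auto
   show "AE x in lborel. norm (std_normal_density x * \<bar>x\<bar> powr p) \<le> norm (std_normal_density x * 1 + std_normal_density x * \<bar>x - 0\<bar> ^ k)"
   proof (rule AE_I2)
    fix x :: real
    have "\<bar>x\<bar> powr p \<le> 1 + \<bar>x\<bar> ^ k"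
    proof (cases "\<bar>x\<bar> \<le> 1")
     case True
     then have "\<bar>x\<bar> powr p \<le> 1" using p by (intro powr_le1) auto
     then show ?thesis by (simp add: add_increasing2)
    next
     case False
     then have "\<bar>x\<bar> powr p \<le> \<bar>x\<bar> powr real k" using k by (intro powr_mono) auto
     then show ?thesis using False by (simp add: powr_realpow)
    qed
    then have "std_normal_density x * \<bar>x\<bar> powr p \<le> std_normal_density x * (1 + \<bar>x\<bar> ^ k)"
     by (intro mult_left_mono) auto
    then show "norm (std_normal_density x * \<bar>x\<bar> powr p) \<le> norm (std_normal_density x * 1 + std_normal_density x * \<bar>x - 0\<bar> ^ k)"
     by (simp add: distrib_left abs_mult)
   qed
  qed measurable
  then have iZ: "integrable M (\<lambda>w. \<bar>Z w\<bar> powr p)"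
   using distributed_integrable[OF Z, of "\<lambda>x. \<bar>x\<bar> powr p"] by simp
  have eZ: "(LINT x|lborel. std_normal_density x * \<bar>x\<bar> powr p) = moment p M Z"
   using distributed_integral[OF Z, of "\<lambda>x. \<bar>x\<bar> powr p"] by simp
  have sc: "\<bar>B t w - B s w\<bar> powr p = (t - s) powr (p / 2) * \<bar>Z w\<bar> powr p" for w
  proof -
   have "\<bar>B t w - B s w\<bar> = \<sigma> * \<bar>Z w\<bar>" using \<sigma> by (simp add: Z_def)
   moreover have "\<sigma> powr p = (t - s) powr (p / 2)"
    using st by (simp add: \<sigma>_def powr_half_sqrt[symmetric] powr_powr)
   ultimately show ?thesis using \<sigma> by (simp add: powr_mult)
  qed
  show ?thesis unfolding sc eZ using iZ by simp
 qed simp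
 then show "integrable M (\<lambda>w. \<bar>B t w - B s w\<bar> powr p)"
  and "p > 0 \<Longrightarrow> moment p M (\<lambda>w. B t w - B s w) = (t - s) powr (p / 2) * (LINT x|lborel. std_normal_density x * \<bar>x\<bar> powr p)"
  by auto
qed

lemma increment_mean:
 assumes st: "0 \<le> s" "s \<le> t" "t \<le> 1"
 shows "integrable M (\<lambda>w. B t w - B s w)" "(LINT w|M. B t w - B s w) = 0"
proof -
 have "integrable M (\<lambda>w. B t w - B s w) \<and> (LINT w|M. B t w - B s w) = 0"
 proof (cases "s = t")
  case False
  then have \<sigma>: "sqrt (t - s) > 0" using st by simp
  have D: "distributed M lborel (\<lambda>w. B t w - B s w) (normal_density 0 (sqrt (t - s)))"
   using False st by (intro B_increment_normal) auto
  show ?thesis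
   using distributed_integrable[OF D, of "\<lambda>x. x"] distributed_integral[OF D, of "\<lambda>x. x"]
    integrable_normal_moment_nz_1[OF \<sigma>, of 0] integral_normal_moment_nz_1[OF \<sigma>, of 0] by simp
 qed simp
 then show "integrable M (\<lambda>w. B t w - B s w)" "(LINT w|M. B t w - B s w) = 0" by auto
qed

lemma increment_square:
 assumes st: "0 \<le> s" "s \<le> t" "t \<le> 1"
 shows "integrable M (\<lambda>w. (B t w - B s w)\<^sup>2)" "(LINT w|M. (B t w - B s w)\<^sup>2) = t - s"
proof -
 have "(LINT x|lborel. std_normal_density x * x\<^sup>2) = 1"
  using integral_std_normal_moment_even[of 1] by (simp add: fact_numeral)
 then show "integrable M (\<lambda>w. (B t w - B s w)\<^sup>2)" "(LINT w|M. (B t w - B s w)\<^sup>2) = t - s"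
  using increment_moment[OF st, of 2] st by auto
qed

lemma increment_product:
 assumes st: "0 \<le> s" "s \<le> t" "t \<le> 1" and \<zeta>: "\<zeta> \<in> borel_measurable (F s)" "integrable M \<zeta>"
  and \<phi>[measurable]: "\<phi> \<in> borel_measurable borel" and i: "integrable M (\<lambda>w. \<phi> (B t w - B s w) :: real)"
 shows "integrable M (\<lambda>w. \<zeta> w * \<phi> (B t w - B s w))"
  "(LINT w|M. \<zeta> w * \<phi> (B t w - B s w)) = (LINT w|M. \<zeta> w) * (LINT w|M. \<phi> (B t w - B s w))"
proof -
 have "integrable M (\<lambda>w. \<zeta> w * \<phi> (B t w - B s w)) \<and>
  (LINT w|M. \<zeta> w * \<phi> (B t w - B s w)) = (LINT w|M. \<zeta> w) * (LINT w|M. \<phi> (B t w - B s w))"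
 proof (cases "s = t")
  case True
  then show ?thesis using \<zeta>(2) by (simp add: prob_space)
 next
  case False
  then have "indep_var borel \<zeta> borel (\<lambda>w. B t w - B s w)"
   using st \<zeta> by (intro F_indep_increment) auto
  from indep_var_compose[OF this measurable_ident \<phi>]
  have "indep_var borel \<zeta> borel (\<lambda>w. \<phi> (B t w - B s w))" by (simp add: comp_def id_def)
  from indep_var_lebesgue_integral[OF this \<zeta>(2) i] indep_var_integrable[OF this \<zeta>(2) i]
  show ?thesis by simp
 qed
 then show "integrable M (\<lambda>w. \<zeta> w * \<phi> (B t w - B s w))"
  "(LINT w|M. \<zeta> w * \<phi> (B t w - B s w)) = (LINT w|M. \<zeta> w) * (LINT w|M. \<phi> (B t w - B s w))"
  by auto
qed

lemma increment_orthogonal: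
 assumes st: "0 \<le> s" "s \<le> t" "t \<le> 1" and \<zeta>: "\<zeta> \<in> borel_measurable (F s)" "integrable M \<zeta>"
 shows "integrable M (\<lambda>w. \<zeta> w * (B t w - B s w))" "(LINT w|M. \<zeta> w * (B t w - B s w)) = 0"
 using increment_product[OF st \<zeta>, of "\<lambda>x. x"] increment_mean[OF st] by auto

lemma increment_square_product:
 assumes st: "0 \<le> s" "s \<le> t" "t \<le> 1" and \<zeta>: "\<zeta> \<in> borel_measurable (F s)" "integrable M \<zeta>"
 shows "integrable M (\<lambda>w. \<zeta> w * (B t w - B s w)\<^sup>2)" "(LINT w|M. \<zeta> w * (B t w - B s w)\<^sup>2) = (LINT w|M. \<zeta> w) * (t - s)"
 using increment_product[OF st \<zeta>, of "\<lambda>x. x\<^sup>2"] increment_square[OF st] by auto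

text \<open>Two intervals that may overlap, with a \<le> c. Cutting at e = min b c and f = min b d
  leaves the common part [c,f]; every other piece is a later increment times something known before
  it, and has mean 0.\<close>

lemma covariance_aux:
 assumes ab: "0 \<le> a" "a \<le> b" "b \<le> 1" and cd: "c \<le> d" "d \<le> 1" and ac: "a \<le> c"
  and \<zeta>[measurable]: "\<zeta> \<in> borel_measurable (F c)" and b\<zeta>: "\<And>w. w \<in> space M \<Longrightarrow> \<bar>\<zeta> w\<bar> \<le> C"
 shows "integrable M (\<lambda>w. \<zeta> w * (B b w - B a w) * (B d w - B c w))"
  "(LINT w|M. \<zeta> w * (B b w - B a w) * (B d w - B c w)) = (LINT w|M. \<zeta> w) * max 0 (min b d - c)"
proof -
 have c1: "c \<le> 1" "0 \<le> c" using cd ab ac by auto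
 have i\<zeta>: "integrable M \<zeta>"
  using b\<zeta> measurable_F_M[OF \<zeta> c1(1)] by (intro integrable_const_bound[where B=C]) auto
 have bounded_inc: "integrable M (\<lambda>w. \<zeta> w * (B q w - B p w))" if "0 \<le> p" "p \<le> q" "q \<le> 1" for p q
 proof (rule Bochner_Integration.integrable_bound)
  show "integrable M (\<lambda>w. C * (B q w - B p w))" using increment_mean(1)[OF that] by simp
  show "(\<lambda>w. \<zeta> w * (B q w - B p w)) \<in> borel_measurable M"
   using that measurable_F_M[OF \<zeta> c1(1)] by (intro borel_measurable_times borel_measurable_diff B_measurable) auto
  show "AE w in M. norm (\<zeta> w * (B q w - B p w)) \<le> norm (C * (B q w - B p w))"
   using b\<zeta> by (intro AE_I2) (auto simp: abs_mult intro!: mult_right_mono order_trans[OF b\<zeta>])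
 qed
 define e where "e = min b c"
 have e: "a \<le> e" "e \<le> b" "e \<le> c" using ab ac by (auto simp: e_def)
 have 1: "integrable M (\<lambda>w. (\<zeta> w * (B e w - B a w)) * (B d w - B c w))"
  "(LINT w|M. (\<zeta> w * (B e w - B a w)) * (B d w - B c w)) = 0"
 proof -
  have "(\<lambda>w. \<zeta> w * (B e w - B a w)) \<in> borel_measurable (F c)"
   using ab e by (intro borel_measurable_times \<zeta> borel_measurable_diff B_measurable_F) auto
  then show "integrable M (\<lambda>w. (\<zeta> w * (B e w - B a w)) * (B d w - B c w))"
   "(LINT w|M. (\<zeta> w * (B e w - B a w)) * (B d w - B c w)) = 0"
   using increment_orthogonal[OF c1(2) cd] bounded_inc[of a e] e ab by auto
 qed
 show "integrable M (\<lambda>w. \<zeta> w * (B b w - B a w) * (B d w - B c w))"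
  "(LINT w|M. \<zeta> w * (B b w - B a w) * (B d w - B c w)) = (LINT w|M. \<zeta> w) * max 0 (min b d - c)"
 proof -
  have "integrable M (\<lambda>w. \<zeta> w * (B b w - B a w) * (B d w - B c w)) \<and>
   (LINT w|M. \<zeta> w * (B b w - B a w) * (B d w - B c w)) = (LINT w|M. \<zeta> w) * max 0 (min b d - c)"
  proof (cases "b \<le> c")
   case True
   then show ?thesis using 1 by (simp add: e_def)
  next
   case False
   then have ec: "e = c" by (simp add: e_def)
   define f where "f = min b d"
   have f: "c \<le> f" "f \<le> b" "f \<le> d" using False cd by (auto simp: f_def)
   have \<zeta>f: "\<zeta> \<in> borel_measurable (F f)" by (rule measurable_F_mono[OF \<zeta> f(1)])
   have bf: "(\<lambda>w. \<zeta> w * (B f w - B c w)) \<in> borel_measurable (F f)"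
    using c1 f by (intro borel_measurable_times \<zeta>f borel_measurable_diff B_measurable_F) auto
   have 2: "integrable M (\<lambda>w. \<zeta> w * (B f w - B c w)\<^sup>2)" "(LINT w|M. \<zeta> w * (B f w - B c w)\<^sup>2) = (LINT w|M. \<zeta> w) * (f - c)"
    using c1 f cd by (intro increment_square_product \<zeta> i\<zeta>; simp)+
   have 3: "integrable M (\<lambda>w. \<zeta> w * (B f w - B c w) * (B d w - B f w))"
    "(LINT w|M. \<zeta> w * (B f w - B c w) * (B d w - B f w)) = 0"
    "integrable M (\<lambda>w. \<zeta> w * (B f w - B c w) * (B b w - B f w))"
    "(LINT w|M. \<zeta> w * (B f w - B c w) * (B b w - B f w)) = 0"
    using c1 f cd ab by (intro increment_orthogonal bf bounded_inc; simp)+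
   \<comment> \<open>One of the two remainders beyond f is empty, so the expansion contains no
     product of these remainders.\<close>
   have "f = b \<or> f = d" by (auto simp: f_def)
   then have split: "\<zeta> w * (B b w - B a w) * (B d w - B c w) =
    (\<zeta> w * (B e w - B a w)) * (B d w - B c w) + (\<zeta> w * (B f w - B c w)\<^sup>2 +
     (\<zeta> w * (B f w - B c w) * (B d w - B f w) + \<zeta> w * (B f w - B c w) * (B b w - B f w)))" for w
    unfolding ec by (auto simp: power2_eq_square algebra_simps)
   show ?thesis unfolding split using 1 2 3 f by (simp add: f_def)
  qed
  then show "integrable M (\<lambda>w. \<zeta> w * (B b w - B a w) * (B d w - B c w))"
   "(LINT w|M. \<zeta> w * (B b w - B a w) * (B d w - B c w)) = (LINT w|M. \<zeta> w) * max 0 (min b d - c)" by auto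
 qed
qed

lemma covariance:
 assumes ab: "0 \<le> a" "a \<le> b" "b \<le> 1" and cd: "0 \<le> c" "c \<le> d" "d \<le> 1"
  and \<xi>: "\<xi> \<in> borel_measurable (F a)" "\<And>w. w \<in> space M \<Longrightarrow> \<bar>\<xi> w\<bar> \<le> C"
  and \<eta>: "\<eta> \<in> borel_measurable (F c)" "\<And>w. w \<in> space M \<Longrightarrow> \<bar>\<eta> w\<bar> \<le> D"
 shows "integrable M (\<lambda>w. (\<xi> w * (B b w - B a w)) * (\<eta> w * (B d w - B c w)))"
  "(LINT w|M. (\<xi> w * (B b w - B a w)) * (\<eta> w * (B d w - B c w))) =
   (LINT w|M. \<xi> w * \<eta> w) * max 0 (min b d - max a c)"
proof -
 have bd: "\<bar>\<xi> w * \<eta> w\<bar> \<le> C * D" if "w \<in> space M" for w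
  using \<xi>(2)[OF that] \<eta>(2)[OF that] by (simp add: abs_mult mult_mono')
 have "integrable M (\<lambda>w. (\<xi> w * (B b w - B a w)) * (\<eta> w * (B d w - B c w))) \<and>
  (LINT w|M. (\<xi> w * (B b w - B a w)) * (\<eta> w * (B d w - B c w))) =
   (LINT w|M. \<xi> w * \<eta> w) * max 0 (min b d - max a c)"
 proof (cases "a \<le> c")
  case True
  have m: "(\<lambda>w. \<xi> w * \<eta> w) \<in> borel_measurable (F c)"
   using measurable_F_mono[OF \<xi>(1) True] \<eta>(1) by simp
  show ?thesis
   using covariance_aux[OF ab cd(2,3) True m bd] True by (simp add: mult_ac max_def)
 next
  case False
  have m: "(\<lambda>w. \<xi> w * \<eta> w) \<in> borel_measurable (F a)"
   using measurable_F_mono[OF \<eta>(1), of a] \<xi>(1) False by simp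
  show ?thesis
   using covariance_aux[OF cd ab(2,3) _ m bd] False by (simp add: mult_ac max_def min.commute)
 qed
 then show "integrable M (\<lambda>w. (\<xi> w * (B b w - B a w)) * (\<eta> w * (B d w - B c w)))"
  "(LINT w|M. (\<xi> w * (B b w - B a w)) * (\<eta> w * (B d w - B c w))) =
   (LINT w|M. \<xi> w * \<eta> w) * max 0 (min b d - max a c)" by auto
qed

end

section \<open>Mean-square estimates\<close>

text \<open>Squared norms with the crude factor 2 replace Minkowski's inequality, which keeps all
  estimates in \<open>ennreal\<close> and free of finiteness conditions.\<close>

lemma nsq_add_le:
 assumes [measurable]: "f \<in> borel_measurable N" "g \<in> borel_measurable N"
 shows "nsq N (\<lambda>x. f x + g x) \<le> 2 * (nsq N f + nsq N g)"
proof -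
 have "nsq N (\<lambda>x. f x + g x) \<le> (\<integral>\<^sup>+x. 2 * (ennreal ((f x)\<^sup>2) + ennreal ((g x)\<^sup>2)) \<partial>N)"
 proof (intro nn_integral_mono)
  fix x
  have "(f x + g x)\<^sup>2 \<le> 2 * ((f x)\<^sup>2 + (g x)\<^sup>2)"
   using sum_squares_bound[of "f x" "g x"] by (simp add: power2_sum)
  then have "ennreal ((f x + g x)\<^sup>2) \<le> ennreal (2 * ((f x)\<^sup>2 + (g x)\<^sup>2))" by (rule ennreal_leI)
  also have "\<dots> = 2 * (ennreal ((f x)\<^sup>2) + ennreal ((g x)\<^sup>2))" by (simp add: ennreal_mult)
  finally show "ennreal ((f x + g x)\<^sup>2) \<le> 2 * (ennreal ((f x)\<^sup>2) + ennreal ((g x)\<^sup>2))" .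
 qed
 also have "\<dots> = 2 * (nsq N f + nsq N g)" by (simp add: nn_integral_cmult nn_integral_add)
 finally show ?thesis .
qed

lemma nsq_diff_commute: "nsq N (\<lambda>x. f x - g x) = nsq N (\<lambda>x. g x - f x)"
 by (simp add: power2_commute)

lemma nsq_triangle:
 assumes [measurable]: "f \<in> borel_measurable N" "g \<in> borel_measurable N" "h \<in> borel_measurable N"
 shows "nsq N (\<lambda>x. f x - h x) \<le> 2 * (nsq N (\<lambda>x. f x - g x) + nsq N (\<lambda>x. g x - h x))"
 using nsq_add_le[of "\<lambda>x. f x - g x" N "\<lambda>x. g x - h x"] by simp

lemma nsq_le_diff:
 assumes [measurable]: "f \<in> borel_measurable N" "g \<in> borel_measurable N"
 shows "nsq N f \<le> 2 * (nsq N (\<lambda>x. f x - g x) + nsq N g)"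
 using nsq_add_le[of "\<lambda>x. f x - g x" N g] by simp

lemma nsq_cmult:
 assumes [measurable]: "f \<in> borel_measurable N"
 shows "nsq N (\<lambda>x. c * f x) = ennreal (c\<^sup>2) * nsq N f"
 by (simp add: power_mult_distrib ennreal_mult nn_integral_cmult)

lemma nsq_zero_AE:
 assumes [measurable]: "f \<in> borel_measurable N" and "nsq N f \<le> 0"
 shows "AE x in N. f x = 0"
proof -
 have "AE x in N. (f x)\<^sup>2 = 0" by (rule AE_zero_of_nn_integral) (use assms in auto)
 then show ?thesis by simp
qed

lemma nsq_complete:
 assumes [measurable]: "\<And>n. f n \<in> borel_measurable N"
  and "\<And>e. e > 0 \<Longrightarrow> \<exists>k. \<forall>m\<ge>k. \<forall>n\<ge>k. nsq N (\<lambda>x. f m x - f n x) \<le> e"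
 shows "\<exists>g\<in>borel_measurable N. (\<lambda>n. nsq N (\<lambda>x. f n x - g x)) \<longlonglongrightarrow> 0"
 using Lp_complete[of f N 2] assms by simp

lemma nsq_subseq_AE:
 assumes "\<And>n. f n \<in> borel_measurable N" "g \<in> borel_measurable N" "(\<lambda>n. nsq N (\<lambda>x. f n x - g x)) \<longlonglongrightarrow> 0"
 shows "\<exists>s. strict_mono s \<and> (AE x in N. (\<lambda>n. f (s n) x) \<longlonglongrightarrow> g x)"
 using Lp_tendsto_subseq_AE[of f N g 2] assms by simp

lemma ennreal_tendsto_zero_le:
 fixes a b :: "nat \<Rightarrow> ennreal"
 assumes "b \<longlonglongrightarrow> 0" "\<And>n. a n \<le> c * b n" "c < \<infinity>"
 shows "a \<longlonglongrightarrow> 0"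
proof (rule tendsto_sandwich[OF _ _ tendsto_const])
 have "(\<lambda>n. c * b n) \<longlonglongrightarrow> c * 0"
  using assms(1,3) by (intro ennreal_tendsto_cmult) auto
 then show "(\<lambda>n. c * b n) \<longlonglongrightarrow> 0" by simp
qed (use assms(2) in auto)

lemma nsq_cauchy_of_tendsto:
 assumes [measurable]: "\<And>n. f n \<in> borel_measurable N" "g \<in> borel_measurable N"
  and lim: "(\<lambda>n. nsq N (\<lambda>x. f n x - g x)) \<longlonglongrightarrow> 0" and e: "e > 0"
 shows "\<exists>k. \<forall>m\<ge>k. \<forall>n\<ge>k. nsq N (\<lambda>x. f m x - f n x) \<le> e"
proof -
 have "\<forall>\<^sub>F n in sequentially. nsq N (\<lambda>x. f n x - g x) < e / 4"
  using e by (intro order_tendstoD[OF lim]) (auto simp: ennreal_zero_less_divide)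
 then obtain k where k: "\<And>n. n \<ge> k \<Longrightarrow> nsq N (\<lambda>x. f n x - g x) \<le> e / 4"
  by (auto simp: eventually_sequentially intro: less_imp_le)
 have "nsq N (\<lambda>x. f m x - f n x) \<le> e" if "m \<ge> k" "n \<ge> k" for m n
 proof -
  have "nsq N (\<lambda>x. f m x - f n x) \<le> 2 * (nsq N (\<lambda>x. f m x - g x) + nsq N (\<lambda>x. g x - f n x))"
   by (rule nsq_triangle) measurable
  also have "\<dots> \<le> 2 * (e / 4 + e / 4)"
   using k[OF that(1)] k[OF that(2)] by (intro mult_left_mono add_mono) (simp_all add: nsq_diff_commute[of N g])
  also have "\<dots> = (4 * e) / 4" by (simp add: ennreal_times_divide[symmetric] mult_2[symmetric] flip: mult.assoc)
  also have "\<dots> = e" by (subst mult.commute) (simp add: ennreal_mult_divide_eq)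
  finally show ?thesis .
 qed
 then show ?thesis by blast
qed

text \<open>Moves the product measures of the statement, one for each t, to the single product with
  Lebesgue measure on the whole line, where a time interval is an indicator.\<close>

lemma pair_dt_eq:
 assumes "sigma_finite_measure M"
 shows "M \<Otimes>\<^sub>M dt t = restrict_space (M \<Otimes>\<^sub>M lborel) (space M \<times> {0..t})"
proof (rule pair_measure_eqI[OF assms])
 interpret M: sigma_finite_measure M by fact
 let ?R = "restrict_space (M \<Otimes>\<^sub>M lborel) (space M \<times> {0..t})"
 have \<Omega>: "space M \<times> {0..t} \<in> sets (M \<Otimes>\<^sub>M lborel)" by auto
 show "sigma_finite_measure (dt t)"
  by (rule sigma_finite_measure_restrict_space[OF sigma_finite_lborel]) simp
 have id: "(\<lambda>p. p) \<in> measurable (M \<Otimes>\<^sub>M dt t) (M \<Otimes>\<^sub>M lborel)"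
 proof (rule measurable_pair)
  have "(\<lambda>x. x) \<in> measurable (dt t) lborel" by (rule measurable_restrict_space1) simp
  from measurable_compose[OF measurable_snd this]
  show "snd \<circ> (\<lambda>p. p) \<in> measurable (M \<Otimes>\<^sub>M dt t) lborel" by (simp add: comp_def)
 qed (simp add: comp_def)
 show "sets (M \<Otimes>\<^sub>M dt t) = sets ?R"
 proof
  show "sets (M \<Otimes>\<^sub>M dt t) \<subseteq> sets ?R"
  proof -
   have sp: "space M \<times> space (dt t) = space ?R"
    by (auto simp: space_restrict_space space_pair_measure)
   have "{a \<times> b |a b. a \<in> sets M \<and> b \<in> sets (dt t)} \<subseteq> sets ?R"
   proof
    fix X assume "X \<in> {a \<times> b |a b. a \<in> sets M \<and> b \<in> sets (dt t)}"
    then obtain a b where X: "X = a \<times> b" "a \<in> sets M" "b \<in> sets (dt t)" by blast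
    then obtain c where c: "c \<in> sets lborel" "b = c \<inter> {0..t}" by (auto simp: sets_restrict_space)
    have "X = (space M \<times> {0..t}) \<inter> (a \<times> c)" using X c sets.sets_into_space[OF X(2)] by auto
    moreover have "a \<times> c \<in> sets (M \<Otimes>\<^sub>M lborel)" using X c by auto
    ultimately show "X \<in> sets ?R" by (auto simp: sets_restrict_space)
   qed
   then show ?thesis unfolding sets_pair_measure sp by (rule sets.sigma_sets_subset)
  qed
  show "sets ?R \<subseteq> sets (M \<Otimes>\<^sub>M dt t)"
  proof
   fix X assume "X \<in> sets ?R"
   then obtain Y where Y: "Y \<in> sets (M \<Otimes>\<^sub>M lborel)" "X = (space M \<times> {0..t}) \<inter> Y" by (auto simp: sets_restrict_space)
   have "X = (\<lambda>p. p) -` Y \<inter> space (M \<Otimes>\<^sub>M dt t)" using Y by (auto simp: space_pair_measure space_restrict_space)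
   then show "X \<in> sets (M \<Otimes>\<^sub>M dt t)" using measurable_sets[OF id Y(1)] by simp
  qed
 qed
 fix a b assume a: "a \<in> sets M" and b: "b \<in> sets (dt t)"
 then obtain c where c: "c \<in> sets lborel" "b = c \<inter> {0..t}" by (auto simp: sets_restrict_space)
 have b': "b \<subseteq> {0..t}" "b \<in> sets lborel" using c by auto
 have "emeasure ?R (a \<times> b) = emeasure (M \<Otimes>\<^sub>M lborel) (a \<times> b)"
  using \<Omega> a b' sets.sets_into_space[OF a] by (intro emeasure_restrict_space) auto
 also have "\<dots> = emeasure M a * emeasure lborel b" using a b' by (intro lborel.emeasure_pair_measure_Times) auto
 also have "emeasure lborel b = emeasure (dt t) b" using b' by (intro emeasure_restrict_space[symmetric]) auto
 finally show "emeasure M a * emeasure (dt t) b = emeasure ?R (a \<times> b)" by simp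
qed

section \<open>Elementary integrals and their mean-square closure\<close>

context brownian
begin

abbreviation P :: "('w \<times> real) measure" where "P \<equiv> M \<Otimes>\<^sub>M lborel"

abbreviation proc_pow :: "real \<Rightarrow> real \<Rightarrow> ('w \<times> real \<Rightarrow> real) \<Rightarrow> ennreal" where
 "proc_pow r T u \<equiv> \<integral>\<^sup>+p. ennreal (indicator {0..T} (snd p) * \<bar>u p\<bar> powr r) \<partial>P"

abbreviation weighted_pow :: "real \<Rightarrow> (real \<Rightarrow> real) \<Rightarrow> ('w \<times> real \<Rightarrow> real) \<Rightarrow> ennreal" where
 "weighted_pow r h u \<equiv> \<integral>\<^sup>+p. ennreal ((h (snd p))\<^sup>2 * \<bar>u p\<bar> powr r) \<partial>P"

sublocale P: pair_sigma_finite M lborel ..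

lemma sigma_finite_M: "sigma_finite_measure M" ..

text \<open>Unlike in a simple process the intervals may overlap, so that sums need no common
  refinement. In exchange the isometry requires the covariance of overlapping increments.\<close>

inductive elem :: "('w \<times> real \<Rightarrow> real) \<Rightarrow> ('w \<Rightarrow> real) \<Rightarrow> bool" where
 elem_zero: "elem (\<lambda>p. 0) (\<lambda>w. 0)"
| elem_add: "elem V X \<Longrightarrow> 0 \<le> a \<Longrightarrow> a \<le> b \<Longrightarrow> b \<le> 1 \<Longrightarrow> \<xi> \<in> borel_measurable (F a) \<Longrightarrow>
  \<forall>w\<in>space M. \<bar>\<xi> w\<bar> \<le> C \<Longrightarrow>
  elem (\<lambda>p. V p + \<xi> (fst p) * indicator {a<..b} (snd p)) (\<lambda>w. X w + \<xi> w * (B b w - B a w))"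

lemma elem_props:
 assumes "elem V X"
 shows "V \<in> borel_measurable P \<and> X \<in> borel_measurable M \<and> (\<exists>C. \<forall>w\<in>space M. \<forall>s. \<bar>V (w, s)\<bar> \<le> C) \<and>
  (\<forall>w s. s \<notin> {0<..1} \<longrightarrow> V (w, s) = 0) \<and> integrable M (\<lambda>w. (X w)\<^sup>2)"
 using assms
proof induction
 case elem_zero
 then show ?case by auto
next
 case (elem_add V X a b \<xi> C)
 then have [measurable]: "V \<in> borel_measurable P" "X \<in> borel_measurable M" "\<xi> \<in> borel_measurable M"
   "B a \<in> borel_measurable M" "B b \<in> borel_measurable M"
  by (auto intro: measurable_F_M B_measurable)
 obtain D where D: "\<And>w s. w \<in> space M \<Longrightarrow> \<bar>V (w, s)\<bar> \<le> D" using elem_add.IH by blast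
 have C: "0 \<le> C" using elem_add.hyps not_empty by (metis abs_ge_zero all_not_in_conv order_trans)
 have "\<bar>V (w, s) + \<xi> w * indicator {a<..b} s\<bar> \<le> D + C" if "w \<in> space M" for w s
  using D[OF that, of s] elem_add.hyps that C by (auto simp: indicator_def intro!: order_trans[OF abs_triangle_ineq] add_mono)
 moreover have "integrable M (\<lambda>w. (X w + \<xi> w * (B b w - B a w))\<^sup>2)"
 proof (rule Bochner_Integration.integrable_bound)
  show "integrable M (\<lambda>w. 2 * (X w)\<^sup>2 + 2 * C\<^sup>2 * (B b w - B a w)\<^sup>2)"
   using elem_add.IH increment_square(1)[of a b] elem_add.hyps by auto
  show "AE w in M. norm ((X w + \<xi> w * (B b w - B a w))\<^sup>2) \<le> norm (2 * (X w)\<^sup>2 + 2 * C\<^sup>2 * (B b w - B a w)\<^sup>2)"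
  proof (rule AE_I2)
   fix w assume w: "w \<in> space M"
   have "(X w + \<xi> w * (B b w - B a w))\<^sup>2 \<le> 2 * (X w)\<^sup>2 + 2 * (\<xi> w * (B b w - B a w))\<^sup>2"
    using sum_squares_bound[of "X w" "\<xi> w * (B b w - B a w)"] by (simp add: power2_sum)
   also have "(\<xi> w * (B b w - B a w))\<^sup>2 \<le> C\<^sup>2 * (B b w - B a w)\<^sup>2"
    using elem_add.hyps w by (auto simp: power_mult_distrib intro!: mult_right_mono power2_le_iff_abs_le[THEN iffD2, OF C])
   finally show "norm ((X w + \<xi> w * (B b w - B a w))\<^sup>2) \<le> norm (2 * (X w)\<^sup>2 + 2 * C\<^sup>2 * (B b w - B a w)\<^sup>2)" by simp
  qed
 qed measurable
 moreover have "\<forall>w s. s \<notin> {0<..1} \<longrightarrow> V (w, s) + \<xi> w * indicator {a<..b} s = 0"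
  using elem_add by (auto simp: indicator_def)
 ultimately show ?case by auto
qed

lemma elem_measurable:
 assumes "elem V X"
 shows "V \<in> borel_measurable P" "X \<in> borel_measurable M"
 using elem_props[OF assms] by auto

lemma bounded_supp_integrable:
 fixes V :: "'w \<times> real \<Rightarrow> real"
 assumes [measurable]: "V \<in> borel_measurable P" and C: "\<And>w s. w \<in> space M \<Longrightarrow> \<bar>V (w, s)\<bar> \<le> C"
  and z: "\<And>w s. s \<notin> {0<..1} \<Longrightarrow> V (w, s) = 0"
 shows "integrable P V"
proof (rule integrableI_bounded)
 have "(\<integral>\<^sup>+p. ennreal (norm (V p)) \<partial>P) \<le> (\<integral>\<^sup>+p. ennreal C * indicator {0..1} (snd p) \<partial>P)"
 proof (intro nn_integral_mono)
  fix p assume "p \<in> space P"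
  then show "ennreal (norm (V p)) \<le> ennreal C * indicator {0..1} (snd p)"
   using C[of "fst p" "snd p"] z[of "snd p" "fst p"]
   by (cases p) (auto simp: space_pair_measure indicator_def intro: ennreal_leI)
 qed
 also have "\<dots> = (\<integral>\<^sup>+w. \<integral>\<^sup>+s. ennreal C * indicator {0..1::real} s \<partial>lborel \<partial>M)"
  by (subst lborel.nn_integral_fst[symmetric]) auto
 also have "\<dots> = (\<integral>\<^sup>+w. ennreal C \<partial>M)"
 proof (intro nn_integral_cong)
  fix w :: 'w
  show "(\<integral>\<^sup>+s. ennreal C * indicator {0..1::real} s \<partial>lborel) = ennreal C"
   by (subst nn_integral_cmult) simp_all
 qed
 also have "\<dots> < \<infinity>" by (simp add: emeasure_space_1)
 finally show "(\<integral>\<^sup>+p. ennreal (norm (V p)) \<partial>P) < \<infinity>" .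
qed (rule assms(1))

lemma integral_indicator_prod:
 assumes "integrable M f"
 shows "(LINT p|P. f (fst p) * indicator {a<..b} (snd p) * indicator {c<..d} (snd p)) = (LINT w|M. f w) * max 0 (min b d - max a (c::real))"
proof -
 have ind: "indicator {a<..b} s * indicator {c<..d} s = (indicator {max a c<..min b d} s :: real)" for s
  by (auto simp: indicator_def)
 have [measurable]: "f \<in> borel_measurable M" using assms by auto
 have len: "measure lborel {max a c<..min b d} = max 0 (min b d - max a c)"
  by (cases "max a c \<le> min b d") auto
 have int: "integrable P (case_prod (\<lambda>w s. f w * indicator {max a c<..min b d} s))"
 proof (rule integrableI_bounded)
  have "(\<integral>\<^sup>+p. ennreal (norm (case_prod (\<lambda>w s. f w * indicator {max a c<..min b d} s) p)) \<partial>P) =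
    (\<integral>\<^sup>+w. \<integral>\<^sup>+s. ennreal \<bar>f w\<bar> * indicator {max a c<..min b d} s \<partial>lborel \<partial>M)"
   by (subst lborel.nn_integral_fst[symmetric]) (auto intro!: nn_integral_cong simp: indicator_def)
  also have "\<dots> = (\<integral>\<^sup>+w. ennreal \<bar>f w\<bar> \<partial>M) * emeasure lborel {max a c<..min b d}"
   by (simp add: nn_integral_cmult nn_integral_multc)
  also have "\<dots> < \<infinity>"
   using assms by (cases "max a c \<le> min b d") (auto simp: integrable_iff_bounded ennreal_mult_less_top)
  finally show "(\<integral>\<^sup>+p. ennreal (norm (case_prod (\<lambda>w s. f w * indicator {max a c<..min b d} s) p)) \<partial>P) < \<infinity>" .
 qed measurable
 have "(LINT p|P. f (fst p) * indicator {a<..b} (snd p) * indicator {c<..d} (snd p)) =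
   (LINT p|P. case_prod (\<lambda>w s. f w * indicator {max a c<..min b d} s) p)"
  by (simp add: mult.assoc ind case_prod_beta')
 also have "\<dots> = (LINT w|M. LINT s|lborel. f w * indicator {max a c<..min b d} s)"
  by (rule P.integral_fst[OF int, symmetric])
 finally show ?thesis by (simp add: len)
qed

text \<open>The polarised isometry against one term. It supplies the mixed term when
  \<open>elem_isometry\<close> adds a summand.\<close>

lemma elem_single:
 assumes "elem V X" and cd: "0 \<le> c" "c \<le> d" "d \<le> 1"
  and \<eta>: "\<eta> \<in> borel_measurable (F c)" "\<forall>w\<in>space M. \<bar>\<eta> w\<bar> \<le> D"
 shows "integrable M (\<lambda>w. X w * (\<eta> w * (B d w - B c w))) \<and> integrable P (\<lambda>p. V p * (\<eta> (fst p) * indicator {c<..d} (snd p))) \<and>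
  (LINT w|M. X w * (\<eta> w * (B d w - B c w))) = (LINT p|P. V p * (\<eta> (fst p) * indicator {c<..d} (snd p)))"
 using assms(1)
proof induction
 case elem_zero
 then show ?case by simp
next
 case (elem_add V X a b \<xi> C)
 have [measurable]: "\<xi> \<in> borel_measurable M" "\<eta> \<in> borel_measurable M"
  using elem_add cd \<eta> by (auto intro: measurable_F_M)
 note cov = covariance[OF elem_add.hyps(2,3,4) cd elem_add.hyps(5) _ \<eta>(1), of C D]
 have bd: "\<bar>\<xi> w * \<eta> w\<bar> \<le> C * D" if "w \<in> space M" for w
  using elem_add.hyps(6) \<eta>(2) that by (simp add: abs_mult mult_mono')
 have i: "integrable M (\<lambda>w. \<xi> w * \<eta> w)"
  using bd by (intro integrable_const_bound[where B="C * D"]) auto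
 have iP: "integrable P (\<lambda>p. \<xi> (fst p) * \<eta> (fst p) * indicator {a<..b} (snd p) * indicator {c<..d} (snd p))"
 proof (rule bounded_supp_integrable)
  show "\<bar>\<xi> (fst (w, s)) * \<eta> (fst (w, s)) * indicator {a<..b} (snd (w, s)) * indicator {c<..d} (snd (w, s))\<bar> \<le> C * D"
   if "w \<in> space M" for w s
   using bd[OF that] order_trans[OF abs_ge_zero bd[OF that]] by (auto simp: indicator_def)
 qed (use elem_add.hyps in \<open>auto simp: indicator_def\<close>)
 have 1: "(X w + \<xi> w * (B b w - B a w)) * (\<eta> w * (B d w - B c w)) =
   X w * (\<eta> w * (B d w - B c w)) + (\<xi> w * (B b w - B a w)) * (\<eta> w * (B d w - B c w))" for w
  by (simp add: algebra_simps)
 have 2: "(V p + \<xi> (fst p) * indicator {a<..b} (snd p)) * (\<eta> (fst p) * indicator {c<..d} (snd p)) =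
   V p * (\<eta> (fst p) * indicator {c<..d} (snd p)) + \<xi> (fst p) * \<eta> (fst p) * indicator {a<..b} (snd p) * indicator {c<..d} (snd p)" for p
  by (simp add: algebra_simps)
 show ?case
  unfolding 1 2 using elem_add.IH cov iP elem_add.hyps(6) \<eta>(2) integral_indicator_prod[OF i, of a b c d] by simp
qed

lemma elem_isometry:
 assumes "elem V X"
 shows "nsq M X = nsq P V"
proof -
 have "integrable M (\<lambda>w. (X w)\<^sup>2) \<and> integrable P (\<lambda>p. (V p)\<^sup>2) \<and> (LINT w|M. (X w)\<^sup>2) = (LINT p|P. (V p)\<^sup>2)"
  using assms
 proof induction
  case elem_zero
  then show ?case by simp
 next
  case (elem_add V X a b \<xi> C)
  let ?x = "\<lambda>w. \<xi> w * (B b w - B a w)" and ?v = "\<lambda>p. \<xi> (fst p) * indicator {a<..b} (snd p)"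
  note s1 = elem_single[OF elem_add.hyps(1,2,3,4,5,6)]
  have e: "elem ?v ?x" using elem.elem_add[OF elem_zero elem_add.hyps(2-6)] by simp
  note s2 = elem_single[OF e elem_add.hyps(2-6)]
  have 1: "(X w + ?x w)\<^sup>2 = (X w)\<^sup>2 + (2 * (X w * ?x w) + ?x w * ?x w)" for w
   by (simp add: power2_eq_square algebra_simps)
  have 2: "(V p + ?v p)\<^sup>2 = (V p)\<^sup>2 + (2 * (V p * ?v p) + ?v p * ?v p)" for p
   by (simp add: power2_eq_square algebra_simps)
  show ?case unfolding 1 2 using elem_add.IH s1 s2
   by (auto intro!: Bochner_Integration.integrable_add integrable_mult_right)
 qed
 then show ?thesis by (simp add: nn_integral_eq_integral)
qed

lemma elem_plus:
 assumes "elem V X" "elem W Y"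
 shows "elem (\<lambda>p. V p + W p) (\<lambda>w. X w + Y w)"
 using assms(2)
proof induction
 case elem_zero
 then show ?case using assms(1) by simp
next
 case (elem_add W Y a b \<xi> C)
 show ?case using elem.elem_add[OF elem_add.IH elem_add.hyps(2-6)] by (simp add: add.assoc)
qed

lemma elem_scale:
 assumes "elem V X"
 shows "elem (\<lambda>p. c * V p) (\<lambda>w. c * X w)"
 using assms
proof induction
 case elem_zero
 then show ?case using elem.elem_zero by simp
next
 case (elem_add W Y a b \<xi> C)
 have "elem (\<lambda>p. c * W p + (c * \<xi> (fst p)) * indicator {a<..b} (snd p)) (\<lambda>w. c * Y w + (c * \<xi> w) * (B b w - B a w))"
  by (rule elem.elem_add[OF elem_add.IH elem_add.hyps(2-4), where C="\<bar>c\<bar> * C"])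
   (use elem_add.hyps in \<open>auto simp: abs_mult intro!: mult_left_mono\<close>)
 then show ?case by (simp add: algebra_simps)
qed

text \<open>The closure, in the product of two L2 spaces, of the graph of the elementary integral.
  Being a relation, it needs no choice of a representative and no prior square integrability of
  \<open>v\<close>.\<close>

definition ito :: "('w \<times> real \<Rightarrow> real) \<Rightarrow> ('w \<Rightarrow> real) \<Rightarrow> bool" where
 "ito v X \<longleftrightarrow> v \<in> borel_measurable P \<and> X \<in> borel_measurable M \<and>
  (\<forall>e>0. \<exists>V Y. elem V Y \<and> nsq P (\<lambda>p. V p - v p) \<le> ennreal e \<and> nsq M (\<lambda>w. Y w - X w) \<le> ennreal e)"

section \<open>Linearity and isometry of the closure\<close>

lemma ito_measurable: "ito v X \<Longrightarrow> v \<in> borel_measurable P" "ito v X \<Longrightarrow> X \<in> borel_measurable M"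
 by (auto simp: ito_def)

lemma elem_ito: "elem V X \<Longrightarrow> ito V X"
 unfolding ito_def using elem_measurable by (auto intro!: exI[of _ V] exI[of _ X])

lemma ito_plus:
 assumes "ito v X" "ito wt Y"
 shows "ito (\<lambda>p. v p + wt p) (\<lambda>w. X w + Y w)"
proof -
 note [measurable] = ito_measurable[OF assms(1)] ito_measurable[OF assms(2)]
 have "\<exists>V Z. elem V Z \<and> nsq P (\<lambda>p. V p - (v p + wt p)) \<le> ennreal e \<and> nsq M (\<lambda>w. Z w - (X w + Y w)) \<le> ennreal e"
  if e: "e > 0" for e
 proof -
  obtain V X' where V: "elem V X'" "nsq P (\<lambda>p. V p - v p) \<le> ennreal (e/4)" "nsq M (\<lambda>w. X' w - X w) \<le> ennreal (e/4)"
   using assms(1) e unfolding ito_def by (meson divide_pos_pos zero_less_numeral)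
  obtain W Y' where W: "elem W Y'" "nsq P (\<lambda>p. W p - wt p) \<le> ennreal (e/4)" "nsq M (\<lambda>w. Y' w - Y w) \<le> ennreal (e/4)"
   using assms(2) e unfolding ito_def by (meson divide_pos_pos zero_less_numeral)
  note [measurable] = elem_measurable[OF V(1)] elem_measurable[OF W(1)]
  have four: "2 * (ennreal (e/4) + ennreal (e/4)) = ennreal e"
   using e by (simp flip: ennreal_plus ennreal_numeral ennreal_mult)
  have "nsq P (\<lambda>p. (V p - v p) + (W p - wt p)) \<le> 2 * (ennreal (e/4) + ennreal (e/4))"
   using V(2) W(2) by (intro order_trans[OF nsq_add_le] mult_left_mono add_mono) auto
  moreover have "nsq M (\<lambda>w. (X' w - X w) + (Y' w - Y w)) \<le> 2 * (ennreal (e/4) + ennreal (e/4))"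
   using V(3) W(3) by (intro order_trans[OF nsq_add_le] mult_left_mono add_mono) auto
  ultimately show ?thesis
   using elem_plus[OF V(1) W(1)] unfolding four by (intro exI conjI) (auto simp: algebra_simps)
 qed
 then show ?thesis unfolding ito_def by simp
qed

lemma ito_scale:
 assumes "ito v X"
 shows "ito (\<lambda>p. c * v p) (\<lambda>w. c * X w)"
proof -
 note [measurable] = ito_measurable[OF assms(1)]
 have "\<exists>V Z. elem V Z \<and> nsq P (\<lambda>p. V p - c * v p) \<le> ennreal e \<and> nsq M (\<lambda>w. Z w - c * X w) \<le> ennreal e"
  if e: "e > 0" for e
 proof -
  define d where "d = e / (c\<^sup>2 + 1)"
  have d: "d > 0" "c\<^sup>2 * d \<le> e" using e by (auto simp: d_def field_simps add_pos_nonneg power2_eq_square intro!: divide_pos_pos)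
  obtain V X' where V: "elem V X'" "nsq P (\<lambda>p. V p - v p) \<le> ennreal d" "nsq M (\<lambda>w. X' w - X w) \<le> ennreal d"
   using assms(1) d(1) unfolding ito_def by blast
  note [measurable] = elem_measurable[OF V(1)]
  have le: "ennreal (c\<^sup>2) * y \<le> ennreal e" if "y \<le> ennreal d" for y
  proof -
   have "ennreal (c\<^sup>2) * y \<le> ennreal (c\<^sup>2) * ennreal d" using that by (rule mult_left_mono) simp
   also have "\<dots> \<le> ennreal e" using d by (simp add: ennreal_leI flip: ennreal_mult)
   finally show ?thesis .
  qed
  have "nsq P (\<lambda>p. c * (V p - v p)) \<le> ennreal e" "nsq M (\<lambda>w. c * (X' w - X w)) \<le> ennreal e"
   using V(2,3) by (simp_all only: nsq_cmult borel_measurable_diff elem_measurable[OF V(1)] ito_measurable[OF assms(1)] le)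
  then show ?thesis
   using elem_scale[OF V(1), of c] by (intro exI conjI) (auto simp: right_diff_distrib)
 qed
 then show ?thesis unfolding ito_def by simp
qed

lemma ito_diff: "ito v X \<Longrightarrow> ito wt Y \<Longrightarrow> ito (\<lambda>p. v p - wt p) (\<lambda>w. X w - Y w)"
 using ito_plus[OF _ ito_scale[of wt Y "-1"], of v X] by simp

lemma ito_zero: "ito (\<lambda>p. 0) (\<lambda>w. 0)"
 by (rule elem_ito[OF elem_zero])

lemma ito_sum:
 assumes "\<And>i. i \<in> I \<Longrightarrow> ito (v i) (X i)"
 shows "ito (\<lambda>p. \<Sum>i\<in>I. v i p) (\<lambda>w. \<Sum>i\<in>I. X i w)"
 using assms by (induction I rule: infinite_finite_induct) (auto intro: ito_zero ito_plus)

text \<open>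
 The factor 4 replaces the isometry constant 1; only the order of magnitude is ever used.
\<close>

lemma ito_norm:
 assumes "ito v X"
 shows "nsq M X \<le> 4 * nsq P v" "nsq P v \<le> 4 * nsq M X" "nsq P v < \<infinity>"
proof -
 note [measurable] = ito_measurable[OF assms]
 \<comment> \<open>Stated for two arbitrary measures, so that one argument gives the bound in both
   directions.\<close>
 have key: "nsq N1 f1 \<le> 4 * nsq N2 f2"
  if [measurable]: "f1 \<in> borel_measurable N1" "f2 \<in> borel_measurable N2"
   and ap: "\<And>e. e > 0 \<Longrightarrow> \<exists>g1 g2. g1 \<in> borel_measurable N1 \<and> g2 \<in> borel_measurable N2 \<and> nsq N1 g1 = nsq N2 g2 \<and>
    nsq N1 (\<lambda>x. g1 x - f1 x) \<le> ennreal e \<and> nsq N2 (\<lambda>x. g2 x - f2 x) \<le> ennreal e"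
  for N1 :: "'a measure" and N2 :: "'b measure" and f1 f2
 proof (rule ennreal_le_epsilon)
  fix e :: real assume e: "0 < e"
  obtain g1 g2 where [measurable]: "g1 \<in> borel_measurable N1" "g2 \<in> borel_measurable N2"
   and g: "nsq N1 g1 = nsq N2 g2" "nsq N1 (\<lambda>x. g1 x - f1 x) \<le> ennreal (e/6)" "nsq N2 (\<lambda>x. g2 x - f2 x) \<le> ennreal (e/6)"
   using ap[of "e/6"] e by auto
  have "nsq N1 f1 \<le> 2 * (nsq N1 (\<lambda>x. f1 x - g1 x) + nsq N1 g1)" by (rule nsq_le_diff) measurable
  also have "\<dots> \<le> 2 * (ennreal (e/6) + 2 * (ennreal (e/6) + nsq N2 f2))"
   using g(2,3) unfolding g(1) nsq_diff_commute[of N1 f1]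
   by (intro mult_left_mono add_mono order_trans[OF nsq_le_diff[of g2 N2 f2]]) auto
  also have "\<dots> = 4 * nsq N2 f2 + (2 * ennreal (e/6) + 4 * ennreal (e/6))" by (simp add: distrib_left add_ac flip: mult.assoc)
  also have "2 * ennreal (e/6) + 4 * ennreal (e/6) = ennreal e"
   using e by (simp flip: ennreal_plus ennreal_numeral ennreal_mult)
  finally show "nsq N1 f1 \<le> 4 * nsq N2 f2 + ennreal e" .
 qed
 show "nsq M X \<le> 4 * nsq P v"
 proof (rule key)
  fix e :: real assume "e > 0"
  then obtain V Y where "elem V Y" "nsq P (\<lambda>p. V p - v p) \<le> ennreal e" "nsq M (\<lambda>w. Y w - X w) \<le> ennreal e"
   using assms unfolding ito_def by blast
  then show "\<exists>g1 g2. g1 \<in> borel_measurable M \<and> g2 \<in> borel_measurable P \<and> nsq M g1 = nsq P g2 \<and>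
    nsq M (\<lambda>x. g1 x - X x) \<le> ennreal e \<and> nsq P (\<lambda>x. g2 x - v x) \<le> ennreal e"
   using elem_measurable elem_isometry by blast
 qed measurable
 show "nsq P v \<le> 4 * nsq M X"
 proof (rule key)
  fix e :: real assume "e > 0"
  then obtain V Y where "elem V Y" "nsq P (\<lambda>p. V p - v p) \<le> ennreal e" "nsq M (\<lambda>w. Y w - X w) \<le> ennreal e"
   using assms unfolding ito_def by blast
  then show "\<exists>g1 g2. g1 \<in> borel_measurable P \<and> g2 \<in> borel_measurable M \<and> nsq P g1 = nsq M g2 \<and>
    nsq P (\<lambda>x. g1 x - v x) \<le> ennreal e \<and> nsq M (\<lambda>x. g2 x - X x) \<le> ennreal e"
   by (intro exI[of _ V] exI[of _ Y]) (simp add: elem_measurable elem_isometry)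
 qed measurable
 obtain V Y where V: "elem V Y" "nsq P (\<lambda>p. V p - v p) \<le> ennreal 1"
  using assms unfolding ito_def by (meson zero_less_one)
 note [measurable] = elem_measurable[OF V(1)]
 have "integrable M (\<lambda>w. (Y w)\<^sup>2)" using elem_props[OF V(1)] by blast
 then have "nsq P V < \<infinity>" unfolding elem_isometry[OF V(1), symmetric] by (simp add: nn_integral_eq_integral)
 moreover have "nsq P v \<le> 2 * (nsq P (\<lambda>p. v p - V p) + nsq P V)" by (rule nsq_le_diff) measurable
 moreover have "nsq P (\<lambda>p. v p - V p) < \<infinity>"
  using V(2) by (subst nsq_diff_commute) (rule le_less_trans, auto)
 ultimately show "nsq P v < \<infinity>" by (auto simp: ennreal_mult_less_top intro: le_less_trans)
qed

lemma ito_unique: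
 assumes "ito v X" "ito v Y"
 shows "AE w in M. X w = Y w"
proof -
 note [measurable] = ito_measurable[OF assms(1)] ito_measurable[OF assms(2)]
 have "nsq M (\<lambda>w. X w - Y w) \<le> 0" using ito_norm(1)[OF ito_diff[OF assms]] by simp
 then have "AE w in M. X w - Y w = 0" by (intro nsq_zero_AE) auto
 then show ?thesis by simp
qed

section \<open>Limits of stochastic integrals\<close>

lemma ito_limit:
 assumes I: "\<And>n. ito (v n) (X n)" and [measurable]: "wt \<in> borel_measurable P" "Z \<in> borel_measurable M"
  and v: "(\<lambda>n. nsq P (\<lambda>p. v n p - wt p)) \<longlonglongrightarrow> 0" and X: "(\<lambda>n. nsq M (\<lambda>w. X n w - Z w)) \<longlonglongrightarrow> 0"
 shows "ito wt Z"
proof -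
 note [measurable] = ito_measurable[OF I]
 have "\<exists>V Y. elem V Y \<and> nsq P (\<lambda>p. V p - wt p) \<le> ennreal e \<and> nsq M (\<lambda>w. Y w - Z w) \<le> ennreal e"
  if e: "e > 0" for e
 proof -
  have four: "2 * (ennreal (e/4) + ennreal (e/4)) = ennreal e"
   using e by (simp flip: ennreal_plus ennreal_numeral ennreal_mult)
  have "\<forall>\<^sub>F n in sequentially. nsq P (\<lambda>p. v n p - wt p) < ennreal (e/4) \<and> nsq M (\<lambda>w. X n w - Z w) < ennreal (e/4)"
   using e order_tendstoD(2)[OF v] order_tendstoD(2)[OF X] by (intro eventually_conj) auto
  then obtain n where "nsq P (\<lambda>p. v n p - wt p) < ennreal (e/4) \<and> nsq M (\<lambda>w. X n w - Z w) < ennreal (e/4)"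
   using eventually_happens'[OF sequentially_bot] by blast
  then have n: "nsq P (\<lambda>p. v n p - wt p) \<le> ennreal (e/4)" "nsq M (\<lambda>w. X n w - Z w) \<le> ennreal (e/4)"
   by (auto intro: less_imp_le)
  obtain V Y where V: "elem V Y" "nsq P (\<lambda>p. V p - v n p) \<le> ennreal (e/4)" "nsq M (\<lambda>w. Y w - X n w) \<le> ennreal (e/4)"
   using I[of n] e unfolding ito_def by (meson divide_pos_pos zero_less_numeral)
  note [measurable] = elem_measurable[OF V(1)]
  have "nsq P (\<lambda>p. V p - wt p) \<le> 2 * (nsq P (\<lambda>p. V p - v n p) + nsq P (\<lambda>p. v n p - wt p))"
   by (rule nsq_triangle) measurable
  also have "\<dots> \<le> 2 * (ennreal (e/4) + ennreal (e/4))"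
   by (intro mult_left_mono add_mono n V) simp
  finally have "nsq P (\<lambda>p. V p - wt p) \<le> 2 * (ennreal (e/4) + ennreal (e/4))" .
  moreover have "nsq M (\<lambda>w. Y w - Z w) \<le> 2 * (nsq M (\<lambda>w. Y w - X n w) + nsq M (\<lambda>w. X n w - Z w))"
   by (rule nsq_triangle) measurable
  moreover have "\<dots> \<le> 2 * (ennreal (e/4) + ennreal (e/4))"
   by (intro mult_left_mono add_mono n V) simp
  ultimately have "nsq P (\<lambda>p. V p - wt p) \<le> 2 * (ennreal (e/4) + ennreal (e/4))"
   "nsq M (\<lambda>w. Y w - Z w) \<le> 2 * (ennreal (e/4) + ennreal (e/4))" by (auto intro: order_trans)
  then show ?thesis using V(1) unfolding four by blast
 qed
 then show ?thesis unfolding ito_def by simp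
qed

lemma ito_cong_AE:
 assumes I: "ito v X" and [measurable]: "wt \<in> borel_measurable P" "Z \<in> borel_measurable M"
  and "AE p in P. v p = wt p" "AE w in M. X w = Z w"
 shows "ito wt Z"
proof (rule ito_limit[OF I])
 have "nsq P (\<lambda>p. v p - wt p) = nsq P (\<lambda>p. 0)"
  using assms(4) by (intro nn_integral_cong_AE) (auto elim!: eventually_mono)
 then show "(\<lambda>n. nsq P (\<lambda>p. v p - wt p)) \<longlonglongrightarrow> 0" by simp
 have "nsq M (\<lambda>p. X p - Z p) = nsq M (\<lambda>p. 0)"
  using assms(5) by (intro nn_integral_cong_AE) (auto elim!: eventually_mono)
 then show "(\<lambda>n. nsq M (\<lambda>p. X p - Z p)) \<longlonglongrightarrow> 0" by simp
qed measurable

text \<open>Existence of integrals: if the integrands converge, their integrals form a Cauchy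
  sequence by the isometry.\<close>

lemma ito_complete:
 assumes I: "\<And>n. ito (v n) (X n)" and [measurable]: "wt \<in> borel_measurable P"
  and v: "(\<lambda>n. nsq P (\<lambda>p. v n p - wt p)) \<longlonglongrightarrow> 0"
 shows "\<exists>Z. ito wt Z \<and> (\<lambda>n. nsq M (\<lambda>w. X n w - Z w)) \<longlonglongrightarrow> 0"
proof -
 note [measurable] = ito_measurable[OF I]
 have "\<exists>Z\<in>borel_measurable M. (\<lambda>n. nsq M (\<lambda>w. X n w - Z w)) \<longlonglongrightarrow> 0"
 proof (rule nsq_complete)
  fix e :: ennreal assume e: "e > 0"
  then have "e / 4 > 0" by (simp add: ennreal_zero_less_divide)
  then obtain k where k: "\<And>m n. m \<ge> k \<Longrightarrow> n \<ge> k \<Longrightarrow> nsq P (\<lambda>p. v m p - v n p) \<le> e / 4"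
   using nsq_cauchy_of_tendsto[OF _ _ v] by auto blast
  have "nsq M (\<lambda>w. X m w - X n w) \<le> e" if "m \<ge> k" "n \<ge> k" for m n
  proof -
   have "nsq M (\<lambda>w. X m w - X n w) \<le> 4 * nsq P (\<lambda>p. v m p - v n p)" by (rule ito_norm(1)[OF ito_diff[OF I I]])
   also have "\<dots> \<le> 4 * (e / 4)" using k[OF that] by (intro mult_left_mono) auto
   also have "\<dots> = e" by (simp add: ennreal_times_divide ennreal_mult_divide_eq mult.commute[of 4])
   finally show ?thesis .
  qed
  then show "\<exists>k. \<forall>m\<ge>k. \<forall>n\<ge>k. nsq M (\<lambda>x. X m x - X n x) \<le> e" by blast
 qed measurable
 then obtain Z where Z: "Z \<in> borel_measurable M" "(\<lambda>n. nsq M (\<lambda>w. X n w - Z w)) \<longlonglongrightarrow> 0" by blast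
 then have "ito wt Z" by (intro ito_limit[OF I _ _ v]) auto
 with Z show ?thesis by blast
qed

text \<open>The opposite passage: convergence of the integrals makes the integrands Cauchy, by the
  lower bound of the isometry, and pointwise convergence merely identifies their limit as
  \<open>wt\<close>. Square integrability of \<open>wt\<close> thus comes out as a conclusion. The
  condition concerns every subsequence because the L2 limit is reached pointwise only along some
  unknown one.\<close>

lemma ito_of_limit:
 assumes I: "\<And>n. ito (v n) (X n)" and [measurable]: "wt \<in> borel_measurable P" "Z \<in> borel_measurable M"
  and v: "\<And>s :: nat \<Rightarrow> nat. strict_mono s \<Longrightarrow> \<exists>s' :: nat \<Rightarrow> nat. strict_mono s' \<and> (AE p in P. (\<lambda>n. v (s (s' n)) p) \<longlonglongrightarrow> wt p)"
  and X: "(\<lambda>n. nsq M (\<lambda>w. X n w - Z w)) \<longlonglongrightarrow> 0"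
 shows "ito wt Z"
proof -
 note [measurable] = ito_measurable[OF I]
 have "\<exists>v'\<in>borel_measurable P. (\<lambda>n. nsq P (\<lambda>p. v n p - v' p)) \<longlonglongrightarrow> 0"
 proof (rule nsq_complete)
  fix e :: ennreal assume e: "e > 0"
  then have "e / 4 > 0" by (simp add: ennreal_zero_less_divide)
  then obtain k where k: "\<And>m n. m \<ge> k \<Longrightarrow> n \<ge> k \<Longrightarrow> nsq M (\<lambda>p. X m p - X n p) \<le> e / 4"
   using nsq_cauchy_of_tendsto[OF _ _ X] by auto blast
  have "nsq P (\<lambda>w. v m w - v n w) \<le> e" if "m \<ge> k" "n \<ge> k" for m n
  proof -
   have "nsq P (\<lambda>w. v m w - v n w) \<le> 4 * nsq M (\<lambda>p. X m p - X n p)" by (rule ito_norm(2)[OF ito_diff[OF I I]])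
   also have "\<dots> \<le> 4 * (e / 4)" using k[OF that] by (intro mult_left_mono) auto
   also have "\<dots> = e" by (simp add: ennreal_times_divide ennreal_mult_divide_eq mult.commute[of 4])
   finally show ?thesis .
  qed
  then show "\<exists>k. \<forall>m\<ge>k. \<forall>n\<ge>k. nsq P (\<lambda>x. v m x - v n x) \<le> e" by blast
 qed measurable
 then obtain v' where [measurable]: "v' \<in> borel_measurable P" and v': "(\<lambda>n. nsq P (\<lambda>p. v n p - v' p)) \<longlonglongrightarrow> 0" by blast
 have I': "ito v' Z" by (rule ito_limit[OF I _ _ v' X]) measurable
 obtain s where s: "strict_mono s" "AE p in P. (\<lambda>n. v (s n) p) \<longlonglongrightarrow> v' p"
  using nsq_subseq_AE[OF _ _ v'] by auto
 obtain s' where s': "strict_mono s'" "AE p in P. (\<lambda>n. v (s (s' n)) p) \<longlonglongrightarrow> wt p"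
  using v[OF s(1)] by blast
 have "AE p in P. v' p = wt p"
  using s(2) s'(2)
 proof eventually_elim
  case (elim p)
  have "(\<lambda>n. v (s (s' n)) p) \<longlonglongrightarrow> v' p"
   using LIMSEQ_subseq_LIMSEQ[OF elim(1) s'(1)] by (simp add: comp_def)
  then show ?case using elim(2) LIMSEQ_unique by blast
 qed
 then show ?thesis by (intro ito_cong_AE[OF I']) auto
qed

end

section \<open>Dyadic step functions\<close>

text \<open>Open on the left and closed on the right like the pieces of simple processes; the cells
  of one level tile (0,1].\<close>

definition dyi :: "nat \<Rightarrow> nat \<Rightarrow> real \<Rightarrow> real" where
 "dyi n j s = indicator {real j / 2^n<..real (Suc j) / 2^n} s"

definition dstep :: "nat \<Rightarrow> (nat \<Rightarrow> real) \<Rightarrow> real \<Rightarrow> real" where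
 "dstep n c s = (\<Sum>j<2^n. c j * dyi n j s)"

lemma measurable_dyi[measurable]: "dyi n j \<in> borel_measurable borel"
 unfolding dyi_def[abs_def] by measurable

lemma measurable_dstep[measurable]: "dstep n c \<in> borel_measurable borel"
 unfolding dstep_def[abs_def] by measurable

lemma dyi_nonneg: "dyi n j s \<ge> 0" "dyi n j s \<le> 1"
 by (auto simp: dyi_def indicator_def)

lemma dyi_sq: "(dyi n j s)\<^sup>2 = dyi n j s"
 by (auto simp: dyi_def indicator_def)

lemma dyi_mult: "dyi n i s * dyi n j s = (if i = j then dyi n j s else 0)"
proof (cases "i = j")
 case False
 have "dyi n i s = 0 \<or> dyi n j s = 0"
 proof (rule ccontr)
  assume "\<not> ?thesis"
  then have "real i < s * 2^n" "s * 2^n \<le> real (Suc i)" "real j < s * 2^n" "s * 2^n \<le> real (Suc j)"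
   by (auto simp: dyi_def indicator_def field_simps split: if_splits)
  then have "i < Suc j" "j < Suc i" by (meson less_le_trans of_nat_less_iff)+
  then show False using False by simp
 qed
 then show ?thesis using False by auto
qed (auto simp: dyi_def indicator_def)

lemma dyi_supp:
 assumes "j < 2^n" "s \<notin> {0<..1}"
 shows "dyi n j s = 0"
proof -
 have gen: "s \<notin> {a<..b}" if "0 \<le> a" "b \<le> 1" for a b :: real using that assms(2) by auto
 have "real (Suc j) \<le> 2^n" using assms(1) by (metis Suc_leI of_nat_le_iff of_nat_numeral of_nat_power)
 then have "real (Suc j) / 2^n \<le> 1" by simp
 then have "s \<notin> {real j / 2^n<..real (Suc j) / 2^n}" by (intro gen) simp_all
 then show ?thesis by (simp add: dyi_def del: of_nat_Suc)
qed

lemma dstep_supp: "s \<notin> {0<..1} \<Longrightarrow> dstep n c s = 0"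
 unfolding dstep_def by (auto intro!: sum.neutral simp: dyi_supp)

lemma dyi_integral: "integrable lborel (dyi n j)" "(LINT s|lborel. dyi n j s) = 1 / 2^n"
proof -
 have "real j / 2^n \<le> real (Suc j) / 2^n" by (simp add: divide_right_mono)
 then show "integrable lborel (dyi n j)" "(LINT s|lborel. dyi n j s) = 1 / 2^n"
  unfolding dyi_def[abs_def] by (auto simp: diff_divide_distrib[symmetric])
qed

lemma dstep_integral: "integrable lborel (dstep n c)" "(LINT s|lborel. dstep n c s) = (\<Sum>j<2^n. c j) / 2^n"
 unfolding dstep_def[abs_def] using dyi_integral by (auto simp: sum_divide_distrib)

lemma dstep_mult: "dstep n c s * dstep n d s = dstep n (\<lambda>j. c j * d j) s"
proof -
 have "dstep n c s * dstep n d s = (\<Sum>i<2^n. \<Sum>j<2^n. c i * d j * (dyi n i s * dyi n j s))"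
  unfolding dstep_def by (simp add: sum_product mult_ac)
 also have "\<dots> = (\<Sum>i<2^n. \<Sum>j<2^n. if i = j then c i * d j * dyi n j s else 0)"
  unfolding dyi_mult by (intro sum.cong) auto
 also have "\<dots> = dstep n (\<lambda>j. c j * d j) s" unfolding dstep_def by (simp add: sum.delta)
 finally show ?thesis .
qed

lemma dstep_sq: "(dstep n c s)\<^sup>2 = dstep n (\<lambda>j. (c j)\<^sup>2) s"
 using dstep_mult[of n c s c] by (simp add: power2_eq_square)

lemma dstep_diff: "dstep n c s - dstep n d s = dstep n (\<lambda>j. c j - d j) s"
 by (simp add: dstep_def sum_subtractf left_diff_distrib)

lemma dyi_split: "dyi n j s = dyi (Suc n) (2 * j) s + dyi (Suc n) (2 * j + 1) s"
proof -
 have "{real j / 2^n<..real (Suc j) / 2^n} = {real (2 * j) / 2^Suc n<..real (Suc (2 * j)) / 2^Suc n} \<union> {real (2 * j + 1) / 2^Suc n<..real (Suc (2 * j + 1)) / 2^Suc n}"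
  by (auto simp: field_simps)
 moreover have "{real (2 * j) / 2^Suc n<..real (Suc (2 * j)) / 2^Suc n} \<inter> {real (2 * j + 1) / 2^Suc n<..real (Suc (2 * j + 1)) / 2^Suc n} = {}"
  by auto
 ultimately show ?thesis unfolding dyi_def by (auto simp: indicator_def split: if_splits)
qed

lemma sum_even_odd: "(\<Sum>i<2 * N. f i) = (\<Sum>j<N. f (2 * j) + f (2 * j + 1 :: nat) :: real)"
 by (induction N) auto

lemma dstep_refine_Suc: "dstep n c s = dstep (Suc n) (\<lambda>j. c (j div 2)) s"
 unfolding dstep_def power_Suc sum_even_odd by (subst dyi_split) (simp add: distrib_left)

text \<open>\<open>j div 2^(m - n)\<close> is the coarse cell that contains the fine cell j.\<close>

lemma dstep_refine:
 assumes "n \<le> m"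
 shows "dstep n c s = dstep m (\<lambda>j. c (j div 2^(m - n))) s"
 using assms
proof (induction m rule: dec_induct)
 case (step m)
 have "dstep n c s = dstep (Suc m) (\<lambda>j. c (j div 2 div 2^(m - n))) s"
  using step.IH dstep_refine_Suc[of m] by simp
 moreover have "j div 2 div 2^(m - n) = j div 2^(Suc m - n)" for j :: nat
  using step.hyps by (simp add: Suc_diff_le div_mult2_eq)
 ultimately show ?case by simp
qed simp

lemma dstep_L2: "dstep n c \<in> L2_01"
proof -
 have "sq_upto 1 (dstep n c) \<le> nsq lborel (dstep n c)"
  by (intro nn_integral_mono) (auto simp: indicator_def)
 also have "\<dots> < \<infinity>"
  unfolding dstep_sq using dstep_integral(1)[of n "\<lambda>j. (c j)\<^sup>2"] dstep_sq[of n c]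
  by (subst nn_integral_eq_integral) (auto simp flip: dstep_sq)
 finally show ?thesis by (simp add: L2_01_def)
qed

lemma nsq_dstep: "nsq lborel (dstep n c) = ennreal ((\<Sum>j<2^n. (c j)\<^sup>2) / 2^n)"
proof -
 have nn: "0 \<le> dstep n (\<lambda>j. (c j)\<^sup>2) s" for s unfolding dstep_sq[symmetric] by simp
 show ?thesis unfolding dstep_sq
  by (subst nn_integral_eq_integral[OF dstep_integral(1)]) (simp_all add: nn dstep_integral(2))
qed

lemma dyi_dstep: "k < 2^n \<Longrightarrow> dyi n k s = dstep n (\<lambda>j. if j = k then 1 else 0) s"
 unfolding dstep_def by (simp add: if_distrib[of "\<lambda>x. x * _"] sum.delta cong: if_cong)

lemma dyi_L2: "k < 2^n \<Longrightarrow> dyi n k \<in> L2_01"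
 using dstep_L2[of n "\<lambda>j. if j = k then 1 else 0"] dyi_dstep[of k n] by (metis ext)

section \<open>Step functions representing a functional on square integrable functions\<close>

definition L2_functional :: "((real \<Rightarrow> real) \<Rightarrow> real) \<Rightarrow> real \<Rightarrow> bool" where
 "L2_functional l C \<longleftrightarrow> C \<ge> 0 \<and>
  (\<forall>f\<in>L2_01. \<forall>g\<in>L2_01. \<forall>a b. l (\<lambda>s. a * f s + b * g s) = a * l f + b * l g) \<and>
  (\<forall>f\<in>L2_01. ennreal ((l f)\<^sup>2) \<le> ennreal C * sq_upto 1 f)"

text \<open>The projection of the Riesz representative of \<open>l\<close> onto the step functions
  of level n. The factor \<open>2^n\<close> normalises, as each cell has squared norm
  \<open>1 / 2^n\<close>.\<close>

definition repr :: "((real \<Rightarrow> real) \<Rightarrow> real) \<Rightarrow> nat \<Rightarrow> real \<Rightarrow> real" where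
 "repr l n = dstep n (\<lambda>j. 2^n * l (dyi n j))"

context
 fixes l C assumes l: "L2_functional l C"
begin

lemma L2_functional_lin:
 "f \<in> L2_01 \<Longrightarrow> g \<in> L2_01 \<Longrightarrow> l (\<lambda>s. a * f s + b * g s) = a * l f + b * l g"
 using l[unfolded L2_functional_def, THEN conjunct2, THEN conjunct1, rule_format] by this

lemma L2_functional_sum:
 assumes "finite I" "\<And>i. i \<in> I \<Longrightarrow> f i \<in> L2_01"
 shows "(\<lambda>s. \<Sum>i\<in>I. c i * f i s) \<in> L2_01 \<and> l (\<lambda>s. \<Sum>i\<in>I. c i * f i s) = (\<Sum>i\<in>I. c i * l (f i))"
 using assms
proof (induction I)
 case empty
 have z: "(\<lambda>s. 0) \<in> L2_01" by (simp add: L2_01_def)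
 have "l (\<lambda>s. 0 * 0 + 0 * 0) = 0 * l (\<lambda>s. 0) + 0 * l (\<lambda>s. 0)"
  by (rule L2_functional_lin[OF z z])
 with z show ?case by simp
next
 case (insert i I)
 have 1: "(\<lambda>s. \<Sum>i\<in>I. c i * f i s) \<in> L2_01" "l (\<lambda>s. \<Sum>i\<in>I. c i * f i s) = (\<Sum>i\<in>I. c i * l (f i))" and 2: "f i \<in> L2_01"
  using insert by auto
 have eq: "(\<lambda>s. \<Sum>i\<in>insert i I. c i * f i s) = (\<lambda>s. c i * f i s + 1 * (\<Sum>i\<in>I. c i * f i s))"
  using insert by auto
 have "l (\<lambda>s. c i * f i s + 1 * (\<Sum>i\<in>I. c i * f i s)) = c i * l (f i) + 1 * l (\<lambda>s. \<Sum>i\<in>I. c i * f i s)"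
  by (rule L2_functional_lin[OF 2 1(1)])
 then show ?case using L2_01_lin[OF 2 1(1), of "c i" 1] 1(2) insert.hyps unfolding eq by simp
qed

lemma L2_functional_dstep: "l (dstep n c) = (\<Sum>j<2^n. c j * l (dyi n j))"
 using L2_functional_sum[of "{..<2^n}" "dyi n" c] by (simp add: dyi_L2 dstep_def[abs_def])

text \<open>The approximation already represents \<open>l\<close> exactly on all coarser step
  functions; orthogonality between levels follows from this.\<close>

lemma repr_integral:
 assumes "m \<le> n"
 shows "(LINT s|lborel. repr l n s * dstep m c s) = l (dstep m c)"
proof -
 have eq: "dstep m c = dstep n (\<lambda>j. c (j div 2^(n - m)))" using dstep_refine[OF assms] by blast
 have "(LINT s|lborel. repr l n s * dstep m c s) = (\<Sum>j<2^n. 2^n * l (dyi n j) * c (j div 2^(n - m))) / 2^n"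
  unfolding eq repr_def dstep_mult dstep_integral(2) ..
 also have "\<dots> = l (dstep m c)" unfolding eq L2_functional_dstep by (simp add: sum_divide_distrib mult_ac)
 finally show ?thesis .
qed

lemma repr_int:
 shows "integrable lborel (\<lambda>s. repr l n s * repr l m s)"
proof -
 have int: "integrable lborel (\<lambda>s. dstep n c s * dstep m d s)" if "n \<le> m" for n m c d
 proof -
  have "dstep n c = dstep m (\<lambda>j. c (j div 2^(m - n)))" using dstep_refine[OF that] by blast
  then show ?thesis by (simp add: dstep_mult dstep_integral(1))
 qed
 show ?thesis
 proof (cases "n \<le> m")
  case False
  then show ?thesis unfolding repr_def by (subst mult.commute) (simp add: int)
 qed (simp add: repr_def int)
qed

text \<open>Testing \<open>l\<close> on its own approximation h gives \<open>l h\<close> = |h|^2,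
  while boundedness gives (\<open>l h\<close>)^2 \<le> C |h|^2; together they bound |h|^2 by
  C.\<close>

lemma repr_sq: "nsq lborel (repr l n) = ennreal (l (repr l n))" "l (repr l n) \<le> C" "l (repr l n) \<ge> 0"
proof -
 have 1: "(LINT s|lborel. (repr l n s)\<^sup>2) = l (repr l n)"
  using repr_integral[of n n "\<lambda>j. 2^n * l (dyi n j)"] by (simp add: repr_def power2_eq_square)
 have "(LINT s|lborel. (repr l n s)\<^sup>2) \<ge> 0" by (rule Bochner_Integration.integral_nonneg) simp
 then show nn: "l (repr l n) \<ge> 0" using 1 by simp
 show 2: "nsq lborel (repr l n) = ennreal (l (repr l n))"
  unfolding 1[symmetric] using repr_int[of n n] by (intro nn_integral_eq_integral) (auto simp: power2_eq_square)
 have L: "repr l n \<in> L2_01" unfolding repr_def by (rule dstep_L2)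
 have C: "C \<ge> 0" using l by (simp add: L2_functional_def)
 have "ennreal ((l (repr l n))\<^sup>2) \<le> ennreal C * sq_upto 1 (repr l n)"
  using l L by (simp add: L2_functional_def)
 also have "\<dots> \<le> ennreal C * nsq lborel (repr l n)"
  by (intro mult_left_mono nn_integral_mono) (auto simp: indicator_def)
 finally have "(l (repr l n))\<^sup>2 \<le> C * l (repr l n)"
  unfolding 2 using nn C by (simp flip: ennreal_mult)
 then show "l (repr l n) \<le> C"
  using nn C by (cases "l (repr l n) = 0") (auto simp: power2_eq_square)
qed

text \<open>Pythagoras for nested projections.\<close>

lemma repr_diff:
 assumes "m \<le> n"
 shows "nsq lborel (\<lambda>s. repr l n s - repr l m s) = ennreal (l (repr l n) - l (repr l m))"
proof -
 have i: "(LINT s|lborel. repr l n s * repr l n s) = l (repr l n)" "(LINT s|lborel. repr l m s * repr l m s) = l (repr l m)"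
  "(LINT s|lborel. repr l n s * repr l m s) = l (repr l m)"
  using repr_integral[of n n "\<lambda>j. 2^n * l (dyi n j)"] repr_integral[of m m "\<lambda>j. 2^m * l (dyi m j)"]
   repr_integral[OF assms, of "\<lambda>j. 2^m * l (dyi m j)"] by (simp_all add: repr_def)
 have sq: "(repr l n s - repr l m s)\<^sup>2 = repr l n s * repr l n s - 2 * (repr l n s * repr l m s) + repr l m s * repr l m s" for s
  by (simp add: power2_eq_square algebra_simps)
 have "integrable lborel (\<lambda>s. (repr l n s - repr l m s)\<^sup>2)"
  unfolding sq using repr_int by auto
 moreover have "(LINT s|lborel. (repr l n s - repr l m s)\<^sup>2) = l (repr l n) - l (repr l m)"
  unfolding sq using repr_int i by simp
 ultimately show ?thesis by (simp add: nn_integral_eq_integral)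
qed

lemma repr_mono: "m \<le> n \<Longrightarrow> l (repr l m) \<le> l (repr l n)"
proof -
 assume "m \<le> n"
 have "(LINT s|lborel. (repr l n s - repr l m s)\<^sup>2) = l (repr l n) - l (repr l m)"
 proof -
  have i: "(LINT s|lborel. repr l n s * repr l n s) = l (repr l n)" "(LINT s|lborel. repr l m s * repr l m s) = l (repr l m)"
   "(LINT s|lborel. repr l n s * repr l m s) = l (repr l m)"
   using repr_integral[of n n "\<lambda>j. 2^n * l (dyi n j)"] repr_integral[of m m "\<lambda>j. 2^m * l (dyi m j)"]
    repr_integral[OF \<open>m \<le> n\<close>, of "\<lambda>j. 2^m * l (dyi m j)"] by (simp_all add: repr_def)
  have sq: "(repr l n s - repr l m s)\<^sup>2 = repr l n s * repr l n s - 2 * (repr l n s * repr l m s) + repr l m s * repr l m s" for s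
   by (simp add: power2_eq_square algebra_simps)
  show ?thesis unfolding sq using repr_int i by simp
 qed
 moreover have "(LINT s|lborel. (repr l n s - repr l m s)\<^sup>2) \<ge> 0" by (rule Bochner_Integration.integral_nonneg) simp
 ultimately show ?thesis by linarith
qed

text \<open>The squared norms \<open>l (repr l n)\<close> increase with n and stay below C, so they
  converge, and their differences are the squared distances.\<close>

lemma repr_cauchy:
 assumes "e > 0"
 shows "\<exists>k. \<forall>m\<ge>k. \<forall>n\<ge>k. nsq lborel (\<lambda>s. repr l m s - repr l n s) \<le> ennreal e"
proof -
 have "convergent (\<lambda>n. l (repr l n))"
  using repr_mono repr_sq(2,3) by (intro Bseq_mono_convergent BseqI'[where K=C]) (auto simp: mono_def)
 then have "Cauchy (\<lambda>n. l (repr l n))" by (rule convergent_Cauchy)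
 then obtain k where k: "\<And>m n. m \<ge> k \<Longrightarrow> n \<ge> k \<Longrightarrow> dist (l (repr l m)) (l (repr l n)) < e"
  using assms unfolding Cauchy_def by blast
 have "nsq lborel (\<lambda>s. repr l m s - repr l n s) \<le> ennreal e" if "m \<ge> k" "n \<ge> k" for m n
 proof (cases "n \<le> m")
  case True
  then show ?thesis using repr_diff[OF True] k[OF that] by (auto simp: dist_real_def intro!: ennreal_leI)
 next
  case False
  then show ?thesis unfolding nsq_diff_commute[of lborel "repr l m"]
   using repr_diff[of m n] k[OF that] by (auto simp: dist_real_def intro!: ennreal_leI)
 qed
 then show ?thesis by blast
qed

end

section \<open>Dyadic averages\<close>

lemma L2_mult_integrable:
 assumes [measurable]: "f \<in> borel_measurable N" "g \<in> borel_measurable N" and "nsq N f < \<infinity>" "nsq N g < \<infinity>"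
 shows "integrable N (\<lambda>x. f x * g x)"
proof (rule Bochner_Integration.integrable_bound)
 show "integrable N (\<lambda>x. (f x)\<^sup>2 + (g x)\<^sup>2)"
  using assms by (intro Bochner_Integration.integrable_add integrableI_bounded) auto
 show "AE x in N. norm (f x * g x) \<le> norm ((f x)\<^sup>2 + (g x)\<^sup>2)"
 proof (rule AE_I2)
  fix x
  have "2 * (\<bar>f x\<bar> * \<bar>g x\<bar>) \<le> (f x)\<^sup>2 + (g x)\<^sup>2" using sum_squares_bound[of "\<bar>f x\<bar>" "\<bar>g x\<bar>"] by simp
  moreover have "0 \<le> \<bar>f x\<bar> * \<bar>g x\<bar>" by simp
  ultimately have "\<bar>f x\<bar> * \<bar>g x\<bar> \<le> (f x)\<^sup>2 + (g x)\<^sup>2" by linarith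
  then show "norm (f x * g x) \<le> norm ((f x)\<^sup>2 + (g x)\<^sup>2)" by (simp add: abs_mult)
 qed
qed measurable

lemma cauchy_schwarz_integral:
 assumes [measurable]: "f \<in> borel_measurable N" "g \<in> borel_measurable N" and f: "nsq N f < \<infinity>" and g: "nsq N g < \<infinity>"
 shows "ennreal ((LINT x|N. f x * g x)\<^sup>2) \<le> nsq N f * nsq N g"
proof -
 have "ennreal \<bar>LINT x|N. f x * g x\<bar> \<le> (\<integral>\<^sup>+x. ennreal \<bar>f x\<bar> * ennreal \<bar>g x\<bar> \<partial>N)"
  using ennreal_abs_integral_le[of N "\<lambda>x. f x * g x"] by (simp add: abs_mult ennreal_mult)
 then have "(ennreal \<bar>LINT x|N. f x * g x\<bar>)\<^sup>2 \<le> (\<integral>\<^sup>+x. ennreal \<bar>f x\<bar> * ennreal \<bar>g x\<bar> \<partial>N)\<^sup>2" by (rule power_mono) simp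
 also have "\<dots> \<le> (\<integral>\<^sup>+x. (ennreal \<bar>f x\<bar>)\<^sup>2 \<partial>N) * (\<integral>\<^sup>+x. (ennreal \<bar>g x\<bar>)\<^sup>2 \<partial>N)"
  by (rule Cauchy_Schwarz_nn_integral) measurable
 finally show ?thesis by (simp add: ennreal_power)
qed

text \<open>Here \<open>repr\<close> of the functional given by \<open>\<phi>\<close> is the sequence of averages of \<open>\<phi>\<close> over dyadic intervals.\<close>

definition pair_fun :: "(real \<Rightarrow> real) \<Rightarrow> (real \<Rightarrow> real) \<Rightarrow> real" where
 "pair_fun \<phi> f = (LINT s|lborel. \<phi> s * f s)"

lemma pair_functional:
 assumes [measurable]: "\<phi> \<in> borel_measurable borel" and fin: "nsq lborel \<phi> < \<infinity>" and z: "\<And>s. s \<notin> {0..1} \<Longrightarrow> \<phi> s = 0"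
 shows "L2_functional (pair_fun \<phi>) (enn2real (nsq lborel \<phi>))"
 unfolding L2_functional_def
proof (intro conjI ballI allI)
 have eq: "pair_fun \<phi> f = (LINT s|lborel. \<phi> s * (indicator {0..1} s * f s))" for f
 proof -
  have "\<phi> s * f s = \<phi> s * (indicator {0..1} s * f s)" for s
   using z[of s] by (cases "s \<in> {0..1}") auto
  then show ?thesis unfolding pair_fun_def by (intro Bochner_Integration.integral_cong refl)
 qed
 have sq: "(indicator {0..1} s * f s)\<^sup>2 = indicator {0..1} s * (f s)\<^sup>2" for f :: "real \<Rightarrow> real" and s :: real
  by (auto simp: indicator_def)
 have int: "integrable lborel (\<lambda>s. \<phi> s * (indicator {0..1} s * f s))" if "f \<in> L2_01" for f
  using that fin by (intro L2_mult_integrable) (auto simp: L2_01_def sq)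
 show "pair_fun \<phi> (\<lambda>s. a * f s + b * g s) = a * pair_fun \<phi> f + b * pair_fun \<phi> g" if "f \<in> L2_01" "g \<in> L2_01" for f g a b
 proof -
  have "pair_fun \<phi> (\<lambda>s. a * f s + b * g s) = (LINT s|lborel. a * (\<phi> s * (indicator {0..1} s * f s)) + b * (\<phi> s * (indicator {0..1} s * g s)))"
   unfolding eq by (simp add: algebra_simps)
  then show ?thesis unfolding eq using int[OF that(1)] int[OF that(2)] by simp
 qed
 show "ennreal ((pair_fun \<phi> f)\<^sup>2) \<le> ennreal (enn2real (nsq lborel \<phi>)) * sq_upto 1 f"
  if "f \<in> L2_01" for f
  using cauchy_schwarz_integral[of \<phi> lborel "\<lambda>s. indicator {0..1} s * f s"] that fin
  unfolding eq by (auto simp: L2_01_def sq less_top)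
qed simp

lemma dyadic_floor_tendsto:
 assumes "0 \<le> (x::real)"
 shows "(\<lambda>m. real (nat \<lfloor>x * 2^m\<rfloor>) / 2^m) \<longlonglongrightarrow> x"
proof (rule tendsto_sandwich[where h="\<lambda>m. x"])
 show "\<forall>\<^sub>F m in sequentially. x - (1/2)^m \<le> real (nat \<lfloor>x * 2^m\<rfloor>) / 2^m"
 proof (rule always_eventually, rule allI)
  fix m
  have "x * 2^m - 1 \<le> real (nat \<lfloor>x * 2^m\<rfloor>)" using assms by linarith
  then have "(x * 2^m - 1) / 2^m \<le> real (nat \<lfloor>x * 2^m\<rfloor>) / 2^m" by (rule divide_right_mono) simp
  then show "x - (1/2)^m \<le> real (nat \<lfloor>x * 2^m\<rfloor>) / 2^m" by (simp add: diff_divide_distrib power_divide)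
 qed
 show "\<forall>\<^sub>F m in sequentially. real (nat \<lfloor>x * 2^m\<rfloor>) / 2^m \<le> x"
 proof (rule always_eventually, rule allI)
  fix m
  have "real (nat \<lfloor>x * 2^m\<rfloor>) \<le> x * 2^m" using assms by (simp add: of_nat_floor)
  then show "real (nat \<lfloor>x * 2^m\<rfloor>) / 2^m \<le> x" by (simp add: divide_le_eq)
 qed
 have "(\<lambda>m. x - (1/2)^m) \<longlonglongrightarrow> x - 0" by (intro tendsto_intros LIMSEQ_power_zero) auto
 then show "(\<lambda>m. x - (1/2)^m) \<longlonglongrightarrow> x" by simp
qed simp

lemma sum_dyi_interval:
 shows "(\<Sum>i<k. dyi m i s) = indicator {0<..real k / 2^m} s"
proof (induction k)
 case (Suc k)
 have gen: "indicator {0<..a} s + indicator {a<..b} s = (indicator {0<..b} s :: real)" if "0 \<le> a" "a \<le> b" for a b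
  using that by (auto simp: indicator_def)
 have "0 \<le> real k / 2^m" "real k / 2^m \<le> real (Suc k) / 2^m" by (auto intro: divide_right_mono)
 from gen[OF this] show ?case using Suc by (simp add: dyi_def del: of_nat_Suc)
qed simp

text \<open>The averages converge in L2 to some g that pairs with every step function as \<phi>
  does. Hence the indefinite integral of g - \<phi> vanishes at dyadic points, by continuity on all
  of [0,1], and g = \<phi> almost everywhere.\<close>

lemma dyadic_averages_tendsto:
 assumes [measurable]: "\<phi> \<in> borel_measurable borel" and fin: "nsq lborel \<phi> < \<infinity>" and z: "\<And>s. s \<notin> {0..1} \<Longrightarrow> \<phi> s = 0"
 shows "(\<lambda>n. nsq lborel (\<lambda>s. repr (pair_fun \<phi>) n s - \<phi> s)) \<longlonglongrightarrow> 0"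
proof -
 note L = pair_functional[OF assms]
 let ?H = "repr (pair_fun \<phi>)"
 have [measurable]: "?H n \<in> borel_measurable borel" for n unfolding repr_def by simp
 have "\<exists>g\<in>borel_measurable lborel. (\<lambda>n. nsq lborel (\<lambda>s. ?H n s - g s)) \<longlonglongrightarrow> 0"
 proof (rule nsq_complete)
  fix e :: ennreal assume "e > 0"
  then obtain e' where e': "0 < e'" "ennreal e' \<le> e"
   by (cases e) (auto intro: that[of 1])
  then show "\<exists>k. \<forall>m\<ge>k. \<forall>n\<ge>k. nsq lborel (\<lambda>x. ?H m x - ?H n x) \<le> e"
   using repr_cauchy[OF L e'(1)] by (meson order_trans)
 qed measurable
 then obtain g where [measurable]: "g \<in> borel_measurable borel" and g: "(\<lambda>n. nsq lborel (\<lambda>s. ?H n s - g s)) \<longlonglongrightarrow> 0" by auto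
 have gfin: "nsq lborel g < \<infinity>"
 proof -
  obtain n where "nsq lborel (\<lambda>s. ?H n s - g s) < 1"
   using order_tendstoD(2)[OF g, of 1] by (auto simp: eventually_sequentially)
  then have n: "nsq lborel (\<lambda>s. ?H n s - g s) < \<infinity>" by (rule less_trans) simp
  have "nsq lborel g \<le> 2 * (nsq lborel (\<lambda>s. g s - ?H n s) + nsq lborel (?H n))" by (rule nsq_le_diff) measurable
  also have "\<dots> < \<infinity>"
   using n repr_sq(1)[OF L] unfolding nsq_diff_commute[of lborel g] by (auto simp: ennreal_mult_less_top less_top)
  finally show ?thesis .
 qed
 define h where "h s = g s - \<phi> s" for s
 have [measurable]: "h \<in> borel_measurable borel" unfolding h_def by measurable
 have hfin: "nsq lborel h < \<infinity>"
 proof -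
  have "nsq lborel h \<le> 2 * (nsq lborel g + nsq lborel (\<lambda>s. - \<phi> s))"
   using nsq_add_le[of g lborel "\<lambda>s. - \<phi> s"] by (simp add: h_def)
  also have "\<dots> < \<infinity>" using gfin fin by (simp add: ennreal_mult_less_top)
  finally show ?thesis .
 qed
 have fs: "(LINT s|lborel. g s * dstep m c s) = (LINT s|lborel. \<phi> s * dstep m c s)" for m c
 proof -
  have dfin: "nsq lborel (dstep m c) < \<infinity>" by (simp add: nsq_dstep)
  have "(\<lambda>n. ennreal ((LINT s|lborel. (?H n s - g s) * dstep m c s)\<^sup>2)) \<longlonglongrightarrow> 0"
  proof (rule ennreal_tendsto_zero_le[OF g])
   fix n
   have f2: "nsq lborel (\<lambda>s. ?H n s - g s) < \<infinity>"
    using nsq_add_le[of "?H n" lborel "\<lambda>s. - g s"] gfin repr_sq(1)[OF L, of n]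
    by (auto simp: ennreal_mult_less_top less_top intro: le_less_trans)
   show "ennreal ((LINT s|lborel. (?H n s - g s) * dstep m c s)\<^sup>2) \<le> nsq lborel (dstep m c) * nsq lborel (\<lambda>s. ?H n s - g s)"
    using cauchy_schwarz_integral[OF _ _ f2 dfin] by (simp add: mult.commute)
  qed (rule dfin)
  then have "(\<lambda>n. LINT s|lborel. (?H n s - g s) * dstep m c s) \<longlonglongrightarrow> 0"
   using ennreal_powr_tendsto_0_iff[of 2 "\<lambda>n. LINT s|lborel. (?H n s - g s) * dstep m c s"] by simp
  moreover have "\<forall>\<^sub>F n in sequentially. (LINT s|lborel. (?H n s - g s) * dstep m c s) =
    (LINT s|lborel. \<phi> s * dstep m c s) - (LINT s|lborel. g s * dstep m c s)"
   using eventually_ge_at_top[of m]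
  proof eventually_elim
   case (elim n)
   have "integrable lborel (\<lambda>s. ?H n s * dstep m c s)" "integrable lborel (\<lambda>s. g s * dstep m c s)"
    using repr_sq(1)[OF L, of n] gfin dfin by (auto intro!: L2_mult_integrable)
   then show ?case using repr_integral[OF L elim, of c] by (simp add: left_diff_distrib pair_fun_def)
  qed
  ultimately have "(\<lambda>n. (LINT s|lborel. \<phi> s * dstep m c s) - (LINT s|lborel. g s * dstep m c s)) \<longlonglongrightarrow> 0"
   by (rule Lim_transform_eventually)
  then show ?thesis by (simp add: LIMSEQ_const_iff)
 qed
 have hL1: "abs_upto 1 h < \<infinity>"
 proof (rule nn_indicator_L1[where p=2])
  have "pow_upto 2 1 h \<le> nsq lborel h"
   by (intro nn_integral_mono) (auto simp: indicator_def)
  then show "pow_upto 2 1 h < \<infinity>" using hfin by (rule le_less_trans)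
 qed auto
 have dy0: "frac_int 1 h (real k / 2^m) = 0" if k: "k \<le> 2^m" for k m
 proof -
  define c :: "nat \<Rightarrow> real" where "c j = (if j < k then 1 else 0)" for j
  have d: "dstep m c s = indicator {0<..real k / 2^m} s" for s
  proof -
   have "dstep m c s = (\<Sum>j<2^m. if j < k then dyi m j s else 0)"
    unfolding dstep_def c_def by (intro sum.cong) auto
   also have "\<dots> = (\<Sum>j<k. dyi m j s)"
    using k by (intro sum.mono_neutral_cong_right) auto
   finally show ?thesis by (simp add: sum_dyi_interval)
  qed
  have i: "integrable lborel (\<lambda>s. g s * dstep m c s)" "integrable lborel (\<lambda>s. \<phi> s * dstep m c s)"
   using gfin fin by (auto intro!: L2_mult_integrable simp: nsq_dstep)
  have "frac_int 1 h (real k / 2^m) = (LINT s|lborel. g s * dstep m c s - \<phi> s * dstep m c s)"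
   unfolding frac_int_one[OF \<open>h \<in> borel_measurable borel\<close>]
  proof (rule integral_cong_AE)
   show "AE s in lborel. indicator {0..real k / 2^m} s * h s = g s * dstep m c s - \<phi> s * dstep m c s"
    using AE_lborel_singleton[of 0] unfolding d h_def by eventually_elim (auto simp: indicator_def)
  qed measurable
  also have "\<dots> = 0" using i fs[of m c] by simp
  finally show ?thesis .
 qed
 have "AE s in lborel. s \<in> {0..1} \<longrightarrow> h s = 0"
 proof (rule frac_int_one_zero[OF _ hL1], measurable, rule AE_I2, rule impI)
  fix x :: real assume x: "x \<in> {0..1}"
  let ?x = "\<lambda>m. real (nat \<lfloor>x * 2^m\<rfloor>) / 2^m"
  have le: "nat \<lfloor>x * 2^m\<rfloor> \<le> 2^m" for m
  proof -
   have "x * 2^m \<le> 1 * 2^m" using x by (intro mult_right_mono) auto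
   then have "real (nat \<lfloor>x * 2^m\<rfloor>) \<le> 2^m" using x by (intro order_trans[OF of_nat_floor]) auto
   then show ?thesis by (metis of_nat_le_iff of_nat_numeral of_nat_power)
  qed
  have x01: "?x m \<in> {0..1}" for m
  proof -
   have "real (nat \<lfloor>x * 2^m\<rfloor>) \<le> 2^m" using le[of m] by (metis of_nat_le_iff of_nat_numeral of_nat_power)
   then show ?thesis by simp
  qed
  have "(\<lambda>m. frac_int 1 h (?x m)) \<longlonglongrightarrow> frac_int 1 h x"
   using continuous_on_tendsto_compose[OF continuous_frac_int_one[OF _ hL1] dyadic_floor_tendsto x] x01 x by auto
  then show "frac_int 1 h x = 0" using dy0[OF le] by (simp add: LIMSEQ_const_iff)
 qed
 then have "AE s in lborel. g s = \<phi> s"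
 proof -
  have "AE s in lborel. s \<notin> {0..1} \<longrightarrow> g s = 0"
  proof -
   obtain t where t: "strict_mono t" "AE x in lborel. (\<lambda>n. ?H (t n) x) \<longlonglongrightarrow> g x"
    using nsq_subseq_AE[OF _ _ g] by auto
   from t(2) show ?thesis
   proof eventually_elim
    case (elim x)
    show ?case
    proof
     assume "x \<notin> {0..1}"
     then have "?H n x = 0" for n unfolding repr_def by (intro dstep_supp) auto
     with elim show "g x = 0" by (simp add: LIMSEQ_const_iff)
    qed
   qed
  qed
  with \<open>AE s in lborel. s \<in> {0..1} \<longrightarrow> h s = 0\<close> show ?thesis
  proof eventually_elim
   case (elim s)
   then show ?case using z[of s] by (cases "s \<in> {0..1}") (auto simp: h_def)
  qed
 qed
 then have "nsq lborel (\<lambda>s. ?H n s - \<phi> s) = nsq lborel (\<lambda>s. ?H n s - g s)" for n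
  by (intro nn_integral_cong_AE) (auto elim!: eventually_mono)
 then show ?thesis using g by simp
qed

section \<open>Backward averages\<close>

text \<open>Each cell carries the average over the preceding one, a quantity that depends on
  \<open>f\<close> only up to the left end of the cell. Applied to the paths of an adapted process,
  this gives simple processes. The first cell has no predecessor and gets 0.\<close>

definition bavg :: "nat \<Rightarrow> (real \<Rightarrow> real) \<Rightarrow> real \<Rightarrow> real" where
 "bavg m f = dstep m (\<lambda>j. if j = 0 then 0 else 2^m * (LINT s|lborel. f s * dyi m (j - 1) s))"

lemma measurable_bavg[measurable]: "bavg m f \<in> borel_measurable borel"
 unfolding bavg_def by measurable

lemma dstep_cong: "(\<And>j. j < 2^n \<Longrightarrow> c j = d j) \<Longrightarrow> dstep n c s = dstep n d s"
 unfolding dstep_def by (intro sum.cong) auto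

lemma sum_shift_le:
 fixes a :: "nat \<Rightarrow> real"
 assumes "\<And>j. a j \<ge> 0"
 shows "(\<Sum>j<N. if j = 0 then 0 else a (j - 1)) \<le> (\<Sum>j<N. a j)"
proof (cases N)
 case (Suc n)
 have "(\<Sum>j<Suc n. if j = 0 then 0 else a (j - 1)) = (\<Sum>j<n. a j)"
  by (subst sum.lessThan_Suc_shift) simp
 then show ?thesis using Suc assms by simp
qed simp

lemma nsq_bavg_le:
 assumes [measurable]: "f \<in> borel_measurable borel" and fin: "nsq lborel f < \<infinity>" and z: "\<And>s. s \<notin> {0..1} \<Longrightarrow> f s = 0"
 shows "nsq lborel (bavg m f) \<le> nsq lborel f"
proof -
 note L = pair_functional[OF assms]
 let ?a = "\<lambda>j. 2^m * (LINT s|lborel. f s * dyi m j s)"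
 have "(\<Sum>j<2^m. (if j = 0 then 0 else ?a (j - 1))\<^sup>2) = (\<Sum>j<2^m. if j = 0 then 0 else (?a (j - 1))\<^sup>2)"
  by (intro sum.cong) auto
 also have "\<dots> \<le> (\<Sum>j<2^m. (?a j)\<^sup>2)"
  using sum_shift_le[of "\<lambda>j. (?a j)\<^sup>2" "2^m"] by simp
 finally have "nsq lborel (bavg m f) \<le> nsq lborel (repr (pair_fun f) m)"
  unfolding bavg_def repr_def pair_fun_def nsq_dstep by (intro ennreal_leI divide_right_mono) auto
 also have "\<dots> = ennreal (pair_fun f (repr (pair_fun f) m))" by (rule repr_sq(1)[OF L])
 also have "\<dots> \<le> ennreal (enn2real (nsq lborel f))" by (intro ennreal_leI repr_sq(2)[OF L])
 also have "\<dots> = nsq lborel f" using fin by (simp add: less_top)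
 finally show ?thesis .
qed

lemma bavg_diff:
 assumes [measurable]: "f \<in> borel_measurable borel" "g \<in> borel_measurable borel"
  and "nsq lborel f < \<infinity>" "nsq lborel g < \<infinity>"
 shows "bavg m (\<lambda>s. f s - g s) s = bavg m f s - bavg m g s"
proof -
 have d: "nsq lborel (dyi m j) < \<infinity>" for j
  unfolding dyi_sq using dyi_integral[of m j] by (simp add: nn_integral_eq_integral dyi_nonneg)
 have "integrable lborel (\<lambda>s. f s * dyi m j s)" "integrable lborel (\<lambda>s. g s * dyi m j s)" for j
  using assms d by (auto intro!: L2_mult_integrable)
 then show ?thesis
  unfolding bavg_def dstep_diff by (intro dstep_cong) (auto simp: left_diff_distrib right_diff_distrib)
qed

lemma dstep_dyi_integral: "k < 2^n \<Longrightarrow> (LINT s|lborel. dstep n c s * dyi n k s) = c k / 2^n"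
proof -
 assume k: "k < 2^n"
 have "(LINT s|lborel. dstep n c s * dyi n k s) = (\<Sum>j<2^n. c j * (if j = k then 1 else 0)) / 2^n"
  unfolding dyi_dstep[OF k] dstep_mult dstep_integral(2) ..
 also have "(\<Sum>j<2^n. c j * (if j = k then 1 else 0)) = c k"
  using k by (simp add: if_distrib[of "\<lambda>x. _ * x"] cong: if_cong)
 finally show ?thesis .
qed

lemma bavg_dstep: "bavg m (dstep m d) s = dstep m (\<lambda>j. if j = 0 then 0 else d (j - 1)) s"
 unfolding bavg_def by (intro dstep_cong) (auto simp: dstep_dyi_integral)

text \<open>On a step function of level k the backward average is a shift by one fine cell. It
  changes values only in the at most \<open>2^k\<close> fine cells that follow a coarse boundary,
  each of length \<open>1 / 2^m\<close>.\<close>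

lemma bavg_dstep_tendsto: "(\<lambda>m. nsq lborel (\<lambda>s. bavg m (dstep k c) s - dstep k c s)) \<longlonglongrightarrow> 0"
proof -
 define C where "C = (\<Sum>i<2^k. \<bar>c i\<bar>)"
 have c: "\<bar>c i\<bar> \<le> C" if "i < 2^k" for i
  unfolding C_def using that by (intro member_le_sum) auto
 have C0: "C \<ge> 0" by (simp add: C_def sum_nonneg)
 have bound: "nsq lborel (\<lambda>s. bavg m (dstep k c) s - dstep k c s) \<le> ennreal (2^k * (2 * C)\<^sup>2 / 2^m)" if km: "k \<le> m" for m
 proof -
  define q :: nat where "q = 2^(m - k)"
  have q: "q > 0" "(2::nat)^m = 2^k * q" using km by (auto simp: q_def simp flip: power_add)
  define d where "d j = c (j div q)" for j
  have eq: "dstep k c = dstep m d" using dstep_refine[OF km, of c] unfolding d_def q_def by blast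
  define a where "a j = (if j = 0 then 0 else d (j - 1)) - d j" for j
  have dC: "\<bar>d j\<bar> \<le> C" if "j < 2^m" for j
   unfolding d_def using that q by (intro c) (simp add: less_mult_imp_div_less)
  have a0: "a j = 0" if "\<not> q dvd j" for j
  proof -
   have "j \<noteq> 0" using that by (intro notI) simp
   then obtain i where i: "j = Suc i" by (cases j) auto
   have "Suc i mod q \<noteq> 0" using that i by (simp add: dvd_eq_mod_eq_0)
   then have "Suc i div q = i div q" by (simp add: div_Suc)
   then show ?thesis by (simp add: a_def d_def i)
  qed
  have aC: "(a j)\<^sup>2 \<le> (2 * C)\<^sup>2" if "j < 2^m" for j
  proof -
   have "\<bar>a j\<bar> \<le> 2 * C"
   proof (cases "j = 0")
    case True
    then show ?thesis using dC[OF that] C0 by (simp add: a_def)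
   next
    case False
    have "\<bar>d (j - 1) - d j\<bar> \<le> \<bar>d (j - 1)\<bar> + \<bar>d j\<bar>" by (rule abs_triangle_ineq4)
    moreover have "j - 1 < 2^m" using that by simp
    ultimately show ?thesis using dC[OF that] dC[of "j - 1"] False by (simp add: a_def)
   qed
   then show ?thesis using C0 by (intro abs_le_square_iff[THEN iffD1]) simp
  qed
  have "(\<Sum>j<2^m. (a j)\<^sup>2) = (\<Sum>j\<in>{j. j < 2^m \<and> q dvd j}. (a j)\<^sup>2)"
   by (intro sum.mono_neutral_right) (auto simp: a0)
  also have "\<dots> \<le> real (card {j. j < 2^m \<and> q dvd j}) * (2 * C)\<^sup>2"
   using sum_bounded_above[of "{j. j < 2^m \<and> q dvd j}" "\<lambda>j. (a j)\<^sup>2" "(2 * C)\<^sup>2"] aC by auto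
  also have "card {j. j < 2^m \<and> q dvd j} \<le> card ((\<lambda>i. q * i) ` {..<2^k})"
   using q by (intro card_mono) (auto simp: dvd_def mult.commute)
  then have "real (card {j. j < 2^m \<and> q dvd j}) \<le> real (card ((\<lambda>i. q * i) ` {..<2^k}))" by simp
  also have "\<dots> \<le> real (2^k)" using card_image_le[of "{..<(2::nat)^k}" "\<lambda>i. q * i"] by (metis card_lessThan finite_lessThan of_nat_le_iff)
  finally have "(\<Sum>j<2^m. (a j)\<^sup>2) \<le> 2^k * (2 * C)\<^sup>2" by (simp add: mult_right_mono)
  moreover have "nsq lborel (\<lambda>s. bavg m (dstep k c) s - dstep k c s) = ennreal ((\<Sum>j<2^m. (a j)\<^sup>2) / 2^m)"
   unfolding eq bavg_dstep dstep_diff a_def[symmetric] by (rule nsq_dstep)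
  ultimately show ?thesis by (simp add: ennreal_leI divide_right_mono)
 qed
 show ?thesis
 proof (rule tendsto_sandwich[OF _ _ tendsto_const])
  have "(\<lambda>m. 2^k * (2 * C)\<^sup>2 * (1/2)^m) \<longlonglongrightarrow> 2^k * (2 * C)\<^sup>2 * 0"
   by (intro tendsto_mult tendsto_const LIMSEQ_power_zero) simp
  then have "(\<lambda>m. ennreal (2^k * (2 * C)\<^sup>2 / 2^m)) \<longlonglongrightarrow> ennreal 0"
   by (intro tendsto_ennrealI) (simp add: power_divide)
  then show "(\<lambda>m. ennreal (2^k * (2 * C)\<^sup>2 / 2^m)) \<longlonglongrightarrow> 0" by simp
  show "\<forall>\<^sub>F m in sequentially. nsq lborel (\<lambda>s. bavg m (dstep k c) s - dstep k c s) \<le> ennreal (2^k * (2 * C)\<^sup>2 / 2^m)"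
   using eventually_ge_at_top[of k] by eventually_elim (rule bound)
 qed simp
qed

text \<open>Density argument: the backward averages are contractions of L2 and converge on step
  functions, which approximate \<open>f\<close> by \<open>dyadic_averages_tendsto\<close>.\<close>

lemma bavg_tendsto:
 assumes [measurable]: "f \<in> borel_measurable borel" and fin: "nsq lborel f < \<infinity>" and z: "\<And>s. s \<notin> {0..1} \<Longrightarrow> f s = 0"
 shows "(\<lambda>m. nsq lborel (\<lambda>s. bavg m f s - f s)) \<longlonglongrightarrow> 0"
proof (rule order_tendstoI)
 fix e0 :: ennreal assume "0 < e0"
 then obtain e where e0: "0 < e" "e < e0" using dense by blast
 \<comment> \<open>10 = 2 (1 + 2 + 2): the total weight of three errors after two uses of
   \<open>nsq_triangle\<close>.\<close>
 then have e: "e / 10 > 0" by (simp add: ennreal_zero_less_divide)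
 let ?H = "repr (pair_fun f)"
 have [measurable]: "?H n \<in> borel_measurable borel" for n unfolding repr_def by simp
 obtain k where k: "nsq lborel (\<lambda>s. ?H k s - f s) < e / 10"
  using order_tendstoD(2)[OF dyadic_averages_tendsto[OF assms] e] by (auto simp: eventually_sequentially)
 have Hfin: "nsq lborel (?H k) < \<infinity>" unfolding repr_def by (simp add: nsq_dstep)
 have Hz: "?H k s = 0" if "s \<notin> {0..1}" for s unfolding repr_def using that by (intro dstep_supp) auto
 have "\<forall>\<^sub>F m in sequentially. nsq lborel (\<lambda>s. bavg m (?H k) s - ?H k s) < e / 10"
  using order_tendstoD(2)[OF bavg_dstep_tendsto e] unfolding repr_def by blast
 then show "\<forall>\<^sub>F m in sequentially. nsq lborel (\<lambda>s. bavg m f s - f s) < e0"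
 proof eventually_elim
  case (elim m)
  have dfin: "nsq lborel (\<lambda>s. f s - ?H k s) < \<infinity>"
   using k unfolding nsq_diff_commute[of lborel f] by (rule less_le_trans) simp
  have "nsq lborel (\<lambda>s. bavg m f s - bavg m (?H k) s) = nsq lborel (bavg m (\<lambda>s. f s - ?H k s))"
   using bavg_diff[OF _ _ fin Hfin, of m] by simp
  also have "\<dots> \<le> nsq lborel (\<lambda>s. f s - ?H k s)"
   by (intro nsq_bavg_le dfin) (auto simp: z Hz)
  finally have 1: "nsq lborel (\<lambda>s. bavg m f s - bavg m (?H k) s) < e / 10"
   using k unfolding nsq_diff_commute[of lborel f] by (rule le_less_trans)
  have "nsq lborel (\<lambda>s. bavg m f s - f s) \<le> 2 * (nsq lborel (\<lambda>s. bavg m f s - bavg m (?H k) s) + nsq lborel (\<lambda>s. bavg m (?H k) s - f s))"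
   by (rule nsq_triangle) measurable
  also have "\<dots> \<le> 2 * (nsq lborel (\<lambda>s. bavg m f s - bavg m (?H k) s) + 2 * (nsq lborel (\<lambda>s. bavg m (?H k) s - ?H k s) + nsq lborel (\<lambda>s. ?H k s - f s)))"
   by (intro mult_left_mono add_mono order_refl nsq_triangle) auto
  also have "\<dots> \<le> 2 * (e / 10 + 2 * (e / 10 + e / 10))"
   using 1 elim k by (intro mult_left_mono add_mono) (auto intro: less_imp_le)
  also have "\<dots> = 10 * (e / 10)" by (simp add: distrib_left mult_2[symmetric] flip: mult.assoc distrib_right)
  also have "\<dots> = e" by (simp add: ennreal_times_divide ennreal_mult_divide_eq mult.commute[of 10])
  finally show ?case using e0(2) by (rule le_less_trans)
 qed
qed simp

section \<open>Averages of adapted processes\<close>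

context brownian
begin

definition adapted :: "('w \<times> real \<Rightarrow> real) \<Rightarrow> bool" where
 "adapted v \<longleftrightarrow> (\<forall>s\<in>{0..1}. (\<lambda>w. v (w, s)) \<in> borel_measurable (F s))"

text \<open>Modification on a null set preserves measurability because the filtration contains the
  null sets of M.\<close>

lemma measurable_F_AE:
 assumes G: "G \<in> borel_measurable (F b)" and V: "V \<in> borel_measurable M" and b: "b \<le> 1"
  and eq: "AE w in M. V w = (G w :: real)"
 shows "V \<in> borel_measurable (F b)"
proof (rule measurableI)
 have GM: "G \<in> borel_measurable M" by (rule measurable_F_M[OF G b])
 obtain N where N: "N \<in> null_sets M" "{w\<in>space M. V w \<noteq> G w} \<subseteq> N"
  using eq by (auto elim!: AE_E3[where M=M] simp: AE_iff_null eventually_ae_filter)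
 fix A :: "real set" assume A: "A \<in> sets borel"
 have "V -` A \<inter> space M \<inter> N \<in> null_sets M"
  using N(1) A V by (intro null_set_Int1) auto
 then have "V -` A \<inter> space M \<inter> N \<in> sets (F b)" by (rule null_sets_F)
 moreover have "G -` A \<inter> space (F b) - N \<in> sets (F b)"
  using measurable_sets[OF G A] null_sets_F[OF N(1)] by auto
 moreover have "V -` A \<inter> space (F b) = (G -` A \<inter> space (F b) - N) \<union> (V -` A \<inter> space M \<inter> N)"
  using N(2) by auto
 ultimately show "V -` A \<inter> space (F b) \<in> sets (F b)" by (simp only: sets.Un)
qed simp

lemma integrable_prod_indicator:
 assumes "integrable M f"
 shows "integrable P (\<lambda>p. f (fst p) * indicator {0..1} (snd p) :: real)"
proof (rule integrableI_bounded)
 have [measurable]: "f \<in> borel_measurable M" using assms by auto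
 show "(\<lambda>p. f (fst p) * indicator {0..1} (snd p)) \<in> borel_measurable P" by measurable
 have "(\<integral>\<^sup>+p. ennreal (norm (f (fst p) * indicator {0..1} (snd p))) \<partial>P) =
   (\<integral>\<^sup>+w. \<integral>\<^sup>+s. ennreal \<bar>f w\<bar> * indicator {0..1::real} s \<partial>lborel \<partial>M)"
  by (subst lborel.nn_integral_fst[symmetric]) (auto intro!: nn_integral_cong simp: indicator_def)
 also have "\<dots> = (\<integral>\<^sup>+w. ennreal \<bar>f w\<bar> \<partial>M)"
  by (intro nn_integral_cong, subst nn_integral_cmult) auto
 also have "\<dots> < \<infinity>" using assms by (simp add: integrable_iff_bounded)
 finally show "(\<integral>\<^sup>+p. ennreal (norm (f (fst p) * indicator {0..1} (snd p))) \<partial>P) < \<infinity>" .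
qed

text \<open>
 A jointly measurable adapted process need not be progressively measurable; nevertheless its
 time averages \<open>V\<close> are adapted because \<open>V\<close> and \<open>E[V | F b]\<close> have the same inner product with
 both \<open>V\<close> and \<open>E[V | F b]\<close>.
\<close>

lemma average_measurable_F:
 assumes v[measurable]: "v \<in> borel_measurable P" and K: "\<And>w s. w \<in> space M \<Longrightarrow> \<bar>v (w, s)\<bar> \<le> K"
  and ad: "adapted v" and ab: "0 \<le> a" "a \<le> b" "b \<le> 1"
 shows "(\<lambda>w. LINT s|lborel. v (w, s) * indicator {a<..b} s) \<in> borel_measurable (F b)"
proof -
 interpret S: finite_measure_subalgebra M "F b"
  by unfold_locales (rule F_subalgebra[OF ab(3)])
 define V where "V w = (LINT s|lborel. v (w, s) * indicator {a<..b} s)" for w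
 have [measurable]: "V \<in> borel_measurable M" unfolding V_def by measurable
 have K0: "K \<ge> 0" using K not_empty by (metis abs_ge_zero all_not_in_conv order_trans)
 have vs: "integrable lborel (\<lambda>s. v (w, s) * indicator {a<..b} s)" if "w \<in> space M" for w
 proof (rule Bochner_Integration.integrable_bound)
  show "integrable lborel (\<lambda>s. K * indicator {a<..b} s :: real)" using ab by simp
  show "AE s in lborel. norm (v (w, s) * indicator {a<..b} s) \<le> norm (K * indicator {a<..b} s :: real)"
   using K[OF that] K0 by (intro AE_I2) (auto simp: indicator_def)
  show "(\<lambda>s. v (w, s) * indicator {a<..b} s) \<in> borel_measurable lborel"
   using that by measurable
 qed
 have VK: "\<bar>V w\<bar> \<le> K" if "w \<in> space M" for w
 proof -
  have "\<bar>V w\<bar> \<le> (LINT s|lborel. \<bar>v (w, s) * indicator {a<..b} s\<bar>)" unfolding V_def by (rule integral_abs_bound)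
  also have "\<dots> \<le> (LINT s|lborel. K * indicator {a<..b} s)"
  proof (rule integral_mono)
   show "integrable lborel (\<lambda>s. \<bar>v (w, s) * indicator {a<..b} s\<bar>)" using vs[OF that] by simp
   show "integrable lborel (\<lambda>s. K * indicator {a<..b} s :: real)" using ab by simp
   show "\<bar>v (w, s) * indicator {a<..b} s\<bar> \<le> K * indicator {a<..b} s" for s
    using K[OF that, of s] by (auto simp: indicator_def)
  qed
  also have "\<dots> = K * (b - a)" using ab by simp
  also have "\<dots> \<le> K * 1" using ab K0 by (intro mult_left_mono) auto
  finally show ?thesis by simp
 qed
 have iV: "integrable M V" using VK by (intro integrable_const_bound[where B=K]) auto
 define G where "G = real_cond_exp M (F b) V"
 have GF: "G \<in> borel_measurable (F b)" unfolding G_def by simp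
 have [measurable]: "G \<in> borel_measurable M" by (rule measurable_F_M[OF GF ab(3)])
 have iG: "integrable M G" unfolding G_def using S.real_cond_exp_int(1)[OF iV] .
 have bounded_mult: "integrable M (\<lambda>w. f w * g w)"
  if "integrable M g" and [measurable]: "f \<in> borel_measurable M" and "\<And>w. w \<in> space M \<Longrightarrow> \<bar>f w\<bar> \<le> K" for f g :: "'w \<Rightarrow> real"
 proof (rule Bochner_Integration.integrable_bound)
  show "integrable M (\<lambda>w. K * g w)" using that(1) by simp
  show "AE w in M. norm (f w * g w) \<le> norm (K * g w)"
   using that(3) K0 by (intro AE_I2) (auto simp: abs_mult intro: mult_right_mono)
 qed (use that(1) in measurable)
 have fub: "(LINT w|M. g w * V w) = (LINT s|lborel. LINT w|M. (v (w, s) * indicator {a<..b} s) * g w)"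
  if ig: "integrable M g" for g :: "'w \<Rightarrow> real"
 proof -
  have [measurable]: "g \<in> borel_measurable M" using ig by auto
  have "integrable P (\<lambda>p. v p * indicator {a<..b} (snd p) * g (fst p))"
  proof (rule Bochner_Integration.integrable_bound)
   show "integrable P (\<lambda>p. K * (g (fst p) * indicator {0..1} (snd p)))"
    using integrable_prod_indicator[OF ig] by simp
   show "AE p in P. norm (v p * indicator {a<..b} (snd p) * g (fst p)) \<le> norm (K * (g (fst p) * indicator {0..1} (snd p)))"
   proof (rule AE_I2)
    fix p assume "p \<in> space P"
    then have "\<bar>v p\<bar> \<le> K" using K[of "fst p" "snd p"] by (auto simp: space_pair_measure)
    then show "norm (v p * indicator {a<..b} (snd p) * g (fst p)) \<le> norm (K * (g (fst p) * indicator {0..1} (snd p)))"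
     using ab K0 by (auto simp: abs_mult indicator_def intro: mult_right_mono)
   qed
  qed measurable
  then have i: "integrable P (case_prod (\<lambda>w s. (v (w, s) * indicator {a<..b} s) * g w))"
   by (simp add: case_prod_beta')
  have "(LINT w|M. g w * V w) = (LINT w|M. LINT s|lborel. (v (w, s) * indicator {a<..b} s) * g w)"
   unfolding V_def by (simp add: mult.commute)
  then show ?thesis using P.Fubini_integral[OF i] by simp
 qed
 \<comment> \<open>For s in (a,b] the variable v(.,s) is known at time b and can be moved through
   the conditional expectation; for other s both sides are 0.\<close>
 have inner: "(LINT w|M. (v (w, s) * indicator {a<..b} s) * V w) = (LINT w|M. (v (w, s) * indicator {a<..b} s) * G w)" for s
 proof (cases "s \<in> {a<..b}")
  case True
  then have "(\<lambda>w. v (w, s)) \<in> borel_measurable (F b)"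
   using ad ab by (intro measurable_F_mono[of _ s b]) (auto simp: adapted_def)
  moreover have "integrable M (\<lambda>w. v (w, s) * V w)"
   using K by (intro bounded_mult iV) auto
  ultimately show ?thesis
   using True S.real_cond_exp_intg(2)[of "\<lambda>w. v (w, s)" V] by (simp add: G_def)
 qed simp
 have "(LINT w|M. V w * V w) = (LINT s|lborel. LINT w|M. (v (w, s) * indicator {a<..b} s) * V w)"
  by (rule fub[OF iV])
 also have "\<dots> = (LINT s|lborel. LINT w|M. (v (w, s) * indicator {a<..b} s) * G w)"
  by (simp only: inner)
 also have "\<dots> = (LINT w|M. G w * V w)" by (rule fub[OF iG, symmetric])
 finally have 1: "(LINT w|M. V w * V w) = (LINT w|M. G w * V w)" .
 have iGV: "integrable M (\<lambda>w. G w * V w)" using bounded_mult[OF iG, of V] VK by (simp add: mult.commute)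
 have iGG: "integrable M (\<lambda>w. G w * G w)" and 2: "(LINT w|M. G w * G w) = (LINT w|M. G w * V w)"
  using S.real_cond_exp_intg[OF iGV GF] by (auto simp: G_def)
 have iVV: "integrable M (\<lambda>w. V w * V w)" using bounded_mult[OF iV, of V] VK by simp
 have sq: "(V w - G w)\<^sup>2 = V w * V w - 2 * (G w * V w) + G w * G w" for w
  by (simp add: power2_eq_square algebra_simps)
 have "integrable M (\<lambda>w. (V w - G w)\<^sup>2)" unfolding sq using iGV iGG iVV by simp
 moreover have "(LINT w|M. (V w - G w)\<^sup>2) = 0" unfolding sq using iGV iGG iVV 1 2 by simp
 ultimately have "nsq M (\<lambda>w. V w - G w) = 0" by (simp add: nn_integral_eq_integral)
 then have "AE w in M. V w - G w = 0" by (intro nsq_zero_AE) auto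
 then have "AE w in M. V w = G w" by simp
 then have "V \<in> borel_measurable (F b)" by (intro measurable_F_AE[OF GF _ ab(3)]) auto
 then show ?thesis by (simp add: V_def[abs_def])
qed

end

section \<open>Existence of the Ito integral\<close>

lemma Lp2_iff: "f \<in> Lp 2 N \<longleftrightarrow> f \<in> borel_measurable N \<and> nsq N f < \<infinity>"
 unfolding Lp_def by (auto simp: integrable_iff_bounded)

lemma Lp2_norm_tendsto:
 assumes "\<And>k. f k \<in> Lp 2 N"
 shows "(\<lambda>k. Lp_norm 2 N (f k)) \<longlonglongrightarrow> 0 \<longleftrightarrow> (\<lambda>k. nsq N (f k)) \<longlonglongrightarrow> 0"
proof -
 have eq: "ennreal (\<bar>Lp_norm 2 N (f k)\<bar> powr 2) = nsq N (f k)" for k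
  using Lp_norm_powr[OF assms[of k]] Lp_norm_nonneg[of 2 N "f k"] by simp
 show ?thesis using ennreal_powr_tendsto_0_iff[of 2 "\<lambda>k. Lp_norm 2 N (f k)"] unfolding eq by simp
qed

context brownian
begin

lemma measurable_pair_dt:
 fixes f :: "'w \<times> real \<Rightarrow> real"
 shows "f \<in> borel_measurable (M \<Otimes>\<^sub>M dt t) \<longleftrightarrow> (\<lambda>p. indicator {0..t} (snd p) * f p) \<in> borel_measurable P"
proof -
 have "f \<in> borel_measurable (M \<Otimes>\<^sub>M dt t) \<longleftrightarrow> (\<lambda>p. indicator (space M \<times> {0..t}) p *\<^sub>R f p) \<in> borel_measurable P"
  unfolding pair_dt_eq[OF sigma_finite_M] by (rule borel_measurable_restrict_space_iff) auto
 also have "\<dots> \<longleftrightarrow> (\<lambda>p. indicator {0..t} (snd p) * f p) \<in> borel_measurable P"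
  by (intro measurable_cong) (auto simp: space_pair_measure indicator_def)
 finally show ?thesis .
qed

lemma nn_integral_pair_dt:
 "(\<integral>\<^sup>+p. f p \<partial>(M \<Otimes>\<^sub>M dt t)) = (\<integral>\<^sup>+p. f p * indicator {0..t} (snd p) \<partial>P)"
proof -
 have "(\<integral>\<^sup>+p. f p \<partial>(M \<Otimes>\<^sub>M dt t)) = (\<integral>\<^sup>+p. f p * indicator (space M \<times> {0..t}) p \<partial>P)"
  unfolding pair_dt_eq[OF sigma_finite_M] by (rule nn_integral_restrict_space) auto
 also have "\<dots> = (\<integral>\<^sup>+p. f p * indicator {0..t} (snd p) \<partial>P)"
  by (intro nn_integral_cong) (auto simp: space_pair_measure indicator_def)
 finally show ?thesis .
qed

lemma nsq_pair_dt: "nsq (M \<Otimes>\<^sub>M dt t) f = nsq P (\<lambda>p. indicator {0..t} (snd p) * f p)"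
 unfolding nn_integral_pair_dt by (intro nn_integral_cong) (auto simp: indicator_def)

section \<open>Approximation of adapted processes by simple ones\<close>

lemma simple_elem:
 assumes "simple_process M B t n \<tau> \<xi>" "t \<le> 1"
 shows "elem (\<lambda>p. simple_value n \<tau> \<xi> (snd p) (fst p)) (simple_integral B n \<tau> \<xi>)"
proof -
 have \<tau>: "\<tau> 0 = 0" "\<tau> n = t" and mono: "mono_on {..n} \<tau>"
  and \<xi>: "\<And>i. i < n \<Longrightarrow> \<xi> i \<in> borel_measurable (F (\<tau> i))" "\<And>i. i < n \<Longrightarrow> \<exists>C. \<forall>w\<in>space M. \<bar>\<xi> i w\<bar> \<le> C"
  using assms(1) unfolding simple_process_def by auto
 have t01: "0 \<le> \<tau> i" "\<tau> i \<le> 1" if "i \<le> n" for i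
  using mono_onD[OF mono, of 0 i] mono_onD[OF mono, of i n] that \<tau> assms(2) by auto
 have "m \<le> n \<Longrightarrow> elem (\<lambda>p. \<Sum>i<m. \<xi> i (fst p) * indicator {\<tau> i<..\<tau> (Suc i)} (snd p)) (\<lambda>w. \<Sum>i<m. \<xi> i w * (B (\<tau> (Suc i)) w - B (\<tau> i) w))" for m
 proof (induction m)
  case (Suc m)
  obtain C where C: "\<forall>w\<in>space M. \<bar>\<xi> m w\<bar> \<le> C" using \<xi>(2)[of m] Suc.prems by auto
  have "elem (\<lambda>p. (\<Sum>i<m. \<xi> i (fst p) * indicator {\<tau> i<..\<tau> (Suc i)} (snd p)) + \<xi> m (fst p) * indicator {\<tau> m<..\<tau> (Suc m)} (snd p))
   (\<lambda>w. (\<Sum>i<m. \<xi> i w * (B (\<tau> (Suc i)) w - B (\<tau> i) w)) + \<xi> m w * (B (\<tau> (Suc m)) w - B (\<tau> m) w))"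
   using Suc t01[of m] t01[of "Suc m"] mono_onD[OF mono, of m "Suc m"] \<xi>(1)[of m] C
   by (intro elem_add[where C=C]) auto
  then show ?case by simp
 qed (simp add: elem_zero)
 from this[of n] show ?thesis by (simp add: simple_value_def simple_integral_def[abs_def])
qed

lemma bavg_coefficient:
 assumes v[measurable]: "v \<in> borel_measurable P" and K: "\<And>w s. w \<in> space M \<Longrightarrow> \<bar>v (w, s)\<bar> \<le> K"
  and ad: "adapted v" and j: "0 < j" "j < 2^m"
 shows "(\<lambda>w. 2^m * (LINT s|lborel. v (w, s) * dyi m (j - 1) s)) \<in> borel_measurable (F (real j / 2^m))"
  and "w \<in> space M \<Longrightarrow> \<bar>2^m * (LINT s|lborel. v (w, s) * dyi m (j - 1) s)\<bar> \<le> K"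
proof -
 have d: "dyi m (j - 1) s = indicator {real (j - 1) / 2^m<..real j / 2^m} s" for s
  using j by (simp add: dyi_def)
 have le: "real j / 2^m \<le> 1"
  using j(2) by (simp add: divide_le_eq)
 have "(\<lambda>w. LINT s|lborel. v (w, s) * indicator {real (j - 1) / 2^m<..real j / 2^m} s) \<in> borel_measurable (F (real j / 2^m))"
  by (rule average_measurable_F[OF v K ad _ _ le]) (auto intro: divide_right_mono)
 then show "(\<lambda>w. 2^m * (LINT s|lborel. v (w, s) * dyi m (j - 1) s)) \<in> borel_measurable (F (real j / 2^m))"
  unfolding d by measurable
 assume w: "w \<in> space M"
 have K0: "K \<ge> 0" using K[OF w] order_trans abs_ge_zero by blast
 have "\<bar>LINT s|lborel. v (w, s) * dyi m (j - 1) s\<bar> \<le> (LINT s|lborel. \<bar>v (w, s) * dyi m (j - 1) s\<bar>)"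
  by (rule integral_abs_bound)
 also have "\<dots> \<le> (LINT s|lborel. K * dyi m (j - 1) s)"
 proof (rule integral_mono)
  show le: "\<bar>v (w, s) * dyi m (j - 1) s\<bar> \<le> K * dyi m (j - 1) s" for s
   using K[OF w, of s] dyi_nonneg[of m "j - 1" s] by (simp add: abs_mult mult_right_mono)
  show K': "integrable lborel (\<lambda>s. K * dyi m (j - 1) s)" using dyi_integral by simp
  have [measurable]: "(\<lambda>s. v (w, s)) \<in> borel_measurable lborel" using w by measurable
  show "integrable lborel (\<lambda>s. \<bar>v (w, s) * dyi m (j - 1) s\<bar>)"
   by (rule Bochner_Integration.integrable_bound[OF K']) (use le K0 dyi_nonneg in \<open>auto intro!: AE_I2 simp: abs_mult\<close>)
 qed
 also have "\<dots> = K / 2^m" using dyi_integral(2) by simp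
 finally show "\<bar>2^m * (LINT s|lborel. v (w, s) * dyi m (j - 1) s)\<bar> \<le> K"
  by (simp add: abs_mult field_simps)
qed

lemma measurable_bavg_process[measurable]:
 assumes [measurable]: "v \<in> borel_measurable P"
 shows "(\<lambda>p. bavg m (\<lambda>s. v (fst p, s)) (snd p)) \<in> borel_measurable P"
 unfolding bavg_def dstep_def by measurable

text \<open>Convergence holds path by path, and the bound on v dominates the squared errors by a
  constant.\<close>

lemma bavg_process_tendsto:
 assumes v[measurable]: "v \<in> borel_measurable P" and K: "\<And>w s. w \<in> space M \<Longrightarrow> \<bar>v (w, s)\<bar> \<le> K"
  and z: "\<And>w s. s \<notin> {0..1} \<Longrightarrow> v (w, s) = 0"
 shows "(\<lambda>m. nsq P (\<lambda>p. bavg m (\<lambda>s. v (fst p, s)) (snd p) - v p)) \<longlonglongrightarrow> 0"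
proof -
 have vm[measurable]: "(\<lambda>s. v (w, s)) \<in> borel_measurable borel" if "w \<in> space M" for w
 proof -
  have "(\<lambda>s. v (w, s)) \<in> borel_measurable lborel" using that by measurable
  then show ?thesis by simp
 qed
 have vb: "nsq lborel (\<lambda>s. v (w, s)) \<le> ennreal (K\<^sup>2)" if "w \<in> space M" for w
 proof -
  have "nsq lborel (\<lambda>s. v (w, s)) \<le> (\<integral>\<^sup>+s. ennreal (K\<^sup>2) * indicator {0..1::real} s \<partial>lborel)"
  proof (intro nn_integral_mono)
   fix s :: real
   show "ennreal ((v (w, s))\<^sup>2) \<le> ennreal (K\<^sup>2) * indicator {0..1} s"
   proof (cases "s \<in> {0..1}")
    case True
    have "(v (w, s))\<^sup>2 \<le> K\<^sup>2" using power_mono[OF K[OF that, of s] abs_ge_zero, of 2] by simp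
    then show ?thesis using True by (simp add: ennreal_leI)
   qed (simp add: z)
  qed
  also have "\<dots> = ennreal (K\<^sup>2)" by (subst nn_integral_cmult) auto
  finally show ?thesis .
 qed
 define D where "D m w = nsq lborel (\<lambda>s. bavg m (\<lambda>s. v (w, s)) s - v (w, s))" for m w
 have meas: "(\<lambda>p. ennreal ((bavg m (\<lambda>s. v (fst p, s)) (snd p) - v p)\<^sup>2)) \<in> borel_measurable P" for m by measurable
 have eq: "nsq P (\<lambda>p. bavg m (\<lambda>s. v (fst p, s)) (snd p) - v p) = (\<integral>\<^sup>+w. D m w \<partial>M)" for m
  using lborel.nn_integral_fst[OF meas] by (simp add: D_def)
 have Dm[measurable]: "D m \<in> borel_measurable M" for m
  using lborel.borel_measurable_nn_integral_fst[OF meas] by (simp add: D_def[abs_def])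
 have fin: "nsq lborel (\<lambda>s. v (w, s)) < \<infinity>" if "w \<in> space M" for w
  using vb[OF that] by (rule le_less_trans) simp
 have bd: "D m w \<le> ennreal (4 * K\<^sup>2)" if "w \<in> space M" for m w
 proof -
  have "D m w \<le> 2 * (nsq lborel (bavg m (\<lambda>s. v (w, s))) + nsq lborel (\<lambda>s. - v (w, s)))"
   using nsq_add_le[of "bavg m (\<lambda>s. v (w, s))" lborel "\<lambda>s. - v (w, s)"] vm[OF that] by (simp add: D_def)
  also have "\<dots> \<le> 2 * (ennreal (K\<^sup>2) + ennreal (K\<^sup>2))"
   using order_trans[OF nsq_bavg_le[OF vm[OF that] fin[OF that] z] vb[OF that]] vb[OF that]
   by (intro mult_left_mono add_mono) auto
  also have "\<dots> = ennreal (4 * K\<^sup>2)" by (simp flip: ennreal_plus ennreal_numeral ennreal_mult)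
  finally show ?thesis .
 qed
 have "(\<lambda>m. \<integral>\<^sup>+w. D m w \<partial>M) \<longlonglongrightarrow> (\<integral>\<^sup>+w. 0 \<partial>M)"
 proof (rule nn_integral_dominated_convergence[where w="\<lambda>w. ennreal (4 * K\<^sup>2)"])
  show "AE w in M. (\<lambda>m. D m w) \<longlonglongrightarrow> 0"
   unfolding D_def using bavg_tendsto[OF vm fin z] by (intro AE_I2) auto
 qed (use bd in \<open>auto simp: emeasure_space_1\<close>)
 then show ?thesis unfolding eq by simp
qed

lemma simple_approx_bounded:
 assumes v[measurable]: "v \<in> borel_measurable P" and K: "\<And>w s. w \<in> space M \<Longrightarrow> \<bar>v (w, s)\<bar> \<le> K"
  and ad: "adapted v" and t: "0 \<le> t" "t \<le> 1" and z: "\<And>w s. s \<notin> {0..t} \<Longrightarrow> v (w, s) = 0" and e: "e > 0"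
 shows "\<exists>n \<tau> \<xi>. simple_process M B t n \<tau> \<xi> \<and> nsq P (\<lambda>p. simple_value n \<tau> \<xi> (snd p) (fst p) - v p) \<le> e"
proof -
 have z1: "v (w, s) = 0" if "s \<notin> {0..1}" for w s using that t by (intro z) auto
 obtain m where m: "nsq P (\<lambda>p. bavg m (\<lambda>s. v (fst p, s)) (snd p) - v p) < e"
  using order_tendstoD(2)[OF bavg_process_tendsto[OF v K z1] e] by (auto simp: eventually_sequentially)
 \<comment> \<open>Grid points beyond t collapse to t and their intervals become empty. The
   corresponding coefficients are set to 0, since they would involve v after time t.\<close>
 define \<tau> where "\<tau> i = min (real i / 2^m) t" for i
 define \<xi> where "\<xi> i w = (if i = 0 \<or> real i / 2^m > t then 0 else 2^m * (LINT s|lborel. v (w, s) * dyi m (i - 1) s))" for i w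
 have sp: "simple_process M B t (2^m) \<tau> \<xi>"
  unfolding simple_process_def
 proof (intro conjI allI impI)
  show "\<tau> 0 = 0" "\<tau> (2^m) = t" using t by (auto simp: \<tau>_def)
  show "mono_on {..2^m} \<tau>" unfolding \<tau>_def by (intro mono_onI min.mono divide_right_mono) auto
  fix i :: nat assume i: "i < 2^m"
  show "\<xi> i \<in> borel_measurable (F (\<tau> i))"
  proof (cases "i = 0 \<or> real i / 2^m > t")
   case True
   then show ?thesis unfolding \<xi>_def[abs_def] by (simp only: if_True) simp
  next
   case False
   then have "\<tau> i = real i / 2^m" by (simp add: \<tau>_def)
   then show ?thesis using False bavg_coefficient(1)[OF v K ad, of i m] i by (simp add: \<xi>_def[abs_def])
  qed
  show "\<exists>C. \<forall>w\<in>space M. \<bar>\<xi> i w\<bar> \<le> C"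
  proof (intro exI ballI)
   fix w assume w: "w \<in> space M"
   show "\<bar>\<xi> i w\<bar> \<le> \<bar>K\<bar>"
   proof (cases "i = 0 \<or> real i / 2^m > t")
    case False
    then show ?thesis using bavg_coefficient(2)[OF v K ad _ i w] by (simp add: \<xi>_def)
   qed (auto simp: \<xi>_def)
  qed
 qed
 have sv: "simple_value (2^m) \<tau> \<xi> s w = indicator {..t} s * bavg m (\<lambda>s. v (w, s)) s" for s w
  unfolding simple_value_def bavg_def dstep_def sum_distrib_left
 proof (intro sum.cong refl)
  fix i :: nat
  show "\<xi> i w * indicator {\<tau> i<..\<tau> (Suc i)} s = indicator {..t} s * ((if i = 0 then 0 else 2^m * (LINT s|lborel. v (w, s) * dyi m (i - 1) s)) * dyi m i s)"
  proof (cases "i = 0")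
   case False
   have gen: "(if a > t then 0 else x) * indicator {min a t<..min b t} s = indicator {..t} s * (x * (indicator {a<..b} s :: real))" for a b x :: real
    by (auto simp: indicator_def)
   show ?thesis using False gen[of "real i / 2^m" _ "real (Suc i) / 2^m"]
    unfolding \<xi>_def \<tau>_def dyi_def[of m i] by simp
  qed (simp add: \<xi>_def)
 qed
 have "nsq P (\<lambda>p. simple_value (2^m) \<tau> \<xi> (snd p) (fst p) - v p) \<le> nsq P (\<lambda>p. bavg m (\<lambda>s. v (fst p, s)) (snd p) - v p)"
 proof (intro nn_integral_mono ennreal_leI)
  fix p
  show "(simple_value (2^m) \<tau> \<xi> (snd p) (fst p) - v p)\<^sup>2 \<le> (bavg m (\<lambda>s. v (fst p, s)) (snd p) - v p)\<^sup>2"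
   using z[of "snd p" "fst p"] by (cases "snd p \<le> t") (auto simp: sv)
 qed
 also have "\<dots> \<le> e" using m by (rule less_imp_le)
 finally show ?thesis using sp by blast
qed

definition clip :: "real \<Rightarrow> real \<Rightarrow> real" where
 "clip k x = max (- k) (min k x)"

lemma clip_props: "k \<ge> 0 \<Longrightarrow> \<bar>clip k x\<bar> \<le> k" "k \<ge> 0 \<Longrightarrow> \<bar>clip k x\<bar> \<le> \<bar>x\<bar>" "k \<ge> 0 \<Longrightarrow> \<bar>clip k x - x\<bar> \<le> \<bar>x\<bar>" "k \<ge> 0 \<Longrightarrow> clip k 0 = 0"
 "\<bar>x\<bar> \<le> k \<Longrightarrow> clip k x = x"
 by (auto simp: clip_def)

lemma measurable_clip[measurable]: "clip k \<in> borel_measurable borel"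
 unfolding clip_def[abs_def] by measurable

lemma clip_tendsto: "(\<lambda>n. clip (real n) x) \<longlonglongrightarrow> x"
proof (rule tendsto_eventually)
 obtain N :: nat where "\<bar>x\<bar> \<le> real N" using real_arch_simple by blast
 then show "\<forall>\<^sub>F n in sequentially. clip (real n) x = x"
  by (intro eventually_sequentiallyI[of N] clip_props(5)) (simp add: order_trans[of _ "real N"])
qed

lemma nn_powr_clip_tendsto:
 fixes v :: "'x \<Rightarrow> real"
 assumes [measurable]: "v \<in> borel_measurable N" and fin: "pow_int p N v < \<infinity>" and p: "p > 0"
 shows "(\<lambda>k. pow_int p N (\<lambda>x. clip (real k) (v x) - v x)) \<longlonglongrightarrow> 0"
proof -
 have "(\<lambda>k. pow_int p N (\<lambda>x. clip (real k) (v x) - v x)) \<longlonglongrightarrow> (\<integral>\<^sup>+x. 0 \<partial>N)"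
 proof (rule nn_integral_dominated_convergence[OF _ _ _ _ fin])
  show "AE x in N. ennreal (\<bar>clip (real j) (v x) - v x\<bar> powr p) \<le> ennreal (\<bar>v x\<bar> powr p)" for j
   using p clip_props(3)[of "real j"] by (intro AE_I2 ennreal_leI powr_mono2) auto
  have "(\<lambda>k. clip (real k) (v x) - v x) \<longlonglongrightarrow> 0" for x
   using clip_tendsto[of "v x"] by (rule LIM_zero)
  then show "AE x in N. (\<lambda>k. ennreal (\<bar>clip (real k) (v x) - v x\<bar> powr p)) \<longlonglongrightarrow> 0"
   by (intro AE_I2) (simp add: ennreal_powr_tendsto_0_iff[OF p])
 qed measurable
 then show ?thesis by simp
qed

lemma adapted_clip:
 assumes "adapted v" shows "adapted (\<lambda>p. clip k (v p))"
 unfolding adapted_def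
proof
 fix s :: real assume "s \<in> {0..1}"
 then have "(\<lambda>w. v (w, s)) \<in> borel_measurable (F s)" using assms by (simp add: adapted_def)
 from measurable_compose[OF this measurable_clip] show "(\<lambda>w. clip k (v (w, s))) \<in> borel_measurable (F s)" .
qed

lemma simple_approx:
 assumes v[measurable]: "v \<in> borel_measurable P" and fin: "nsq P v < \<infinity>"
  and ad: "adapted v" and t: "0 \<le> t" "t \<le> 1" and z: "\<And>w s. s \<notin> {0..t} \<Longrightarrow> v (w, s) = 0" and e: "e > 0"
 shows "\<exists>n \<tau> \<xi>. simple_process M B t n \<tau> \<xi> \<and> nsq P (\<lambda>p. simple_value n \<tau> \<xi> (snd p) (fst p) - v p) \<le> e"
proof -
 have e4: "e / 4 > 0" using e by (simp add: ennreal_zero_less_divide)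
 have "(\<lambda>k. nsq P (\<lambda>p. clip (real k) (v p) - v p)) \<longlonglongrightarrow> 0"
  using nn_powr_clip_tendsto[of v P 2] fin by simp
 from order_tendstoD(2)[OF this e4]
 obtain k :: nat where k: "nsq P (\<lambda>p. clip (real k) (v p) - v p) < e / 4"
  by (auto simp: eventually_sequentially)
 have "\<exists>n \<tau> \<xi>. simple_process M B t n \<tau> \<xi> \<and> nsq P (\<lambda>p. simple_value n \<tau> \<xi> (snd p) (fst p) - clip (real k) (v p)) \<le> e / 4"
  using clip_props(1)[of "real k"] z
  by (intro simple_approx_bounded[where K="real k"] adapted_clip ad t e4) (auto simp: clip_props(4))
 then obtain n \<tau> \<xi> where s: "simple_process M B t n \<tau> \<xi>" "nsq P (\<lambda>p. simple_value n \<tau> \<xi> (snd p) (fst p) - clip (real k) (v p)) \<le> e / 4"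
  by blast
 note [measurable] = elem_measurable(1)[OF simple_elem[OF s(1) t(2)]]
 have "nsq P (\<lambda>p. simple_value n \<tau> \<xi> (snd p) (fst p) - v p) \<le>
  2 * (nsq P (\<lambda>p. simple_value n \<tau> \<xi> (snd p) (fst p) - clip (real k) (v p)) + nsq P (\<lambda>p. clip (real k) (v p) - v p))"
  by (rule nsq_triangle) measurable
 also have "\<dots> \<le> 2 * (e / 4 + e / 4)" using s(2) k by (intro mult_left_mono add_mono) auto
 also have "\<dots> = (4 * e) / 4" by (simp add: ennreal_times_divide[symmetric] mult_2[symmetric] flip: mult.assoc)
 also have "\<dots> = e" by (subst mult.commute) (simp add: ennreal_mult_divide_eq)
 finally show ?thesis using s(1) by blast
qed

lemma simple_approx_seq:
 assumes v: "v \<in> borel_measurable P" and fin: "nsq P v < \<infinity>"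
  and ad: "adapted v" and t: "0 \<le> t" "t \<le> 1" and z: "\<And>w s. s \<notin> {0..t} \<Longrightarrow> v (w, s) = 0"
 obtains n \<tau> \<xi> X where "\<And>k :: nat. simple_process M B t (n k) (\<tau> k) (\<xi> k)"
  "(\<lambda>k. nsq P (\<lambda>p. simple_value (n k) (\<tau> k) (\<xi> k) (snd p) (fst p) - v p)) \<longlonglongrightarrow> 0"
  "ito v X" "(\<lambda>k. nsq M (\<lambda>w. simple_integral B (n k) (\<tau> k) (\<xi> k) w - X w)) \<longlonglongrightarrow> 0"
proof -
 define Q where "Q k x \<longleftrightarrow> simple_process M B t (fst x) (fst (snd x)) (snd (snd x)) \<and>
  nsq P (\<lambda>p. simple_value (fst x) (fst (snd x)) (snd (snd x)) (snd p) (fst p) - v p) \<le> ennreal ((1/2)^k)"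
  for k :: nat and x :: "nat \<times> (nat \<Rightarrow> real) \<times> (nat \<Rightarrow> 'w \<Rightarrow> real)"
 have "\<exists>x. Q k x" for k
  using simple_approx[OF assms, of "ennreal ((1/2)^k)"] by (auto simp: Q_def)
 then obtain x where x: "\<And>k. Q k (x k)" by metis
 define n where "n k = fst (x k)" for k
 define \<tau> where "\<tau> k = fst (snd (x k))" for k
 define \<xi> where "\<xi> k = snd (snd (x k))" for k
 have s: "simple_process M B t (n k) (\<tau> k) (\<xi> k)" "nsq P (\<lambda>p. simple_value (n k) (\<tau> k) (\<xi> k) (snd p) (fst p) - v p) \<le> ennreal ((1/2)^k)" for k
  using x[of k] by (simp_all add: Q_def n_def \<tau>_def \<xi>_def)
 have lim: "(\<lambda>k. nsq P (\<lambda>p. simple_value (n k) (\<tau> k) (\<xi> k) (snd p) (fst p) - v p)) \<longlonglongrightarrow> 0"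
 proof (rule tendsto_sandwich[OF _ _ tendsto_const])
  show "(\<lambda>k. ennreal ((1/2)^k)) \<longlonglongrightarrow> 0"
   using tendsto_ennrealI[OF LIMSEQ_power_zero[of "1/2::real"]] by simp
 qed (use s(2) in auto)
 obtain X where "ito v X" "(\<lambda>k. nsq M (\<lambda>w. simple_integral B (n k) (\<tau> k) (\<xi> k) w - X w)) \<longlonglongrightarrow> 0"
  using ito_complete[OF elem_ito[OF simple_elem[OF s(1) t(2)]] v lim] by blast
 then show ?thesis using that s(1) lim by blast
qed

lemma ito_exists:
 assumes "v \<in> borel_measurable P" "nsq P v < \<infinity>" "adapted v" "\<And>w s. s \<notin> {0..1} \<Longrightarrow> v (w, s) = 0"
 shows "\<exists>X. ito v X"
 using simple_approx_seq[OF assms(1-3) _ _ assms(4)] by (metis order_refl zero_le_one)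

section \<open>Comparison with the integral used in the statement\<close>

lemma ito_integrable_of_adapted:
 fixes u :: "real \<Rightarrow> 'w \<Rightarrow> real"
 assumes v_def: "v = (\<lambda>p. indicator {0..t} (snd p) * u (snd p) (fst p))"
  and v: "v \<in> borel_measurable P" "nsq P v < \<infinity>" "adapted v" and t: "0 \<le> t" "t \<le> 1"
 shows "ito_integrable M B t u"
proof -
 have z: "v (w, s) = 0" if "s \<notin> {0..t}" for w s using that by (simp add: v_def)
 obtain n \<tau> \<xi> X where s: "\<And>k :: nat. simple_process M B t (n k) (\<tau> k) (\<xi> k)"
  and lim: "(\<lambda>k. nsq P (\<lambda>p. simple_value (n k) (\<tau> k) (\<xi> k) (snd p) (fst p) - v p)) \<longlonglongrightarrow> 0"
  and I: "ito v X" and limX: "(\<lambda>k. nsq M (\<lambda>w. simple_integral B (n k) (\<tau> k) (\<xi> k) w - X w)) \<longlonglongrightarrow> 0"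
  by (rule simple_approx_seq[OF v t z], assumption, rule that) blast+
 note el = simple_elem[OF s t(2)]
 note [measurable] = elem_measurable[OF el] ito_measurable[OF I]
 have pu: "(\<lambda>(w, s). u s w) = (\<lambda>p. u (snd p) (fst p))" by (simp add: case_prod_beta')
 have 1: "(\<lambda>(w, s). u s w) \<in> Lp 2 (M \<Otimes>\<^sub>M dt t)"
  unfolding Lp2_iff measurable_pair_dt nsq_pair_dt pu using v unfolding v_def by auto
 have Xfin: "nsq M X < \<infinity>"
  using ito_norm(1)[OF I] v(2) by (auto simp: ennreal_mult_less_top intro: le_less_trans)
 have 2: "X \<in> Lp 2 M" unfolding Lp2_iff using Xfin ito_measurable[OF I] by auto
 let ?d = "\<lambda>k (w, s). simple_value (n k) (\<tau> k) (\<xi> k) s w - u s w"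
 have deq: "indicator {0..t} (snd p) * ?d k p = indicator {0..t} (snd p) * (simple_value (n k) (\<tau> k) (\<xi> k) (snd p) (fst p) - v p)" for k p
  by (auto simp: v_def indicator_def split: prod.splits)
 have dle: "nsq (M \<Otimes>\<^sub>M dt t) (?d k) \<le> nsq P (\<lambda>p. simple_value (n k) (\<tau> k) (\<xi> k) (snd p) (fst p) - v p)" for k
  unfolding nsq_pair_dt deq by (intro nn_integral_mono ennreal_leI) (auto simp: indicator_def)
 have dfin: "nsq P (\<lambda>p. simple_value (n k) (\<tau> k) (\<xi> k) (snd p) (fst p) - v p) < \<infinity>" for k
  using ito_norm(3)[OF ito_diff[OF elem_ito[OF el] I]] .
 have dL: "?d k \<in> Lp 2 (M \<Otimes>\<^sub>M dt t)" for k
  unfolding Lp2_iff measurable_pair_dt deq using le_less_trans[OF dle dfin] v(1) by auto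
 have 3: "(\<lambda>k. Lp_norm 2 (M \<Otimes>\<^sub>M dt t) (?d k)) \<longlonglongrightarrow> 0"
  unfolding Lp2_norm_tendsto[of ?d, OF dL]
  by (rule tendsto_sandwich[OF _ _ tendsto_const lim]) (use dle in auto)
 have iL: "(\<lambda>w. simple_integral B (n k) (\<tau> k) (\<xi> k) w - X w) \<in> Lp 2 M" for k
 proof -
  have "nsq M (\<lambda>w. simple_integral B (n k) (\<tau> k) (\<xi> k) w - X w) \<le> 4 * nsq P (\<lambda>p. simple_value (n k) (\<tau> k) (\<xi> k) (snd p) (fst p) - v p)"
   by (rule ito_norm(1)[OF ito_diff[OF elem_ito[OF el] I]])
  also have "\<dots> < \<infinity>" using dfin by (simp add: ennreal_mult_less_top)
  finally show ?thesis unfolding Lp2_iff by simp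
 qed
 have 4: "(\<lambda>k. Lp_norm 2 M (\<lambda>w. simple_integral B (n k) (\<tau> k) (\<xi> k) w - X w)) \<longlonglongrightarrow> 0"
  using Lp2_norm_tendsto[of "\<lambda>k w. simple_integral B (n k) (\<tau> k) (\<xi> k) w - X w", OF iL] limX by blast
 have "has_ito_integral M B t u X"
  unfolding has_ito_integral_def using 1 2 3 4 s by blast
 then show ?thesis unfolding ito_integrable_def by blast
qed

text \<open>With \<open>ito_unique\<close> this pins down, up to a null set, the variable that
  \<open>SOME\<close> picks in \<open>ito_integral\<close>.\<close>

lemma has_ito_integral_ito:
 assumes h: "has_ito_integral M B t u X" and t: "0 \<le> t" "t \<le> 1"
 shows "ito (\<lambda>p. indicator {0..t} (snd p) * u (snd p) (fst p)) X"
proof -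
 let ?v = "\<lambda>p. indicator {0..t} (snd p) * u (snd p) (fst p)"
 have pu: "(\<lambda>(w, s). u s w) = (\<lambda>p. u (snd p) (fst p))" by (simp add: case_prod_beta')
 have uL: "?v \<in> borel_measurable P" "nsq P ?v < \<infinity>" and XL: "X \<in> borel_measurable M" "nsq M X < \<infinity>"
  using h unfolding has_ito_integral_def Lp2_iff measurable_pair_dt nsq_pair_dt pu by auto
 obtain n \<tau> \<xi> where s: "\<And>k :: nat. simple_process M B t (n k) (\<tau> k) (\<xi> k)"
  and l1: "(\<lambda>k. Lp_norm 2 (M \<Otimes>\<^sub>M dt t) (\<lambda>(w, s). simple_value (n k) (\<tau> k) (\<xi> k) s w - u s w)) \<longlonglongrightarrow> 0"
  and l2: "(\<lambda>k. Lp_norm 2 M (\<lambda>w. simple_integral B (n k) (\<tau> k) (\<xi> k) w - X w)) \<longlonglongrightarrow> 0"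
  using h unfolding has_ito_integral_def by blast
 note el = simple_elem[OF s t(2)]
 note [measurable] = elem_measurable[OF el] uL(1) XL(1)
 let ?d = "\<lambda>k (w, s). simple_value (n k) (\<tau> k) (\<xi> k) s w - u s w"
 have sz: "simple_value (n k) (\<tau> k) (\<xi> k) s w = 0" if "s \<notin> {0..t}" for k s w
 proof -
  have \<tau>: "\<tau> k 0 = 0" "\<tau> k (n k) = t" and mono: "mono_on {..n k} (\<tau> k)" using s[of k] unfolding simple_process_def by auto
  have "s \<notin> {\<tau> k i<..\<tau> k (Suc i)}" if "i < n k" for i
   using mono_onD[OF mono, of 0 i] mono_onD[OF mono, of "Suc i" "n k"] that \<tau> \<open>s \<notin> {0..t}\<close> by auto
  then show ?thesis unfolding simple_value_def by (intro sum.neutral) auto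
 qed
 have deq: "indicator {0..t} (snd p) * ?d k p = simple_value (n k) (\<tau> k) (\<xi> k) (snd p) (fst p) - ?v p" for k p
  using sz[of "snd p" k "fst p"] by (auto simp: indicator_def split: prod.splits)
 have efin: "nsq P (\<lambda>p. simple_value (n k) (\<tau> k) (\<xi> k) (snd p) (fst p)) < \<infinity>" for k
  using ito_norm(3)[OF elem_ito[OF el]] .
 have dfin: "nsq P (\<lambda>p. simple_value (n k) (\<tau> k) (\<xi> k) (snd p) (fst p) - ?v p) < \<infinity>" for k
 proof -
  have "nsq P (\<lambda>p. simple_value (n k) (\<tau> k) (\<xi> k) (snd p) (fst p) - ?v p) \<le> 2 * (nsq P (\<lambda>p. simple_value (n k) (\<tau> k) (\<xi> k) (snd p) (fst p)) + nsq P (\<lambda>p. - ?v p))"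
   using nsq_add_le[of "\<lambda>p. simple_value (n k) (\<tau> k) (\<xi> k) (snd p) (fst p)" P "\<lambda>p. - ?v p"] by simp
  also have "\<dots> < \<infinity>" using efin uL(2) by (simp add: ennreal_mult_less_top)
  finally show ?thesis .
 qed
 have dL: "?d k \<in> Lp 2 (M \<Otimes>\<^sub>M dt t)" for k
  unfolding Lp2_iff measurable_pair_dt nsq_pair_dt deq using dfin by auto
 have "(\<lambda>k. nsq (M \<Otimes>\<^sub>M dt t) (?d k)) \<longlonglongrightarrow> 0" using l1 Lp2_norm_tendsto[of ?d, OF dL] by blast
 then have 1: "(\<lambda>k. nsq P (\<lambda>p. simple_value (n k) (\<tau> k) (\<xi> k) (snd p) (fst p) - ?v p)) \<longlonglongrightarrow> 0"
  unfolding nsq_pair_dt deq .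
 have sfin: "nsq M (simple_integral B (n k) (\<tau> k) (\<xi> k)) < \<infinity>" for k
  using ito_norm(1)[OF elem_ito[OF el], of k] efin[of k] by (auto simp: ennreal_mult_less_top intro: le_less_trans)
 have iL: "(\<lambda>w. simple_integral B (n k) (\<tau> k) (\<xi> k) w - X w) \<in> Lp 2 M" for k
 proof -
  have "nsq M (\<lambda>w. simple_integral B (n k) (\<tau> k) (\<xi> k) w - X w) \<le> 2 * (nsq M (simple_integral B (n k) (\<tau> k) (\<xi> k)) + nsq M (\<lambda>w. - X w))"
   using nsq_add_le[of "simple_integral B (n k) (\<tau> k) (\<xi> k)" M "\<lambda>w. - X w"] by simp
  also have "\<dots> < \<infinity>" using sfin XL(2) by (simp add: ennreal_mult_less_top)
  finally show ?thesis unfolding Lp2_iff by simp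
 qed
 have 2: "(\<lambda>k. nsq M (\<lambda>w. simple_integral B (n k) (\<tau> k) (\<xi> k) w - X w)) \<longlonglongrightarrow> 0"
  using l2 Lp2_norm_tendsto[of "\<lambda>k w. simple_integral B (n k) (\<tau> k) (\<xi> k) w - X w", OF iL] by blast
 show ?thesis by (rule ito_limit[OF elem_ito[OF el] uL(1) XL(1) 1 2])
qed

end

section \<open>A moment inequality\<close>

text \<open>The mean value theorem at 1, with both signs of z in one formula:
  \<open>\<theta> * z \<ge> 0\<close> records that \<theta> lies on the same side of 0 as z.\<close>

lemma powr_mvt:
 assumes "z > (-1::real)"
 shows "\<exists>\<theta>. \<bar>\<theta>\<bar> \<le> \<bar>z\<bar> \<and> \<theta> * z \<ge> 0 \<and> (1 + z) powr q = 1 + q * (1 + \<theta>) powr (q - 1) * z"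
proof -
 have D: "((\<lambda>x. (1 + x) powr q) has_real_derivative q * (1 + x) powr (q - 1)) (at x)" if "x > -1" for x
  using that by (auto intro!: derivative_eq_intros)
 consider "z = 0" | "z > 0" | "z < 0" by linarith
 then show ?thesis
 proof cases
  case 1
  then show ?thesis by (intro exI[of _ 0]) simp
 next
  case 2
  obtain \<theta> where "0 < \<theta>" "\<theta> < z" "(1 + z) powr q - (1 + 0) powr q = (z - 0) * (q * (1 + \<theta>) powr (q - 1))"
   using MVT2[of 0 z "\<lambda>x. (1 + x) powr q" "\<lambda>x. q * (1 + x) powr (q - 1)"] D 2 by auto
  then show ?thesis using 2 by (intro exI[of _ \<theta>]) (auto simp: algebra_simps)
 next
  case 3
  obtain \<theta> where "z < \<theta>" "\<theta> < 0" "(1 + 0) powr q - (1 + z) powr q = (0 - z) * (q * (1 + \<theta>) powr (q - 1))"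
   using MVT2[of z 0 "\<lambda>x. (1 + x) powr q" "\<lambda>x. q * (1 + x) powr (q - 1)"] D 3 assms by auto
  then show ?thesis using 3 by (intro exI[of _ \<theta>]) (auto simp: algebra_simps mult_nonpos_nonpos)
 qed
qed

text \<open>Second-order expansion of |x|^r for real r \<ge> 2. By homogeneity x = 1 is the main
  case: for small z the mean value theorem is applied twice, for large z the power |z|^r dominates.
  Only the linear term keeps its sign, as it will have mean 0.\<close>

lemma powr_taylor:
 assumes r: "r \<ge> (2::real)"
 obtains c where "c \<ge> 0"
  "\<And>x y. \<bar>x + y\<bar> powr r \<le> \<bar>x\<bar> powr r + r * x * \<bar>x\<bar> powr (r - 2) * y + c * (\<bar>x\<bar> powr (r - 2) * y\<^sup>2 + \<bar>y\<bar> powr r)"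
proof
 \<comment> \<open>For |z| > 1/2 one has |1 + z| \<le> 3 |z|, and 2 r z^2 absorbs the linear term.
   The last summand bounds the Taylor remainder for |z| \<le> 1/2.\<close>
 define c where "c = 3 powr r + 2 * r + r * (r - 1) * 2 powr (r - 2)"
 have nn: "0 \<le> r * (r - 1) * 2 powr (r - 2)" using r by simp
 have "c \<ge> 1" unfolding c_def using nn r ge_one_powr_ge_zero[of 3 r] by linarith
 then have c1: "c \<ge> 1" "c \<ge> 0" by auto
 show "c \<ge> 0" by fact
 have unit: "\<bar>1 + z\<bar> powr r \<le> 1 + r * z + c * (z\<^sup>2 + \<bar>z\<bar> powr r)" for z :: real
 proof (cases "\<bar>z\<bar> \<le> 1/2")
  case False
  have "\<bar>1 + z\<bar> powr r \<le> (3 * \<bar>z\<bar>) powr r" using False r by (intro powr_mono2) auto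
  also have "\<dots> = 3 powr r * \<bar>z\<bar> powr r" by (simp add: powr_mult)
  also have "\<dots> \<le> c * \<bar>z\<bar> powr r" using r by (intro mult_right_mono) (auto simp: c_def)
  finally have 1: "\<bar>1 + z\<bar> powr r \<le> c * \<bar>z\<bar> powr r" .
  have "\<bar>z\<bar> * 1 \<le> \<bar>z\<bar> * (2 * \<bar>z\<bar>)" using False by (intro mult_left_mono) auto
  then have "\<bar>z\<bar> \<le> 2 * z\<^sup>2" by (simp add: power2_eq_square flip: abs_mult)
  then have "- z \<le> 2 * z\<^sup>2" by linarith
  then have "r * (- z) \<le> r * (2 * z\<^sup>2)" using r by (intro mult_left_mono) auto
  moreover have "2 * r * z\<^sup>2 \<le> c * z\<^sup>2" using r by (intro mult_right_mono) (auto simp: c_def)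
  ultimately have "0 \<le> 1 + r * z + c * z\<^sup>2" by simp
  then show ?thesis using 1 by (simp add: distrib_left)
 next
  case True
  then have z1: "z > -1" by auto
  obtain \<theta> where \<theta>: "\<bar>\<theta>\<bar> \<le> \<bar>z\<bar>" "\<theta> * z \<ge> 0" "(1 + z) powr r = 1 + r * (1 + \<theta>) powr (r - 1) * z"
   using powr_mvt[OF z1] by blast
  have "\<theta> > -1" using \<theta>(1) True by auto
  from powr_mvt[OF this, of "r - 1"]
  obtain \<eta> where \<eta>: "\<bar>\<eta>\<bar> \<le> \<bar>\<theta>\<bar>" "(1 + \<theta>) powr (r - 1) = 1 + (r - 1) * (1 + \<eta>) powr (r - 1 - 1) * \<theta>" by blast
  have "(1 + \<eta>) powr (r - 2) \<le> 2 powr (r - 2)" using \<eta>(1) \<theta>(1) True r by (intro powr_mono2) auto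
  moreover have "\<theta> * z \<le> z\<^sup>2"
  proof -
   have "\<bar>\<theta>\<bar> * \<bar>z\<bar> \<le> \<bar>z\<bar> * \<bar>z\<bar>" using \<theta>(1) by (intro mult_right_mono) auto
   then show ?thesis by (simp add: power2_eq_square flip: abs_mult)
  qed
  ultimately have "(1 + \<eta>) powr (r - 2) * (\<theta> * z) \<le> 2 powr (r - 2) * z\<^sup>2" using \<theta>(2) by (intro mult_mono) auto
  then have 1: "r * (r - 1) * ((1 + \<eta>) powr (r - 2) * (\<theta> * z)) \<le> r * (r - 1) * (2 powr (r - 2) * z\<^sup>2)"
   using r by (intro mult_left_mono) auto
  have "\<bar>1 + z\<bar> powr r = 1 + r * z + r * (r - 1) * ((1 + \<eta>) powr (r - 2) * (\<theta> * z))"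
   using z1 \<theta>(3) \<eta>(2) by (simp add: algebra_simps)
  also have "\<dots> \<le> 1 + r * z + r * (r - 1) * 2 powr (r - 2) * z\<^sup>2" using 1 by (simp add: mult.assoc)
  also have "r * (r - 1) * 2 powr (r - 2) * z\<^sup>2 \<le> c * z\<^sup>2" using r by (intro mult_right_mono) (auto simp: c_def)
  finally have "\<bar>1 + z\<bar> powr r \<le> 1 + r * z + c * z\<^sup>2" by simp
  moreover have "0 \<le> c * \<bar>z\<bar> powr r" using c1 by simp
  ultimately show ?thesis by (simp add: distrib_left)
 qed
 fix x y :: real
 show "\<bar>x + y\<bar> powr r \<le> \<bar>x\<bar> powr r + r * x * \<bar>x\<bar> powr (r - 2) * y + c * (\<bar>x\<bar> powr (r - 2) * y\<^sup>2 + \<bar>y\<bar> powr r)"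
 proof (cases "x = 0")
  case True
  have "1 * \<bar>y\<bar> powr r \<le> c * \<bar>y\<bar> powr r" using c1 by (intro mult_right_mono) auto
  then show ?thesis using True by simp
 next
  case False
  define z where "z = y / x"
  have y: "y = x * z" using False by (simp add: z_def)
  have x2: "\<bar>x\<bar> powr (r - 2) * x\<^sup>2 = \<bar>x\<bar> powr r"
  proof -
   have "\<bar>x\<bar> powr (r - 2) * \<bar>x\<bar> powr 2 = \<bar>x\<bar> powr r" by (simp only: powr_add[symmetric]) simp
   then show ?thesis using False by simp
  qed
  have "\<bar>x + y\<bar> powr r = \<bar>x\<bar> powr r * \<bar>1 + z\<bar> powr r"
  proof -
   have "\<bar>x + y\<bar> = \<bar>x\<bar> * \<bar>1 + z\<bar>" unfolding y by (simp add: distrib_left flip: abs_mult)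
   then show ?thesis by (simp add: powr_mult)
  qed
  also have "\<dots> \<le> \<bar>x\<bar> powr r * (1 + r * z + c * (z\<^sup>2 + \<bar>z\<bar> powr r))"
   by (intro mult_left_mono unit) auto
  also have "\<dots> = \<bar>x\<bar> powr r + r * (\<bar>x\<bar> powr r * z) + c * (\<bar>x\<bar> powr r * z\<^sup>2 + \<bar>x\<bar> powr r * \<bar>z\<bar> powr r)"
   by (simp add: algebra_simps)
  also have "\<bar>x\<bar> powr r * \<bar>z\<bar> powr r = \<bar>y\<bar> powr r" unfolding y by (simp add: abs_mult powr_mult)
  also have "\<bar>x\<bar> powr r * z\<^sup>2 = \<bar>x\<bar> powr (r - 2) * y\<^sup>2" unfolding y x2[symmetric] by (simp add: power_mult_distrib)
  also have "\<bar>x\<bar> powr r * z = x * \<bar>x\<bar> powr (r - 2) * y" unfolding y x2[symmetric] by (simp add: power2_eq_square)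
  finally show ?thesis by (simp add: mult.assoc)
 qed
qed

lemma powr_young:
 fixes a b r :: real
 assumes "r \<ge> 2" "a \<ge> 0" "b \<ge> 0"
 shows "a powr (r - 2) * b\<^sup>2 \<le> a powr r + b powr r"
proof (cases "a = 0 \<or> b = 0")
 case False
 then have pos: "a > 0" "b > 0" using assms by auto
 define m where "m = max a b"
 have "a powr (r - 2) * b powr 2 \<le> m powr (r - 2) * m powr 2"
  using assms by (intro mult_mono powr_mono2) (auto simp: m_def)
 also have "\<dots> = m powr r" by (simp flip: powr_add)
 also have "\<dots> \<le> a powr r + b powr r" by (auto simp: m_def max_def)
 finally show ?thesis using pos by simp
qed (use assms in auto)

lemma powr_le_one_plus:
 fixes x p q :: real
 assumes "0 \<le> p" "p \<le> q"
 shows "\<bar>x\<bar> powr p \<le> 1 + \<bar>x\<bar> powr q"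
proof (cases "\<bar>x\<bar> \<le> 1")
 case True
 then have "\<bar>x\<bar> powr p \<le> 1" using assms by (intro powr_le1) auto
 then show ?thesis by (simp add: add_increasing2)
next
 case False
 then have "\<bar>x\<bar> powr p \<le> \<bar>x\<bar> powr q" using assms by (intro powr_mono) auto
 then show ?thesis by simp
qed

context brownian
begin

section \<open>The inequality for finite sums\<close>

lemma integrable_bounded_mult:
 fixes f g :: "'w \<Rightarrow> real"
 assumes "integrable M g" "f \<in> borel_measurable M" "\<And>w. w \<in> space M \<Longrightarrow> \<bar>f w\<bar> \<le> K"
 shows "integrable M (\<lambda>w. f w * g w)"
proof (rule Bochner_Integration.integrable_bound)
 show "integrable M (\<lambda>w. K * g w)" using assms(1) by simp
 have "K \<ge> 0" using assms(3) not_empty by (metis abs_ge_zero all_not_in_conv order_trans)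
 then show "AE w in M. norm (f w * g w) \<le> norm (K * g w)"
  using assms(3) by (intro AE_I2) (auto simp: abs_mult intro: mult_right_mono)
 have "g \<in> borel_measurable M" using assms(1) by auto
 then show "(\<lambda>w. f w * g w) \<in> borel_measurable M" using assms(2) by measurable
qed

text \<open>The linear Taylor term has mean 0. In the quadratic term \<open>powr_young\<close>
  separates X from \<xi>. The last term carries W^(r/2) with W = h^2 (t - s), which is at most W
  because W \<le> 1 and r \<ge> 2.\<close>

lemma martingale_moment_step:
 assumes r: "r \<ge> 2" and c: "c \<ge> 0"
  and taylor: "\<And>x y. \<bar>x + y\<bar> powr r \<le> \<bar>x\<bar> powr r + r * x * \<bar>x\<bar> powr (r - 2) * y + c * (\<bar>x\<bar> powr (r - 2) * y\<^sup>2 + \<bar>y\<bar> powr r)"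
  and st: "0 \<le> s" "s \<le> t" "t \<le> 1" and X: "X \<in> borel_measurable (F s)" "integrable M (\<lambda>w. \<bar>X w\<bar> powr r)"
  and \<xi>: "\<xi> \<in> borel_measurable (F s)" "\<And>w. w \<in> space M \<Longrightarrow> \<bar>\<xi> w\<bar> \<le> K" and wt: "h\<^sup>2 * (t - s) \<le> 1"
 defines "\<mu> \<equiv> (LINT x|lborel. std_normal_density x * \<bar>x\<bar> powr r)"
 shows "integrable M (\<lambda>w. \<bar>X w + h * \<xi> w * (B t w - B s w)\<bar> powr r)"
  "moment r M (\<lambda>w. X w + h * \<xi> w * (B t w - B s w)) \<le>
   (1 + c * (h\<^sup>2 * (t - s))) * moment r M X + c * (1 + \<mu>) * (h\<^sup>2 * (t - s)) * moment r M \<xi>"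
proof -
 let ?\<Delta> = "\<lambda>w. B t w - B s w"
 have s1: "s \<le> 1" using st by auto
 note XM[measurable] = measurable_F_M[OF X(1) s1] and \<xi>M[measurable] = measurable_F_M[OF \<xi>(1) s1]
 have [measurable]: "B t \<in> borel_measurable M" "B s \<in> borel_measurable M" using st by (auto intro: B_measurable)
 have K0: "K \<ge> 0" using \<xi>(2) not_empty by (metis abs_ge_zero all_not_in_conv order_trans)
 have iX: "integrable M (\<lambda>w. \<bar>X w\<bar> powr p)" if "0 \<le> p" "p \<le> r" for p
 proof (rule Bochner_Integration.integrable_bound)
  show "integrable M (\<lambda>w. 1 + \<bar>X w\<bar> powr r)" using X(2) by simp
  show "AE w in M. norm (\<bar>X w\<bar> powr p) \<le> norm (1 + \<bar>X w\<bar> powr r)"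
   using powr_le_one_plus[OF that] by (intro AE_I2) (simp add: abs_of_nonneg add_nonneg_nonneg)
 qed measurable
 have i\<xi>: "integrable M (\<lambda>w. \<bar>\<xi> w\<bar> powr r)"
  using \<xi>(2) r by (intro integrable_const_bound[where B="K powr r"]) (auto intro!: AE_I2 powr_mono2)
 define \<zeta>1 where "\<zeta>1 w = \<xi> w * (r * h * (X w * \<bar>X w\<bar> powr (r - 2)))" for w
 define \<zeta>2 where "\<zeta>2 w = (\<xi> w)\<^sup>2 * (h\<^sup>2 * \<bar>X w\<bar> powr (r - 2))" for w
 define \<zeta>3 where "\<zeta>3 w = \<bar>h\<bar> powr r * \<bar>\<xi> w\<bar> powr r" for w
 have ax: "\<bar>x * \<bar>x\<bar> powr (r - 2)\<bar> = \<bar>x\<bar> powr (r - 1)" for x :: real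
  using powr_mult_base[of "\<bar>x\<bar>" "r - 2"] by (simp add: abs_mult)
 have iX1: "integrable M (\<lambda>w. X w * \<bar>X w\<bar> powr (r - 2))"
  by (rule Bochner_Integration.integrable_bound[OF iX[of "r - 1"]]) (use r ax in auto)
 have \<zeta>F: "\<zeta>1 \<in> borel_measurable (F s)" "\<zeta>2 \<in> borel_measurable (F s)" "\<zeta>3 \<in> borel_measurable (F s)"
  unfolding \<zeta>1_def[abs_def] \<zeta>2_def[abs_def] \<zeta>3_def[abs_def] using X(1) \<xi>(1) by measurable
 have i1: "integrable M \<zeta>1" unfolding \<zeta>1_def[abs_def]
  by (rule integrable_bounded_mult[OF _ \<xi>M \<xi>(2)]) (use iX1 in auto)
 have \<xi>2: "\<bar>(\<xi> w)\<^sup>2\<bar> \<le> K\<^sup>2" if "w \<in> space M" for w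
  using power_mono[OF \<xi>(2)[OF that], of 2] by simp
 have i2: "integrable M \<zeta>2" unfolding \<zeta>2_def[abs_def]
  by (rule integrable_bounded_mult[where K="K\<^sup>2"]) (use iX[of "r - 2"] r \<xi>2 in auto)
 have i3: "integrable M \<zeta>3" unfolding \<zeta>3_def[abs_def] using i\<xi> by simp
 note p1 = increment_orthogonal[OF st \<zeta>F(1) i1]
 note p2 = increment_square_product[OF st \<zeta>F(2) i2]
 have p3: "integrable M (\<lambda>w. \<zeta>3 w * \<bar>?\<Delta> w\<bar> powr r)"
  "(LINT w|M. \<zeta>3 w * \<bar>?\<Delta> w\<bar> powr r) = (LINT w|M. \<zeta>3 w) * ((t - s) powr (r / 2) * \<mu>)"
  using increment_product[OF st \<zeta>F(3) i3, of "\<lambda>x. \<bar>x\<bar> powr r"] increment_moment[OF st, of r] r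
  by (auto simp: \<mu>_def)
 let ?R = "\<lambda>w. \<bar>X w\<bar> powr r + \<zeta>1 w * ?\<Delta> w + c * (\<zeta>2 w * (?\<Delta> w)\<^sup>2 + \<zeta>3 w * \<bar>?\<Delta> w\<bar> powr r)"
 have le: "\<bar>X w + h * \<xi> w * ?\<Delta> w\<bar> powr r \<le> ?R w" for w
  using taylor[of "X w" "h * \<xi> w * ?\<Delta> w"]
  by (simp add: \<zeta>1_def \<zeta>2_def \<zeta>3_def power_mult_distrib abs_mult powr_mult mult_ac)
 have iR: "integrable M ?R" using X(2) p1(1) p2(1) p3(1) by simp
 show int: "integrable M (\<lambda>w. \<bar>X w + h * \<xi> w * ?\<Delta> w\<bar> powr r)"
  by (rule Bochner_Integration.integrable_bound[OF iR]) (use le in \<open>auto intro!: AE_I2 intro: order_trans[OF _ abs_ge_self]\<close>)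
 define e x where "e = moment r M X" and "x = moment r M \<xi>"
 define W where "W = h\<^sup>2 * (t - s)"
 have W: "0 \<le> W" "W \<le> 1" using st wt by (auto simp: W_def)
 have x0: "x \<ge> 0" unfolding x_def by (rule Bochner_Integration.integral_nonneg) simp
 have \<mu>0: "\<mu> \<ge> 0" unfolding \<mu>_def by (rule Bochner_Integration.integral_nonneg) simp
 have "moment r M (\<lambda>w. X w + h * \<xi> w * ?\<Delta> w) \<le> (LINT w|M. ?R w)"
  using int iR le by (rule integral_mono)
 also have "\<dots> = e + c * ((LINT w|M. \<zeta>2 w) * (t - s) + (LINT w|M. \<zeta>3 w) * ((t - s) powr (r / 2) * \<mu>))"
  using X(2) p1 p2 p3 by (simp add: e_def)
 also have "(LINT w|M. \<zeta>2 w) * (t - s) \<le> W * (e + x)"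
 proof -
  have "(LINT w|M. \<zeta>2 w) \<le> (LINT w|M. h\<^sup>2 * (\<bar>X w\<bar> powr r + \<bar>\<xi> w\<bar> powr r))"
  proof (rule integral_mono[OF i2])
   show "integrable M (\<lambda>w. h\<^sup>2 * (\<bar>X w\<bar> powr r + \<bar>\<xi> w\<bar> powr r))" using X(2) i\<xi> by simp
   fix w
   have "h\<^sup>2 * (\<bar>X w\<bar> powr (r - 2) * \<bar>\<xi> w\<bar>\<^sup>2) \<le> h\<^sup>2 * (\<bar>X w\<bar> powr r + \<bar>\<xi> w\<bar> powr r)"
    using powr_young[OF r, of "\<bar>X w\<bar>" "\<bar>\<xi> w\<bar>"] by (intro mult_left_mono) auto
   then show "\<zeta>2 w \<le> h\<^sup>2 * (\<bar>X w\<bar> powr r + \<bar>\<xi> w\<bar> powr r)" by (simp add: \<zeta>2_def mult_ac)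
  qed
  also have "\<dots> = h\<^sup>2 * (e + x)" using X(2) i\<xi> by (simp add: e_def x_def)
  finally have "(LINT w|M. \<zeta>2 w) * (t - s) \<le> h\<^sup>2 * (e + x) * (t - s)" using st by (intro mult_right_mono) auto
  then show ?thesis by (simp add: W_def mult_ac)
 qed
 also have "(LINT w|M. \<zeta>3 w) * ((t - s) powr (r / 2) * \<mu>) \<le> W * x * \<mu>"
 proof -
  have "\<bar>h\<bar> powr r * (t - s) powr (r / 2) = W powr (r / 2)"
  proof (cases "h = 0")
   case False
   have "\<bar>h\<bar> powr r = (\<bar>h\<bar> powr 2) powr (r / 2)" by (simp only: powr_powr) simp
   then have "\<bar>h\<bar> powr r = (h\<^sup>2) powr (r / 2)" using False by simp
   then show ?thesis using st by (simp add: W_def powr_mult)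
  qed (use r in \<open>simp add: W_def\<close>)
  also have "\<dots> \<le> W powr 1" using W r by (intro powr_mono') auto
  finally have "\<bar>h\<bar> powr r * (t - s) powr (r / 2) \<le> W" using W by simp
  then have "\<bar>h\<bar> powr r * (t - s) powr (r / 2) * (x * \<mu>) \<le> W * (x * \<mu>)" using x0 \<mu>0 by (intro mult_right_mono) auto
  moreover have "(LINT w|M. \<zeta>3 w) = \<bar>h\<bar> powr r * x" by (simp add: \<zeta>3_def x_def)
  ultimately show ?thesis by (simp add: mult_ac)
 qed
 finally have "moment r M (\<lambda>w. X w + h * \<xi> w * ?\<Delta> w) \<le> e + c * (W * (e + x) + W * x * \<mu>)"
  using c by (simp add: mult_left_mono)
 also have "\<dots> = (1 + c * W) * e + c * (1 + \<mu>) * W * x" by (simp add: algebra_simps)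
 finally show "moment r M (\<lambda>w. X w + h * \<xi> w * ?\<Delta> w) \<le>
   (1 + c * (h\<^sup>2 * (t - s))) * moment r M X + c * (1 + \<mu>) * (h\<^sup>2 * (t - s)) * moment r M \<xi>"
  by (simp add: W_def e_def x_def)
qed

abbreviation dsum :: "nat \<Rightarrow> (nat \<Rightarrow> real) \<Rightarrow> (nat \<Rightarrow> real) \<Rightarrow> (nat \<Rightarrow> 'w \<Rightarrow> real) \<Rightarrow> 'w \<Rightarrow> real" where
 "dsum N \<tau> h \<xi> w \<equiv> \<Sum>i<N. h i * \<xi> i w * (B (\<tau> (Suc i)) w - B (\<tau> i) w)"

abbreviation dmass :: "nat \<Rightarrow> (nat \<Rightarrow> real) \<Rightarrow> (nat \<Rightarrow> real) \<Rightarrow> real" where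
 "dmass N \<tau> h \<equiv> \<Sum>i<N. (h i)\<^sup>2 * (\<tau> (Suc i) - \<tau> i)"

text \<open>Discrete Gronwall: each step multiplies the moment by 1 + c w \<le> exp (c w), and the
  weights w add up to at most 1.\<close>

lemma discrete_moment:
 assumes r: "r \<ge> 2"
 obtains C where "C \<ge> 0"
  "\<And>N \<tau> h \<xi> K. mono_on {..N} \<tau> \<Longrightarrow> \<tau> ` {..N} \<subseteq> {0..1} \<Longrightarrow> (\<And>i. i < N \<Longrightarrow> \<xi> i \<in> borel_measurable (F (\<tau> i))) \<Longrightarrow>
   (\<And>i w. i < N \<Longrightarrow> w \<in> space M \<Longrightarrow> \<bar>\<xi> i w\<bar> \<le> K) \<Longrightarrow> (dmass N \<tau> h) \<le> 1 \<Longrightarrow>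
   integrable M (\<lambda>w. \<bar>dsum N \<tau> h \<xi> w\<bar> powr r) \<and>
   moment r M (dsum N \<tau> h \<xi>) \<le>
    C * (\<Sum>i<N. (h i)\<^sup>2 * (\<tau> (Suc i) - \<tau> i) * moment r M (\<xi> i))"
proof -
 obtain c where c: "c \<ge> 0" and taylor: "\<And>x y. \<bar>x + y\<bar> powr r \<le> \<bar>x\<bar> powr r + r * x * \<bar>x\<bar> powr (r - 2) * y + c * (\<bar>x\<bar> powr (r - 2) * y\<^sup>2 + \<bar>y\<bar> powr r)"
  using powr_taylor[OF r] by blast
 define \<mu> where "\<mu> = (LINT x|lborel. std_normal_density x * \<bar>x\<bar> powr r)"
 have \<mu>0: "\<mu> \<ge> 0" unfolding \<mu>_def by (rule Bochner_Integration.integral_nonneg) simp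
 show ?thesis
 proof (rule that[of "exp c * (c * (1 + \<mu>))"])
  show "exp c * (c * (1 + \<mu>)) \<ge> 0" using c \<mu>0 by simp
  fix N :: nat and \<tau> h :: "nat \<Rightarrow> real" and \<xi> :: "nat \<Rightarrow> 'w \<Rightarrow> real" and K :: real
  assume mono: "mono_on {..N} \<tau>" and t01: "\<tau> ` {..N} \<subseteq> {0..1}" and \<xi>: "\<And>i. i < N \<Longrightarrow> \<xi> i \<in> borel_measurable (F (\<tau> i))"
   and K: "\<And>i w. i < N \<Longrightarrow> w \<in> space M \<Longrightarrow> \<bar>\<xi> i w\<bar> \<le> K" and W1: "(dmass N \<tau> h) \<le> 1"
  define wt where "wt i = (h i)\<^sup>2 * (\<tau> (Suc i) - \<tau> i)" for i
  define x where "x i = moment r M (\<xi> i)" for i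
  define X where "X n w = (\<Sum>i<n. h i * \<xi> i w * (B (\<tau> (Suc i)) w - B (\<tau> i) w))" for n w
  have inc: "\<tau> i \<le> \<tau> (Suc i)" if "i < N" for i using that by (intro mono_onD[OF mono]) auto
  have T: "0 \<le> \<tau> i" "\<tau> i \<le> 1" if "i \<le> N" for i using t01 that by auto
  have w0: "wt i \<ge> 0" if "i < N" for i using inc[OF that] by (simp add: wt_def)
  have x0: "x i \<ge> 0" for i unfolding x_def by (rule Bochner_Integration.integral_nonneg) simp
  have sw: "(\<Sum>i<n. wt i) \<le> 1" if "n \<le> N" for n
   using that w0 W1 sum_mono2[of "{..<N}" "{..<n}" wt] by (auto simp: wt_def)
  have "n \<le> N \<Longrightarrow> X n \<in> borel_measurable (F (\<tau> n)) \<and> integrable M (\<lambda>w. \<bar>X n w\<bar> powr r) \<and>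
   moment r M (X n) \<le> exp (c * (\<Sum>i<n. wt i)) * (c * (1 + \<mu>) * (\<Sum>i<n. wt i * x i))" for n
  proof (induction n)
   case 0
   have "X 0 = (\<lambda>w. 0)" by (simp add: X_def[abs_def])
   then show ?case using r by simp
  next
   case (Suc n)
   then have n: "n < N" and IH: "X n \<in> borel_measurable (F (\<tau> n))" "integrable M (\<lambda>w. \<bar>X n w\<bar> powr r)"
    "moment r M (X n) \<le> exp (c * (\<Sum>i<n. wt i)) * (c * (1 + \<mu>) * (\<Sum>i<n. wt i * x i))" by auto
   have XS: "X (Suc n) = (\<lambda>w. X n w + h n * \<xi> n w * (B (\<tau> (Suc n)) w - B (\<tau> n) w))"
    by (simp add: X_def[abs_def])
   have "0 \<le> (\<Sum>i<n. wt i)" using w0 n by (intro sum_nonneg) auto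
   then have "wt n \<le> (\<Sum>i<Suc n. wt i)" by simp
   then have wn: "wt n \<le> 1" using sw[of "Suc n"] n by simp
   have Tn: "0 \<le> \<tau> n" "\<tau> (Suc n) \<le> 1" using T[of n] T[of "Suc n"] n by auto
   note step = martingale_moment_step[OF r c taylor Tn(1) inc[OF n] Tn(2) IH(1,2) \<xi>[OF n] K[OF n], of "h n", folded \<mu>_def]
   have s1: "integrable M (\<lambda>w. \<bar>X (Suc n) w\<bar> powr r)"
    "moment r M (X (Suc n)) \<le> (1 + c * wt n) * moment r M (X n) + c * (1 + \<mu>) * wt n * x n"
    unfolding XS using step n wn by (auto simp: wt_def x_def)
   have m: "X (Suc n) \<in> borel_measurable (F (\<tau> (Suc n)))"
   proof -
    have "X n \<in> borel_measurable (F (\<tau> (Suc n)))" "\<xi> n \<in> borel_measurable (F (\<tau> (Suc n)))"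
     using measurable_F_mono[OF IH(1) inc[OF n]] measurable_F_mono[OF \<xi>[OF n] inc[OF n]] by auto
    moreover have "B (\<tau> (Suc n)) \<in> borel_measurable (F (\<tau> (Suc n)))" "B (\<tau> n) \<in> borel_measurable (F (\<tau> (Suc n)))"
     using T n inc[OF n] by (auto intro!: B_measurable_F)
    ultimately show ?thesis unfolding XS by measurable
   qed
   let ?S = "\<Sum>i<n. wt i" and ?T = "\<Sum>i<n. wt i * x i"
   have S0: "?S \<ge> 0" "?T \<ge> 0" using w0 x0 n by (auto intro!: sum_nonneg)
   have g0: "c * (1 + \<mu>) \<ge> 0" using c \<mu>0 by simp
   have "(1 + c * wt n) * moment r M (X n) \<le> exp (c * wt n) * (exp (c * ?S) * (c * (1 + \<mu>) * ?T))"
    using IH(3) c w0[OF n] exp_ge_add_one_self[of "c * wt n"] S0 g0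
    by (intro mult_mono) (auto intro!: Bochner_Integration.integral_nonneg)
   also have "\<dots> = exp (c * (?S + wt n)) * (c * (1 + \<mu>) * ?T)" by (simp add: exp_add distrib_left)
   finally have 1: "(1 + c * wt n) * moment r M (X n) \<le> exp (c * (?S + wt n)) * (c * (1 + \<mu>) * ?T)" .
   have "1 * (c * (1 + \<mu>) * (wt n * x n)) \<le> exp (c * (?S + wt n)) * (c * (1 + \<mu>) * (wt n * x n))"
    using c S0 w0[OF n] x0 g0 by (intro mult_right_mono) (auto intro!: mult_nonneg_nonneg)
   then have "moment r M (X (Suc n)) \<le> exp (c * (?S + wt n)) * (c * (1 + \<mu>) * ?T) + exp (c * (?S + wt n)) * (c * (1 + \<mu>) * (wt n * x n))"
    using s1(2) 1 by (simp add: mult.assoc)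
   then show ?case using m s1(1) by (simp add: distrib_left)
  qed
  from this[of N] have N: "integrable M (\<lambda>w. \<bar>X N w\<bar> powr r)"
   "moment r M (X N) \<le> exp (c * (\<Sum>i<N. wt i)) * (c * (1 + \<mu>) * (\<Sum>i<N. wt i * x i))" by auto
  have "c * (\<Sum>i<N. wt i) \<le> c * 1" using sw[of N] c by (intro mult_left_mono) auto
  then have "exp (c * (\<Sum>i<N. wt i)) * (c * (1 + \<mu>) * (\<Sum>i<N. wt i * x i)) \<le> exp c * (c * (1 + \<mu>) * (\<Sum>i<N. wt i * x i))"
   using c \<mu>0 w0 x0 by (intro mult_right_mono mult_nonneg_nonneg sum_nonneg) auto
  with N show "integrable M (\<lambda>w. \<bar>dsum N \<tau> h \<xi> w\<bar> powr r) \<and>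
   moment r M (dsum N \<tau> h \<xi>) \<le>
    exp c * (c * (1 + \<mu>)) * (\<Sum>i<N. (h i)\<^sup>2 * (\<tau> (Suc i) - \<tau> i) * moment r M (\<xi> i))"
   by (simp add: X_def wt_def x_def mult.assoc)
 qed
qed

text \<open>Homogeneity removes the restriction on the total weight W: dividing h by sqrt W costs
  W^(r/2) on the left and gains 1 / W on the right, which leaves the exponent r/2 - 1.\<close>

lemma discrete_moment_scaled:
 assumes r: "r \<ge> 2"
 obtains C where "C \<ge> 0"
  "\<And>N \<tau> h \<xi> K. mono_on {..N} \<tau> \<Longrightarrow> \<tau> ` {..N} \<subseteq> {0..1} \<Longrightarrow> (\<And>i. i < N \<Longrightarrow> \<xi> i \<in> borel_measurable (F (\<tau> i))) \<Longrightarrow>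
   (\<And>i w. i < N \<Longrightarrow> w \<in> space M \<Longrightarrow> \<bar>\<xi> i w\<bar> \<le> K) \<Longrightarrow>
   pow_int r M (dsum N \<tau> h \<xi>) \<le>
    ennreal (C * (dmass N \<tau> h) powr (r / 2 - 1) *
     (\<Sum>i<N. (h i)\<^sup>2 * (\<tau> (Suc i) - \<tau> i) * moment r M (\<xi> i)))"
proof -
 obtain C where C: "C \<ge> 0"
  and base: "\<And>N \<tau> h \<xi> K. mono_on {..N} \<tau> \<Longrightarrow> \<tau> ` {..N} \<subseteq> {0..1} \<Longrightarrow> (\<And>i. i < N \<Longrightarrow> \<xi> i \<in> borel_measurable (F (\<tau> i))) \<Longrightarrow>
   (\<And>i w. i < N \<Longrightarrow> w \<in> space M \<Longrightarrow> \<bar>\<xi> i w\<bar> \<le> K) \<Longrightarrow> (dmass N \<tau> h) \<le> 1 \<Longrightarrow>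
   integrable M (\<lambda>w. \<bar>dsum N \<tau> h \<xi> w\<bar> powr r) \<and>
   moment r M (dsum N \<tau> h \<xi>) \<le>
    C * (\<Sum>i<N. (h i)\<^sup>2 * (\<tau> (Suc i) - \<tau> i) * moment r M (\<xi> i))"
  by (rule discrete_moment[OF r], rule that) blast+
 show ?thesis
 proof (rule that[OF C])
  fix N :: nat and \<tau> h :: "nat \<Rightarrow> real" and \<xi> :: "nat \<Rightarrow> 'w \<Rightarrow> real" and K :: real
  assume mono: "mono_on {..N} \<tau>" and t01: "\<tau> ` {..N} \<subseteq> {0..1}" and \<xi>: "\<And>i. i < N \<Longrightarrow> \<xi> i \<in> borel_measurable (F (\<tau> i))"
   and K: "\<And>i w. i < N \<Longrightarrow> w \<in> space M \<Longrightarrow> \<bar>\<xi> i w\<bar> \<le> K"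
  define W where "W = (dmass N \<tau> h)"
  let ?X = "\<lambda>w. dsum N \<tau> h \<xi> w"
  let ?S = "\<Sum>i<N. (h i)\<^sup>2 * (\<tau> (Suc i) - \<tau> i) * moment r M (\<xi> i)"
  have w0: "(h i)\<^sup>2 * (\<tau> (Suc i) - \<tau> i) \<ge> 0" if "i < N" for i
   using that mono_onD[OF mono, of i "Suc i"] by auto
  have "W \<ge> 0" unfolding W_def using w0 by (intro sum_nonneg) auto
  show "pow_int r M ?X \<le> ennreal (C * W powr (r / 2 - 1) * ?S)"
  proof (cases "W = 0")
   case True
   have "(h i)\<^sup>2 * (\<tau> (Suc i) - \<tau> i) = 0" if "i < N" for i
    using True w0 that unfolding W_def by (subst (asm) sum_nonneg_eq_0_iff) auto
   then have "h i * \<xi> i w * (B (\<tau> (Suc i)) w - B (\<tau> i) w) = 0" if "i < N" for i w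
    using that by force
   then have "?X w = 0" for w by (intro sum.neutral) auto
   then show ?thesis using r by simp
  next
   case False
   with \<open>W \<ge> 0\<close> have W: "W > 0" by simp
   define k where "k i = h i / sqrt W" for i
   have k2: "(k i)\<^sup>2 = (h i)\<^sup>2 / W" for i using W by (simp add: k_def power_divide)
   have "(\<Sum>i<N. (k i)\<^sup>2 * (\<tau> (Suc i) - \<tau> i)) = (dmass N \<tau> h) / W"
    unfolding k2 by (simp add: sum_divide_distrib)
   then have "(\<Sum>i<N. (k i)\<^sup>2 * (\<tau> (Suc i) - \<tau> i)) = W / W" by (simp only: W_def)
   then have k1: "(\<Sum>i<N. (k i)\<^sup>2 * (\<tau> (Suc i) - \<tau> i)) \<le> 1" using W by simp
   let ?Y = "\<lambda>w. \<Sum>i<N. k i * \<xi> i w * (B (\<tau> (Suc i)) w - B (\<tau> i) w)"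
   have Y: "integrable M (\<lambda>w. \<bar>?Y w\<bar> powr r)"
    "moment r M ?Y \<le> C * (\<Sum>i<N. (k i)\<^sup>2 * (\<tau> (Suc i) - \<tau> i) * moment r M (\<xi> i))"
    using base[OF mono t01 \<xi> K k1] by auto
   have XY: "\<bar>?X w\<bar> powr r = W powr (r / 2) * \<bar>?Y w\<bar> powr r" for w
   proof -
    have "?X w = sqrt W * ?Y w" using W by (simp add: k_def sum_distrib_left)
    then have "\<bar>?X w\<bar> powr r = sqrt W powr r * \<bar>?Y w\<bar> powr r" using W by (simp add: abs_mult powr_mult)
    also have "sqrt W powr r = W powr (r / 2)" using W by (simp add: powr_half_sqrt[symmetric] powr_powr)
    finally show ?thesis .
   qed
   have "pow_int r M ?X = ennreal (W powr (r / 2) * moment r M ?Y)"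
    unfolding XY using Y(1) by (subst nn_integral_eq_integral) auto
   also have "\<dots> \<le> ennreal (W powr (r / 2) * (C * (\<Sum>i<N. (k i)\<^sup>2 * (\<tau> (Suc i) - \<tau> i) * moment r M (\<xi> i))))"
    using Y(2) by (intro ennreal_leI mult_left_mono) auto
   also have "(\<Sum>i<N. (k i)\<^sup>2 * (\<tau> (Suc i) - \<tau> i) * moment r M (\<xi> i)) = ?S / W"
    unfolding k2 by (simp add: sum_divide_distrib)
   also have "W powr (r / 2) * (C * (?S / W)) = C * W powr (r / 2 - 1) * ?S"
    using W by (simp add: powr_diff)
   finally show ?thesis .
  qed
 qed
qed

end

section \<open>The inequality for dyadic integrands\<close>

lemma dyi_nn_integral: "(\<integral>\<^sup>+s. ennreal (dyi n j s) \<partial>lborel) = ennreal (1 / 2^n)"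
 using dyi_integral[of n j] dyi_nonneg[of n j] by (subst nn_integral_eq_integral) auto

context brownian
begin

lemma dyadic_elem:
 assumes v: "v \<in> borel_measurable P" and K: "\<And>w s. w \<in> space M \<Longrightarrow> \<bar>v (w, s)\<bar> \<le> K"
  and ad: "adapted v"
 defines "\<xi> \<equiv> \<lambda>m j w. if j = 0 then 0 else 2^m * (LINT s|lborel. v (w, s) * dyi m (j - 1) s)"
 shows "j < 2^m \<Longrightarrow> h j * \<xi> m j w = h j * (if j = 0 then 0 else 2^m * (LINT s|lborel. v (w, s) * dyi m (j - 1) s))"
  and "j < 2^m \<Longrightarrow> \<xi> m j \<in> borel_measurable (F (real j / 2^m))"
  and "j < 2^m \<Longrightarrow> w \<in> space M \<Longrightarrow> \<bar>\<xi> m j w\<bar> \<le> \<bar>K\<bar>"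
  and "ito (\<lambda>p. dstep m (\<lambda>j. h j * \<xi> m j (fst p)) (snd p))
   (\<lambda>w. \<Sum>j<2^m. h j * \<xi> m j w * (B (real (Suc j) / 2^m) w - B (real j / 2^m) w))"
proof -
 show 0: "h j * \<xi> m j w = h j * (if j = 0 then 0 else 2^m * (LINT s|lborel. v (w, s) * dyi m (j - 1) s))" by (simp add: \<xi>_def)
 have meas: "\<xi> m j \<in> borel_measurable (F (real j / 2^m))" if "j < 2^m" for j
  using bavg_coefficient(1)[OF v K ad, of j m] that by (cases "j = 0") (auto simp: \<xi>_def[abs_def])
 then show "j < 2^m \<Longrightarrow> \<xi> m j \<in> borel_measurable (F (real j / 2^m))" .
 have bd: "\<bar>\<xi> m j w\<bar> \<le> \<bar>K\<bar>" if "j < 2^m" "w \<in> space M" for j w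
  using bavg_coefficient(2)[OF v K ad, of j m w] that by (cases "j = 0") (auto simp: \<xi>_def)
 then show "j < 2^m \<Longrightarrow> w \<in> space M \<Longrightarrow> \<bar>\<xi> m j w\<bar> \<le> \<bar>K\<bar>" .
 have "simple_process M B 1 (2^m) (\<lambda>j. real j / 2^m) (\<lambda>j w. h j * \<xi> m j w)"
  unfolding simple_process_def
 proof (intro conjI allI impI)
  show "mono_on {..2^m} (\<lambda>j. real j / 2^m)" by (intro mono_onI divide_right_mono) auto
  fix j :: nat assume j: "j < 2^m"
  note [measurable] = meas[OF j]
  show "(\<lambda>w. h j * \<xi> m j w) \<in> borel_measurable (F (real j / 2^m))" by measurable
  show "\<exists>C. \<forall>w\<in>space M. \<bar>h j * \<xi> m j w\<bar> \<le> C"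
   using bd[OF j] by (intro exI[of _ "\<bar>h j\<bar> * \<bar>K\<bar>"]) (auto simp: abs_mult intro!: mult_left_mono)
 qed auto
 from elem_ito[OF simple_elem[OF this]]
 show "ito (\<lambda>p. dstep m (\<lambda>j. h j * \<xi> m j (fst p)) (snd p))
   (\<lambda>w. \<Sum>j<2^m. h j * \<xi> m j w * (B (real (Suc j) / 2^m) w - B (real j / 2^m) w))"
  unfolding simple_value_def Defs.simple_integral_def dstep_def dyi_def by simp
qed

text \<open>Jensen's inequality for the uniform distribution on a cell, path by path.\<close>

lemma dyadic_coefficient_moment:
 assumes [measurable]: "u \<in> borel_measurable P" and r: "r \<ge> 1" and int: "integrable M (\<lambda>w. \<bar>2^m * (LINT s|lborel. u (w, s) * dyi m j s)\<bar> powr r)"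
 shows "ennreal (moment r M (\<lambda>w. 2^m * (LINT s|lborel. u (w, s) * dyi m j s))) \<le>
  ennreal (2^m) * (\<integral>\<^sup>+p. ennreal (\<bar>u p\<bar> powr r * dyi m j (snd p)) \<partial>P)"
proof -
 have "ennreal (moment r M (\<lambda>w. 2^m * (LINT s|lborel. u (w, s) * dyi m j s))) =
   pow_int r M (\<lambda>w. 2^m * (LINT s|lborel. u (w, s) * dyi m j s))"
  using int by (subst nn_integral_eq_integral) auto
 also have "\<dots> \<le> (\<integral>\<^sup>+w. ennreal (2^m) * (\<integral>\<^sup>+s. ennreal (\<bar>u (w, s)\<bar> powr r * dyi m j s) \<partial>lborel) \<partial>M)"
 proof (rule nn_integral_mono)
  fix w assume w: "w \<in> space M"
  have [measurable]: "(\<lambda>s. u (w, s)) \<in> borel_measurable borel"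
   using measurable_compose[OF measurable_Pair1'[OF w], of u lborel borel] by simp
  have "(\<integral>\<^sup>+s. ennreal (2^m * dyi m j s) \<partial>lborel) = ennreal (2^m) * ennreal (1 / 2^m)"
   by (simp add: ennreal_mult' nn_integral_cmult dyi_nn_integral)
  also have "\<dots> = 1" by (simp flip: ennreal_mult')
  finally have "(\<integral>\<^sup>+s. ennreal (2^m * dyi m j s) \<partial>lborel) \<le> ennreal 1" by simp
  from integral_powr_le[OF _ _ _ r _ this, of "\<lambda>s. u (w, s)"] dyi_nonneg[of m j]
  have "ennreal (\<bar>LINT s|lborel. u (w, s) * (2^m * dyi m j s)\<bar> powr r) \<le> (\<integral>\<^sup>+s. ennreal (\<bar>u (w, s)\<bar> powr r * (2^m * dyi m j s)) \<partial>lborel)"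
   by simp
  also have "\<dots> = ennreal (2^m) * (\<integral>\<^sup>+s. ennreal (\<bar>u (w, s)\<bar> powr r * dyi m j s) \<partial>lborel)"
   by (subst nn_integral_cmult[symmetric]) (auto simp: mult_ac simp flip: ennreal_mult')
  also have "(LINT s|lborel. u (w, s) * (2^m * dyi m j s)) = 2^m * (LINT s|lborel. u (w, s) * dyi m j s)"
   by (subst integral_mult_right_zero[symmetric]) (simp only: mult.left_commute)
  finally show "ennreal (\<bar>2^m * (LINT s|lborel. u (w, s) * dyi m j s)\<bar> powr r) \<le> ennreal (2^m) * (\<integral>\<^sup>+s. ennreal (\<bar>u (w, s)\<bar> powr r * dyi m j s) \<partial>lborel)" .
 qed
 also have "\<dots> = ennreal (2^m) * (\<integral>\<^sup>+p. ennreal (\<bar>u p\<bar> powr r * dyi m j (snd p)) \<partial>P)"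
  by (subst lborel.nn_integral_fst[symmetric]) (auto simp: nn_integral_cmult)
 finally show ?thesis .
qed

lemma dstep_sq_mass:
 assumes [measurable]: "g \<in> borel_measurable P" and "\<And>p. g p \<ge> 0"
 shows "(\<integral>\<^sup>+p. ennreal ((dstep m d (snd p))\<^sup>2 * g p) \<partial>P) = (\<Sum>j<2^m. ennreal ((d j)\<^sup>2) * (\<integral>\<^sup>+p. ennreal (g p * dyi m j (snd p)) \<partial>P))"
proof -
 have "ennreal ((dstep m d (snd p))\<^sup>2 * g p) = (\<Sum>j<2^m. ennreal ((d j)\<^sup>2) * ennreal (g p * dyi m j (snd p)))" for p :: "'w \<times> real"
 proof -
  have "(dstep m d (snd p))\<^sup>2 = (\<Sum>j<2^m. (d j)\<^sup>2 * dyi m j (snd p))" by (simp only: dstep_sq) (simp add: dstep_def)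
  then show ?thesis using assms(2)[of p] dyi_nonneg
   by (simp add: sum_distrib_left mult_ac sum_ennreal flip: ennreal_mult)
 qed
 then show ?thesis by (simp add: nn_integral_sum nn_integral_cmult)
qed

text \<open>On cells of a level m \<ge> n the step function is constant, so a backward average of
  the product is a deterministic coefficient times a backward average of u, and the finite-sum
  inequality applies. Fatou's lemma removes m. The bound K on u does not enter the constant.\<close>

lemma dyadic_moment_bounded:
 assumes r: "r \<ge> 2"
 obtains C where "C \<ge> 0"
  "\<And>n c u K X. u \<in> borel_measurable P \<Longrightarrow> (\<And>w s. w \<in> space M \<Longrightarrow> \<bar>u (w, s)\<bar> \<le> K) \<Longrightarrow> adapted u \<Longrightarrow>
   (\<And>w s. s \<notin> {0..1} \<Longrightarrow> u (w, s) = 0) \<Longrightarrow> ito (\<lambda>p. dstep n c (snd p) * u p) X \<Longrightarrow>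
   pow_int r M X \<le> ennreal (C * ((\<Sum>j<2^n. (c j)\<^sup>2) / 2^n) powr (r / 2 - 1)) *
    weighted_pow r (dstep n c) u"
proof -
 obtain C where C: "C \<ge> 0"
  and base: "\<And>N \<tau> h \<xi> K. mono_on {..N} \<tau> \<Longrightarrow> \<tau> ` {..N} \<subseteq> {0..1} \<Longrightarrow> (\<And>i. i < N \<Longrightarrow> \<xi> i \<in> borel_measurable (F (\<tau> i))) \<Longrightarrow>
   (\<And>i w. i < N \<Longrightarrow> w \<in> space M \<Longrightarrow> \<bar>\<xi> i w\<bar> \<le> K) \<Longrightarrow>
   pow_int r M (dsum N \<tau> h \<xi>) \<le>
    ennreal (C * (dmass N \<tau> h) powr (r / 2 - 1) *
     (\<Sum>i<N. (h i)\<^sup>2 * (\<tau> (Suc i) - \<tau> i) * moment r M (\<xi> i)))"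
  by (rule discrete_moment_scaled[OF r], rule that) blast+
 show ?thesis
 proof (rule that[OF C])
  fix n :: nat and c and u :: "'w \<times> real \<Rightarrow> real" and K X
  assume u[measurable]: "u \<in> borel_measurable P" and K: "\<And>w s. w \<in> space M \<Longrightarrow> \<bar>u (w, s)\<bar> \<le> K" and ad: "adapted u"
   and z: "\<And>w s. s \<notin> {0..1} \<Longrightarrow> u (w, s) = 0" and X: "ito (\<lambda>p. dstep n c (snd p) * u p) X"
  define W where "W = (\<Sum>j<2^n. (c j)\<^sup>2) / 2^n"
  have W0: "W \<ge> 0" by (simp add: W_def sum_nonneg)
  define v where "v p = dstep n c (snd p) * u p" for p
  have v[measurable]: "v \<in> borel_measurable P" unfolding v_def by measurable
  define D where "D = (\<Sum>j<2^n. \<bar>c j\<bar>)"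
  have D: "\<bar>dstep n c s\<bar> \<le> D" for s unfolding dstep_def D_def using dyi_nonneg[of n _ s]
   by (intro order.trans[OF sum_abs] sum_mono) (auto simp: abs_mult intro: mult_left_le)
  have "D \<ge> 0" by (simp add: D_def sum_nonneg)
  have vK: "\<bar>v (w, s)\<bar> \<le> D * K" if "w \<in> space M" for w s
   using D[of s] K[OF that, of s] \<open>D \<ge> 0\<close> by (auto simp: v_def abs_mult intro!: mult_mono)
  have vz: "v (w, s) = 0" if "s \<notin> {0..1}" for w s using z[OF that] by (simp add: v_def)
  define d where "d m j = c (j div 2^(m - n))" for m j
  have dd: "dstep n c s = dstep m (d m) s" if "n \<le> m" for m s unfolding d_def by (rule dstep_refine[OF that])
  \<comment> \<open>Shifted by one cell in accordance with \<open>bavg\<close>, so that coefficient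
    and average belong to the same cell j - 1. The shift can only lower the total weight.\<close>
  define h where "h m j = (if j = 0 then 0 else d m (j - 1))" for m j
  define \<xi> where "\<xi> m j w = (if j = 0 then 0 else 2^m * (LINT s|lborel. u (w, s) * dyi m (j - 1) s))" for m j w
  define Y where "Y m w = (\<Sum>j<2^m. h m j * \<xi> m j w * (B (real (Suc j) / 2^m) w - B (real j / 2^m) w))" for m w
  note el = dyadic_elem[OF u K ad, folded \<xi>_def]
  have I: "ito (\<lambda>p. dstep m (\<lambda>j. h m j * \<xi> m j (fst p)) (snd p)) (Y m)" for m
   using el(4)[of m "h m"] unfolding Y_def .
  have ba: "bavg m (\<lambda>s. v (w, s)) s = dstep m (\<lambda>j. h m j * \<xi> m j w) s" if "n \<le> m" for m w s
   unfolding bavg_def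
  proof (rule dstep_cong)
   fix j :: nat assume j: "j < 2^m"
   show "(if j = 0 then 0 else 2^m * (LINT s|lborel. v (w, s) * dyi m (j - 1) s)) = h m j * \<xi> m j w"
   proof (cases "j = 0")
    case False
    have "dstep m (d m) s * dyi m (j - 1) s = d m (j - 1) * dyi m (j - 1) s" for s
     using j False by (auto simp: dstep_def sum_distrib_right mult.assoc dyi_mult if_distrib[of "(*) _"] cong: if_cong)
    then have "v (w, s) * dyi m (j - 1) s = d m (j - 1) * (u (w, s) * dyi m (j - 1) s)" for s
     unfolding v_def dd[OF that] by (simp add: mult_ac)
    then have "(LINT s|lborel. v (w, s) * dyi m (j - 1) s) = (LINT s|lborel. d m (j - 1) * (u (w, s) * dyi m (j - 1) s))"
     by (simp only:)
    then show ?thesis using False by (simp add: h_def \<xi>_def)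
   qed (simp add: h_def)
  qed
  have lim: "(\<lambda>m. nsq P (\<lambda>p. dstep (m + n) (\<lambda>j. h (m + n) j * \<xi> (m + n) j (fst p)) (snd p) - v p)) \<longlonglongrightarrow> 0"
   using LIMSEQ_ignore_initial_segment[OF bavg_process_tendsto[OF v vK vz], of n] by (simp add: ba)
  obtain Z where Z: "ito v Z" "(\<lambda>m. nsq M (\<lambda>w. Y (m + n) w - Z w)) \<longlonglongrightarrow> 0"
   using ito_complete[OF I v lim] by blast
  have XZ: "AE w in M. X w = Z w" using ito_unique[OF X[folded v_def] Z(1)] .
  have Ym[measurable]: "Y m \<in> borel_measurable M" for m using ito_measurable(2)[OF I] .
  obtain s where s: "strict_mono s" "AE w in M. (\<lambda>m. Y (s m + n) w) \<longlonglongrightarrow> Z w"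
   using nsq_subseq_AE[OF Ym ito_measurable(2)[OF Z(1)] Z(2)] by blast
  let ?E = "weighted_pow r (dstep n c) u"
  have bound: "pow_int r M (Y m) \<le> ennreal (C * W powr (r / 2 - 1)) * ?E" if nm: "n \<le> m" for m
  proof -
   define A where "A = (\<Sum>i<2^m. (h m i)\<^sup>2 * (real (Suc i) / 2^m - real i / 2^m))"
   define E where "E = (\<Sum>i<2^m. (h m i)\<^sup>2 * (real (Suc i) / 2^m - real i / 2^m) * moment r M (\<xi> m i))"
   have inc: "real (Suc i) / 2^m - real i / 2^m = 1 / 2^m" for i by (simp add: add_divide_distrib)
   have 1: "pow_int r M (Y m) \<le> ennreal (C * A powr (r / 2 - 1) * E)"
    unfolding Y_def A_def E_def
   proof (rule base[of "2^m" "\<lambda>j. real j / 2^m" "\<xi> m" "\<bar>K\<bar>" "h m"])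
    show "mono_on {..2^m} (\<lambda>j. real j / 2^m)" by (intro mono_onI divide_right_mono) auto
    show "(\<lambda>j. real j / 2^m) ` {..2^m} \<subseteq> {0..1}" by auto
   qed (use el in auto)
   have "A = (\<Sum>j<2^m. if j = 0 then 0 else (d m (j - 1))\<^sup>2 / 2^m)"
    unfolding A_def inc h_def by (intro sum.cong) auto
   also have "\<dots> \<le> (\<Sum>j<2^m. (d m j)\<^sup>2 / 2^m)" by (rule sum_shift_le[of "\<lambda>j. (d m j)\<^sup>2 / 2^m"]) simp
   also have "\<dots> = (\<Sum>j<2^m. (d m j)\<^sup>2) / 2^m" by (simp add: sum_divide_distrib)
   also have "\<dots> = W"
   proof -
    have "ennreal ((\<Sum>j<2^m. (d m j)\<^sup>2) / 2^m) = ennreal W"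
     unfolding W_def nsq_dstep[symmetric] using dd[OF nm] by simp
    then show ?thesis using W0 by (subst (asm) ennreal_inj) (auto intro!: divide_nonneg_nonneg sum_nonneg)
   qed
   finally have AW: "A \<le> W" .
   have A0: "A \<ge> 0" unfolding A_def inc by (intro sum_nonneg) auto
   define a where "a j = moment r M (\<lambda>w. 2^m * (LINT s|lborel. u (w, s) * dyi m j s))" for j
   have a0: "a j \<ge> 0" for j unfolding a_def by (rule Bochner_Integration.integral_nonneg) simp
   have "E = (\<Sum>j<2^m. if j = 0 then 0 else (d m (j - 1))\<^sup>2 / 2^m * a (j - 1))"
    unfolding E_def inc h_def \<xi>_def a_def by (intro sum.cong) auto
   then have "ennreal E = ennreal (\<Sum>j<2^m - 1. (d m j)\<^sup>2 / 2^m * a j)"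
   proof -
    assume e: "E = (\<Sum>j<2^m. if j = 0 then 0 else (d m (j - 1))\<^sup>2 / 2^m * a (j - 1))"
    have "2^m = Suc (2^m - 1)" by simp
    then have "E = (\<Sum>j<Suc (2^m - 1). if j = 0 then 0 else (d m (j - 1))\<^sup>2 / 2^m * a (j - 1))" unfolding e by simp
    also have "\<dots> = (\<Sum>j<2^m - 1. (d m j)\<^sup>2 / 2^m * a j)" by (subst sum.lessThan_Suc_shift) simp
    finally show ?thesis by simp
   qed
   also have "\<dots> = (\<Sum>j<2^m - 1. ennreal ((d m j)\<^sup>2 / 2^m * a j))" using a0 by (subst sum_ennreal) auto
   also have "\<dots> \<le> (\<Sum>j<2^m - 1. ennreal ((d m j)\<^sup>2) * (\<integral>\<^sup>+p. ennreal (\<bar>u p\<bar> powr r * dyi m j (snd p)) \<partial>P))"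
   proof (rule sum_mono)
    fix j :: nat assume "j \<in> {..<2^m - 1}"
    then have j: "Suc j < 2^m" by auto
    have 1: "(\<lambda>w. \<bar>2^m * (LINT s|lborel. u (w, s) * dyi m j s)\<bar> powr r) = (\<lambda>w. \<bar>\<xi> m (Suc j) w\<bar> powr r)" by (simp add: \<xi>_def)
    have "real (Suc j) \<le> real (2^m)" using j by (simp only: of_nat_le_iff less_imp_le)
    then have [measurable]: "\<xi> m (Suc j) \<in> borel_measurable M"
     by (intro measurable_F_M[OF el(2)[OF _ j]]) auto
    have "integrable M (\<lambda>w. \<bar>\<xi> m (Suc j) w\<bar> powr r)"
     using el(3)[OF _ j] r by (intro integrable_const_bound[of _ "\<bar>K\<bar> powr r"]) (auto intro!: AE_I2 powr_mono2)
    from dyadic_coefficient_moment[OF u _ this[folded 1]] r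
    have "ennreal (a j) \<le> ennreal (2^m) * (\<integral>\<^sup>+p. ennreal (\<bar>u p\<bar> powr r * dyi m j (snd p)) \<partial>P)" by (simp add: a_def)
    then have "ennreal ((d m j)\<^sup>2 / 2^m) * ennreal (a j) \<le> ennreal ((d m j)\<^sup>2 / 2^m) * (ennreal (2^m) * (\<integral>\<^sup>+p. ennreal (\<bar>u p\<bar> powr r * dyi m j (snd p)) \<partial>P))"
     by (intro mult_left_mono) auto
    also have "\<dots> = ennreal ((d m j)\<^sup>2) * (\<integral>\<^sup>+p. ennreal (\<bar>u p\<bar> powr r * dyi m j (snd p)) \<partial>P)"
     by (simp flip: mult.assoc ennreal_mult)
    finally show "ennreal ((d m j)\<^sup>2 / 2^m * a j) \<le> ennreal ((d m j)\<^sup>2) * (\<integral>\<^sup>+p. ennreal (\<bar>u p\<bar> powr r * dyi m j (snd p)) \<partial>P)"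
     using a0[of j] by (simp add: ennreal_mult del: times_divide_eq_left)
   qed
   also have "\<dots> \<le> (\<Sum>j<2^m. ennreal ((d m j)\<^sup>2) * (\<integral>\<^sup>+p. ennreal (\<bar>u p\<bar> powr r * dyi m j (snd p)) \<partial>P))"
    by (intro sum_mono2) auto
   also have "\<dots> = (\<integral>\<^sup>+p. ennreal ((dstep m (d m) (snd p))\<^sup>2 * \<bar>u p\<bar> powr r) \<partial>P)"
    by (rule dstep_sq_mass[symmetric]) auto
   also have "\<dots> = ?E" by (simp add: dd[OF nm])
   finally have E: "ennreal E \<le> ?E" .
   have E0: "E \<ge> 0" unfolding E_def inc by (intro sum_nonneg mult_nonneg_nonneg Bochner_Integration.integral_nonneg) auto
   have "ennreal (C * A powr (r / 2 - 1) * E) = ennreal (C * A powr (r / 2 - 1)) * ennreal E" using C E0 by (simp add: ennreal_mult)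
   also have "\<dots> \<le> ennreal (C * W powr (r / 2 - 1)) * ?E"
    using C r AW A0 E by (intro mult_mono ennreal_leI mult_left_mono powr_mono2) auto
   finally show ?thesis using 1 by (rule order.trans[rotated])
  qed
  have "pow_int r M Z \<le> ennreal (C * W powr (r / 2 - 1)) * ?E"
   using r bound by (intro nn_powr_fatou[OF _ _ s(2)]) auto
  also have "pow_int r M Z = pow_int r M X"
   using XZ by (intro nn_integral_cong_AE) auto
  finally show "pow_int r M X \<le> ennreal (C * ((\<Sum>j<2^n. (c j)\<^sup>2) / 2^n) powr (r / 2 - 1)) * ?E"
   unfolding W_def .
 qed
qed

lemma nsq_finite_of_Lr:
 assumes [measurable]: "u \<in> borel_measurable P" and r: "r \<ge> 2" and fin: "pow_int r P u < \<infinity>"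
  and z: "\<And>w s. s \<notin> {0..1} \<Longrightarrow> u (w, s) = 0"
 shows "nsq P u < \<infinity>"
proof -
 have 1: "ennreal ((u p)\<^sup>2) \<le> indicator {0..1} (snd p) + ennreal (\<bar>u p\<bar> powr r)" for p
 proof (cases "snd p \<in> {0..1}")
  case True
  show ?thesis
  proof (cases "\<bar>u p\<bar> \<le> 1")
   case c: True
   then have "(u p)\<^sup>2 \<le> 1" by (simp add: abs_square_le_1)
   then show ?thesis using True by (simp add: add_increasing2)
  next
   case False
   have "(u p)\<^sup>2 = \<bar>u p\<bar> powr 2" by (simp add: powr_numeral)
   also have "\<dots> \<le> \<bar>u p\<bar> powr r" using False r by (intro powr_mono) auto
   finally show ?thesis by (simp add: add_increasing)
  qed
 next
  case False then show ?thesis using z[of "snd p" "fst p"] by simp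
 qed
 have "(\<integral>\<^sup>+p. indicator {0..1::real} (snd p) \<partial>P) = 1"
  by (subst lborel.nn_integral_fst[symmetric]) (auto simp: emeasure_space_1)
 moreover have "nsq P u \<le> (\<integral>\<^sup>+p. indicator {0..1} (snd p) + ennreal (\<bar>u p\<bar> powr r) \<partial>P)"
  using 1 by (intro nn_integral_mono)
 moreover have "\<dots> = (\<integral>\<^sup>+p. indicator {0..1} (snd p) \<partial>P) + pow_int r P u"
  by (intro nn_integral_add) auto
 ultimately have "nsq P u \<le> 1 + pow_int r P u" by simp
 also have "\<dots> < \<infinity>" using fin by simp
 finally show ?thesis .
qed

text \<open>Truncating the values of u removes its bound, since the constant is the same for all
  truncations.\<close>

lemma dyadic_moment:
 assumes r: "r \<ge> 2"
 obtains C where "C \<ge> 0"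
  "\<And>n c u X. u \<in> borel_measurable P \<Longrightarrow> nsq P u < \<infinity> \<Longrightarrow> adapted u \<Longrightarrow>
   (\<And>w s. s \<notin> {0..1} \<Longrightarrow> u (w, s) = 0) \<Longrightarrow> ito (\<lambda>p. dstep n c (snd p) * u p) X \<Longrightarrow>
   pow_int r M X \<le> ennreal (C * ((\<Sum>j<2^n. (c j)\<^sup>2) / 2^n) powr (r / 2 - 1)) *
    weighted_pow r (dstep n c) u"
proof -
 obtain C where C: "C \<ge> 0"
  and base: "\<And>n c u K X. u \<in> borel_measurable P \<Longrightarrow> (\<And>w s. w \<in> space M \<Longrightarrow> \<bar>u (w, s)\<bar> \<le> K) \<Longrightarrow> adapted u \<Longrightarrow>
   (\<And>w s. s \<notin> {0..1} \<Longrightarrow> u (w, s) = 0) \<Longrightarrow> ito (\<lambda>p. dstep n c (snd p) * u p) X \<Longrightarrow>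
   pow_int r M X \<le> ennreal (C * ((\<Sum>j<2^n. (c j)\<^sup>2) / 2^n) powr (r / 2 - 1)) *
    weighted_pow r (dstep n c) u"
  by (rule dyadic_moment_bounded[OF r], rule that) blast+
 show ?thesis
 proof (rule that[OF C])
  fix n :: nat and c and u :: "'w \<times> real \<Rightarrow> real" and X
  assume u[measurable]: "u \<in> borel_measurable P" and fin: "nsq P u < \<infinity>" and ad: "adapted u"
   and z: "\<And>w s. s \<notin> {0..1} \<Longrightarrow> u (w, s) = 0" and X: "ito (\<lambda>p. dstep n c (snd p) * u p) X"
  let ?v = "\<lambda>k p. dstep n c (snd p) * clip (real k) (u p)" and ?w = "\<lambda>p. dstep n c (snd p) * u p"
  define D where "D = (\<Sum>j<2^n. \<bar>c j\<bar>)"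
  have D: "\<bar>dstep n c s\<bar> \<le> D" for s unfolding dstep_def D_def using dyi_nonneg[of n _ s]
   by (intro order.trans[OF sum_abs] sum_mono) (auto simp: abs_mult intro: mult_left_le)
  have D2: "(dstep n c s * y)\<^sup>2 \<le> D\<^sup>2 * y\<^sup>2" for s y
   using power_mono[OF D[of s], of 2] by (simp add: power_mult_distrib mult_right_mono)
  have uz: "clip (real k) (u (w, s)) = 0" if "s \<notin> {0..1}" for k w s using z[OF that] by (simp add: clip_props)
  have adc: "adapted (\<lambda>p. clip (real k) (u p))" for k using adapted_clip[OF ad] .
  have "\<exists>Y. ito (?v k) Y" for k
  proof (rule ito_exists)
   have "nsq P (?v k) \<le> (\<integral>\<^sup>+p. ennreal (D\<^sup>2) * ennreal ((u p)\<^sup>2) \<partial>P)"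
   proof (rule nn_integral_mono)
    fix p
    have "(?v k p)\<^sup>2 \<le> D\<^sup>2 * (clip (real k) (u p))\<^sup>2" by (rule D2)
    also have "\<dots> \<le> D\<^sup>2 * (u p)\<^sup>2" using clip_props(2)[of "real k" "u p"] by (intro mult_left_mono) (simp_all add: abs_le_square_iff)
    finally show "ennreal ((?v k p)\<^sup>2) \<le> ennreal (D\<^sup>2) * ennreal ((u p)\<^sup>2)" by (simp add: ennreal_leI flip: ennreal_mult)
   qed
   also have "\<dots> = ennreal (D\<^sup>2) * nsq P u" by (simp add: nn_integral_cmult)
   also have "\<dots> < \<infinity>" using fin by (simp add: ennreal_mult_less_top)
   finally show "nsq P (?v k) < \<infinity>" .
   show "adapted (?v k)" using adc[of k] unfolding adapted_def by (auto intro!: borel_measurable_times)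
  qed (auto simp: uz)
  then obtain Y where Y: "\<And>k. ito (?v k) (Y k)" by metis
  have lim0: "(\<lambda>k. nsq P (\<lambda>p. clip (real k) (u p) - u p)) \<longlonglongrightarrow> 0"
   using nn_powr_clip_tendsto[OF u, of 2] fin by (simp add: powr_numeral)
  have "nsq P (\<lambda>p. ?v k p - ?w p) \<le> ennreal (D\<^sup>2) * nsq P (\<lambda>p. clip (real k) (u p) - u p)" for k
  proof -
   have "nsq P (\<lambda>p. ?v k p - ?w p) \<le> (\<integral>\<^sup>+p. ennreal (D\<^sup>2) * ennreal ((clip (real k) (u p) - u p)\<^sup>2) \<partial>P)"
    using D2 by (intro nn_integral_mono) (simp add: ennreal_leI flip: ennreal_mult right_diff_distrib)
   also have "\<dots> = ennreal (D\<^sup>2) * nsq P (\<lambda>p. clip (real k) (u p) - u p)" by (simp add: nn_integral_cmult)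
   finally show ?thesis .
  qed
  then have lim: "(\<lambda>k. nsq P (\<lambda>p. ?v k p - ?w p)) \<longlonglongrightarrow> 0" by (intro ennreal_tendsto_zero_le[OF lim0]) auto
  obtain Z where Z: "ito ?w Z" "(\<lambda>k. nsq M (\<lambda>w. Y k w - Z w)) \<longlonglongrightarrow> 0"
   using ito_complete[OF Y _ lim] by auto
  have Ym[measurable]: "Y k \<in> borel_measurable M" for k using ito_measurable(2)[OF Y] .
  obtain s where s: "strict_mono s" "AE w in M. (\<lambda>m. Y (s m) w) \<longlonglongrightarrow> Z w"
   using nsq_subseq_AE[OF Ym ito_measurable(2)[OF Z(1)] Z(2)] by blast
  let ?B = "ennreal (C * ((\<Sum>j<2^n. (c j)\<^sup>2) / 2^n) powr (r / 2 - 1))"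
  have bound: "pow_int r M (Y k) \<le> ?B * weighted_pow r (dstep n c) u" for k
  proof -
   have "pow_int r M (Y k) \<le> ?B * (\<integral>\<^sup>+p. ennreal ((dstep n c (snd p))\<^sup>2 * \<bar>clip (real k) (u p)\<bar> powr r) \<partial>P)"
    using clip_props(1)[of "real k"] uz by (intro base[OF _ _ adc _ Y, of k "real k"]) auto
   also have "\<dots> \<le> ?B * weighted_pow r (dstep n c) u"
    using clip_props(2)[of "real k"] r by (intro mult_left_mono nn_integral_mono ennreal_leI powr_mono2) auto
   finally show ?thesis .
  qed
  have "pow_int r M Z \<le> ?B * weighted_pow r (dstep n c) u"
   using r bound by (intro nn_powr_fatou[OF _ _ s(2)]) auto
  also have "pow_int r M Z = pow_int r M X"
   using ito_unique[OF X Z(1)] by (intro nn_integral_cong_AE) auto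
  finally show "pow_int r M X \<le> ?B * weighted_pow r (dstep n c) u" .
 qed
qed

end

section \<open>The kernel of the preimage\<close>

text \<open>Cutting K to the triangle makes the operator an integral over the whole line and the
  rows Borel functions that vanish outside [0,1].\<close>

definition kern :: "(real \<Rightarrow> real \<Rightarrow> real) \<Rightarrow> real \<Rightarrow> real \<Rightarrow> real" where
 "kern K t s = (if 0 \<le> s \<and> s \<le> t \<and> t \<le> 1 then K t s else 0)"

abbreviation kint :: "(real \<Rightarrow> real \<Rightarrow> real) \<Rightarrow> real \<Rightarrow> ('w \<times> real \<Rightarrow> real) \<Rightarrow> 'w \<times> real \<Rightarrow> real" where
 "kint K t u \<equiv> \<lambda>p. kern K t (snd p) * u p"

lemma measurable_kern:
 assumes "measurable_kernel K" and [measurable]: "f \<in> borel_measurable N" "g \<in> borel_measurable N"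
 shows "(\<lambda>x. kern K (f x) (g x)) \<in> borel_measurable N"
proof -
 have "(\<lambda>p. indicator ({0..1} \<times> {0..1}) p * K (fst p) (snd p)) \<in> borel_measurable (borel :: (real \<times> real) measure)"
  using assms(1) unfolding measurable_kernel_def
  by (subst (asm) borel_measurable_restrict_space_iff) (auto simp: case_prod_beta borel_Times)
 then have [measurable]: "(\<lambda>p. indicator ({0..1} \<times> {0..1}) p * K (fst p) (snd p)) \<in> borel_measurable (borel \<Otimes>\<^sub>M borel)"
  by (simp add: borel_prod)
 have "(\<lambda>x. (\<lambda>p. indicator ({0..1} \<times> {0..1}) p * K (fst p) (snd p)) (f x, g x) * (if g x \<le> f x then 1 else 0)) \<in> borel_measurable N"
  by measurable
 also have "(\<lambda>x. (\<lambda>p. indicator ({0..1} \<times> {0..1}) p * K (fst p) (snd p)) (f x, g x) * (if g x \<le> f x then 1 else 0)) = (\<lambda>x. kern K (f x) (g x))"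
  by (auto simp: kern_def fun_eq_iff indicator_def)
 finally show ?thesis .
qed

lemma kern_zero: "s \<notin> {0..1} \<Longrightarrow> kern K t s = 0"
 by (auto simp: kern_def)

lemma volterra_op_kern:
 assumes "t \<in> {0..1}"
 shows "volterra_op K f t = pair_fun (kern K t) f"
 unfolding volterra_op_def pair_fun_def set_lebesgue_integral_def
 using assms by (intro Bochner_Integration.integral_cong) (auto simp: kern_def)

text \<open>The row is tested on its own truncations f: \<open>volterra_op K f t\<close> is then the
  squared norm of f, while (A) and (\<gamma> + 1/2) 2 > 1 bound its square by a constant times that
  norm squared. The bound is uniform in the truncation and passes to the row.\<close>

lemma kern_L2:
 assumes mK: "measurable_kernel K" and hA: "hypothesis_A K \<gamma>" and t: "t \<in> {0..1}"
 shows "nsq lborel (kern K t) < \<infinity>"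
proof -
 have \<gamma>: "\<gamma> > 0" using hA by (simp add: hypothesis_A_def)
 obtain G :: "(real \<Rightarrow> real) \<Rightarrow> real \<Rightarrow> real" and C where C: "C \<ge> 0" and G: "\<And>f. G f \<in> borel_measurable borel"
  and G2: "\<And>f. f \<in> L2_01 \<Longrightarrow> sq_upto 1 (G f) \<le> ennreal C * sq_upto 1 f"
  and GV: "\<And>f t. f \<in> L2_01 \<Longrightarrow> t \<in> {0..1} \<Longrightarrow> frac_int (\<gamma> + 1/2) (G f) t = volterra_op K f t"
  by (rule kernel_preimage[OF hA], rule that) blast+
 have "\<gamma> + 1/2 > 0" "(2::real) > 1" "(\<gamma> + 1/2) * 2 > 1" using \<gamma> by auto
 from frac_int_sup_bound[OF this] obtain D where D: "D \<ge> 0" and sup: "\<And>f x. f \<in> borel_measurable borel \<Longrightarrow> 0 \<le> x \<Longrightarrow> x \<le> 1 \<Longrightarrow>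
   ennreal (\<bar>frac_int (\<gamma> + 1/2) f x\<bar> powr 2) \<le> ennreal D * pow_upto 2 x f"
  by blast
 let ?k = "kern K t"
 have km[measurable]: "?k \<in> borel_measurable borel" by (rule measurable_kern[OF mK]) auto
 define f where "f m s = (if \<bar>?k s\<bar> \<le> real m then ?k s else 0)" for m :: nat and s
 have fm[measurable]: "f m \<in> borel_measurable borel" for m unfolding f_def by measurable
 have fb: "\<bar>f m s\<bar> \<le> real m" and fz: "s \<notin> {0..1} \<Longrightarrow> f m s = 0" and fk: "?k s * f m s = (f m s)\<^sup>2" for m s
  by (auto simp: f_def kern_zero power2_eq_square)
 have bd: "nsq lborel (f m) \<le> ennreal (D * C)" for m
 proof -
  have "ennreal ((f m s)\<^sup>2) \<le> ennreal ((real m)\<^sup>2) * indicator {0..1} s" for s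
   using fb[of m s] fz[of s m] by (cases "s \<in> {0..1}") (auto simp: abs_le_square_iff[symmetric] intro!: ennreal_leI)
  then have "nsq lborel (f m) \<le> (\<integral>\<^sup>+s. ennreal ((real m)\<^sup>2) * indicator {0..1::real} s \<partial>lborel)"
   by (intro nn_integral_mono)
  also have "\<dots> < \<infinity>" by (simp add: nn_integral_cmult)
  finally have fin: "nsq lborel (f m) < \<infinity>" .
  have eq: "sq_upto 1 (f m) = nsq lborel (f m)"
   using fz by (intro nn_integral_cong) (auto simp: indicator_def)
  have L2: "f m \<in> L2_01" using fin eq by (simp add: L2_01_def)
  have i: "integrable lborel (\<lambda>s. (f m s)\<^sup>2)" using fin by (intro integrableI_bounded) auto
  define a where "a = (LINT s|lborel. (f m s)\<^sup>2)"
  have a0: "a \<ge> 0" unfolding a_def by (rule Bochner_Integration.integral_nonneg) simp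
  have na: "nsq lborel (f m) = ennreal a" unfolding a_def using i by (intro nn_integral_eq_integral) auto
  have "volterra_op K (f m) t = a" using t by (simp add: volterra_op_kern pair_fun_def fk a_def)
  then have "ennreal (a\<^sup>2) = ennreal (\<bar>frac_int (\<gamma> + 1/2) (G (f m)) t\<bar> powr 2)"
   using GV[OF L2 t] by (simp add: powr_numeral)
  also have "\<dots> \<le> ennreal D * pow_upto 2 t (G (f m))"
   using t by (intro sup G) auto
  also have "\<dots> \<le> ennreal D * sq_upto 1 (G (f m))"
   using t by (intro mult_left_mono nn_integral_mono) (auto simp: indicator_def powr_numeral)
  also have "\<dots> \<le> ennreal D * (ennreal C * ennreal a)"
   using G2[OF L2] unfolding eq na by (rule mult_left_mono) simp
  also have "\<dots> = ennreal (D * C * a)" using C D a0 by (simp add: ennreal_mult mult.assoc)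
  finally have "a * a \<le> D * C * a" using C D a0 by (simp add: power2_eq_square)
  then have "a \<le> D * C" using a0 C D by (cases "a = 0") auto
  then show ?thesis unfolding na by (rule ennreal_leI)
 qed
 have "(\<lambda>m. f m s) \<longlonglongrightarrow> ?k s" for s
 proof (rule tendsto_eventually)
  obtain n where "\<bar>?k s\<bar> \<le> real n" using real_arch_simple by blast
  then show "\<forall>\<^sub>F m in sequentially. f m s = ?k s"
   by (intro eventually_sequentiallyI[of n]) (auto simp: f_def)
 qed
 then have "pow_int 2 lborel ?k \<le> ennreal (D * C)"
  using bd by (intro nn_powr_fatou[of f]) (auto simp: powr_numeral)
 then have "nsq lborel ?k \<le> ennreal (D * C)" by (simp add: powr_numeral)
 also have "\<dots> < \<infinity>" by simp
 finally show ?thesis .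
qed

text \<open>Uniform integrability: below a level k of \<phi> the small integral of g decides, above
  it the bound \<open>B\<close> together with the small tail of \<phi>.\<close>

lemma small_product:
 fixes \<phi> :: "'a \<Rightarrow> real"
 assumes [measurable]: "\<phi> \<in> borel_measurable N" and \<phi>0: "\<And>x. \<phi> x \<ge> 0" and fin: "(\<integral>\<^sup>+x. ennreal (\<phi> x) \<partial>N) < \<infinity>" and e: "e > 0" and B0: "B \<ge> 0"
 obtains d where "d > 0" "\<And>g. g \<in> borel_measurable N \<Longrightarrow> (\<And>x. g x \<le> ennreal B) \<Longrightarrow> (\<integral>\<^sup>+x. g x \<partial>N) \<le> ennreal d \<Longrightarrow>
  (\<integral>\<^sup>+x. ennreal (\<phi> x) * g x \<partial>N) \<le> ennreal e"
proof -
 have i: "integrable N \<phi>" using fin \<phi>0 by (intro integrableI_bounded) auto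
 have "(\<lambda>k. LINT x|N. \<phi> x - min (\<phi> x) (real k)) \<longlonglongrightarrow> (LINT x|N. 0)"
 proof (rule integral_dominated_convergence[where w=\<phi>])
  show "AE x in N. (\<lambda>k. \<phi> x - min (\<phi> x) (real k)) \<longlonglongrightarrow> 0"
  proof (rule AE_I2, rule tendsto_eventually)
   fix x obtain n where "\<phi> x \<le> real n" using real_arch_simple by blast
   then show "\<forall>\<^sub>F k in sequentially. \<phi> x - min (\<phi> x) (real k) = 0" by (intro eventually_sequentiallyI[of n]) auto
  qed
  show "AE x in N. norm (\<phi> x - min (\<phi> x) (real k)) \<le> \<phi> x" for k by (intro AE_I2) (auto simp: min_def \<phi>0)
 qed (use i in auto)
 then have l: "(\<lambda>k. LINT x|N. \<phi> x - min (\<phi> x) (real k)) \<longlonglongrightarrow> 0" by simp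
 have "0 < e / (2 * (B + 1))" using e B0 by simp
 from order_tendstoD(2)[OF l this] obtain k where k: "(LINT x|N. \<phi> x - min (\<phi> x) (real k)) < e / (2 * (B + 1))"
  by (auto simp: eventually_sequentially)
 define T where "T = (LINT x|N. \<phi> x - min (\<phi> x) (real k))"
 have T0: "T \<ge> 0" unfolding T_def by (intro Bochner_Integration.integral_nonneg) auto
 have "integrable N (\<lambda>x. \<phi> x - min (\<phi> x) (real k))" using \<phi>0
  by (intro Bochner_Integration.integrable_bound[OF i]) (auto simp: min_def)
 then have nT: "(\<integral>\<^sup>+x. ennreal (\<phi> x - min (\<phi> x) (real k)) \<partial>N) = ennreal T" unfolding T_def by (intro nn_integral_eq_integral) auto
 show ?thesis
 proof (rule that[of "e / (2 * (real k + 1))"])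
  show "e / (2 * (real k + 1)) > 0" using e by simp
  fix g assume [measurable]: "g \<in> borel_measurable N" and gB: "\<And>x. g x \<le> ennreal B" and gd: "(\<integral>\<^sup>+x. g x \<partial>N) \<le> ennreal (e / (2 * (real k + 1)))"
  have "ennreal (\<phi> x) * g x \<le> ennreal B * ennreal (\<phi> x - min (\<phi> x) (real k)) + ennreal (real k) * g x" for x
  proof -
   have "ennreal (\<phi> x) = ennreal (\<phi> x - min (\<phi> x) (real k)) + ennreal (min (\<phi> x) (real k))"
    using \<phi>0[of x] by (subst ennreal_plus[symmetric]) auto
   then have "ennreal (\<phi> x) * g x = ennreal (\<phi> x - min (\<phi> x) (real k)) * g x + ennreal (min (\<phi> x) (real k)) * g x" by (simp add: distrib_right)
   also have "\<dots> \<le> ennreal (\<phi> x - min (\<phi> x) (real k)) * ennreal B + ennreal (real k) * g x"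
    using gB by (intro add_mono mult_left_mono mult_right_mono ennreal_leI) auto
   finally show ?thesis by (simp add: mult.commute)
  qed
  then have "(\<integral>\<^sup>+x. ennreal (\<phi> x) * g x \<partial>N) \<le> (\<integral>\<^sup>+x. ennreal B * ennreal (\<phi> x - min (\<phi> x) (real k)) + ennreal (real k) * g x \<partial>N)"
   by (intro nn_integral_mono)
  also have "\<dots> = ennreal B * ennreal T + ennreal (real k) * (\<integral>\<^sup>+x. g x \<partial>N)"
   by (simp add: nn_integral_add nn_integral_cmult nT)
  also have "\<dots> \<le> ennreal B * ennreal T + ennreal (real k) * ennreal (e / (2 * (real k + 1)))"
   using gd by (intro add_mono mult_left_mono) auto
  also have "\<dots> = ennreal (B * T + real k * (e / (2 * (real k + 1))))"
   using B0 T0 e by (simp only: ennreal_plus ennreal_mult' mult_nonneg_nonneg of_nat_0_le_iff divide_nonneg_nonneg less_imp_le add_nonneg_nonneg zero_le_numeral zero_le_one)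
  also have "\<dots> \<le> ennreal e"
  proof (rule ennreal_leI)
   have "B * T \<le> (B + 1) * (e / (2 * (B + 1)))" using k B0 T0 by (intro mult_mono) (auto simp: T_def)
   also have "\<dots> = e / 2" using B0 by (simp add: field_simps)
   finally have 1: "B * T \<le> e / 2" .
   have "real k * (e / (2 * (real k + 1))) \<le> e / 2" using e by (simp add: field_simps)
   with 1 show "B * T + real k * (e / (2 * (real k + 1))) \<le> e" by linarith
  qed
  finally show "(\<integral>\<^sup>+x. ennreal (\<phi> x) * g x \<partial>N) \<le> ennreal e" .
 qed
qed

text \<open>
 The functional \<open>f \<mapsto> \<Phi> f x\<close> on \<open>L\<^sup>2\<close> has a Riesz representative, whose dyadic
 approximations are the functions \<open>H n x\<close> below; they are the kernel of
 \<open>I\<^sup>-\<^sup>\<delta> \<circ> K\<close>.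
\<close>

locale kernel_preimage_family =
 fixes K :: "real \<Rightarrow> real \<Rightarrow> real" and \<delta> C :: real and \<Phi> :: "(real \<Rightarrow> real) \<Rightarrow> real \<Rightarrow> real"
 assumes \<delta>: "\<delta> > 0" and C: "C \<ge> 0"
  and \<Phi>_measurable: "\<And>f. \<Phi> f \<in> borel_measurable borel"
  and \<Phi>_linear: "\<And>f g x a b. f \<in> L2_01 \<Longrightarrow> g \<in> L2_01 \<Longrightarrow> x \<in> {0..1} \<Longrightarrow> \<Phi> (\<lambda>s. a * f s + b * g s) x = a * \<Phi> f x + b * \<Phi> g x"
  and \<Phi>_sup: "\<And>f x. f \<in> L2_01 \<Longrightarrow> x \<in> {0..1} \<Longrightarrow> ennreal ((\<Phi> f x)\<^sup>2) \<le> ennreal C * sq_upto 1 f"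
  and \<Phi>_L1: "\<And>f. f \<in> L2_01 \<Longrightarrow> sq_upto 1 (\<Phi> f) \<le> ennreal C * (abs_upto 1 f)\<^sup>2"
  and \<Phi>_volterra: "\<And>f t. f \<in> L2_01 \<Longrightarrow> t \<in> {0..1} \<Longrightarrow> frac_int \<delta> (\<Phi> f) t = volterra_op K f t"
  and \<Phi>_causal: "\<And>f a x. f \<in> L2_01 \<Longrightarrow> a \<in> {0..1} \<Longrightarrow> (\<And>s. s \<in> {0..a} \<Longrightarrow> f s = 0) \<Longrightarrow> x \<in> {0..a} \<Longrightarrow> \<Phi> f x = 0"
begin

section \<open>Rows, columns and causality of the approximate kernel\<close>

lemma functional: "x \<in> {0..1} \<Longrightarrow> L2_functional (\<lambda>f. \<Phi> f x) C"
 unfolding L2_functional_def using C \<Phi>_linear \<Phi>_sup by blast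

definition coeff where "coeff n x j = (if x \<in> {0..1} then 2^n * \<Phi> (dyi n j) x else 0)"
definition H where "H n x = dstep n (coeff n x)"

lemma H_repr: "x \<in> {0..1} \<Longrightarrow> H n x = repr (\<lambda>f. \<Phi> f x) n"
 by (simp add: H_def[abs_def] repr_def[abs_def] coeff_def[abs_def])

lemma H_outside: "x \<notin> {0..1} \<Longrightarrow> H n x s = 0"
 unfolding H_def coeff_def dstep_def by (auto intro!: sum.neutral)

lemma measurable_coeff[measurable (raw)]:
 assumes [measurable]: "f \<in> borel_measurable N"
 shows "(\<lambda>y. coeff n (f y) j) \<in> borel_measurable N"
proof -
 note [measurable] = \<Phi>_measurable
 show ?thesis unfolding coeff_def by measurable
qed

lemma measurable_H[measurable (raw)]:
 assumes [measurable]: "f \<in> borel_measurable N" "g \<in> borel_measurable N"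
 shows "(\<lambda>y. H n (f y) (g y)) \<in> borel_measurable N"
 unfolding H_def dstep_def by measurable

lemma H_diff_dstep:
 assumes "m \<le> n"
 shows "H n x s - H m x s = dstep n (\<lambda>j. coeff n x j - coeff m x (j div 2^(n - m))) s"
 unfolding H_def by (subst dstep_refine[OF assms, of "coeff m x"]) (simp add: dstep_diff)

lemma nsq_H: "nsq lborel (H n x) \<le> ennreal C"
 using repr_sq(1,2)[OF functional, of x n] H_outside[of x n]
 by (cases "x \<in> {0..1}") (auto simp: H_repr intro!: ennreal_leI)

lemma nsq_H_split:
 assumes "m \<le> n"
 shows "nsq lborel (H n x) = nsq lborel (H m x) + nsq lborel (\<lambda>s. H n x s - H m x s)"
proof (cases "x \<in> {0..1}")
 case True
 have "\<Phi> (repr (\<lambda>f. \<Phi> f x) m) x \<le> \<Phi> (repr (\<lambda>f. \<Phi> f x) n) x"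
  using repr_mono[OF functional[OF True] assms] .
 then show ?thesis using True repr_sq(1,3)[OF functional[OF True]] repr_diff[OF functional[OF True] assms]
  by (simp add: H_repr flip: ennreal_plus)
qed (simp add: H_outside)

text \<open>The cell containing s starts after x, so its indicator vanishes on [0,x] and causality
  of \<Phi> applies. The margin is the length of one cell.\<close>

lemma H_causal:
 assumes "x + 1 / 2^n < s"
 shows "H n x s = 0"
proof (cases "x \<in> {0..1}")
 case True
 have "coeff n x j * dyi n j s = 0" if j: "j < 2^n" for j
 proof (cases "s \<in> {real j / 2^n<..real (Suc j) / 2^n}")
  case s: True
  have "real j / 2^n \<ge> s - 1 / 2^n" using s by (simp add: add_divide_distrib)
  then have x: "x \<in> {0..real j / 2^n}" using assms True by auto
  have "real j \<le> 2^n" using j by (metis less_imp_le of_nat_le_iff of_nat_numeral of_nat_power)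
  then have "\<Phi> (dyi n j) x = 0"
   using x by (intro \<Phi>_causal[OF dyi_L2[OF j], of "real j / 2^n"]) (auto simp: dyi_def indicator_def)
  then show ?thesis by (simp add: coeff_def)
 qed (simp add: dyi_def)
 then show ?thesis unfolding H_def dstep_def by (intro sum.neutral) auto
qed (simp add: H_outside)

text \<open>As a function of x, \<open>H n x s\<close> is \<Phi> applied to \<open>2^n\<close> times
  the indicator of the cell of s. This function has L1 norm 1, so the bound from L1 into L2 is
  uniform in n and s.\<close>

lemma H_column: "nsq lborel (\<lambda>x. H n x s) \<le> ennreal C"
proof (cases "s \<in> {0<..1}")
 case True
 note [measurable] = \<Phi>_measurable
 have "(H n x s)\<^sup>2 = (\<Sum>j<2^n. indicator {0..1} x * ((2^n)\<^sup>2 * (\<Phi> (dyi n j) x)\<^sup>2) * dyi n j s)" for x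
  unfolding H_def dstep_sq by (auto simp: dstep_def coeff_def power_mult_distrib intro!: sum.cong)
 then have "nsq lborel (\<lambda>x. H n x s) =
   (\<integral>\<^sup>+x. (\<Sum>j<2^n. ennreal ((2^n)\<^sup>2 * dyi n j s) * ennreal (indicator {0..1} x * (\<Phi> (dyi n j) x)\<^sup>2)) \<partial>lborel)"
  using dyi_nonneg by (intro nn_integral_cong) (simp add: sum_ennreal mult_ac flip: ennreal_mult)
 also have "\<dots> = (\<Sum>j<2^n. ennreal ((2^n)\<^sup>2 * dyi n j s) * sq_upto 1 (\<Phi> (dyi n j)))"
  by (simp add: nn_integral_sum nn_integral_cmult)
 also have "\<dots> \<le> (\<Sum>j<2^n. ennreal (C * dyi n j s))"
 proof (rule sum_mono)
  fix j :: nat assume "j \<in> {..<2^n}"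
  then have j: "j < 2^n" by simp
  have "abs_upto 1 (dyi n j) = (\<integral>\<^sup>+t. ennreal (dyi n j t) \<partial>lborel)"
  proof (rule nn_integral_cong)
   fix t :: real
   show "ennreal (indicator {0..1} t * \<bar>dyi n j t\<bar>) = ennreal (dyi n j t)"
    using dyi_nonneg(1)[of n j t] dyi_supp[OF j, of t] by (cases "t \<in> {0<..1}") auto
  qed
  also have "\<dots> = ennreal (1 / 2^n)" by (rule dyi_nn_integral)
  finally have "sq_upto 1 (\<Phi> (dyi n j)) \<le> ennreal C * (ennreal (1 / 2^n))\<^sup>2"
   using \<Phi>_L1[OF dyi_L2[OF j]] by simp
  also have "\<dots> = ennreal (C * (1 / 2^n)\<^sup>2)" using C by (simp add: ennreal_mult ennreal_power)
  finally have "ennreal ((2^n)\<^sup>2 * dyi n j s) * sq_upto 1 (\<Phi> (dyi n j)) \<le>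
    ennreal ((2^n)\<^sup>2 * dyi n j s) * ennreal (C * (1 / 2^n)\<^sup>2)"
   by (rule mult_left_mono) simp
  also have "\<dots> = ennreal (C * dyi n j s)"
   using C dyi_nonneg[of n j s] by (simp add: power_divide flip: ennreal_mult)
  finally show "ennreal ((2^n)\<^sup>2 * dyi n j s) * sq_upto 1 (\<Phi> (dyi n j)) \<le> ennreal (C * dyi n j s)" .
 qed
 also have "\<dots> = ennreal (C * (\<Sum>j<2^n. dyi n j s))" using C dyi_nonneg by (simp add: sum_ennreal sum_distrib_left)
 also have "\<dots> \<le> ennreal (C * 1)" using C unfolding sum_dyi_interval by (intro ennreal_leI mult_left_mono) (auto simp: indicator_def)
 finally show ?thesis by simp
qed (simp add: H_def dstep_supp)

lemma H_column_diff: "nsq lborel (\<lambda>x. H n x s - H m x s) \<le> ennreal (4 * C)"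
proof -
 have "nsq lborel (\<lambda>x. H n x s + - H m x s) \<le> 2 * (nsq lborel (\<lambda>x. H n x s) + nsq lborel (\<lambda>x. - H m x s))"
  by (rule nsq_add_le) auto
 also have "\<dots> \<le> 2 * (ennreal C + ennreal C)" using H_column[of _ s] by (intro mult_left_mono add_mono) auto
 also have "\<dots> = ennreal (4 * C)" using C by (simp add: ennreal_mult' flip: ennreal_plus)
 finally show ?thesis by simp
qed

text \<open>By Pythagoras in each row, the squared distance over the square is a difference of total
  masses \<open>A n\<close>, which increase and are at most C. Tonelli then reads this as smallness
  of the columns in the mean.\<close>

lemma H_cauchy:
 assumes e: "e > 0"
 shows "\<exists>k. \<forall>m\<ge>k. \<forall>n\<ge>m. (\<integral>\<^sup>+s. nsq lborel (\<lambda>x. H n x s - H m x s) \<partial>lborel) \<le> ennreal e"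
proof -
 define A where "A n = (\<integral>\<^sup>+x. nsq lborel (H n x) \<partial>lborel)" for n
 define D where "D m n = (\<integral>\<^sup>+x. nsq lborel (\<lambda>s. H n x s - H m x s) \<partial>lborel)" for m n
 have AD: "A n = A m + D m n" if "m \<le> n" for m n
  unfolding A_def D_def by (subst nsq_H_split[OF that], rule nn_integral_add) measurable
 have "A n \<le> (\<integral>\<^sup>+x. ennreal C * indicator {0..1::real} x \<partial>lborel)" for n
  unfolding A_def using nsq_H[of n] by (intro nn_integral_mono) (auto simp: indicator_def H_outside)
 then have AC: "A n \<le> ennreal C" for n by (rule order.trans) (simp add: nn_integral_cmult)
 define a where "a n = enn2real (A n)" for n
 have Aa: "A n = ennreal (a n)" for n unfolding a_def using AC[of n] by (intro ennreal_enn2real[symmetric]) (auto intro: order.strict_trans1)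
 have a0: "a n \<ge> 0" for n by (simp add: a_def)
 have aC: "a n \<le> C" for n using AC[of n] C a0[of n] unfolding Aa by simp
 have "incseq a" unfolding incseq_def using AD a0 by (auto simp: Aa) (metis AD Aa a0 ennreal_le_iff le_iff_add)
 moreover have "Bseq a" using aC a0 by (intro BseqI'[of _ C]) (auto simp: abs_of_nonneg)
 ultimately have "convergent a" by (intro Bseq_mono_convergent) (auto simp: incseq_def)
 then have "Cauchy a" by (rule convergent_Cauchy)
 then obtain k where k: "\<And>m n. m \<ge> k \<Longrightarrow> n \<ge> k \<Longrightarrow> dist (a m) (a n) < e" using e unfolding Cauchy_def by blast
 have "D m n \<le> ennreal e" if "m \<ge> k" "n \<ge> m" for m n
 proof -
  have "ennreal (a n) = ennreal (a m) + D m n" using AD[OF that(2)] by (simp add: Aa)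
  moreover have "a n \<le> a m + e" using k[of m n] that by (auto simp: dist_real_def)
  ultimately have "ennreal (a m) + D m n \<le> ennreal (a m) + ennreal e" using a0 e by (metis ennreal_leI ennreal_plus less_imp_le)
  then show ?thesis by (simp add: ennreal_add_left_cancel_le)
 qed
 moreover have "(\<integral>\<^sup>+s. nsq lborel (\<lambda>x. H n x s - H m x s) \<partial>lborel) = D m n" for m n
  unfolding D_def by (rule lborel_pair.Fubini') measurable
 ultimately show ?thesis by metis
qed

end

section \<open>Fractional integrals of finite sums, and comparison of moments\<close>

lemma nn_frac_bounded:
 assumes [measurable]: "f \<in> borel_measurable borel" and \<delta>: "\<delta> > 0" and t: "t \<in> {0..1}"
  and b: "\<And>x. x \<in> {0..1} \<Longrightarrow> \<bar>f x\<bar> \<le> b"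
 shows "nn_frac \<delta> f t < \<infinity>"
proof -
 have "b \<ge> 0" using b[of 0] by auto
 have "\<bar>f x\<bar> * frac_kernel \<delta> t x \<le> b * frac_kernel \<delta> t x" for x
 proof (cases "x \<in> {0..1}")
  case True then show ?thesis using b frac_kernel_nonneg[OF \<delta>] by (intro mult_right_mono) auto
 next
  case False
  then have "frac_kernel \<delta> t x = 0" using t by (auto simp: frac_kernel_def)
  then show ?thesis by simp
 qed
 then have "nn_frac \<delta> f t \<le> (\<integral>\<^sup>+x. ennreal b * ennreal (frac_kernel \<delta> t x) \<partial>lborel)"
  unfolding nn_frac_def using \<open>b \<ge> 0\<close> frac_kernel_nonneg[OF \<delta>]
  by (intro nn_integral_mono) (auto simp: ennreal_leI simp flip: ennreal_mult)
 also have "\<dots> = ennreal b * (\<integral>\<^sup>+x. ennreal (frac_kernel \<delta> t x) \<partial>lborel)" by (simp add: nn_integral_cmult)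
 also have "\<dots> < \<infinity>" using t nn_integral_frac_kernel[OF \<delta>, of t] by (simp add: ennreal_mult_less_top)
 finally show ?thesis .
qed

lemma frac_int_sum:
 assumes "finite I" and [measurable]: "\<And>i. i \<in> I \<Longrightarrow> f i \<in> borel_measurable borel" and \<delta>: "\<delta> > 0" and t: "t \<in> {0..1}"
  and b: "\<And>i x. i \<in> I \<Longrightarrow> x \<in> {0..1} \<Longrightarrow> \<bar>f i x\<bar> \<le> b"
 shows "frac_int \<delta> (\<lambda>x. \<Sum>i\<in>I. c i * f i x) t = (\<Sum>i\<in>I. c i * frac_int \<delta> (f i) t)"
proof -
 have "integrable lborel (\<lambda>x. f i x * frac_kernel \<delta> t x)" if "i \<in> I" for i
  using nn_frac_bounded[OF assms(2)[OF that] \<delta> t b[OF that]] by (intro integrable_frac \<delta> assms(2) that) auto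
 then show ?thesis
  unfolding frac_int_eq by (simp add: sum_distrib_right mult.assoc Bochner_Integration.integral_sum)
qed

lemma ennreal_eps:
 assumes "(0::ennreal) < e" "c \<ge> 0"
 obtains d where "d > 0" "ennreal c * ennreal d \<le> e"
proof (cases e)
 case (real x)
 then have x: "x > 0" using assms by simp
 have "c * (x / (c + 1)) \<le> x" using x assms by (simp add: field_simps)
 then have "ennreal c * ennreal (x / (c + 1)) \<le> e" using real assms x by (simp flip: ennreal_mult add: ennreal_leI)
 then show ?thesis using x assms by (intro that[of "x / (c + 1)"]) auto
next
 case top then show ?thesis by (intro that[of 1]) auto
qed

lemma (in prob_space) powr_tendsto_nsq:
 assumes [measurable]: "\<And>n. f n \<in> borel_measurable M" and r: "r \<ge> 2"
  and lim: "(\<lambda>n. pow_int r M (f n)) \<longlonglongrightarrow> 0"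
 shows "(\<lambda>n. nsq M (f n)) \<longlonglongrightarrow> 0"
proof (rule order_tendstoI)
 fix a :: ennreal assume a: "0 < a"
 obtain e where e: "e > 0" "ennreal 2 * ennreal e \<le> a" "ennreal e < a"
 proof -
  obtain d where d: "d > 0" "ennreal 4 * ennreal d \<le> a" using ennreal_eps[OF a, of 4] by auto
  have "ennreal d < ennreal (4 * d)" using d(1) by (intro ennreal_lessI) auto
  also have "\<dots> = ennreal 4 * ennreal d" using d(1) by (intro ennreal_mult) auto
  finally have "ennreal d < ennreal 4 * ennreal d" .
  moreover have "ennreal 2 * ennreal d \<le> ennreal 4 * ennreal d" by (intro mult_right_mono) auto
  ultimately show ?thesis using d by (intro that[of d]) (auto intro: order.trans)
 qed
 \<comment> \<open>Chosen so that y^2 > e forces y^2 \<le> c |y|^r.\<close>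
 define c where "c = e powr (1 - r / 2)"
 have c: "c > 0" using e by (simp add: c_def)
 have pt: "y\<^sup>2 \<le> e + c * \<bar>y\<bar> powr r" for y
 proof (cases "y\<^sup>2 \<le> e")
  case False
  have "1 = c * e powr (r / 2 - 1)" using e by (simp add: c_def flip: powr_add)
  also have "\<dots> \<le> c * (y\<^sup>2) powr (r / 2 - 1)" using False e r c by (intro mult_left_mono powr_mono2) auto
  finally have "y\<^sup>2 * 1 \<le> y\<^sup>2 * (c * (y\<^sup>2) powr (r / 2 - 1))" by (intro mult_left_mono) auto
  also have "\<dots> = c * (y\<^sup>2 * (y\<^sup>2) powr (r / 2 - 1))" by (simp only: mult.left_commute)
  also have "\<dots> = c * (y\<^sup>2) powr (r / 2)" by (subst powr_mult_base) auto
  also have "(y\<^sup>2) powr (r / 2) = \<bar>y\<bar> powr r"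
   using powr_powr[of "\<bar>y\<bar>" 2 "r / 2"] by (simp add: powr_numeral)
  finally show ?thesis using e by simp
 qed (use c in \<open>simp add: add_increasing2\<close>)
 have 1: "nsq M (f n) \<le> ennreal e + ennreal c * pow_int r M (f n)" for n
 proof -
  have "nsq M (f n) \<le> (\<integral>\<^sup>+x. ennreal e + ennreal c * ennreal (\<bar>f n x\<bar> powr r) \<partial>M)"
   using pt e c by (intro nn_integral_mono) (simp add: ennreal_leI flip: ennreal_mult ennreal_plus)
  also have "\<dots> = ennreal e + ennreal c * pow_int r M (f n)"
   by (simp add: nn_integral_add nn_integral_cmult emeasure_space_1)
  finally show ?thesis .
 qed
 have "(\<lambda>n. ennreal e + ennreal c * pow_int r M (f n)) \<longlonglongrightarrow> ennreal e + ennreal c * 0"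
  by (intro tendsto_intros ennreal_tendsto_cmult lim) auto
 then have "\<forall>\<^sub>F n in sequentially. ennreal e + ennreal c * pow_int r M (f n) < a"
  using e(3) by (intro order_tendstoD(2)) auto
 then show "\<forall>\<^sub>F n in sequentially. nsq M (f n) < a"
  by eventually_elim (rule order.strict_trans1[OF 1])
qed auto

context brownian
begin

lemma AE_snd_P:
 assumes "AE s in lborel. Q s"
 shows "AE p in P. Q (snd p)"
proof -
 obtain N where N: "{s \<in> space lborel. \<not> Q s} \<subseteq> N" "emeasure lborel N = 0" "N \<in> sets lborel"
  using AE_E[OF assms] by blast
 show ?thesis
 proof (rule AE_I)
  show "{p \<in> space P. \<not> Q (snd p)} \<subseteq> space M \<times> N" using N(1) by (auto simp: space_pair_measure)
  show "emeasure P (space M \<times> N) = 0" using N by (subst lborel.emeasure_pair_measure_Times) auto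
 qed (use N in auto)
qed

lemma nn_integral_snd_P: "f \<in> borel_measurable lborel \<Longrightarrow> (\<integral>\<^sup>+p. f (snd p) \<partial>P) = (\<integral>\<^sup>+s. f s \<partial>lborel)"
 by (subst lborel.nn_integral_fst[symmetric]) (auto simp: emeasure_space_1)

lemma ex_dyi_ito:
 assumes u[measurable]: "u \<in> borel_measurable P" and fin: "nsq P u < \<infinity>" and ad: "adapted u"
  and z: "\<And>w s. s \<notin> {0..1} \<Longrightarrow> u (w, s) = 0"
 shows "\<exists>X. ito (\<lambda>p. dyi n j (snd p) * u p) X"
proof (rule ito_exists)
 have "nsq P (\<lambda>p. dyi n j (snd p) * u p) \<le> nsq P u"
  using dyi_nonneg[of n j] by (intro nn_integral_mono ennreal_leI) (auto simp: power_mult_distrib dyi_sq mult_left_le_one_le)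
 then show "nsq P (\<lambda>p. dyi n j (snd p) * u p) < \<infinity>" using fin by (rule order.strict_trans1)
 show "adapted (\<lambda>p. dyi n j (snd p) * u p)" using ad unfolding adapted_def by (auto intro!: borel_measurable_times)
qed (auto simp: z)

lemma ito_dstep_sum:
 assumes "\<And>j. ito (\<lambda>p. dyi n j (snd p) * u p) (J j)"
 shows "ito (\<lambda>p. dstep n c (snd p) * u p) (\<lambda>w. \<Sum>j<2^n. c j * J j w)"
proof -
 have "ito (\<lambda>p. \<Sum>j<2^n. c j * (dyi n j (snd p) * u p)) (\<lambda>w. \<Sum>j<2^n. c j * J j w)"
  by (intro ito_sum ito_scale assms)
 then show ?thesis by (simp add: dstep_def sum_distrib_right mult.assoc)
qed

end

text \<open>The moment inequality and its constant \<open>D\<close> are assumptions here, to be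
  supplied by \<open>dyadic_moment\<close> before u is given; the bounds below thus have constants
  that do not depend on u.\<close>

locale volterra_integral = brownian M B + kernel_preimage_family K \<delta> C \<Phi>
 for M :: "'w measure" and B K \<delta> C \<Phi> +
 fixes r D :: real and u :: "'w \<times> real \<Rightarrow> real"
 assumes mK: "measurable_kernel K" and kern_fin: "\<And>t. t \<in> {0..1} \<Longrightarrow> nsq lborel (kern K t) < \<infinity>"
  and r: "r \<ge> 2" and u[measurable]: "u \<in> borel_measurable P"
  and u_fin: "pow_int r P u < \<infinity>" and u_adapted: "adapted u"
  and u_zero: "\<And>w s. s \<notin> {0..1} \<Longrightarrow> u (w, s) = 0" and D: "D \<ge> 0"
  and moment: "\<And>n c X. ito (\<lambda>p. dstep n c (snd p) * u p) X \<Longrightarrow>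
   pow_int r M X \<le> ennreal (D * ((\<Sum>j<2^n. (c j)\<^sup>2) / 2^n) powr (r / 2 - 1)) *
    weighted_pow r (dstep n c) u"
begin

lemma u_nsq: "nsq P u < \<infinity>"
 using nsq_finite_of_Lr[OF u r u_fin u_zero] .

definition J where "J n j = (SOME X. ito (\<lambda>p. dyi n j (snd p) * u p) X)"

lemma ito_J: "ito (\<lambda>p. dyi n j (snd p) * u p) (J n j)"
 unfolding J_def by (rule someI_ex[OF ex_dyi_ito[OF u u_nsq u_adapted u_zero]])

lemma J_measurable[measurable]: "J n j \<in> borel_measurable M"
 using ito_measurable(2)[OF ito_J] .

lemma ito_dstep_J: "ito (\<lambda>p. dstep n c (snd p) * u p) (\<lambda>w. \<Sum>j<2^n. c j * J n j w)"
 by (rule ito_dstep_sum[OF ito_J])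

text \<open>A finite sum of functions of x times random variables, hence jointly measurable at once.
  For each x it is an integral of \<open>H n x\<close> times u, by linearity.\<close>

definition Y where "Y n p = (\<Sum>j<2^n. coeff n (snd p) j * J n j (fst p))"

lemma Y_measurable[measurable]: "Y n \<in> borel_measurable P"
 unfolding Y_def by measurable

lemma ito_Y: "ito (\<lambda>p. H n x (snd p) * u p) (\<lambda>w. Y n (w, x))"
 using ito_dstep_J[of n "coeff n x"] by (simp add: H_def Y_def)

definition "D' = D * C powr (r / 2 - 1)"

lemma D'_nonneg: "D' \<ge> 0" using D by (simp add: D'_def)

lemma moment_dstep:
 assumes "ito (\<lambda>p. dstep n c (snd p) * u p) X" "nsq lborel (dstep n c) \<le> ennreal C"
 shows "pow_int r M X \<le> ennreal D' *
    weighted_pow r (dstep n c) u"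
proof -
 have s0: "(\<Sum>j<2^n. (c j)\<^sup>2) / 2^n \<ge> 0" by (intro divide_nonneg_nonneg sum_nonneg) auto
 have "(\<Sum>j<2^n. (c j)\<^sup>2) / 2^n \<le> C" using assms(2) C unfolding nsq_dstep by simp
 then have "D * ((\<Sum>j<2^n. (c j)\<^sup>2) / 2^n) powr (r / 2 - 1) \<le> D'"
  unfolding D'_def using r D s0 by (intro mult_left_mono powr_mono2) auto
 then show ?thesis by (intro order.trans[OF moment[OF assms(1)]] mult_right_mono ennreal_leI) auto
qed

text \<open>Tonelli moves the integration over x onto \<open>(G x s)\<^sup>2\<close> at fixed s;
  here rows give way to columns.\<close>

lemma moment_integrated:
 assumes A[measurable]: "A \<in> sets borel" and G[measurable]: "(\<lambda>p. G (fst p) (snd p)) \<in> borel_measurable (borel \<Otimes>\<^sub>M borel)"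
  and X[measurable]: "X \<in> borel_measurable P"
  and b: "\<And>x. pow_int r M (\<lambda>w. X (w, x)) \<le> ennreal D' * (\<integral>\<^sup>+p. ennreal ((G x (snd p))\<^sup>2 * \<bar>u p\<bar> powr r) \<partial>P)"
 shows "(\<integral>\<^sup>+p. ennreal (indicator A (snd p) * \<bar>X p\<bar> powr r) \<partial>P) \<le>
  ennreal D' * (\<integral>\<^sup>+p. ennreal (\<bar>u p\<bar> powr r) * (\<integral>\<^sup>+x. ennreal (indicator A x * (G x (snd p))\<^sup>2) \<partial>lborel) \<partial>P)"
proof -
 interpret Q: pair_sigma_finite P lborel ..
 have Gm[measurable (raw)]: "(\<lambda>y. G (f y) (g y)) \<in> borel_measurable N" if [measurable]: "f \<in> borel_measurable N" "g \<in> borel_measurable N" for f g and N :: "'c measure"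
  using measurable_compose[OF _ G, of "\<lambda>y. (f y, g y)" N] by simp
 have "(\<integral>\<^sup>+p. ennreal (indicator A (snd p) * \<bar>X p\<bar> powr r) \<partial>P) = (\<integral>\<^sup>+x. (\<integral>\<^sup>+w. ennreal (indicator A x) * ennreal (\<bar>X (w, x)\<bar> powr r) \<partial>M) \<partial>lborel)"
  by (subst P.nn_integral_snd[symmetric]) (auto simp flip: ennreal_mult)
 also have "\<dots> \<le> (\<integral>\<^sup>+x. ennreal (indicator A x) * (ennreal D' * (\<integral>\<^sup>+p. ennreal ((G x (snd p))\<^sup>2 * \<bar>u p\<bar> powr r) \<partial>P)) \<partial>lborel)"
  by (intro nn_integral_mono) (auto simp: nn_integral_cmult intro!: mult_left_mono b)
 also have "\<dots> = (\<integral>\<^sup>+x. (\<integral>\<^sup>+p. ennreal D' * (ennreal (\<bar>u p\<bar> powr r) * ennreal (indicator A x * (G x (snd p))\<^sup>2)) \<partial>P) \<partial>lborel)"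
 proof (rule nn_integral_cong)
  fix x :: real
  have "(\<integral>\<^sup>+p. ennreal D' * (ennreal (\<bar>u p\<bar> powr r) * ennreal (indicator A x * (G x (snd p))\<^sup>2)) \<partial>P) =
   (\<integral>\<^sup>+p. (ennreal (indicator A x) * ennreal D') * ennreal ((G x (snd p))\<^sup>2 * \<bar>u p\<bar> powr r) \<partial>P)"
   by (intro nn_integral_cong) (simp add: ennreal_mult mult_ac)
  also have "\<dots> = (ennreal (indicator A x) * ennreal D') * (\<integral>\<^sup>+p. ennreal ((G x (snd p))\<^sup>2 * \<bar>u p\<bar> powr r) \<partial>P)"
   by (rule nn_integral_cmult) measurable
  finally show "ennreal (indicator A x) * (ennreal D' * (\<integral>\<^sup>+p. ennreal ((G x (snd p))\<^sup>2 * \<bar>u p\<bar> powr r) \<partial>P)) =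
   (\<integral>\<^sup>+p. ennreal D' * (ennreal (\<bar>u p\<bar> powr r) * ennreal (indicator A x * (G x (snd p))\<^sup>2)) \<partial>P)"
   by (simp add: mult.assoc)
 qed
 also have "\<dots> = (\<integral>\<^sup>+p. (\<integral>\<^sup>+x. ennreal D' * (ennreal (\<bar>u p\<bar> powr r) * ennreal (indicator A x * (G x (snd p))\<^sup>2)) \<partial>lborel) \<partial>P)"
  by (rule Q.Fubini') measurable
 also have "\<dots> = ennreal D' * (\<integral>\<^sup>+p. ennreal (\<bar>u p\<bar> powr r) * (\<integral>\<^sup>+x. ennreal (indicator A x * (G x (snd p))\<^sup>2) \<partial>lborel) \<partial>P)"
  by (simp add: nn_integral_cmult)
 finally show ?thesis .
qed

text \<open>The columns of \<open>H n - H m\<close> are small only in the mean over s, while |u|^r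
  is merely integrable. Their uniform bound \<open>4 * C\<close> allows \<open>small_product\<close>
  to combine the two.\<close>

lemma Y_cauchy:
 assumes e: "e > 0"
 shows "\<exists>k. \<forall>m\<ge>k. \<forall>n\<ge>k. pow_int r P (\<lambda>p. Y m p - Y n p) \<le> e"
proof -
 obtain e' where e': "e' > 0" "ennreal D' * ennreal e' \<le> e" using ennreal_eps[OF e D'_nonneg] .
 have "4 * C \<ge> 0" using C by simp
 obtain d where d: "d > 0" "\<And>g. g \<in> borel_measurable P \<Longrightarrow> (\<And>x. g x \<le> ennreal (4 * C)) \<Longrightarrow> (\<integral>\<^sup>+x. g x \<partial>P) \<le> ennreal d \<Longrightarrow>
  (\<integral>\<^sup>+x. ennreal (\<bar>u x\<bar> powr r) * g x \<partial>P) \<le> ennreal e'"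
  by (rule small_product[of "\<lambda>x. \<bar>u x\<bar> powr r" P e' "4 * C"], measurable) (use u_fin e' \<open>4 * C \<ge> 0\<close> in auto)
 obtain k where k: "\<And>m n. k \<le> m \<Longrightarrow> m \<le> n \<Longrightarrow> (\<integral>\<^sup>+s. nsq lborel (\<lambda>x. H n x s - H m x s) \<partial>lborel) \<le> ennreal d"
  using H_cauchy[OF d(1)] by blast
 have *: "pow_int r P (\<lambda>p. Y n p - Y m p) \<le> e" if km: "k \<le> m" and mn: "m \<le> n" for m n
 proof -
  have b: "pow_int r M (\<lambda>w. Y n (w, x) - Y m (w, x)) \<le> ennreal D' * (\<integral>\<^sup>+p. ennreal ((H n x (snd p) - H m x (snd p))\<^sup>2 * \<bar>u p\<bar> powr r) \<partial>P)" for x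
  proof -
   have "ito (\<lambda>p. (H n x (snd p) - H m x (snd p)) * u p) (\<lambda>w. Y n (w, x) - Y m (w, x))"
    using ito_diff[OF ito_Y[of n x] ito_Y[of m x]] by (simp add: left_diff_distrib)
   moreover have "nsq lborel (\<lambda>s. H n x s - H m x s) \<le> nsq lborel (H n x)"
    unfolding nsq_H_split[OF mn] by simp
   then have "nsq lborel (\<lambda>s. H n x s - H m x s) \<le> ennreal C" using nsq_H by (rule order.trans)
   ultimately show ?thesis using moment_dstep unfolding H_diff_dstep[OF mn] by blast
  qed
  have "pow_int r P (\<lambda>p. Y n p - Y m p) = (\<integral>\<^sup>+p. ennreal (indicator UNIV (snd p) * \<bar>Y n p - Y m p\<bar> powr r) \<partial>P)" by simp
  also have "\<dots> \<le> ennreal D' * (\<integral>\<^sup>+p. ennreal (\<bar>u p\<bar> powr r) * (\<integral>\<^sup>+x. ennreal (indicator UNIV x * (H n x (snd p) - H m x (snd p))\<^sup>2) \<partial>lborel) \<partial>P)"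
   by (rule moment_integrated[where G="\<lambda>x s. H n x s - H m x s"]) (use b in auto)
  also have "\<dots> \<le> ennreal D' * ennreal e'"
  proof (intro mult_left_mono d(2))
   have "(\<integral>\<^sup>+p. (\<integral>\<^sup>+x. ennreal (indicator UNIV x * (H n x (snd p) - H m x (snd p))\<^sup>2) \<partial>lborel) \<partial>P) =
    (\<integral>\<^sup>+s. nsq lborel (\<lambda>x. H n x s - H m x s) \<partial>lborel)"
    using nn_integral_snd_P[of "\<lambda>s. nsq lborel (\<lambda>x. H n x s - H m x s)"] by simp
   then show "(\<integral>\<^sup>+p. (\<integral>\<^sup>+x. ennreal (indicator UNIV x * (H n x (snd p) - H m x (snd p))\<^sup>2) \<partial>lborel) \<partial>P) \<le> ennreal d"
    using k[OF km mn] by simp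
  qed (use H_column_diff in auto)
  also note e'(2)
  finally show ?thesis .
 qed
 have "pow_int r P (\<lambda>p. Y m p - Y n p) \<le> e" if "m \<ge> k" "n \<ge> k" for m n
  using *[of m n] *[of n m] that by (cases "m \<le> n") (auto simp: abs_minus_commute)
 then show ?thesis by blast
qed

definition Yl where "Yl = (SOME g. g \<in> borel_measurable P \<and> (\<lambda>n. pow_int r P (\<lambda>p. Y n p - g p)) \<longlonglongrightarrow> 0)"

lemma Yl_measurable[measurable]: "Yl \<in> borel_measurable P"
 and Y_tendsto: "(\<lambda>n. pow_int r P (\<lambda>p. Y n p - Yl p)) \<longlonglongrightarrow> 0"
proof -
 have "\<exists>g\<in>borel_measurable P. (\<lambda>n. pow_int r P (\<lambda>p. Y n p - g p)) \<longlonglongrightarrow> 0"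
  using Y_cauchy r by (intro Lp_complete) auto
 then have "\<exists>g. g \<in> borel_measurable P \<and> (\<lambda>n. pow_int r P (\<lambda>p. Y n p - g p)) \<longlonglongrightarrow> 0" by blast
 from someI_ex[OF this]
 show "Yl \<in> borel_measurable P" "(\<lambda>n. pow_int r P (\<lambda>p. Y n p - Yl p)) \<longlonglongrightarrow> 0"
  unfolding Yl_def by auto
qed

text \<open>At level n causality holds up to one cell, so u enters up to time T +
  \<open>1 / 2^k\<close> for all n \<ge> k. First n grows, by Fatou, then k, by dominated
  convergence.\<close>

lemma Yl_bound:
 assumes T: "T \<in> {0..1}"
 shows "proc_pow r T Yl \<le>
  ennreal (D' * C) * proc_pow r T u"
proof -
 let ?Q = "\<lambda>T. proc_pow r T u"
 have b: "proc_pow r T (Y n) \<le> ennreal (D' * C) * ?Q (T + 1 / 2^k)" if kn: "k \<le> n" for k n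
 proof -
  have m: "pow_int r M (\<lambda>w. Y n (w, x)) \<le> ennreal D' * (\<integral>\<^sup>+p. ennreal ((H n x (snd p))\<^sup>2 * \<bar>u p\<bar> powr r) \<partial>P)" for x
   using moment_dstep[OF ito_Y[unfolded H_def] nsq_H[unfolded H_def]] unfolding H_def .
  have "proc_pow r T (Y n) \<le>
   ennreal D' * (\<integral>\<^sup>+p. ennreal (\<bar>u p\<bar> powr r) * sq_upto T (\<lambda>x. H n x (snd p)) \<partial>P)"
   by (rule moment_integrated[where G="H n"]) (use m in auto)
  also have "\<dots> \<le> ennreal D' * (\<integral>\<^sup>+p. ennreal C * ennreal (indicator {0..T + 1 / 2^k} (snd p) * \<bar>u p\<bar> powr r) \<partial>P)"
  proof (intro mult_left_mono nn_integral_mono)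
   fix p :: "'w \<times> real"
   obtain w s where p: "p = (w, s)" by (cases p)
   consider "s \<in> {0..T + 1 / 2^k}" | "s < 0" | "s > T + 1 / 2^k" by fastforce
   then show "ennreal (\<bar>u p\<bar> powr r) * sq_upto T (\<lambda>x. H n x (snd p)) \<le>
    ennreal C * ennreal (indicator {0..T + 1 / 2^k} (snd p) * \<bar>u p\<bar> powr r)"
   proof cases
    case 1
    have "sq_upto T (\<lambda>x. H n x s) \<le> nsq lborel (\<lambda>x. H n x s)"
     by (intro nn_integral_mono) (auto simp: indicator_def)
    also have "\<dots> \<le> ennreal C" by (rule H_column)
    finally show ?thesis using 1 by (simp add: p mult.commute[of "ennreal C"] mult_left_mono)
   next
    case 2 then show ?thesis using u_zero[of s w] by (simp add: p)
   next
    case 3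
    have "(1::real) / 2^n \<le> 1 / 2^k" using kn by (intro divide_left_mono power_increasing) auto
    then have "indicator {0..T} x * (H n x s)\<^sup>2 = 0" for x using 3 H_causal[of x n s] by (auto simp: indicator_def)
    then have "sq_upto T (\<lambda>x. H n x s) = 0" by (simp only:) simp
    then show ?thesis by (simp add: p)
   qed
  qed simp
  also have "\<dots> = ennreal (D' * C) * ?Q (T + 1 / 2^k)"
   using D'_nonneg C by (subst nn_integral_cmult) (simp_all add: ennreal_mult mult.assoc)
  finally show ?thesis .
 qed
 have p: "r > 0" using r by simp
 have ip: "\<bar>indicator A x * y\<bar> powr r = indicator A x * \<bar>y\<bar> powr r" for A and x y :: real by (simp add: indicator_def)
 obtain s where s: "strict_mono s" "AE p in P. (\<lambda>n. Y (s n) p) \<longlonglongrightarrow> Yl p"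
  using Lp_tendsto_subseq_AE[OF Y_measurable Yl_measurable p Y_tendsto] by blast
 have k: "proc_pow r T Yl \<le> ennreal (D' * C) * ?Q (T + 1 / 2^k)" for k
 proof -
  have "pow_int r P (\<lambda>p. indicator {0..T} (snd p) * Yl p) \<le> ennreal (D' * C) * ?Q (T + 1 / 2^k)"
  proof (rule nn_powr_fatou[where f="\<lambda>n p. indicator {0..T} (snd p) * Y (s n) p"])
   show "AE p in P. (\<lambda>n. indicator {0..T} (snd p) * Y (s n) p) \<longlonglongrightarrow> indicator {0..T} (snd p) * Yl p"
    using s(2) by eventually_elim (intro tendsto_intros)
   show "\<forall>\<^sub>F n in sequentially. pow_int r P (\<lambda>p. indicator {0..T} (snd p) * Y (s n) p) \<le> ennreal (D' * C) * ?Q (T + 1 / 2^k)"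
    using b[of k] seq_suble[OF s(1)] unfolding ip
    by (intro eventually_sequentiallyI[of k]) (meson order.trans)
  qed (use p in measurable)
  then show ?thesis unfolding ip .
 qed
 have "(\<lambda>k. ?Q (T + 1 / 2^k)) \<longlonglongrightarrow> ?Q T"
 proof (rule nn_integral_dominated_convergence[where w="\<lambda>p. ennreal (\<bar>u p\<bar> powr r)"])
  show "AE p in P. (\<lambda>k. ennreal (indicator {0..T + 1 / 2^k} (snd p) * \<bar>u p\<bar> powr r)) \<longlonglongrightarrow> ennreal (indicator {0..T} (snd p) * \<bar>u p\<bar> powr r)"
  proof (rule AE_I2, rule tendsto_eventually)
   fix p :: "'w \<times> real"
   show "\<forall>\<^sub>F k in sequentially. ennreal (indicator {0..T + 1 / 2^k} (snd p) * \<bar>u p\<bar> powr r) = ennreal (indicator {0..T} (snd p) * \<bar>u p\<bar> powr r)"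
   proof (cases "snd p \<le> T")
    case True
    then have "indicator {0..T + 1 / 2^k} (snd p) = (indicator {0..T} (snd p) :: real)" for k :: nat
     by (auto simp: indicator_def intro: order.trans add_increasing2)
    then show ?thesis by simp
   next
    case False
    have "(\<lambda>k. T + (1 / 2)^k) \<longlonglongrightarrow> T + 0" by (intro tendsto_intros LIMSEQ_power_zero) auto
    then have "\<forall>\<^sub>F k in sequentially. T + (1 / 2)^k < snd p" using False by (intro order_tendstoD(2)) auto
    then show ?thesis
    proof eventually_elim
     case (elim k)
     then show ?case using False by (simp add: power_one_over)
    qed
   qed
  qed
 qed (use u_fin in \<open>auto simp: indicator_def\<close>)
 then have "(\<lambda>k. ennreal (D' * C) * ?Q (T + 1 / 2^k)) \<longlonglongrightarrow> ennreal (D' * C) * ?Q T" by (rule ennreal_tendsto_cmult[rotated]) simp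
 then show ?thesis using k by (intro LIMSEQ_le_const) auto
qed

end

context volterra_integral
begin

section \<open>The fractional integral of the limit process\<close>

lemma measurable_pair_kern[measurable]: "(\<lambda>t. pair_fun (kern K t) (dyi n j)) \<in> borel_measurable borel"
proof -
 note [measurable (raw)] = measurable_kern[OF mK]
 show ?thesis unfolding pair_fun_def by measurable
qed

text \<open>The integral of u against the level n dyadic averages of the row
  \<open>kern K t\<close>.\<close>

definition S where "S n t w = (\<Sum>j<2^n. 2^n * pair_fun (kern K t) (dyi n j) * J n j w)"

lemma S_measurable[measurable (raw)]:
 assumes [measurable]: "f \<in> borel_measurable N" "g \<in> measurable N M"
 shows "(\<lambda>y. S n (f y) (g y)) \<in> borel_measurable N"
 unfolding S_def by measurable

lemma ito_S: "ito (\<lambda>p. repr (pair_fun (kern K t)) n (snd p) * u p) (S n t)"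
 using ito_dstep_J[of n "\<lambda>j. 2^n * pair_fun (kern K t) (dyi n j)"] by (simp add: repr_def S_def[abs_def])

lemma \<Phi>_dyi_le:
 assumes j: "j < 2^n" and x: "x \<in> {0..1}"
 shows "\<bar>\<Phi> (dyi n j) x\<bar> \<le> sqrt C"
proof -
 have "sq_upto 1 (dyi n j) \<le> (\<integral>\<^sup>+t. ennreal (dyi n j t) \<partial>lborel)"
  using dyi_nonneg(1)[of n j] by (intro nn_integral_mono ennreal_leI) (auto simp: dyi_sq indicator_def)
 also have "\<dots> = ennreal (1 / 2^n)" by (rule dyi_nn_integral)
 also have "\<dots> \<le> 1" using ennreal_leI[of "1 / 2^n" 1] by simp
 finally have "ennreal C * sq_upto 1 (dyi n j) \<le> ennreal C * 1"
  by (rule mult_left_mono) simp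
 with \<Phi>_sup[OF dyi_L2[OF j] x] have "ennreal ((\<Phi> (dyi n j) x)\<^sup>2) \<le> ennreal C * 1" by (rule order.trans)
 then have "ennreal ((\<Phi> (dyi n j) x)\<^sup>2) \<le> ennreal C" by simp
 then have "(\<Phi> (dyi n j) x)\<^sup>2 \<le> C" using C by simp
 then show ?thesis by (rule real_le_rsqrt[of "\<bar>_\<bar>", simplified])
qed

lemma Y_section_measurable[measurable]: "(\<lambda>x. Y n (w, x)) \<in> borel_measurable borel"
 unfolding Y_def by simp measurable

lemma Yl_section: "w \<in> space M \<Longrightarrow> (\<lambda>x. Yl (w, x)) \<in> borel_measurable borel"
 using measurable_compose[OF measurable_Pair1', of w M Yl lborel borel] by simp

text \<open>What would be a stochastic Fubini theorem is, at a dyadic level, linearity of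
  \<open>frac_int\<close> over a finite sum: \<Phi> of each cell is a preimage of K of that
  cell.\<close>

lemma frac_Y:
 assumes t: "t \<in> {0..1}"
 shows "frac_int \<delta> (\<lambda>x. Y n (w, x)) t = S n t w"
proof -
 have "frac_int \<delta> (\<lambda>x. Y n (w, x)) t = frac_int \<delta> (\<lambda>x. \<Sum>j<2^n. (2^n * J n j w) * \<Phi> (dyi n j) x) t"
  using t by (intro frac_int_cong) (auto simp: Y_def coeff_def mult_ac intro!: sum.cong)
 also have "\<dots> = (\<Sum>j<2^n. (2^n * J n j w) * frac_int \<delta> (\<Phi> (dyi n j)) t)"
  using \<Phi>_dyi_le by (intro frac_int_sum \<delta> t \<Phi>_measurable) auto
 also have "\<dots> = S n t w"
  unfolding S_def using t by (intro sum.cong) (auto simp: \<Phi>_volterra dyi_L2 volterra_op_kern)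
 finally show ?thesis .
qed

lemma nn_frac_Y:
 assumes t: "t \<in> {0..1}"
 shows "nn_frac \<delta> (\<lambda>x. Y n (w, x)) t < \<infinity>"
proof (rule nn_frac_bounded[OF Y_section_measurable \<delta> t])
 fix x :: real assume x: "x \<in> {0..1}"
 show "\<bar>Y n (w, x)\<bar> \<le> (\<Sum>j<2^n. 2^n * sqrt C * \<bar>J n j w\<bar>)"
  unfolding Y_def using x \<Phi>_dyi_le[OF _ x]
  by (intro order.trans[OF sum_abs] sum_mono) (auto simp: coeff_def abs_mult intro!: mult_right_mono)
qed

definition Z where "Z w t = frac_int \<delta> (\<lambda>x. Yl (w, x)) t"

lemma Z_measurable[measurable (raw)]:
 assumes [measurable]: "f \<in> measurable N M" "g \<in> borel_measurable N"
 shows "(\<lambda>y. Z (f y) (g y)) \<in> borel_measurable N"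
 unfolding Z_def frac_int_eq by measurable

definition good where "good w \<longleftrightarrow> (pow_upto r 1 (\<lambda>x. Yl (w, x))) < \<infinity>"

lemma Yl_finite: "proc_pow r 1 Yl < \<infinity>"
proof -
 have "proc_pow r 1 u \<le> pow_int r P u"
  by (intro nn_integral_mono) (auto simp: indicator_def)
 then have "proc_pow r 1 u < \<infinity>" using u_fin by (rule order.strict_trans1)
 then have "ennreal (D' * C) * proc_pow r 1 u < \<infinity>"
  by (simp add: ennreal_mult_less_top)
 then show ?thesis using Yl_bound[of 1] by (auto intro: order.strict_trans1)
qed

lemma AE_good: "AE w in M. good w"
proof -
 have "(\<integral>\<^sup>+w. pow_upto r 1 (\<lambda>x. Yl (w, x)) \<partial>M) \<noteq> \<infinity>"
  using Yl_finite by (subst (asm) lborel.nn_integral_fst[symmetric]) auto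
 then have "AE w in M. pow_upto r 1 (\<lambda>x. Yl (w, x)) \<noteq> \<infinity>"
  by (intro nn_integral_PInf_AE) auto
 then show ?thesis by eventually_elim (simp add: good_def top.not_eq_extremum)
qed

lemma S_minus_Z:
 assumes w: "w \<in> space M" and t: "t \<in> {0..1}" and fin: "nn_frac \<delta> (\<lambda>x. Yl (w, x)) t < \<infinity>"
 shows "S n t w - Z w t = frac_int \<delta> (\<lambda>x. Y n (w, x) - Yl (w, x)) t"
 using frac_int_linear[OF Y_section_measurable Yl_section[OF w] \<delta> nn_frac_Y[OF t] fin, of 1 n w "-1"]
 by (simp add: frac_Y[OF t] Z_def)

text \<open>The integrals \<open>S\<close> converge in mean square and the averaged rows converge to
  the row along subsequences; \<open>ito_of_limit\<close> then gives the integral together with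
  square integrability of its integrand.\<close>

lemma ito_Z_of_tendsto:
 assumes t: "t \<in> {0..1}" and s: "strict_mono (s :: nat \<Rightarrow> nat)"
  and lim: "(\<lambda>n. pow_int r M (\<lambda>w. S (s n) t w - Z w t)) \<longlonglongrightarrow> 0"
 shows "ito (kint K t u) (\<lambda>w. Z w t)"
proof -
 note [measurable (raw)] = measurable_kern[OF mK]
 have k[measurable]: "kern K t \<in> borel_measurable borel" by measurable
 have rm[measurable]: "repr l n \<in> borel_measurable borel" for l n unfolding repr_def by measurable
 have kl: "(\<lambda>n. nsq lborel (\<lambda>x. repr (pair_fun (kern K t)) n x - kern K t x)) \<longlonglongrightarrow> 0"
  using kern_zero by (intro dyadic_averages_tendsto[OF k kern_fin[OF t]]) auto
 show ?thesis
 proof (rule ito_of_limit[where v="\<lambda>n p. repr (pair_fun (kern K t)) (s n) (snd p) * u p" and X="\<lambda>n. S (s n) t"])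
  show "(\<lambda>n. nsq M (\<lambda>w. S (s n) t w - Z w t)) \<longlonglongrightarrow> 0"
   by (rule powr_tendsto_nsq[OF _ r lim]) measurable
  fix q :: "nat \<Rightarrow> nat" assume q: "strict_mono q"
  have "strict_mono (\<lambda>n. s (q n))" using s q by (auto simp: strict_mono_def)
  from LIMSEQ_subseq_LIMSEQ[OF kl this]
  have "(\<lambda>n. nsq lborel (\<lambda>x. repr (pair_fun (kern K t)) (s (q n)) x - kern K t x)) \<longlonglongrightarrow> 0" by (simp add: comp_def)
  then obtain s' where s': "strict_mono s'" "AE x in lborel. (\<lambda>n. repr (pair_fun (kern K t)) (s (q (s' n))) x) \<longlonglongrightarrow> kern K t x"
   using nsq_subseq_AE[of "\<lambda>n. repr (pair_fun (kern K t)) (s (q n))" lborel "kern K t"] by auto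
  have "AE p in P. (\<lambda>n. repr (pair_fun (kern K t)) (s (q (s' n))) (snd p) * u p) \<longlonglongrightarrow> kern K t (snd p) * u p"
   using AE_snd_P[OF s'(2)] by eventually_elim (intro tendsto_intros)
  with s'(1) show "\<exists>s'. strict_mono s' \<and> (AE p in P. (\<lambda>n. repr (pair_fun (kern K t)) (s (q (s' n))) (snd p) * u p) \<longlonglongrightarrow> kern K t (snd p) * u p)"
   by blast
 qed (use ito_S in auto)
qed

text \<open>Pathwise boundedness of \<open>frac_int\<close> on Lr turns convergence of
  \<open>Y\<close> into convergence of \<open>S\<close> to \<open>Z\<close> in Lr over time and
  probability. A subsequence then works for almost every t.\<close>

lemma ito_Z_AE: "AE t in lborel. t \<in> {0..1} \<longrightarrow> ito (kint K t u) (\<lambda>w. Z w t)"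
proof -
 define c where "c = (1 / Gamma (\<delta> + 1)) powr r"
 define g where "g n t = (\<integral>\<^sup>+w. ennreal (indicator {0..1} t * \<bar>S n t w - Z w t\<bar> powr r) \<partial>M)" for n t
 have [measurable]: "g n \<in> borel_measurable lborel" for n unfolding g_def by measurable
 have ip: "indicator A x * \<bar>y\<bar> powr r \<le> \<bar>y\<bar> powr r" for A and x y :: real by (simp add: indicator_def)
 have "(\<integral>\<^sup>+t. g n t \<partial>lborel) \<le> ennreal c * pow_int r P (\<lambda>p. Y n p - Yl p)" for n
 proof -
  have "(\<integral>\<^sup>+t. g n t \<partial>lborel) = (\<integral>\<^sup>+w. pow_upto r 1 (\<lambda>t. S n t w - Z w t) \<partial>M)"
   unfolding g_def by (rule P.Fubini') measurable
  also have "\<dots> \<le> (\<integral>\<^sup>+w. ennreal c * pow_int r lborel (\<lambda>x. Y n (w, x) - Yl (w, x)) \<partial>M)"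
  proof (rule nn_integral_mono_AE)
   show "AE w in M. pow_upto r 1 (\<lambda>t. S n t w - Z w t) \<le>
     ennreal c * pow_int r lborel (\<lambda>x. Y n (w, x) - Yl (w, x))"
    using AE_good AE_space
   proof eventually_elim
    case (elim w)
    note [measurable] = Yl_section[OF elim(2)]
    have "abs_upto 1 (\<lambda>t. Yl (w, t)) < \<infinity>"
     using elim(1) r by (intro nn_indicator_L1[where p=r]) (auto simp: good_def)
    then have "AE t in lborel. t \<in> {0..1} \<longrightarrow> nn_frac \<delta> (\<lambda>x. Yl (w, x)) t < \<infinity>"
     by (intro AE_nn_frac_finite \<delta>) auto
    then have "AE t in lborel. ennreal (indicator {0..1} t * \<bar>S n t w - Z w t\<bar> powr r) =
      ennreal (indicator {0..1} t * \<bar>frac_int \<delta> (\<lambda>x. Y n (w, x) - Yl (w, x)) t\<bar> powr r)"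
    proof eventually_elim
     fix t assume "t \<in> {0..1} \<longrightarrow> nn_frac \<delta> (\<lambda>x. Yl (w, x)) t < \<infinity>"
     then show "ennreal (indicator {0..1} t * \<bar>S n t w - Z w t\<bar> powr r) =
      ennreal (indicator {0..1} t * \<bar>frac_int \<delta> (\<lambda>x. Y n (w, x) - Yl (w, x)) t\<bar> powr r)"
      using S_minus_Z[OF elim(2), of t n] by (cases "t \<in> {0..1}") auto
    qed
    then have "pow_upto r 1 (\<lambda>t. S n t w - Z w t) =
      pow_upto r 1 (frac_int \<delta> (\<lambda>x. Y n (w, x) - Yl (w, x)))"
     by (rule nn_integral_cong_AE)
    also have "\<dots> \<le> ennreal c * pow_upto r 1 (\<lambda>x. Y n (w, x) - Yl (w, x))"
     unfolding c_def using r by (intro frac_int_Lp_bound \<delta>) auto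
    also have "\<dots> \<le> ennreal c * pow_int r lborel (\<lambda>x. Y n (w, x) - Yl (w, x))"
     using ip by (intro mult_left_mono nn_integral_mono ennreal_leI) auto
    finally show ?case .
   qed
  qed
  also have "\<dots> = ennreal c * pow_int r P (\<lambda>p. Y n p - Yl p)"
   by (simp add: nn_integral_cmult flip: lborel.nn_integral_fst)
  finally show ?thesis .
 qed
 then have "(\<lambda>n. \<integral>\<^sup>+t. g n t \<partial>lborel) \<longlonglongrightarrow> 0" by (rule ennreal_tendsto_zero_le[OF Y_tendsto]) simp
 then obtain s where s: "strict_mono s" "AE t in lborel. (\<lambda>n. g (s n) t) \<longlonglongrightarrow> 0"
  using nn_tendsto_zero_subseq_AE[of g lborel] by auto
 show ?thesis using s(2)
 proof eventually_elim
  case (elim t)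
  then show ?case using ito_Z_of_tendsto[OF _ s(1), of t] by (auto simp: g_def)
 qed
qed

text \<open>Above order 1/r the pointwise bound for \<open>frac_int\<close> replaces the bound on
  Lr, and convergence holds at each t.\<close>

lemma ito_Z_everywhere:
 assumes \<delta>r: "\<delta> * r > 1" and t: "t \<in> {0..1}"
 shows "ito (kint K t u) (\<lambda>w. Z w t)"
proof -
 have r1: "r > 1" using r by simp
 obtain E where E: "E \<ge> 0" "\<And>f x. f \<in> borel_measurable borel \<Longrightarrow> 0 \<le> x \<Longrightarrow> x \<le> 1 \<Longrightarrow>
   ennreal (\<bar>frac_int \<delta> f x\<bar> powr r) \<le> ennreal E * pow_upto r x f"
  using frac_int_sup_bound[OF \<delta> r1 \<delta>r] by blast
 have "pow_int r M (\<lambda>w. S n t w - Z w t) \<le> ennreal E * pow_int r P (\<lambda>p. Y n p - Yl p)" for n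
 proof -
  have "pow_int r M (\<lambda>w. S n t w - Z w t) \<le> (\<integral>\<^sup>+w. ennreal E * pow_int r lborel (\<lambda>x. Y n (w, x) - Yl (w, x)) \<partial>M)"
  proof (rule nn_integral_mono_AE)
   show "AE w in M. ennreal (\<bar>S n t w - Z w t\<bar> powr r) \<le> ennreal E * pow_int r lborel (\<lambda>x. Y n (w, x) - Yl (w, x))"
    using AE_good AE_space
   proof eventually_elim
    case (elim w)
    note [measurable] = Yl_section[OF elim(2)]
    have "pow_upto r t (\<lambda>x. Yl (w, x)) \<le> pow_upto r 1 (\<lambda>x. Yl (w, x))"
     using t by (intro nn_integral_mono) (auto simp: indicator_def)
    also have "\<dots> < \<infinity>" using elim(1) by (simp add: good_def)
    finally have "nn_frac \<delta> (\<lambda>x. Yl (w, x)) t < \<infinity>" using t by (intro nn_frac_finite_Lp[OF _ \<delta> r1 \<delta>r]) auto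
    from S_minus_Z[OF elim(2) t this]
    have "ennreal (\<bar>S n t w - Z w t\<bar> powr r) \<le> ennreal E * pow_upto r t (\<lambda>x. Y n (w, x) - Yl (w, x))"
     using t by (simp only:) (intro E(2), auto)
    also have "\<dots> \<le> ennreal E * pow_int r lborel (\<lambda>x. Y n (w, x) - Yl (w, x))"
     by (intro mult_left_mono nn_integral_mono ennreal_leI) (auto simp: indicator_def)
    finally show ?case .
   qed
  qed
  also have "\<dots> = ennreal E * pow_int r P (\<lambda>p. Y n p - Yl p)"
   by (simp add: nn_integral_cmult flip: lborel.nn_integral_fst)
  finally show ?thesis .
 qed
 then have "(\<lambda>n. pow_int r M (\<lambda>w. S n t w - Z w t)) \<longlonglongrightarrow> 0" by (rule ennreal_tendsto_zero_le[OF Y_tendsto]) simp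
 then show ?thesis using ito_Z_of_tendsto[OF t, of "\<lambda>n. n"] by (simp add: strict_mono_def)
qed

end

context brownian
begin

text \<open>The constant precedes u: \<open>D\<close> comes from the moment inequality,
  \<open>C\<close> from the operator bounds. It is the product of D, a row bound to the power r/2 -
  1, and a column bound.\<close>

lemma frac_representation:
 assumes mK: "measurable_kernel K" and hA: "hypothesis_A K \<gamma>" and \<epsilon>: "0 < \<epsilon>" "\<epsilon> < \<gamma>" and r: "r \<ge> 2"
 obtains c where "c \<ge> 0"
  "\<And>u. u \<in> borel_measurable P \<Longrightarrow> pow_int r P u < \<infinity> \<Longrightarrow> adapted u \<Longrightarrow>
   (\<And>w s. s \<notin> {0..1} \<Longrightarrow> u (w, s) = 0) \<Longrightarrow>
   \<exists>Y. Y \<in> borel_measurable P \<and>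
    (\<forall>T\<in>{0..1}. proc_pow r T Y \<le>
     ennreal c * proc_pow r T u) \<and>
    (AE t in lborel. t \<in> {0..1} \<longrightarrow> ito (kint K t u) (\<lambda>w. frac_int (\<gamma> - \<epsilon>) (\<lambda>x. Y (w, x)) t)) \<and>
    ((\<gamma> - \<epsilon>) * r > 1 \<longrightarrow> (\<forall>t\<in>{0..1}. ito (kint K t u) (\<lambda>w. frac_int (\<gamma> - \<epsilon>) (\<lambda>x. Y (w, x)) t)))"
proof -
 obtain D where D: "D \<ge> 0" and moment: "\<And>n c u X. u \<in> borel_measurable P \<Longrightarrow> nsq P u < \<infinity> \<Longrightarrow> adapted u \<Longrightarrow>
   (\<And>w s. s \<notin> {0..1} \<Longrightarrow> u (w, s) = 0) \<Longrightarrow> ito (\<lambda>p. dstep n c (snd p) * u p) X \<Longrightarrow>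
   pow_int r M X \<le> ennreal (D * ((\<Sum>j<2^n. (c j)\<^sup>2) / 2^n) powr (r / 2 - 1)) *
    weighted_pow r (dstep n c) u"
  by (rule dyadic_moment[OF r], rule that) blast+
 obtain \<Phi> C where fam: "kernel_preimage_family K (\<gamma> - \<epsilon>) C \<Phi>"
 proof (rule kernel_functional[OF hA \<epsilon>])
  fix C \<Phi>
  assume h: "C \<ge> 0" "\<And>f. \<Phi> f \<in> borel_measurable borel"
   "\<And>f g x a b. f \<in> L2_01 \<Longrightarrow> g \<in> L2_01 \<Longrightarrow> x \<in> {0..1} \<Longrightarrow> \<Phi> (\<lambda>s. a * f s + b * g s) x = a * \<Phi> f x + b * \<Phi> g x"
   "\<And>f x. f \<in> L2_01 \<Longrightarrow> x \<in> {0..1} \<Longrightarrow> ennreal ((\<Phi> f x)\<^sup>2) \<le> ennreal C * sq_upto 1 f"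
   "\<And>f. f \<in> L2_01 \<Longrightarrow> sq_upto 1 (\<Phi> f) \<le> ennreal C * (abs_upto 1 f)\<^sup>2"
   "\<And>f t. f \<in> L2_01 \<Longrightarrow> t \<in> {0..1} \<Longrightarrow> frac_int (\<gamma> - \<epsilon>) (\<Phi> f) t = volterra_op K f t"
   "\<And>f a x. f \<in> L2_01 \<Longrightarrow> a \<in> {0..1} \<Longrightarrow> (\<And>s. s \<in> {0..a} \<Longrightarrow> f s = 0) \<Longrightarrow> x \<in> {0..a} \<Longrightarrow> \<Phi> f x = 0"
  have "kernel_preimage_family K (\<gamma> - \<epsilon>) C \<Phi>"
   by unfold_locales (use \<epsilon> in simp, (fact h)+)
  then show thesis by (rule that)
 qed
 interpret fam: kernel_preimage_family K "\<gamma> - \<epsilon>" C \<Phi> by (rule fam)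
 show ?thesis
 proof (rule that[of "D * C powr (r / 2 - 1) * C"])
  show "0 \<le> D * C powr (r / 2 - 1) * C" using D fam.C by simp
  fix u :: "'w \<times> real \<Rightarrow> real"
  assume u: "u \<in> borel_measurable P" "pow_int r P u < \<infinity>" "adapted u" "\<And>w s. s \<notin> {0..1} \<Longrightarrow> u (w, s) = 0"
  interpret V: volterra_integral M B K "\<gamma> - \<epsilon>" C \<Phi> r D u
   by unfold_locales (use mK kern_L2[OF mK hA] r u D moment[OF u(1) nsq_finite_of_Lr[OF u(1) r u(2,4)] u(3,4)] in auto)
  show "\<exists>Y. Y \<in> borel_measurable P \<and>
    (\<forall>T\<in>{0..1}. proc_pow r T Y \<le>
     ennreal (D * C powr (r / 2 - 1) * C) * proc_pow r T u) \<and>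
    (AE t in lborel. t \<in> {0..1} \<longrightarrow> ito (kint K t u) (\<lambda>w. frac_int (\<gamma> - \<epsilon>) (\<lambda>x. Y (w, x)) t)) \<and>
    ((\<gamma> - \<epsilon>) * r > 1 \<longrightarrow> (\<forall>t\<in>{0..1}. ito (kint K t u) (\<lambda>w. frac_int (\<gamma> - \<epsilon>) (\<lambda>x. Y (w, x)) t)))"
   using V.Yl_measurable V.Yl_bound V.ito_Z_AE V.ito_Z_everywhere unfolding V.D'_def V.Z_def
   by (intro exI[of _ V.Yl]) blast
 qed
qed

end

text \<open>A preimage of order \<gamma> - \<eta> becomes one of the smaller order \<gamma> -
  \<epsilon> after integration of order \<epsilon> - \<eta>. Equality at every point is assumed
  exactly in the case where \<open>pointwise\<close> demands it.\<close>

lemma frac_space_transfer: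
 fixes y h :: "real \<Rightarrow> real"
 assumes y[measurable]: "y \<in> borel_measurable borel" and r: "r \<ge> 2"
  and fin: "pow_upto r 1 y < \<infinity>"
  and \<eta>: "\<eta> < \<epsilon>" "\<epsilon> < \<gamma>" and T: "0 \<le> T" "T \<le> 1"
  and ae: "AE x in lborel. x \<in> {0..1} \<longrightarrow> h x = frac_int (\<gamma> - \<eta>) y x"
  and ev: "\<And>x. (\<gamma> - \<epsilon>) * r > 1 \<Longrightarrow> x \<in> {0..1} \<Longrightarrow> h x = frac_int (\<gamma> - \<eta>) y x"
 shows "frac_int (\<epsilon> - \<eta>) y \<in> Lp r (dt T)" and "h \<in> frac_space (\<gamma> - \<epsilon>) r T"
  and "frac_norm (\<gamma> - \<epsilon>) r T h = Lp_norm r (dt T) (frac_int (\<epsilon> - \<eta>) y)"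
proof -
 have finT: "pow_upto r S y < \<infinity>" if "S \<le> 1" for S
 proof -
  have "pow_upto r S y \<le> pow_upto r 1 y"
   using that by (intro nn_integral_mono) (auto simp: indicator_def)
  then show ?thesis using fin by (rule order.strict_trans1)
 qed
 have "pow_upto r T (frac_int (\<epsilon> - \<eta>) y) \<le>
  ennreal ((1 / Gamma (\<epsilon> - \<eta> + 1)) powr r) * pow_upto r T y"
  using T r \<eta> by (intro frac_int_Lp_bound) auto
 also have "\<dots> < \<infinity>" using finT[OF T(2)] by (simp add: ennreal_mult_less_top)
 finally show g: "frac_int (\<epsilon> - \<eta>) y \<in> Lp r (dt T)" using r by (subst Lp_dt_iff) auto
 have sg: "frac_int (\<gamma> - \<epsilon>) (frac_int (\<epsilon> - \<eta>) y) x = frac_int (\<gamma> - \<eta>) y x" if "nn_frac (\<gamma> - \<eta>) y x < \<infinity>" for x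
  using frac_int_semigroup[OF y, of "\<gamma> - \<epsilon>" "\<epsilon> - \<eta>" x] that \<eta> by simp
 have pw: "pointwise (\<gamma> - \<epsilon>) r T (\<lambda>x. h x = frac_int (\<gamma> - \<epsilon>) (frac_int (\<epsilon> - \<eta>) y) x)"
  unfolding pointwise_def AE_dt_iff
 proof (intro conjI impI ballI)
  have "abs_upto 1 y < \<infinity>"
   using r by (intro nn_indicator_L1[OF _ _ fin]) auto
  then have "AE x in lborel. x \<in> {0..1} \<longrightarrow> nn_frac (\<gamma> - \<eta>) y x < \<infinity>" using \<eta> by (intro AE_nn_frac_finite) auto
  with ae show "AE x in lborel. x \<in> {0..T} \<longrightarrow> h x = frac_int (\<gamma> - \<epsilon>) (frac_int (\<epsilon> - \<eta>) y) x"
   by eventually_elim (use T sg in auto)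
 next
  fix x assume gr: "(\<gamma> - \<epsilon>) * r > 1" and x: "x \<in> {0..T}"
  have "(\<gamma> - \<epsilon>) * r \<le> (\<gamma> - \<eta>) * r" using \<eta> r by (intro mult_right_mono) auto
  then have gr': "(\<gamma> - \<eta>) * r > 1" using gr by linarith
  then have "nn_frac (\<gamma> - \<eta>) y x < \<infinity>"
   using r \<eta> x T finT by (intro nn_frac_finite_Lp[where p=r]) auto
  then show "h x = frac_int (\<gamma> - \<epsilon>) (frac_int (\<epsilon> - \<eta>) y) x" using ev[OF gr] x T sg by auto
 qed
 show "h \<in> frac_space (\<gamma> - \<epsilon>) r T" unfolding frac_space_def using g pw by auto
 show "frac_norm (\<gamma> - \<epsilon>) r T h = Lp_norm r (dt T) (frac_int (\<epsilon> - \<eta>) y)"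
  using frac_inv_props(4)[OF g pw] r \<eta> T by simp
qed

context brownian
begin

section \<open>A jointly measurable process with prescribed integrals\<close>

lemma adapted_times: "adapted u \<Longrightarrow> adapted (\<lambda>p. f (snd p) * u p)"
 unfolding adapted_def by (auto intro!: borel_measurable_times)

lemma rapid_nsq_AE_tendsto:
 fixes X :: "nat \<Rightarrow> 'w \<Rightarrow> real"
 assumes [measurable]: "\<And>m. X m \<in> borel_measurable M" "Z \<in> borel_measurable M"
  and b: "\<And>m. nsq M (\<lambda>w. X m w - Z w) \<le> ennreal (4 * (1/4)^m)"
 shows "AE w in M. (\<lambda>m. X m w) \<longlonglongrightarrow> Z w"
proof -
 have s: "summable (\<lambda>m. 4 * (1/4)^m :: real)" by (intro summable_mult summable_geometric) auto
 have "(\<integral>\<^sup>+w. (\<Sum>m. ennreal ((X m w - Z w)\<^sup>2)) \<partial>M) = (\<Sum>m. nsq M (\<lambda>w. X m w - Z w))"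
  by (rule nn_integral_suminf) measurable
 also have "\<dots> \<le> (\<Sum>m. ennreal (4 * (1/4)^m))" by (intro suminf_le b) auto
 also have "\<dots> = ennreal (\<Sum>m. 4 * (1/4)^m)" using s by (intro suminf_ennreal2) auto
 also have "\<dots> < \<infinity>" by simp
 finally have "(\<integral>\<^sup>+w. (\<Sum>m. ennreal ((X m w - Z w)\<^sup>2)) \<partial>M) \<noteq> \<infinity>" by simp
 then have "AE w in M. (\<Sum>m. ennreal ((X m w - Z w)\<^sup>2)) \<noteq> \<infinity>" by (intro nn_integral_PInf_AE) measurable
 then show ?thesis
 proof eventually_elim
  case (elim w)
  then have "summable (\<lambda>m. (X m w - Z w)\<^sup>2)" by (intro summable_suminf_not_top) auto
  then have "(\<lambda>m. (X m w - Z w)\<^sup>2) \<longlonglongrightarrow> 0" by (rule summable_LIMSEQ_zero)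
  from tendsto_real_sqrt[OF this] have "(\<lambda>m. \<bar>X m w - Z w\<bar>) \<longlonglongrightarrow> 0" by simp
  then have "(\<lambda>m. X m w - Z w) \<longlonglongrightarrow> 0" by (rule tendsto_rabs_zero_cancel)
  then show ?case by (simp add: LIM_zero_iff)
 qed
qed

text \<open>
 At the exceptional times the process cannot be read off \<open>frac_int\<close>. There it is the limit of
 integrals of simple approximations, whose index depends measurably on the time.
\<close>

lemma measurable_selection:
 assumes mK: "measurable_kernel K" and kf: "\<And>t. t \<in> {0..1} \<Longrightarrow> nsq lborel (kern K t) < \<infinity>"
  and u[measurable]: "u \<in> borel_measurable P" and fin: "nsq P u < \<infinity>" and ad: "adapted u"
  and z: "\<And>w s. s \<notin> {0..1} \<Longrightarrow> u (w, s) = 0"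
 shows "\<exists>N. N \<in> borel_measurable P \<and>
  (\<forall>t\<in>{0..1}. nsq P (kint K t u) < \<infinity> \<longrightarrow> ito (kint K t u) (\<lambda>w. N (w, t)))"
proof -
 note km[measurable (raw)] = measurable_kern[OF mK]
 interpret P: sigma_finite_measure P ..
 define wt where "wt k p = clip (real k) (u p)" for k p
 have wt[measurable]: "wt k \<in> borel_measurable P" for k unfolding wt_def by measurable
 have wle: "\<bar>wt k p\<bar> \<le> \<bar>u p\<bar>" "\<bar>wt k p\<bar> \<le> real k" "\<bar>wt k p - u p\<bar> \<le> \<bar>u p\<bar>" for k p by (auto simp: wt_def clip_props)
 have wz: "wt k (w, s) = 0" if "s \<notin> {0..1}" for k w s using z[OF that] by (simp add: wt_def clip_props)
 have wad: "adapted (wt k)" for k unfolding wt_def by (rule adapted_clip[OF ad])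
 have "nsq P (wt k) \<le> nsq P u" for k using wle(1) by (intro nn_integral_mono ennreal_leI) (simp add: abs_le_square_iff)
 then have wfin: "nsq P (wt k) < \<infinity>" for k using fin by (rule order.strict_trans1)
 have "\<forall>k n j. \<exists>X. ito (\<lambda>p. dyi n j (snd p) * wt k p) X" using ex_dyi_ito[OF wt wfin wad wz] by blast
 then obtain J where J: "\<And>k n j. ito (\<lambda>p. dyi n j (snd p) * wt k p) (J k n j)" by metis
 have [measurable]: "J k n j \<in> borel_measurable M" for k n j using ito_measurable(2)[OF J] .
 define a where "a n t j = 2^n * pair_fun (kern K t) (dyi n j)" for n t j
 have [measurable]: "(\<lambda>t. a n t j) \<in> borel_measurable borel" for n j unfolding a_def pair_fun_def by measurable
 define R where "R n t = dstep n (a n t)" for n t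
 have R: "R n t = repr (pair_fun (kern K t)) n" for n t unfolding R_def a_def[abs_def] repr_def[abs_def] by (rule refl)
 have [measurable]: "(\<lambda>p. R n (fst p) (snd (snd p))) \<in> borel_measurable (borel \<Otimes>\<^sub>M P)" for n unfolding R_def dstep_def by measurable
 have [measurable]: "R n t \<in> borel_measurable borel" for n t unfolding R_def by measurable
 define S where "S k n t w = (\<Sum>j<2^n. a n t j * J k n j w)" for k n t w
 have S: "ito (\<lambda>p. R n t (snd p) * wt k p) (S k n t)" for k n t
  using ito_dstep_sum[OF J] by (simp add: R_def S_def[abs_def])
 \<comment> \<open>One index codes a pair: the truncation level of u and the dyadic level of the
   row.\<close>
 define i1 where "i1 i = fst (prod_decode i)" for i
 define i2 where "i2 i = snd (prod_decode i)" for i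
 define d where "d i t = nsq P (\<lambda>p. R (i2 i) t (snd p) * wt (i1 i) p - kern K t (snd p) * u p)" for i t
 have dm[measurable]: "d i \<in> borel_measurable borel" for i
  unfolding d_def by (rule P.borel_measurable_nn_integral) (simp add: case_prod_beta', measurable)
 \<comment> \<open>The first code with error at most \<open>(1/4)^m\<close>. It depends on t alone
   and not on the path, so at a fixed t the selected variable is still one stochastic
   integral.\<close>
 define idx where "idx m t = (LEAST i. d i t \<le> ennreal ((1/4)^m))" for m t
 have idx[measurable]: "idx m \<in> measurable borel (count_space UNIV)" for m
  unfolding idx_def by measurable
 have Sm: "(\<lambda>p. S (i1 i) (i2 i) (snd p) (fst p)) \<in> borel_measurable P" for i
  unfolding S_def by measurable
 define X where "X m p = S (i1 (idx m (snd p))) (i2 (idx m (snd p))) (snd p) (fst p)" for m p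
 have X[measurable]: "X m \<in> borel_measurable P" for m
  unfolding X_def using measurable_compose[OF measurable_snd idx[of m, folded measurable_lborel1]]
  by (intro measurable_compose_countable[OF Sm, of "\<lambda>p. idx m (snd p)"]) auto
 define N where "N p = lim (\<lambda>m. X m p)" for p
 have N[measurable]: "N \<in> borel_measurable P" unfolding N_def by measurable
 have "ito (kint K t u) (\<lambda>w. N (w, t))"
  if t: "t \<in> {0..1}" and ft: "nsq P (kint K t u) < \<infinity>" for t
 proof -
  have kt[measurable]: "kern K t \<in> borel_measurable borel" by measurable
  obtain Z where Z: "ito (kint K t u) Z"
   using ito_exists[OF _ ft adapted_times[OF ad]] z by auto
  have [measurable]: "Z \<in> borel_measurable M" using ito_measurable(2)[OF Z] .
  have Xt[measurable]: "(\<lambda>w. X m (w, t)) \<in> borel_measurable M" for m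
   using measurable_compose[OF measurable_Pair2', of t lborel "X m" M borel] by simp
  have Nt[measurable]: "(\<lambda>w. N (w, t)) \<in> borel_measurable M"
   using measurable_compose[OF measurable_Pair2', of t lborel "N" M borel] by simp
  have l1: "(\<lambda>k. nsq P (\<lambda>p. kern K t (snd p) * wt k p - kern K t (snd p) * u p)) \<longlonglongrightarrow> 0"
  proof -
   have "(\<lambda>k. nsq P (\<lambda>p. kern K t (snd p) * wt k p - kern K t (snd p) * u p)) \<longlonglongrightarrow> (\<integral>\<^sup>+p. 0 \<partial>P)"
   proof (rule nn_integral_dominated_convergence[where w="\<lambda>p. ennreal ((kern K t (snd p) * u p)\<^sup>2)"])
    show "AE p in P. ennreal ((kern K t (snd p) * wt k p - kern K t (snd p) * u p)\<^sup>2) \<le> ennreal ((kern K t (snd p) * u p)\<^sup>2)" for k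
     using wle(3)[of k] by (intro AE_I2 ennreal_leI) (simp add: abs_le_square_iff[symmetric] abs_mult mult_left_mono flip: right_diff_distrib)
    show "AE p in P. (\<lambda>k. ennreal ((kern K t (snd p) * wt k p - kern K t (snd p) * u p)\<^sup>2)) \<longlonglongrightarrow> 0"
    proof (rule AE_I2)
     fix p
     have "(\<lambda>k. (kern K t (snd p) * wt k p - kern K t (snd p) * u p)\<^sup>2) \<longlonglongrightarrow> (kern K t (snd p) * u p - kern K t (snd p) * u p)\<^sup>2"
      unfolding wt_def by (intro tendsto_intros clip_tendsto)
     then have "(\<lambda>k. ennreal ((kern K t (snd p) * wt k p - kern K t (snd p) * u p)\<^sup>2)) \<longlonglongrightarrow> ennreal 0" by (intro tendsto_ennrealI) simp
     then show "(\<lambda>k. ennreal ((kern K t (snd p) * wt k p - kern K t (snd p) * u p)\<^sup>2)) \<longlonglongrightarrow> 0" by simp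
    qed
   qed (use ft in auto)
   then show ?thesis by simp
  qed
  \<comment> \<open>For a fixed truncation level the integrand is bounded, so convergence of the
    averaged rows in L2 suffices. The order of limits matters: first n, then k.\<close>
  have l2: "(\<lambda>n. nsq P (\<lambda>p. R n t (snd p) * wt k p - kern K t (snd p) * wt k p)) \<longlonglongrightarrow> 0" for k
  proof (rule ennreal_tendsto_zero_le[where b="\<lambda>n. nsq lborel (\<lambda>s. R n t s - kern K t s)" and c="ennreal ((real k)\<^sup>2)"])
   show "(\<lambda>n. nsq lborel (\<lambda>s. R n t s - kern K t s)) \<longlonglongrightarrow> 0"
    unfolding R using kern_zero by (intro dyadic_averages_tendsto[OF kt kf[OF t]]) auto
   fix n
   have "nsq P (\<lambda>p. R n t (snd p) * wt k p - kern K t (snd p) * wt k p) \<le> (\<integral>\<^sup>+p. ennreal ((real k)\<^sup>2) * ennreal ((R n t (snd p) - kern K t (snd p))\<^sup>2) \<partial>P)"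
   proof (intro nn_integral_mono)
    fix p
    have "(wt k p)\<^sup>2 \<le> (real k)\<^sup>2" using wle(2)[of k p] by (simp add: abs_le_square_iff[symmetric])
    then have "(wt k p)\<^sup>2 * (R n t (snd p) - kern K t (snd p))\<^sup>2 \<le> (real k)\<^sup>2 * (R n t (snd p) - kern K t (snd p))\<^sup>2" by (rule mult_right_mono) simp
    moreover have "R n t (snd p) * wt k p - kern K t (snd p) * wt k p = wt k p * (R n t (snd p) - kern K t (snd p))"
     by (simp add: right_diff_distrib mult.commute)
    ultimately show "ennreal ((R n t (snd p) * wt k p - kern K t (snd p) * wt k p)\<^sup>2) \<le> ennreal ((real k)\<^sup>2) * ennreal ((R n t (snd p) - kern K t (snd p))\<^sup>2)"
     by (simp only: power_mult_distrib ennreal_leI flip: ennreal_mult') (simp add: ennreal_leI flip: ennreal_mult)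
   qed
   also have "\<dots> = ennreal ((real k)\<^sup>2) * nsq lborel (\<lambda>s. R n t s - kern K t s)"
    by (subst nn_integral_snd_P[symmetric]) (auto simp: nn_integral_cmult)
   finally show "nsq P (\<lambda>p. R n t (snd p) * wt k p - kern K t (snd p) * wt k p) \<le> ennreal ((real k)\<^sup>2) * nsq lborel (\<lambda>s. R n t s - kern K t s)" .
  qed simp
  have dense: "\<exists>i. d i t \<le> ennreal e" if e: "e > 0" for e :: real
  proof -
   have e4: "0 < ennreal (e / 4)" using e by simp
   obtain k where k: "nsq P (\<lambda>p. kern K t (snd p) * wt k p - kern K t (snd p) * u p) < ennreal (e / 4)"
    using order_tendstoD(2)[OF l1 e4] by (auto simp: eventually_sequentially)
   obtain n where n: "nsq P (\<lambda>p. R n t (snd p) * wt k p - kern K t (snd p) * wt k p) < ennreal (e / 4)"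
    using order_tendstoD(2)[OF l2[of k] e4] by (auto simp: eventually_sequentially)
   have "nsq P (\<lambda>p. R n t (snd p) * wt k p - kern K t (snd p) * u p) \<le> 2 * (nsq P (\<lambda>p. R n t (snd p) * wt k p - kern K t (snd p) * wt k p) +
     nsq P (\<lambda>p. kern K t (snd p) * wt k p - kern K t (snd p) * u p))"
    by (rule nsq_triangle) measurable
   also have "\<dots> \<le> 2 * (ennreal (e / 4) + ennreal (e / 4))" using k n by (intro mult_left_mono add_mono) auto
   also have "\<dots> = ennreal 2 * ennreal (e / 4 + e / 4)" using e by (subst ennreal_plus) auto
   also have "\<dots> = ennreal (2 * (e / 4 + e / 4))" using e by (intro ennreal_mult[symmetric]) auto
   also have "2 * (e / 4 + e / 4) = e" by simp
   finally show ?thesis by (intro exI[of _ "prod_encode (k, n)"]) (simp add: d_def i1_def i2_def)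
  qed
  have "d (idx m t) t \<le> ennreal ((1/4)^m)" for m
   unfolding idx_def by (rule LeastI_ex[OF dense]) simp
  have b: "nsq M (\<lambda>w. X m (w, t) - Z w) \<le> ennreal (4 * (1/4)^m)" for m
  proof -
   let ?i = "idx m t"
   have "nsq M (\<lambda>w. X m (w, t) - Z w) \<le> 4 * d ?i t"
    using ito_norm(1)[OF ito_diff[OF S[of "i2 ?i" t "i1 ?i"] Z]] by (simp add: X_def d_def)
   also have "\<dots> \<le> 4 * ennreal ((1/4)^m)" by (intro mult_left_mono) (fact, simp)
   also have "\<dots> = ennreal (4 * (1/4)^m)" by (simp add: ennreal_mult')
   finally show ?thesis .
  qed
  have "AE w in M. (\<lambda>m. X m (w, t)) \<longlonglongrightarrow> Z w" by (rule rapid_nsq_AE_tendsto[OF _ _ b]) measurable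
  then have "AE w in M. Z w = N (w, t)"
   by eventually_elim (simp add: N_def limI)
  then show ?thesis using Z by (intro ito_cong_AE[OF Z]) auto
 qed
 then show ?thesis using N by blast
qed

end

context brownian
begin

text \<open>Fubini exchanges "almost every t, almost surely" with "almost surely, almost every t",
  for the countably many i at once. If \<gamma> r > 1, all fractional integrals involved are
  continuous, and equality almost everywhere becomes equality everywhere.\<close>

lemma version_paths:
 fixes Y :: "nat \<Rightarrow> 'w \<times> real \<Rightarrow> real" and \<eta> :: "nat \<Rightarrow> real"
 assumes Y[measurable]: "\<And>i. Y i \<in> borel_measurable P" and r: "r \<ge> 2"
  and Yfin: "\<And>i. proc_pow r 1 (Y i) < \<infinity>"
  and N[measurable]: "N \<in> borel_measurable P"
  and ae: "\<And>i. AE t in lborel. t \<in> {0..1} \<longrightarrow> (AE w in M. N (w, t) = frac_int (\<gamma> - \<eta> i) (\<lambda>x. Y i (w, x)) t)"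
  and \<gamma>r: "\<And>i. \<gamma> * r > 1 \<Longrightarrow> (\<gamma> - \<eta> i) * r > 1"
  and ev: "\<And>w t. \<gamma> * r > 1 \<Longrightarrow> N (w, t) = frac_int (\<gamma> - \<eta> 0) (\<lambda>x. Y 0 (w, x)) t"
 shows "AE w in M. \<forall>i. pow_upto r 1 (\<lambda>x. Y i (w, x)) < \<infinity> \<and>
   (AE t in lborel. t \<in> {0..1} \<longrightarrow> N (w, t) = frac_int (\<gamma> - \<eta> i) (\<lambda>x. Y i (w, x)) t) \<and>
   (\<gamma> * r > 1 \<longrightarrow> (\<forall>t\<in>{0..1}. N (w, t) = frac_int (\<gamma> - \<eta> i) (\<lambda>x. Y i (w, x)) t))"
proof -
 have [measurable]: "(\<lambda>p. frac_int (\<gamma> - \<eta> i) (\<lambda>x. Y i (fst p, x)) (snd p)) \<in> borel_measurable P" for i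
  unfolding frac_int_eq by measurable
 have 1: "AE w in M. \<forall>i. pow_upto r 1 (\<lambda>x. Y i (w, x)) < \<infinity>"
  unfolding AE_all_countable
 proof
  fix i
  have "(\<integral>\<^sup>+w. pow_upto r 1 (\<lambda>x. Y i (w, x)) \<partial>M) \<noteq> \<infinity>"
   using Yfin[of i] by (subst (asm) lborel.nn_integral_fst[symmetric]) auto
  then have "AE w in M. pow_upto r 1 (\<lambda>x. Y i (w, x)) \<noteq> \<infinity>"
   by (intro nn_integral_PInf_AE) auto
  then show "AE w in M. pow_upto r 1 (\<lambda>x. Y i (w, x)) < \<infinity>"
   by eventually_elim (simp add: top.not_eq_extremum)
 qed
 have 2: "AE w in M. \<forall>i. AE t in lborel. t \<in> {0..1} \<longrightarrow> N (w, t) = frac_int (\<gamma> - \<eta> i) (\<lambda>x. Y i (w, x)) t"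
  unfolding AE_all_countable
 proof
  fix i
  let ?Q = "\<lambda>w t. t \<in> {0..1} \<longrightarrow> N (w, t) = frac_int (\<gamma> - \<eta> i) (\<lambda>x. Y i (w, x)) t"
  have "AE t in lborel. AE w in M. ?Q w t" using ae[of i] by eventually_elim auto
  moreover have "{p \<in> space P. ?Q (fst p) (snd p)} \<in> sets P"
  proof -
   have "Measurable.pred P (\<lambda>p. snd p \<in> {0..1} \<longrightarrow> N p = frac_int (\<gamma> - \<eta> i) (\<lambda>x. Y i (fst p, x)) (snd p))" by measurable
   then show ?thesis by (simp add: pred_def)
  qed
  ultimately show "AE w in M. AE t in lborel. ?Q w t" using P.AE_commute[of ?Q] by blast
 qed
 from 1 2 AE_space show ?thesis
 proof eventually_elim
  case (elim w)
  have sec: "(\<lambda>x. Y i (w, x)) \<in> borel_measurable borel" for i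
   using measurable_compose[OF measurable_Pair1'[OF elim(3)], of "Y i" lborel borel] by simp
  have "N (w, t) = frac_int (\<gamma> - \<eta> i) (\<lambda>x. Y i (w, x)) t" if g: "\<gamma> * r > 1" and t: "t \<in> {0..1}" for i t
  proof -
   have c: "continuous_on {0..1} (frac_int (\<gamma> - \<eta> i) (\<lambda>x. Y i (w, x)))" for i
    using \<gamma>r[OF g, of i] r elim(1) by (intro frac_int_continuous[OF sec, of r]) (auto simp: divide_less_eq)
   have "frac_int (\<gamma> - \<eta> 0) (\<lambda>x. Y 0 (w, x)) t - frac_int (\<gamma> - \<eta> i) (\<lambda>x. Y i (w, x)) t = 0"
   proof (rule continuous_AE_zero[of 1 "\<lambda>t. frac_int (\<gamma> - \<eta> 0) (\<lambda>x. Y 0 (w, x)) t - frac_int (\<gamma> - \<eta> i) (\<lambda>x. Y i (w, x)) t"])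
    show "continuous_on {0..1} (\<lambda>t. frac_int (\<gamma> - \<eta> 0) (\<lambda>x. Y 0 (w, x)) t - frac_int (\<gamma> - \<eta> i) (\<lambda>x. Y i (w, x)) t)"
     by (intro continuous_intros c)
    show "AE t in lborel. t \<in> {0..1} \<longrightarrow> frac_int (\<gamma> - \<eta> 0) (\<lambda>x. Y 0 (w, x)) t - frac_int (\<gamma> - \<eta> i) (\<lambda>x. Y i (w, x)) t = 0"
     using elim(2)[rule_format, of i] by eventually_elim (simp add: ev[OF g, symmetric])
   qed (use t in auto)
   then show ?thesis by (simp add: ev[OF g])
  qed
  then show ?case using elim(1,2) by blast
 qed
qed

text \<open>The identities are asked at every sample point, because measurability of f is obtained
  by writing it as a power of the measurable \<open>G\<close>; an almost sure identity would not
  yield it.\<close>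

lemma frac_norm_moment:
 assumes y[measurable]: "y \<in> borel_measurable P" and r: "r \<ge> 2" and \<kappa>: "\<kappa> > 0" and T: "0 \<le> T" "T \<le> 1" and c: "c \<ge> 0" "A \<ge> 0"
  and b: "proc_pow r T y \<le> ennreal c * ennreal (A powr r)"
  and Lp: "\<And>w. w \<in> space M \<Longrightarrow> frac_int \<kappa> (\<lambda>x. y (w, x)) \<in> Lp r (dt T)"
  and f: "\<And>w. w \<in> space M \<Longrightarrow> f w = Lp_norm r (dt T) (frac_int \<kappa> (\<lambda>x. y (w, x)))"
 shows "f \<in> Lp r M \<and> Lp_norm r M f \<le> ((1 / Gamma (\<kappa> + 1)) powr r * c) powr (1 / r) * A"
proof -
 define k where "k = (1 / Gamma (\<kappa> + 1)) powr r"
 have k: "k \<ge> 0" by (simp add: k_def)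
 define G where "G w = pow_upto r T (\<lambda>x. frac_int \<kappa> (\<lambda>x. y (w, x)) x)" for w
 have [measurable]: "G \<in> borel_measurable M" unfolding G_def frac_int_eq by measurable
 have fG: "ennreal (f w powr r) = G w" "f w \<ge> 0" if "w \<in> space M" for w
  using Lp_norm_dt_powr[OF Lp[OF that]] r by (auto simp: f[OF that] G_def Lp_norm_nonneg)
 have fe: "f w = enn2real (G w) powr (1 / r)" if "w \<in> space M" for w
  using fG[OF that] r by (simp add: powr_powr flip: fG(1)[OF that])
 have fm[measurable]: "f \<in> borel_measurable M"
  using fe by (subst measurable_cong[where g="\<lambda>w. enn2real (G w) powr (1 / r)"]) auto
 have "pow_int r M f = (\<integral>\<^sup>+w. G w \<partial>M)"
  using fG by (intro nn_integral_cong) auto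
 also have "\<dots> \<le> (\<integral>\<^sup>+w. ennreal k * pow_upto r T (\<lambda>x. y (w, x)) \<partial>M)"
 proof (rule nn_integral_mono)
  fix w assume "w \<in> space M"
  then have "(\<lambda>x. y (w, x)) \<in> borel_measurable borel"
   using measurable_compose[OF measurable_Pair1', of w M y lborel borel] by simp
  then show "G w \<le> ennreal k * pow_upto r T (\<lambda>x. y (w, x))"
   unfolding G_def k_def using \<kappa> T r by (intro frac_int_Lp_bound) auto
 qed
 also have "\<dots> = ennreal k * proc_pow r T y"
  by (subst lborel.nn_integral_fst[symmetric]) (auto simp: nn_integral_cmult)
 also have "\<dots> \<le> ennreal k * (ennreal c * ennreal (A powr r))" by (rule mult_left_mono[OF b]) simp
 also have "\<dots> = ennreal (k * c * A powr r)" using k c by (simp add: ennreal_mult mult.assoc)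
 finally have main: "pow_int r M f \<le> ennreal (k * c * A powr r)" .
 then have "integrable M (\<lambda>w. \<bar>f w\<bar> powr r)"
  by (intro integrableI_bounded) (auto intro: order.strict_trans1)
 then have fL: "f \<in> Lp r M" by (simp add: Lp_def)
 have "ennreal (Lp_norm r M f powr r) \<le> ennreal (k * c * A powr r)"
  using main Lp_norm_powr[OF fL] r by simp
 then have "Lp_norm r M f powr r \<le> k * c * A powr r" using k c by simp
 then have "(Lp_norm r M f powr r) powr (1 / r) \<le> (k * c * A powr r) powr (1 / r)"
  using r by (intro powr_mono2) auto
 also have "\<dots> = (k * c) powr (1 / r) * A" using k c r by (simp add: powr_mult powr_powr)
 also have "(Lp_norm r M f powr r) powr (1 / r) = Lp_norm r M f" using r Lp_norm_nonneg[of r M f] by (simp add: powr_powr)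
 finally show ?thesis using fL by (simp add: k_def)
qed

end

theorem theorem2p1:
  fixes M :: "'w measure" and B :: "real \<Rightarrow> 'w \<Rightarrow> real"
    and K :: "real \<Rightarrow> real \<Rightarrow> real" and \<gamma> r :: real
  assumes "standard_brownian_motion M B"
    and "measurable_kernel K"
    and "hypothesis_A K \<gamma>"
    and "r \<ge> 2"
  shows "\<exists>c :: real \<Rightarrow> real. \<forall>u.
    adapted_process M B u \<and> (\<lambda>(\<omega>, s). u s \<omega>) \<in> Lp r (M \<Otimes>\<^sub>M dt 1) \<longrightarrow>
      pointwise \<gamma> r 1 (volterra_defined_at M B K u) \<and>
      (\<exists>N. volterra_version M B K u N \<and>
        (AE \<omega> in M. \<forall>\<epsilon>\<in>{0<..<\<gamma>}. (\<lambda>t. N t \<omega>) \<in> frac_space (\<gamma> - \<epsilon>) r 1) \<and>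
        (\<gamma> > 1 / r \<longrightarrow>
          (AE \<omega> in M. \<forall>\<epsilon>\<in>{0<..<\<gamma>}. holder_continuous (\<gamma> - 1 / r - \<epsilon>) (\<lambda>t. N t \<omega>))) \<and>
        (\<forall>\<epsilon>\<in>{0<..<\<gamma>}. \<forall>t\<in>{0<..1}.
          (\<lambda>\<omega>. frac_norm (\<gamma> - \<epsilon>) r t (\<lambda>x. N x \<omega>)) \<in> Lp r M \<and>
          Lp_norm r M (\<lambda>\<omega>. frac_norm (\<gamma> - \<epsilon>) r t (\<lambda>x. N x \<omega>))
            \<le> c \<epsilon> * Lp_norm r (M \<Otimes>\<^sub>M dt t) (\<lambda>(\<omega>, s). u s \<omega>)))"
proof -
 interpret brownian M B by unfold_locales fact
 note mK = assms(2) and hA = assms(3) and r = assms(4)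
 have \<gamma>: "\<gamma> > 0" using hA by (simp add: hypothesis_A_def)
 \<comment> \<open>If \<gamma> exceeds 1/r, half of the excess is kept, so that every order \<gamma>
   - \<eta> i also exceeds 1/r.\<close>
 define \<eta>0 where "\<eta>0 = (if \<gamma> * r > 1 then min (\<gamma> / 2) ((\<gamma> - 1 / r) / 2) else \<gamma> / 2)"
 define \<eta> where "\<eta> i = \<eta>0 / 2^i" for i :: nat
 have g1: "\<gamma> - 1 / r > 0" if "\<gamma> * r > 1" using that r by (simp add: field_simps)
 have \<eta>0: "\<eta>0 > 0" "\<eta>0 < \<gamma>" using \<gamma> g1 by (auto simp: \<eta>0_def)
 have \<eta>le: "\<eta> i \<le> \<eta>0" for i using \<eta>0(1) divide_left_mono[of 1 "2^i" \<eta>0] by (simp add: \<eta>_def)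
 have \<eta>: "0 < \<eta> i" "\<eta> i < \<gamma>" for i using \<eta>0 \<eta>le[of i] by (simp add: \<eta>_def, linarith)
 have \<gamma>r: "(\<gamma> - \<eta> i) * r > 1" if "\<gamma> * r > 1" for i
 proof -
  have "\<eta> i < \<gamma> - 1 / r" using \<eta>le[of i] g1[OF that] that by (simp add: \<eta>0_def)
  then have "1 / r < \<gamma> - \<eta> i" by simp
  then show ?thesis using r by (simp add: divide_less_eq)
 qed
 have small: "\<exists>i. \<eta> i < e" if "e > 0" for e
 proof -
  have "(\<lambda>i. \<eta>0 * (1/2)^i) \<longlonglongrightarrow> \<eta>0 * 0" by (intro tendsto_intros LIMSEQ_power_zero) auto
  then have "\<forall>\<^sub>F i in sequentially. \<eta>0 * (1/2)^i < e" using that by (intro order_tendstoD(2)) auto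
  then show ?thesis by (auto simp: eventually_sequentially \<eta>_def power_one_over)
 qed
 \<comment> \<open>Selects, for each \<epsilon> and before u is given, the preimage that serves it.
   Hence the final constant depends on \<epsilon> but not on u.\<close>
 define \<iota> where "\<iota> e = (SOME i. \<eta> i < e)" for e
 have \<iota>: "\<eta> (\<iota> e) < e" if "e > 0" for e unfolding \<iota>_def by (rule someI_ex[OF small[OF that]])
 define R where "R i u Y c \<longleftrightarrow> Y \<in> borel_measurable P \<and>
    (\<forall>T\<in>{0..1}. proc_pow r T Y \<le>
     ennreal c * proc_pow r T u) \<and>
    (AE t in lborel. t \<in> {0..1} \<longrightarrow> ito (kint K t u) (\<lambda>w. frac_int (\<gamma> - \<eta> i) (\<lambda>x. Y (w, x)) t)) \<and>
    ((\<gamma> - \<eta> i) * r > 1 \<longrightarrow> (\<forall>t\<in>{0..1}. ito (kint K t u) (\<lambda>w. frac_int (\<gamma> - \<eta> i) (\<lambda>x. Y (w, x)) t)))" for i u Y c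
 have "\<exists>c. c \<ge> 0 \<and> (\<forall>u. u \<in> borel_measurable P \<longrightarrow> (pow_int r P u) < \<infinity> \<longrightarrow> adapted u \<longrightarrow>
   (\<forall>w s. s \<notin> {0..1} \<longrightarrow> u (w, s) = 0) \<longrightarrow> (\<exists>Y. R i u Y c))" for i
 proof (rule frac_representation[OF mK hA \<eta>[of i] r])
  fix c
  assume c: "c \<ge> 0" and h: "\<And>u. u \<in> borel_measurable P \<Longrightarrow> pow_int r P u < \<infinity> \<Longrightarrow> adapted u \<Longrightarrow>
   (\<And>w s. s \<notin> {0..1} \<Longrightarrow> u (w, s) = 0) \<Longrightarrow>
   \<exists>Y. Y \<in> borel_measurable P \<and>
    (\<forall>T\<in>{0..1}. proc_pow r T Y \<le>
     ennreal c * proc_pow r T u) \<and>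
    (AE t in lborel. t \<in> {0..1} \<longrightarrow> ito (kint K t u) (\<lambda>w. frac_int (\<gamma> - \<eta> i) (\<lambda>x. Y (w, x)) t)) \<and>
    ((\<gamma> - \<eta> i) * r > 1 \<longrightarrow> (\<forall>t\<in>{0..1}. ito (kint K t u) (\<lambda>w. frac_int (\<gamma> - \<eta> i) (\<lambda>x. Y (w, x)) t)))"
  show ?thesis
  proof (intro exI[of _ c] conjI allI impI)
   fix u :: "'w \<times> real \<Rightarrow> real"
   assume "u \<in> borel_measurable P" "pow_int r P u < \<infinity>" "adapted u" and z: "\<forall>w s. s \<notin> {0..1} \<longrightarrow> u (w, s) = 0"
   then show "\<exists>Y. R i u Y c" unfolding R_def by (intro h) (use z in blast)+
  qed (rule c)
 qed
 then obtain c where c0: "\<And>i. c i \<ge> 0" and rep: "\<And>i u. u \<in> borel_measurable P \<Longrightarrow> pow_int r P u < \<infinity> \<Longrightarrow> adapted u \<Longrightarrow>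
   (\<And>w s. s \<notin> {0..1} \<Longrightarrow> u (w, s) = 0) \<Longrightarrow> \<exists>Y. R i u Y (c i)" by metis
 show ?thesis
 proof (intro exI[of _ "\<lambda>\<epsilon>. ((1 / Gamma (\<epsilon> - \<eta> (\<iota> \<epsilon>) + 1)) powr r * c (\<iota> \<epsilon>)) powr (1 / r)"] allI impI, elim conjE)
  fix u :: "real \<Rightarrow> 'w \<Rightarrow> real"
  assume ad: "adapted_process M B u" and uL: "(\<lambda>(w, s). u s w) \<in> Lp r (M \<Otimes>\<^sub>M dt 1)"
  \<comment> \<open>The process is extended by 0 to the whole line, the form in which it is
    integrated over \<open>P\<close>.\<close>
  define U where "U p = indicator {0..1} (snd p) * u (snd p) (fst p)" for p
  have U[measurable]: "U \<in> borel_measurable P"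
   using uL measurable_pair_dt[of "\<lambda>(w, s). u s w" 1] by (simp add: Lp_def U_def[abs_def] case_prod_beta')
  have Uz: "U (w, s) = 0" if "s \<notin> {0..1}" for w s using that by (simp add: U_def)
  have Uad: "adapted U" using ad unfolding adapted_def adapted_process_def U_def by simp
  have uU: "pow_int r (M \<Otimes>\<^sub>M dt T) ((\<lambda>(w, s). u s w)) = proc_pow r T U"
   if "T \<le> 1" for T
   unfolding nn_integral_pair_dt using that by (intro nn_integral_cong) (auto simp: U_def indicator_def split: prod.splits)
  have Ufin: "pow_int r P U < \<infinity>"
  proof -
   have "pow_int r P U = proc_pow r 1 U"
    by (intro nn_integral_cong) (auto simp: U_def indicator_def)
   also have "\<dots> = ennreal (Lp_norm r (M \<Otimes>\<^sub>M dt 1) (\<lambda>(w, s). u s w) powr r)"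
    unfolding uU[OF order.refl, symmetric] using Lp_norm_powr[OF uL] r by simp
   finally show ?thesis by simp
  qed
  have Unorm: "proc_pow r T U = ennreal (Lp_norm r (M \<Otimes>\<^sub>M dt T) (\<lambda>(w, s). u s w) powr r)"
   if T: "T \<le> 1" for T
  proof -
   have "(\<lambda>p. indicator {0..T} (snd p) * (\<lambda>(w, s). u s w) p) = (\<lambda>p. indicator {0..T} (snd p) * U p)"
    using T by (auto simp: U_def indicator_def fun_eq_iff)
   then have m: "(\<lambda>(w, s). u s w) \<in> borel_measurable (M \<Otimes>\<^sub>M dt T)"
    by (subst measurable_pair_dt) simp
   have "proc_pow r T U \<le> pow_int r P U"
    by (intro nn_integral_mono) (auto simp: indicator_def)
   then have "pow_int r (M \<Otimes>\<^sub>M dt T) ((\<lambda>(w, s). u s w)) < \<infinity>"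
    unfolding uU[OF T] using Ufin by (rule order.strict_trans1)
   then have "integrable (M \<Otimes>\<^sub>M dt T) (\<lambda>p. \<bar>(\<lambda>(w, s). u s w) p\<bar> powr r)"
    using m by (intro integrableI_bounded) auto
   then have "(\<lambda>(w, s). u s w) \<in> Lp r (M \<Otimes>\<^sub>M dt T)" using m by (simp add: Lp_def)
   from Lp_norm_powr[OF this] r show ?thesis unfolding uU[OF T, symmetric] by simp
  qed
  have "\<exists>Y. R i U Y (c i)" for i by (rule rep[OF U Ufin Uad Uz])
  then obtain Y where Y: "\<And>i. R i U (Y i) (c i)" by metis
  from Y have Ym[measurable]: "Y i \<in> borel_measurable P"
   and Yb: "T \<in> {0..1} \<Longrightarrow> proc_pow r T (Y i) \<le>
     ennreal (c i) * proc_pow r T U"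
   and YI: "AE t in lborel. t \<in> {0..1} \<longrightarrow> ito (kint K t U) (\<lambda>w. frac_int (\<gamma> - \<eta> i) (\<lambda>x. Y i (w, x)) t)"
   and YE: "(\<gamma> - \<eta> i) * r > 1 \<Longrightarrow> t \<in> {0..1} \<Longrightarrow> ito (kint K t U) (\<lambda>w. frac_int (\<gamma> - \<eta> i) (\<lambda>x. Y i (w, x)) t)" for i T t
   unfolding R_def by blast+
  have Yfin: "proc_pow r 1 (Y i) < \<infinity>" for i
  proof -
   have "ennreal (c i) * proc_pow r 1 U < \<infinity>"
    unfolding Unorm[OF order.refl] by (simp add: ennreal_mult_less_top)
   then show ?thesis using Yb[of 1 i] by (auto intro: order.strict_trans1)
  qed
  have kU: "(\<lambda>p. indicator {0..t} (snd p) * (K t (snd p) * u (snd p) (fst p))) = (kint K t U)" if "t \<in> {0..1}" for t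
   using that by (auto simp: fun_eq_iff kern_def U_def indicator_def)
  have def_iff: "volterra_defined_at M B K u t" if t: "t \<in> {0..1}" and I: "ito (kint K t U) X" for t X
   unfolding volterra_defined_at_def
   using t ito_measurable(1)[OF I] ito_norm(3)[OF I] adapted_times[OF Uad, of "kern K t"]
   by (intro ito_integrable_of_adapted[where v="\<lambda>p. kern K t (snd p) * U p"]) (auto simp: kU[OF t])
  have process: "ito (kint K t U) (volterra_process M B K u t)" if t: "t \<in> {0..1}" and d: "volterra_defined_at M B K u t" for t
  proof -
   have "has_ito_integral M B t (\<lambda>s w. K t s * u s w) (volterra_process M B K u t)"
    unfolding volterra_process_def ito_integral_def
    using d unfolding volterra_defined_at_def ito_integrable_def by (rule someI_ex)
   from has_ito_integral_ito[OF this] t show ?thesis by (simp add: kU[OF t])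
  qed
  \<comment> \<open>If \<gamma> r > 1 the process is read off at all times from one fractional
    integral, which will make the paths continuous. Otherwise the integral may exist at times where
    no fractional integral represents it, and the measurable selection is used.\<close>
  have "\<exists>N. N \<in> borel_measurable P \<and> (\<forall>t\<in>{0..1}. nsq P (kint K t U) < \<infinity> \<longrightarrow> ito (kint K t U) (\<lambda>w. N (w, t))) \<and>
   (\<gamma> * r > 1 \<longrightarrow> (\<forall>w t. N (w, t) = frac_int (\<gamma> - \<eta> 0) (\<lambda>x. Y 0 (w, x)) t))"
  proof (cases "\<gamma> * r > 1")
   case True
   have "(\<lambda>p. frac_int (\<gamma> - \<eta> 0) (\<lambda>x. Y 0 (fst p, x)) (snd p)) \<in> borel_measurable P" unfolding frac_int_eq by measurable
   then show ?thesis using YE[OF \<gamma>r[OF True]]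
    by (intro exI[of _ "\<lambda>p. frac_int (\<gamma> - \<eta> 0) (\<lambda>x. Y 0 (fst p, x)) (snd p)"]) auto
  next
   case False
   then show ?thesis using measurable_selection[OF mK kern_L2[OF mK hA] U nsq_finite_of_Lr[OF U r Ufin Uz] Uad Uz] by blast
  qed
  then obtain N0 where N0[measurable]: "N0 \<in> borel_measurable P"
   and N0I: "\<And>t. t \<in> {0..1} \<Longrightarrow> nsq P (kint K t U) < \<infinity> \<Longrightarrow> ito (kint K t U) (\<lambda>w. N0 (w, t))"
   and N0E: "\<And>w t. \<gamma> * r > 1 \<Longrightarrow> N0 (w, t) = frac_int (\<gamma> - \<eta> 0) (\<lambda>x. Y 0 (w, x)) t" by blast
  have "AE t in lborel. t \<in> {0..1} \<longrightarrow> (AE w in M. N0 (w, t) = frac_int (\<gamma> - \<eta> i) (\<lambda>x. Y i (w, x)) t)" for i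
   using YI[of i]
  proof eventually_elim
   case (elim t)
   show ?case
   proof
    assume t: "t \<in> {0..1}"
    then have I: "ito (kint K t U) (\<lambda>w. frac_int (\<gamma> - \<eta> i) (\<lambda>x. Y i (w, x)) t)" using elim by simp
    show "AE w in M. N0 (w, t) = frac_int (\<gamma> - \<eta> i) (\<lambda>x. Y i (w, x)) t"
     by (rule ito_unique[OF N0I[OF t ito_norm(3)[OF I]] I])
   qed
  qed
  from version_paths[where Y=Y and \<eta>=\<eta> and \<gamma>=\<gamma> and N=N0, OF Ym r Yfin N0 this \<gamma>r N0E]
  have "AE w in M. \<forall>i. pow_upto r 1 (\<lambda>x. Y i (w, x)) < \<infinity> \<and>
   (AE t in lborel. t \<in> {0..1} \<longrightarrow> N0 (w, t) = frac_int (\<gamma> - \<eta> i) (\<lambda>x. Y i (w, x)) t) \<and>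
   (\<gamma> * r > 1 \<longrightarrow> (\<forall>t\<in>{0..1}. N0 (w, t) = frac_int (\<gamma> - \<eta> i) (\<lambda>x. Y i (w, x)) t))" (is "AE w in M. ?G w") .
  \<comment> \<open>On this null set both the process and its preimages are replaced by 0. The path
    identities then hold at every sample point, as \<open>frac_norm_moment\<close> requires.\<close>
  then obtain Bad where Bad: "Bad \<in> null_sets M" and good: "\<And>w. w \<in> space M - Bad \<Longrightarrow> ?G w"
   by (rule AE_E3) (rule that)
  have Bs[measurable]: "Bad \<in> sets M" using Bad by auto
  define N where "N t w = (if w \<in> Bad then 0 else N0 (w, t))" for t w
  define y where "y i p = (if fst p \<in> Bad then 0 else Y i p)" for i p
  have ym[measurable]: "y i \<in> borel_measurable P" for i unfolding y_def by measurable
  have sec: "(\<lambda>x. y i (w, x)) \<in> borel_measurable borel" if "w \<in> space M" for i w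
   using measurable_compose[OF measurable_Pair1'[OF that], of "y i" lborel borel] by simp
  have f0: "frac_int \<alpha> (\<lambda>x. 0) t = 0" for \<alpha> t by (simp add: frac_int_eq)
  have path: "pow_upto r 1 (\<lambda>x. y i (w, x)) < \<infinity>"
   "AE t in lborel. t \<in> {0..1} \<longrightarrow> N t w = frac_int (\<gamma> - \<eta> i) (\<lambda>x. y i (w, x)) t"
   "\<gamma> * r > 1 \<Longrightarrow> t \<in> {0..1} \<Longrightarrow> N t w = frac_int (\<gamma> - \<eta> i) (\<lambda>x. y i (w, x)) t" if "w \<in> space M" for w i t
   using good[of w] that r by (cases "w \<in> Bad"; simp add: N_def y_def f0)+
  have transfer: "frac_int (\<epsilon> - \<eta> i) (\<lambda>x. y i (w, x)) \<in> Lp r (dt T)" "(\<lambda>t. N t w) \<in> frac_space (\<gamma> - \<epsilon>) r T"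
   "frac_norm (\<gamma> - \<epsilon>) r T (\<lambda>t. N t w) = Lp_norm r (dt T) (frac_int (\<epsilon> - \<eta> i) (\<lambda>x. y i (w, x)))"
   if w: "w \<in> space M" and \<epsilon>: "\<epsilon> \<in> {0<..<\<gamma>}" and i: "\<eta> i < \<epsilon>" and T: "0 \<le> T" "T \<le> 1" for w \<epsilon> i T
  proof -
   \<comment> \<open>For (\<gamma> - \<epsilon>) r > 1 also \<gamma> r > 1, so the identity at every
     time is available.\<close>
   have ev: "N x w = frac_int (\<gamma> - \<eta> i) (\<lambda>x. y i (w, x)) x" if "(\<gamma> - \<epsilon>) * r > 1" "x \<in> {0..1}" for x
   proof -
    have "(\<gamma> - \<epsilon>) * r \<le> \<gamma> * r" using \<epsilon> r by (intro mult_right_mono) auto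
    then show ?thesis using path(3)[OF w _ that(2)] that(1) by simp
   qed
   have \<epsilon>': "\<epsilon> < \<gamma>" using \<epsilon> by simp
   note tr = frac_space_transfer[OF sec[OF w] r path(1)[OF w] i \<epsilon>' T path(2)[OF w] ev]
   show "frac_int (\<epsilon> - \<eta> i) (\<lambda>x. y i (w, x)) \<in> Lp r (dt T)" "(\<lambda>t. N t w) \<in> frac_space (\<gamma> - \<epsilon>) r T"
    "frac_norm (\<gamma> - \<epsilon>) r T (\<lambda>t. N t w) = Lp_norm r (dt T) (frac_int (\<epsilon> - \<eta> i) (\<lambda>x. y i (w, x)))"
    using tr by blast+
  qed
  show "pointwise \<gamma> r 1 (volterra_defined_at M B K u) \<and>
   (\<exists>N. volterra_version M B K u N \<and>
    (AE w in M. \<forall>\<epsilon>\<in>{0<..<\<gamma>}. (\<lambda>t. N t w) \<in> frac_space (\<gamma> - \<epsilon>) r 1) \<and>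
    (\<gamma> > 1 / r \<longrightarrow>
     (AE w in M. \<forall>\<epsilon>\<in>{0<..<\<gamma>}. holder_continuous (\<gamma> - 1 / r - \<epsilon>) (\<lambda>t. N t w))) \<and>
    (\<forall>\<epsilon>\<in>{0<..<\<gamma>}. \<forall>t\<in>{0<..1}.
     (\<lambda>w. frac_norm (\<gamma> - \<epsilon>) r t (\<lambda>x. N x w)) \<in> Lp r M \<and>
     Lp_norm r M (\<lambda>w. frac_norm (\<gamma> - \<epsilon>) r t (\<lambda>x. N x w))
      \<le> ((1 / Gamma (\<epsilon> - \<eta> (\<iota> \<epsilon>) + 1)) powr r * c (\<iota> \<epsilon>)) powr (1 / r) * Lp_norm r (M \<Otimes>\<^sub>M dt t) (\<lambda>(w, s). u s w)))"
  proof (intro conjI exI[of _ N] impI ballI)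
   show "pointwise \<gamma> r 1 (volterra_defined_at M B K u)"
    unfolding pointwise_def AE_dt_iff
   proof (intro conjI impI ballI)
    show "AE t in lborel. t \<in> {0..1} \<longrightarrow> volterra_defined_at M B K u t"
     using YI[of 0] by eventually_elim (use def_iff in blast)
    show "volterra_defined_at M B K u t" if "\<gamma> * r > 1" "t \<in> {0..1}" for t
     using def_iff[OF that(2) YE[OF \<gamma>r[OF that(1)] that(2)]] .
   qed
   show "volterra_version M B K u N"
    unfolding volterra_version_def
   proof (intro conjI ballI impI)
    have "(\<lambda>p. indicator {0..1} (snd p) * N (snd p) (fst p)) \<in> borel_measurable P" unfolding N_def by measurable
    then show "(\<lambda>(w, t). N t w) \<in> borel_measurable (M \<Otimes>\<^sub>M dt 1)"
     by (subst measurable_pair_dt) (simp add: case_prod_beta')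
    fix t :: real assume t: "t \<in> {0..1}" and d: "volterra_defined_at M B K u t"
    note I = process[OF t d]
    have "AE w in M. N0 (w, t) = volterra_process M B K u t w"
     by (rule ito_unique[OF N0I[OF t ito_norm(3)[OF I]] I])
    with AE_not_in[OF Bad] show "AE w in M. N t w = volterra_process M B K u t w"
     by eventually_elim (simp add: N_def)
   qed
   show "AE w in M. \<forall>\<epsilon>\<in>{0<..<\<gamma>}. (\<lambda>t. N t w) \<in> frac_space (\<gamma> - \<epsilon>) r 1"
   proof (rule AE_I2, rule ballI)
    fix w \<epsilon> assume "w \<in> space M" and \<epsilon>: "\<epsilon> \<in> {0<..<\<gamma>}"
    then show "(\<lambda>t. N t w) \<in> frac_space (\<gamma> - \<epsilon>) r 1" using \<iota>[of \<epsilon>] by (intro transfer(2)[OF _ \<epsilon>]) auto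
   qed
   show "AE w in M. \<forall>\<epsilon>\<in>{0<..<\<gamma>}. holder_continuous (\<gamma> - 1 / r - \<epsilon>) (\<lambda>t. N t w)" if g: "\<gamma> > 1 / r"
   proof (rule AE_I2, rule ballI)
    fix w \<epsilon> assume w: "w \<in> space M" and \<epsilon>: "\<epsilon> \<in> {0<..<\<gamma>}"
    have gr: "\<gamma> * r > 1" using g r by (simp add: divide_less_eq)
    have "1 / r < \<gamma> - \<eta> (\<iota> \<epsilon>)" using \<gamma>r[OF gr, of "\<iota> \<epsilon>"] r by (simp add: divide_less_eq)
    moreover have "\<eta> (\<iota> \<epsilon>) < \<epsilon>" using \<iota> \<epsilon> by simp
    ultimately show "holder_continuous (\<gamma> - 1 / r - \<epsilon>) (\<lambda>t. N t w)"
     using r path(3)[OF w gr, of _ "\<iota> \<epsilon>"]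
     by (intro frac_int_holder_continuous[OF sec[OF w] _ path(1)[OF w], of "\<gamma> - \<eta> (\<iota> \<epsilon>)" _ _ "\<iota> \<epsilon>"]) auto
   qed
   fix \<epsilon> t :: real assume \<epsilon>: "\<epsilon> \<in> {0<..<\<gamma>}" and t: "t \<in> {0<..1}"
   define i where "i = \<iota> \<epsilon>"
   have i: "\<eta> i < \<epsilon>" using \<iota> \<epsilon> by (simp add: i_def)
   have T: "0 \<le> t" "t \<le> 1" using t by auto
   have "proc_pow r t (y i) \<le> proc_pow r t (Y i)"
    by (intro nn_integral_mono) (auto simp: y_def indicator_def)
   also have "\<dots> \<le> ennreal (c i) * ennreal (Lp_norm r (M \<Otimes>\<^sub>M dt t) (\<lambda>(w, s). u s w) powr r)"
    unfolding Unorm[OF T(2), symmetric] using T by (intro Yb) auto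
   finally have b: "proc_pow r t (y i) \<le> ennreal (c i) * ennreal (Lp_norm r (M \<Otimes>\<^sub>M dt t) (\<lambda>(w, s). u s w) powr r)" .
   have "\<epsilon> - \<eta> i > 0" using i by simp
   from frac_norm_moment[OF ym r this T c0 Lp_norm_nonneg b transfer(1)[OF _ \<epsilon> i T] transfer(3)[OF _ \<epsilon> i T]]
   show "(\<lambda>w. frac_norm (\<gamma> - \<epsilon>) r t (\<lambda>x. N x w)) \<in> Lp r M"
    "Lp_norm r M (\<lambda>w. frac_norm (\<gamma> - \<epsilon>) r t (\<lambda>x. N x w))
      \<le> ((1 / Gamma (\<epsilon> - \<eta> (\<iota> \<epsilon>) + 1)) powr r * c (\<iota> \<epsilon>)) powr (1 / r) * Lp_norm r (M \<Otimes>\<^sub>M dt t) (\<lambda>(w, s). u s w)"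
    unfolding i_def by blast+
  qed
 qed
qed

end
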